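(* Let $\varepsilon>0$, let $f$ be a meromorphic function on the ring domain $R_{1+\varepsilon}=\{(\lambda,z)\in\mathbb{C}^2: 1-\varepsilon<|\lambda|<1+\varepsilon,\ |z|<1\}$, and let $\{\phi_k:\Delta_{1+\varepsilon}\to\Delta\}_{k=1}^{\infty}$ be a test sequence with limit $\phi_0:\Delta_{1+\varepsilon}\to\Delta$. Denote by $C_k$ the graph of $\phi_k$ in $\Delta_{1+\varepsilon}\times\Delta$. Suppose that for every $k$ the restriction $f|_{C_k\cap R_{1+\varepsilon}}$ is well defined and extends to a meromorphic function on the curve $C_k$, and that the number of poles, counted with multiplicities, of these extensions is uniformly bounded in $k$. Then there exists an analytic family of holomorphic graphs $\{C_\alpha\}_{\alpha\in\mathcal{A}}$ (where $C_\alpha$ is the graph of a holomorphic function $\phi_\alpha$), parameterized by a Banach ball $\mathcal{A}$ of infinite dimension, such that: (i) $f|_{C_\alpha\cap R_{1+\varepsilon}}$ extends to a meromorphic function on $C_\alpha$ for every $\alpha\in\mathcal{A}$, and the number of poles, counted with multiplicities, of these extensions is uniformly bounded in $\alpha\in\mathcal{A}$; (ii) moreover, $f$ meromorphically extends as a function of two variables $(\lambda,z)$ to the pinched domain $\mathcal{P}:=\operatorname{Int}\left(\bigcup_{\alpha\in\mathcal{A}}C_\alpha\right)$ swept by the graphs $C_\alpha$.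
   Context: Notation: $\Delta_r=\{\lambda\in\mathbb{C}:|\lambda|<r\}$, $\Delta=\Delta_1$; $(\lambda,z)$ are the standard coordinates in $\mathbb{C}^2$; $\operatorname{Int}$ denotes interior. Test sequence: a sequence of holomorphic functions $\phi_k:\Delta_{1+\varepsilon}\to\Delta$, $k\ge1$, converging uniformly on $\Delta_{1+\varepsilon}$ to some $\phi_0:\Delta_{1+\varepsilon}\to\Delta$, such that $(\phi_k-\phi_0)|_{\partial\Delta}$ does not vanish for all sufficiently large $k$ and the variation of the argument (equivalently, the winding number) of $\phi_k-\phi_0$ along $\partial\Delta$ stays bounded as $k\to\infty$. Analytic family of holomorphic graphs (equivalently, of holomorphic mappings from a disk to $\Delta$): a quadruple $(\mathcal{X},\pi,\mathcal{A},\Phi)$, where $\mathcal{X}$ is a complex manifold (finite-dimensional or Banach), $\pi:\mathcal{X}\to\mathcal{A}$ is a holomorphic submersion onto a positive-dimensional complex (Banach) manifold $\mathcal{A}$ such that every fiber $\mathcal{X}_\alpha=\pi^{-1}(\alpha)$ is a disk, and $\Phi:\mathcal{X}\to\mathbb{C}^2$ is a holomorphic map of generic rank $2$ such that for every $\alpha\in\mathcal{A}$ the image $C_\alpha=\Phi(\mathcal{X}_\alpha)$ is the graph of a holomorphic function $\phi_\alpha$ from the disk (here $\Delta_{1+\varepsilon}$) to $\Delta$. The infinite-dimensional Banach ball $\mathcal{A}$ is an open ball in an infinite-dimensional complex Banach space. Pinched domain: identify $\lambda$ with $(\lambda,0)$. In the normalization $\phi_0\equiv0$ (reached by the coordinate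 change $(\lambda,z)\mapsto(\lambda,z-\phi_0(\lambda))$), a pinched domain is an open neighborhood $\mathcal{P}$ of $\overline{\Delta}\setminus\Lambda$, where $\Lambda\subset\Delta$ is a finite set, such that near every $\lambda_0\in\Lambda$ the domain $\mathcal{P}$ contains a set of the form $\big(\Delta_r^2(\lambda_0,0)\cap\{|z|<c|\lambda-\lambda_0|^{l_0}\}\big)\setminus\{(\lambda_0,0)\}$ for some $r,c>0$ and some integer $l_0\ge1$ (the order of the pinch $\lambda_0$), where $\Delta_r^2(\lambda_0,0)$ is the bidisk of radius $r$ centered at $(\lambda_0,0)$. The pinches themselves do not belong to the pinched domain by definition.
   Formalization: The graphs C_α, the pole bound in (i) and the domain P in (ii) are obtained over the disk Δ_{1+ε'} for every 0<ε'<ε, rather than over Δ_{1+ε} itself; with the same ε the claim fails, e.g. for f=1/(z−h), h a universal covering of C∖({0}∪{1/k: k≥2}), φ_k=1/(k+1). *)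

theory Defs
  imports "HOL-Complex_Analysis.Complex_Analysis" "HOL-Library.Function_Algebras"
begin

section \<open>Complex Banach spaces and holomorphic maps between them\<close>

text \<open>
  Banach spaces are given by carrier sets, so that one can quantify existentially over them.
  All conditions only concern the carrier, except that the scalar multiplication is required
  to turn the whole ambient type into a complex vector space.
\<close>

record 'v banach_data =
  bscale :: "complex \<Rightarrow> 'v \<Rightarrow> 'v"
  bcarrier :: "'v set"
  bnorm :: "'v \<Rightarrow> real"

definition bdist :: "('v::ab_group_add) banach_data \<Rightarrow> 'v \<Rightarrow> 'v \<Rightarrow> real" where
  "bdist E x y = bnorm E (x - y)"

definition complex_banach_space :: "('v::ab_group_add) banach_data \<Rightarrow> bool" where
  "complex_banach_space E \<longleftrightarrow>
     vector_space (bscale E) \<and>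
     module.subspace (bscale E) (bcarrier E) \<and>
     (\<forall>x\<in>bcarrier E. 0 \<le> bnorm E x \<and> (bnorm E x = 0 \<longleftrightarrow> x = 0)) \<and>
     (\<forall>c. \<forall>x\<in>bcarrier E. bnorm E (bscale E c x) = norm c * bnorm E x) \<and>
     (\<forall>x\<in>bcarrier E. \<forall>y\<in>bcarrier E. bnorm E (x + y) \<le> bnorm E x + bnorm E y) \<and>
     Metric_space.mcomplete (bcarrier E) (bdist E)"

definition infinite_dimensional :: "('v::ab_group_add) banach_data \<Rightarrow> bool" where
  "infinite_dimensional E \<longleftrightarrow>
     (\<nexists>S. finite S \<and> S \<subseteq> bcarrier E \<and> bcarrier E \<subseteq> module.span (bscale E) S)"

definition btopology :: "('v::ab_group_add) banach_data \<Rightarrow> 'v topology" where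
  "btopology E = Metric_space.mtopology (bcarrier E) (bdist E)"

definition bball :: "('v::ab_group_add) banach_data \<Rightarrow> 'v \<Rightarrow> real \<Rightarrow> 'v set" where
  "bball E a r = Metric_space.mball (bcarrier E) (bdist E) a r"

definition complex_line :: "complex banach_data" where
  "complex_line = \<lparr>bscale = (*), bcarrier = UNIV, bnorm = norm\<rparr>"

definition complex_plane2 :: "(complex \<times> complex) banach_data" where
  "complex_plane2 = \<lparr>bscale = (\<lambda>c (x, y). (c * x, c * y)), bcarrier = UNIV, bnorm = norm\<rparr>"

definition bounded_clinear_map ::
    "('v::ab_group_add) banach_data \<Rightarrow> ('w::ab_group_add) banach_data \<Rightarrow> ('v \<Rightarrow> 'w) \<Rightarrow> bool" where
  "bounded_clinear_map E G L \<longleftrightarrow>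
     L ` bcarrier E \<subseteq> bcarrier G \<and>
     (\<forall>x\<in>bcarrier E. \<forall>y\<in>bcarrier E. L (x + y) = L x + L y) \<and>
     (\<forall>c. \<forall>x\<in>bcarrier E. L (bscale E c x) = bscale G c (L x)) \<and>
     (\<exists>K. \<forall>x\<in>bcarrier E. bnorm G (L x) \<le> K * bnorm E x)"

text \<open>
  Complex Frechet derivative.  The point \<open>x\<close> is always interior to the set on which
  \<open>f\<close> is of interest, so the values of \<open>f\<close> elsewhere do not matter.
\<close>

definition cfrechet ::
    "('v::ab_group_add) banach_data \<Rightarrow> ('w::ab_group_add) banach_data \<Rightarrow>
     ('v \<Rightarrow> 'w) \<Rightarrow> 'v \<Rightarrow> ('v \<Rightarrow> 'w) \<Rightarrow> bool" where
  "cfrechet E G f x L \<longleftrightarrow>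
     bounded_clinear_map E G L \<and>
     (\<forall>e>0. \<exists>d>0. \<forall>h\<in>bcarrier E. bnorm E h < d \<longrightarrow>
        bnorm G (f (x + h) - f x - L h) \<le> e * bnorm E h)"

definition holomorphic_between ::
    "('v::ab_group_add) banach_data \<Rightarrow> ('w::ab_group_add) banach_data \<Rightarrow>
     'v set \<Rightarrow> ('v \<Rightarrow> 'w) \<Rightarrow> bool" where
  "holomorphic_between E G U f \<longleftrightarrow>
     openin (btopology E) U \<and> f ` U \<subseteq> bcarrier G \<and> (\<forall>x\<in>U. \<exists>L. cfrechet E G f x L)"

section \<open>Complex Banach manifolds\<close>

record ('x, 'v) cmanifold =
  mtop :: "'x topology"
  mmodel :: "'v banach_data"
  mcharts :: "('x set \<times> ('x \<Rightarrow> 'v)) set"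

definition complex_manifold :: "('x, 'v::ab_group_add) cmanifold \<Rightarrow> bool" where
  "complex_manifold M \<longleftrightarrow>
     complex_banach_space (mmodel M) \<and>
     Hausdorff_space (mtop M) \<and>
     (\<Union>(U, \<kappa>)\<in>mcharts M. U) = topspace (mtop M) \<and>
     (\<forall>(U, \<kappa>)\<in>mcharts M.
        openin (mtop M) U \<and>
        openin (btopology (mmodel M)) (\<kappa> ` U) \<and>
        homeomorphic_map (subtopology (mtop M) U)
          (subtopology (btopology (mmodel M)) (\<kappa> ` U)) \<kappa>) \<and>
     (\<forall>(U, \<kappa>)\<in>mcharts M. \<forall>(V, \<kappa>')\<in>mcharts M.
        holomorphic_between (mmodel M) (mmodel M) (\<kappa> ` (U \<inter> V)) (\<kappa>' \<circ> inv_into U \<kappa>))"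

definition open_submanifold :: "('v::ab_group_add) banach_data \<Rightarrow> 'v set \<Rightarrow> ('v, 'v) cmanifold" where
  "open_submanifold E U =
     \<lparr>mtop = subtopology (btopology E) U, mmodel = E, mcharts = {(U, \<lambda>x. x)}\<rparr>"

definition holomorphic_map ::
    "('x, 'v::ab_group_add) cmanifold \<Rightarrow> ('y, 'w::ab_group_add) cmanifold \<Rightarrow> ('x \<Rightarrow> 'y) \<Rightarrow> bool" where
  "holomorphic_map M M' f \<longleftrightarrow>
     continuous_map (mtop M) (mtop M') f \<and>
     (\<forall>(U, \<kappa>)\<in>mcharts M. \<forall>(V, \<kappa>')\<in>mcharts M'.
        holomorphic_between (mmodel M) (mmodel M') (\<kappa> ` (U \<inter> f -` V)) (\<kappa>' \<circ> f \<circ> inv_into U \<kappa>))"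

text \<open>The representatives, in all pairs of charts, of the differential of \<open>f\<close> at \<open>x\<close>.\<close>

definition differentials ::
    "('x, 'v::ab_group_add) cmanifold \<Rightarrow> ('y, 'w::ab_group_add) cmanifold \<Rightarrow>
     ('x \<Rightarrow> 'y) \<Rightarrow> 'x \<Rightarrow> ('v \<Rightarrow> 'w) set" where
  "differentials M M' f x =
     {L. \<exists>(U, \<kappa>)\<in>mcharts M. \<exists>(V, \<kappa>')\<in>mcharts M'. x \<in> U \<and> f x \<in> V \<and>
           cfrechet (mmodel M) (mmodel M') (\<kappa>' \<circ> f \<circ> inv_into U \<kappa>) (\<kappa> x) L}"

text \<open>A submersion of Banach manifolds has surjective differentials with complemented kernel,
  that is, with a bounded linear right inverse.\<close>

definition holomorphic_submersion ::
    "('x, 'v::ab_group_add) cmanifold \<Rightarrow> ('y, 'w::ab_group_add) cmanifold \<Rightarrow> ('x \<Rightarrow> 'y) \<Rightarrow> bool" where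
  "holomorphic_submersion M M' f \<longleftrightarrow>
     holomorphic_map M M' f \<and>
     (\<forall>x\<in>topspace (mtop M). \<forall>L\<in>differentials M M' f x.
        \<exists>R. bounded_clinear_map (mmodel M') (mmodel M) R \<and>
            (\<forall>w\<in>bcarrier (mmodel M'). L (R w) = w))"

text \<open>\<open>S\<close> is a disk in \<open>M\<close>: the image of the unit disk under a holomorphic embedding.\<close>

definition embedded_disk :: "('x, 'v::ab_group_add) cmanifold \<Rightarrow> 'x set \<Rightarrow> bool" where
  "embedded_disk M S \<longleftrightarrow>
     (\<exists>j. let D = open_submanifold complex_line (ball 0 1) in
        holomorphic_map D M j \<and>
        embedding_map (mtop D) (mtop M) j \<and>
        j ` ball 0 1 = S \<and>
        (\<forall>\<zeta>\<in>ball 0 1. \<forall>L\<in>differentials D M j \<zeta>. inj L))"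

definition generic_rank_2 ::
    "('x, 'v::ab_group_add) cmanifold \<Rightarrow> ('x \<Rightarrow> complex \<times> complex) \<Rightarrow> bool" where
  "generic_rank_2 M \<Phi> \<longleftrightarrow>
     mtop M closure_of
       {x \<in> topspace (mtop M). \<exists>L\<in>differentials M (open_submanifold complex_plane2 UNIV) \<Phi> x.
          L ` bcarrier (mmodel M) = UNIV}
     = topspace (mtop M)"

section \<open>Analytic families of holomorphic graphs\<close>

definition graph_over :: "complex set \<Rightarrow> (complex \<Rightarrow> complex) \<Rightarrow> (complex \<times> complex) set" where
  "graph_over D \<phi> = {(\<zeta>, \<phi> \<zeta>) | \<zeta>. \<zeta> \<in> D}"

definition analytic_graph_family ::
    "complex set \<Rightarrow> ('x, 'v::ab_group_add) cmanifold \<Rightarrow> ('x \<Rightarrow> 'a) \<Rightarrow>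
     ('a, 'w::ab_group_add) cmanifold \<Rightarrow> ('x \<Rightarrow> complex \<times> complex) \<Rightarrow>
     ('a \<Rightarrow> complex \<Rightarrow> complex) \<Rightarrow> bool" where
  "analytic_graph_family D X p A \<Phi> \<phi> \<longleftrightarrow>
     complex_manifold X \<and> complex_manifold A \<and>
     (\<exists>v\<in>bcarrier (mmodel A). v \<noteq> 0) \<and>
     holomorphic_submersion X A p \<and>
     p ` topspace (mtop X) = topspace (mtop A) \<and>
     (\<forall>\<alpha>\<in>topspace (mtop A). embedded_disk X {x \<in> topspace (mtop X). p x = \<alpha>}) \<and>
     holomorphic_map X (open_submanifold complex_plane2 UNIV) \<Phi> \<and>
     generic_rank_2 X \<Phi> \<and>
     (\<forall>\<alpha>\<in>topspace (mtop A).
        \<phi> \<alpha> holomorphic_on D \<and> \<phi> \<alpha> ` D \<subseteq> ball 0 1 \<and>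
        \<Phi> ` {x \<in> topspace (mtop X). p x = \<alpha>} = graph_over D (\<phi> \<alpha>))"

section \<open>Meromorphic functions of two variables\<close>

definition holomorphic2_on :: "(complex \<times> complex \<Rightarrow> complex) \<Rightarrow> (complex \<times> complex) set \<Rightarrow> bool" where
  "holomorphic2_on f W \<longleftrightarrow>
     open W \<and> (\<forall>q\<in>W. \<exists>a b. (f has_derivative (\<lambda>(u, v). a * u + b * v)) (at q))"

text \<open>
  As for the univariate \<open>meromorphic_on\<close>, the values of a meromorphic function on the zero sets
  of the local denominators are arbitrary.  Hence equality of meromorphic functions
  is equality on a dense subset, and values at single points have to be taken
  through a local holomorphic representative.
\<close>

definition meromorphic2_on :: "(complex \<times> complex \<Rightarrow> complex) \<Rightarrow> (complex \<times> complex) set \<Rightarrow> bool" where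
  "meromorphic2_on f U \<longleftrightarrow>
     open U \<and>
     (\<forall>q\<in>U. \<exists>W g h. connected W \<and> q \<in> W \<and> W \<subseteq> U \<and>
        holomorphic2_on g W \<and> holomorphic2_on h W \<and> (\<exists>w\<in>W. h w \<noteq> 0) \<and>
        (\<forall>w\<in>W. h w \<noteq> 0 \<longrightarrow> f w = g w / h w))"

definition meromorphic_eq ::
    "(complex \<times> complex) set \<Rightarrow> (complex \<times> complex \<Rightarrow> complex) \<Rightarrow>
     (complex \<times> complex \<Rightarrow> complex) \<Rightarrow> bool" where
  "meromorphic_eq W f g \<longleftrightarrow> W \<subseteq> closure {w \<in> W. f w = g w}"

definition has_regular_value ::
    "(complex \<times> complex \<Rightarrow> complex) \<Rightarrow> complex \<times> complex \<Rightarrow> complex \<Rightarrow> bool" where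
  "has_regular_value f q v \<longleftrightarrow>
     (\<exists>W g. q \<in> W \<and> holomorphic2_on g W \<and> meromorphic_eq W f g \<and> g q = v)"

definition ring_domain :: "real \<Rightarrow> (complex \<times> complex) set" where
  "ring_domain \<epsilon> = {(\<zeta>, z). 1 - \<epsilon> < norm \<zeta> \<and> norm \<zeta> < 1 + \<epsilon> \<and> norm z < 1}"

text \<open>
  \<open>f\<close> is meromorphic on \<open>U\<close> and \<open>C\<close> is the graph of \<open>\<phi>\<close> over \<open>D\<close>, with coordinate \<open>\<zeta>\<close>.
  The restriction of \<open>f\<close> to \<open>C \<inter> U\<close> is well defined if \<open>C \<inter> U\<close> is not contained in the
  set where \<open>f\<close> is not holomorphic; \<open>u\<close> is its meromorphic extension to \<open>C\<close>.
\<close>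

definition restriction_extends_to ::
    "(complex \<times> complex \<Rightarrow> complex) \<Rightarrow> (complex \<times> complex) set \<Rightarrow> complex set \<Rightarrow>
     (complex \<Rightarrow> complex) \<Rightarrow> (complex \<Rightarrow> complex) \<Rightarrow> bool" where
  "restriction_extends_to f U D \<phi> u \<longleftrightarrow>
     (\<exists>\<zeta>\<in>D. (\<zeta>, \<phi> \<zeta>) \<in> U \<and> (\<exists>v. has_regular_value f (\<zeta>, \<phi> \<zeta>) v)) \<and>
     u meromorphic_on D \<and>
     (\<forall>\<zeta>\<in>D. \<forall>v. (\<zeta>, \<phi> \<zeta>) \<in> U \<and> has_regular_value f (\<zeta>, \<phi> \<zeta>) v \<longrightarrow> u \<zeta> = v)"

definition poles_at_most :: "(complex \<Rightarrow> complex) \<Rightarrow> complex set \<Rightarrow> nat \<Rightarrow> bool" where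
  "poles_at_most u D N \<longleftrightarrow>
     finite {z \<in> D. is_pole u z} \<and> (\<Sum>z\<in>{z \<in> D. is_pole u z}. nat (- zorder u z)) \<le> N"

section \<open>Test sequences and pinched domains\<close>

definition test_sequence ::
    "real \<Rightarrow> (nat \<Rightarrow> complex \<Rightarrow> complex) \<Rightarrow> (complex \<Rightarrow> complex) \<Rightarrow> bool" where
  "test_sequence \<epsilon> \<phi> \<phi>0 \<longleftrightarrow>
     (\<forall>k\<ge>1. \<phi> k holomorphic_on ball 0 (1 + \<epsilon>) \<and> \<phi> k ` ball 0 (1 + \<epsilon>) \<subseteq> ball 0 1) \<and>
     \<phi>0 holomorphic_on ball 0 (1 + \<epsilon>) \<and> \<phi>0 ` ball 0 (1 + \<epsilon>) \<subseteq> ball 0 1 \<and>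
     uniform_limit (ball 0 (1 + \<epsilon>)) \<phi> \<phi>0 sequentially \<and>
     (\<forall>\<^sub>F k in sequentially. \<forall>\<zeta>\<in>sphere 0 1. \<phi> k \<zeta> - \<phi>0 \<zeta> \<noteq> 0) \<and>
     (\<exists>B. \<forall>\<^sub>F k in sequentially.
        norm (winding_number ((\<lambda>\<zeta>. \<phi> k \<zeta> - \<phi>0 \<zeta>) \<circ> circlepath 0 1) 0) \<le> B)"

definition pinched_domain_0 :: "(complex \<times> complex) set \<Rightarrow> bool" where
  "pinched_domain_0 P \<longleftrightarrow>
     open P \<and>
     (\<exists>\<Lambda>. finite \<Lambda> \<and> \<Lambda> \<subseteq> ball 0 1 \<and>
        (\<forall>\<zeta>\<in>cball 0 1 - \<Lambda>. (\<zeta>, 0) \<in> P) \<and>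
        (\<forall>\<zeta>0\<in>\<Lambda>. (\<zeta>0, 0) \<notin> P \<and>
           (\<exists>r>0. \<exists>c>0. \<exists>l0::nat. l0 \<ge> 1 \<and>
              {(\<zeta>, z). norm (\<zeta> - \<zeta>0) < r \<and> norm z < r \<and> norm z < c * norm (\<zeta> - \<zeta>0) ^ l0}
                - {(\<zeta>0, 0)} \<subseteq> P)))"

definition pinched_domain :: "(complex \<Rightarrow> complex) \<Rightarrow> (complex \<times> complex) set \<Rightarrow> bool" where
  "pinched_domain \<phi>0 P \<longleftrightarrow> pinched_domain_0 ((\<lambda>(\<zeta>, z). (\<zeta>, z - \<phi>0 \<zeta>)) ` P)"

end

theory Submission
  imports Defs "HOL-Computational_Algebra.Fundamental_Theorem_Algebra"
begin

text \<open>
  In the coordinate \<open>z = y - \<phi>0 x\<close> and over a thin annulus \<open>r1 < \<bar>x\<bar> < r2 < 1\<close> one has an expansion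
  \<open>z ^ D * f (x, \<phi>0 x + z) = (\<Sum>n. A n x * z ^ n)\<close>.  Put \<open>\<delta> k = \<phi> k - \<phi>0\<close>.  Multiplied by a polynomial of bounded
  degree, \<open>\<Sum>n. A n x * \<delta> k x ^ n\<close> extends holomorphically to the disk.  Removing the terms of order below \<open>m\<close>
  and dividing by \<open>\<delta> k ^ m\<close>, by the maximum principle one obtains inductively that each \<open>A m\<close> is meromorphic
  in the disk, with poles only at limits of zeros of \<open>\<delta> k\<close> and of poles of the restrictions.

  The crucial point is that the order of the pole of \<open>A m\<close> grows at most linearly in \<open>m\<close>.  By Harnack's
  inequality the nonvanishing factor of \<open>\<delta> k\<close> is comparable near such a limit point with powers of its value \<open>s\<close>
  there; after separating the zeros that converge fast compared with \<open>s\<close> from the slow ones, a single Taylor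
  coefficient of the \<open>m\<close>-th remainder yields the estimate.  Hence, with \<open>W = (\<Prod>c\<in>\<Lambda>. x - c) ^ n0\<close>, the functions
  \<open>B n = W ^ (n + 1) * A n\<close> are holomorphic with geometric bounds, and \<open>\<Sum>n. B n x * (z / W x) ^ n\<close>, divided
  by \<open>W x * z ^ D\<close>, extends \<open>f\<close> to \<open>\<bar>z\<bar> < \<kappa> * \<bar>W x\<bar>\<close>.

  The graphs are those of \<open>\<phi>0 + W * \<alpha>\<close> with \<open>\<alpha>\<close> in a small ball of \<open>H\<^sup>\<infinity>\<close> around a nonzero linear function.
  As this ball does not contain \<open>0\<close>, the number of zeros of \<open>\<alpha>\<close>, and with it the number of poles, is uniformly
  bounded, while the values \<open>\<alpha> x\<close> for \<open>\<bar>x\<bar> \<le> 1\<close> still fill a neighbourhood of \<open>0\<close>.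
\<close>

section \<open>Holomorphic functions of two variables\<close>

text \<open>The obstacle is the growth of the pole orders. The induction that makes the
  \<open>A m\<close> meromorphic clears the denominators of all earlier coefficients at once; on its
  own this allows orders growing exponentially in \<open>m\<close>, and the series would converge on
  no region pinched to finite order. The linear bound comes from a comparison of scales. Near a
  limit point \<open>c\<close> let \<open>s = norm (e k c)\<close>. Dividing the \<open>m\<close>-th
  remainder by \<open>e ^ m\<close> costs the \<open>j\<close>-th term at most a factor
  \<open>s\<close> to the power \<open>- 3 * (m - j)\<close>, while a circle of radius
  \<open>s powr \<gamma>\<close> about \<open>c\<close> wins back \<open>s powr \<gamma>\<close> for
  every unit by which the exponents of \<open>x - c\<close> in the two terms differ. If the
  exponents grow with a slope exceeding the number of zeros by \<open>3 / \<gamma>\<close>, a pole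
  of still higher order would leave one term that nothing balances.

  The factor \<open>z ^ D\<close> is present because \<open>f\<close> may have poles along the limit
  graph itself. The graphs are finally taken over a smaller concentric disk, so that the local
  descriptions of \<open>f\<close> near the limit graph are needed only over a compact set; finitely
  many of them then give one bound for the number of poles.\<close>

lemma holomorphic2_on_subset:
  "holomorphic2_on f W \<Longrightarrow> open V \<Longrightarrow> V \<subseteq> W \<Longrightarrow> holomorphic2_on f V"
  unfolding holomorphic2_on_def by blast

lemma holomorphic2_on_imp_continuous_on:
  "holomorphic2_on f W \<Longrightarrow> continuous_on W f"
  unfolding holomorphic2_on_def
  by (meson continuous_at_imp_continuous_on has_derivative_continuous)

lemma holomorphic2_on_cong:
  assumes "holomorphic2_on f W" "\<And>q. q \<in> W \<Longrightarrow> f q = g q"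
  shows "holomorphic2_on g W"
  unfolding holomorphic2_on_def
proof (intro conjI ballI)
  show "open W" using assms(1) by (simp add: holomorphic2_on_def)
  fix q assume q: "q \<in> W"
  then obtain a b where "(f has_derivative (\<lambda>(u, v). a * u + b * v)) (at q)"
    using assms(1) by (auto simp: holomorphic2_on_def)
  then have "(g has_derivative (\<lambda>(u, v). a * u + b * v)) (at q)"
    by (rule has_derivative_transform_within_open[OF _ \<open>open W\<close> q]) (use assms in auto)
  then show "\<exists>a b. (g has_derivative (\<lambda>(u, v). a * u + b * v)) (at q)" by blast
qed

lemma holomorphic2_on_local:
  assumes "\<And>q. q \<in> W \<Longrightarrow> \<exists>V. q \<in> V \<and> V \<subseteq> W \<and> holomorphic2_on f V"
  shows "holomorphic2_on f W"
  unfolding holomorphic2_on_def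
proof (intro conjI ballI)
  show "open W"
  proof (subst open_subopen, intro ballI)
    fix q assume "q \<in> W"
    from assms[OF this] show "\<exists>T. open T \<and> q \<in> T \<and> T \<subseteq> W"
      unfolding holomorphic2_on_def by blast
  qed
  fix q assume "q \<in> W"
  from assms[OF this] show "\<exists>a b. (f has_derivative (\<lambda>(u, v). a * u + b * v)) (at q)"
    unfolding holomorphic2_on_def by blast
qed

lemma clinear2_eq: "(\<lambda>q::complex\<times>complex. a * fst q + b * snd q) = (\<lambda>(u, v). a * u + b * v)"
  by (auto simp: fun_eq_iff)

lemma holomorphic2_onE:
  assumes "holomorphic2_on f W" "q \<in> W"
  obtains a b where "(f has_derivative (\<lambda>p. a * fst p + b * snd p)) (at q)"
  using assms unfolding holomorphic2_on_def clinear2_eq by blast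

lemma holomorphic2_onI:
  assumes "open W" "\<And>q. q \<in> W \<Longrightarrow> \<exists>a b. (f has_derivative (\<lambda>p. a * fst p + b * snd p)) (at q)"
  shows "holomorphic2_on f W"
  using assms unfolding holomorphic2_on_def clinear2_eq by blast

lemma holomorphic2_on_compose:
  assumes f: "holomorphic2_on f W" and u: "holomorphic2_on u V" and v: "holomorphic2_on v V"
    and sub: "\<And>q. q \<in> V \<Longrightarrow> (u q, v q) \<in> W"
  shows "holomorphic2_on (\<lambda>q. f (u q, v q)) V"
proof (rule holomorphic2_onI)
  show "open V" using u by (simp add: holomorphic2_on_def)
  fix q assume q: "q \<in> V"
  from holomorphic2_onE[OF u q] obtain a b where
    1: "(u has_derivative (\<lambda>p. a * fst p + b * snd p)) (at q)" .
  from holomorphic2_onE[OF v q] obtain c d where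
    2: "(v has_derivative (\<lambda>p. c * fst p + d * snd p)) (at q)" .
  from holomorphic2_onE[OF f sub[OF q]] obtain A B where
    3: "(f has_derivative (\<lambda>p. A * fst p + B * snd p)) (at (u q, v q))" .
  from has_derivative_compose[OF has_derivative_Pair[OF 1 2] 3]
  have "((\<lambda>q. f (u q, v q)) has_derivative
      (\<lambda>p. A * (a * fst p + b * snd p) + B * (c * fst p + d * snd p))) (at q)" by simp
  also have "(\<lambda>p. A * (a * fst p + b * snd p) + B * (c * fst p + d * snd p))
      = (\<lambda>p. (A * a + B * c) * fst p + (A * b + B * d) * snd p)"
    by (auto simp: algebra_simps)
  finally show "\<exists>a b. ((\<lambda>q. f (u q, v q)) has_derivative (\<lambda>p. a * fst p + b * snd p)) (at q)" by blast
qed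

lemma holomorphic2_on_fst [simp]: "open W \<Longrightarrow> holomorphic2_on fst W"
  by (rule holomorphic2_onI, assumption, rule exI[of _ 1], rule exI[of _ 0]) (auto intro!: derivative_eq_intros)

lemma holomorphic2_on_snd [simp]: "open W \<Longrightarrow> holomorphic2_on snd W"
  by (rule holomorphic2_onI, assumption, rule exI[of _ 0], rule exI[of _ 1]) (auto intro!: derivative_eq_intros)

lemma holomorphic2_on_const [simp]: "open W \<Longrightarrow> holomorphic2_on (\<lambda>_. c) W"
  by (rule holomorphic2_onI) (auto intro!: exI[of _ 0] derivative_eq_intros)

lemma holomorphic2_on_comp1:
  assumes g: "g holomorphic_on S" "open S" and u: "holomorphic2_on u V"
    and sub: "\<And>q. q \<in> V \<Longrightarrow> u q \<in> S"
  shows "holomorphic2_on (\<lambda>q. g (u q)) V"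
proof (rule holomorphic2_onI)
  show "open V" using u by (simp add: holomorphic2_on_def)
  fix q assume q: "q \<in> V"
  from holomorphic2_onE[OF u q] obtain a b where
    1: "(u has_derivative (\<lambda>p. a * fst p + b * snd p)) (at q)" .
  have "(g has_field_derivative deriv g (u q)) (at (u q))"
    using g sub[OF q] holomorphic_derivI by blast
  then have "(g has_derivative (\<lambda>x. deriv g (u q) * x)) (at (u q))"
    by (simp add: has_field_derivative_def)
  from has_derivative_compose[OF 1 this]
  have "((\<lambda>q. g (u q)) has_derivative (\<lambda>p. deriv g (u q) * (a * fst p + b * snd p))) (at q)" by simp
  also have "(\<lambda>p. deriv g (u q) * (a * fst p + b * snd p))
     = (\<lambda>p. (deriv g (u q) * a) * fst p + (deriv g (u q) * b) * snd p)" by (auto simp: algebra_simps)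
  finally show "\<exists>a b. ((\<lambda>q. g (u q)) has_derivative (\<lambda>p. a * fst p + b * snd p)) (at q)" by blast
qed

lemma holomorphic2_on_add:
  assumes u: "holomorphic2_on u V" and v: "holomorphic2_on v V"
  shows "holomorphic2_on (\<lambda>q. u q + v q) V"
proof -
  have "holomorphic2_on (\<lambda>q. fst q + snd q) UNIV"
    by (rule holomorphic2_onI) (auto intro!: exI[of _ 1] derivative_eq_intros)
  from holomorphic2_on_compose[OF this u v] show ?thesis by simp
qed

lemma holomorphic2_on_mult:
  assumes u: "holomorphic2_on u V" and v: "holomorphic2_on v V"
  shows "holomorphic2_on (\<lambda>q. u q * v q) V"
proof -
  have "holomorphic2_on (\<lambda>q. fst q * snd q) UNIV"
  proof (rule holomorphic2_onI)
    fix q :: "complex \<times> complex"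
    show "\<exists>a b. ((\<lambda>q. fst q * snd q) has_derivative (\<lambda>p. a * fst p + b * snd p)) (at q)"
      by (rule exI[of _ "snd q"], rule exI[of _ "fst q"]) (auto intro!: derivative_eq_intros)
  qed simp
  from holomorphic2_on_compose[OF this u v] show ?thesis by simp
qed

lemma holomorphic2_on_uminus:
  "holomorphic2_on u V \<Longrightarrow> holomorphic2_on (\<lambda>q. - u q) V"
  by (rule holomorphic2_on_comp1[of "\<lambda>x. - x" UNIV]) (auto intro!: holomorphic_intros)

lemma holomorphic2_on_diff:
  "holomorphic2_on u V \<Longrightarrow> holomorphic2_on v V \<Longrightarrow> holomorphic2_on (\<lambda>q. u q - v q) V"
  using holomorphic2_on_add[OF _ holomorphic2_on_uminus] by simp

lemma holomorphic2_on_power: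
  "holomorphic2_on u V \<Longrightarrow> holomorphic2_on (\<lambda>q. u q ^ n) V"
  by (rule holomorphic2_on_comp1[of "\<lambda>x. x ^ n" UNIV]) (auto intro!: holomorphic_intros)

lemma holomorphic2_on_divide:
  assumes u: "holomorphic2_on u V" and v: "holomorphic2_on v V" and nz: "\<And>q. q \<in> V \<Longrightarrow> v q \<noteq> 0"
  shows "holomorphic2_on (\<lambda>q. u q / v q) V"
proof -
  have "holomorphic2_on (\<lambda>q. inverse (v q)) V"
    by (rule holomorphic2_on_comp1[of inverse "- {0}"]) (auto intro!: holomorphic_intros v nz)
  from holomorphic2_on_mult[OF u this] show ?thesis by (simp add: field_simps)
qed

lemma holomorphic2_on_fst_comp:
  "g holomorphic_on S \<Longrightarrow> open S \<Longrightarrow> open V \<Longrightarrow> (\<And>q. q \<in> V \<Longrightarrow> fst q \<in> S) \<Longrightarrow>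
    holomorphic2_on (\<lambda>q. g (fst q)) V"
  by (rule holomorphic2_on_comp1[of g S fst]) auto

lemmas holomorphic2_intros = holomorphic2_on_add holomorphic2_on_mult holomorphic2_on_uminus
  holomorphic2_on_diff holomorphic2_on_power holomorphic2_on_divide holomorphic2_on_const
  holomorphic2_on_fst holomorphic2_on_snd

section \<open>Holomorphic curves, Osgood's lemma and the identity theorem\<close>

lemma holomorphic2_on_curve:
  assumes f: "holomorphic2_on f W" and u: "u holomorphic_on S" and v: "v holomorphic_on S"
    and S: "open S" and sub: "\<And>x. x \<in> S \<Longrightarrow> (u x, v x) \<in> W"
  shows "(\<lambda>x. f (u x, v x)) holomorphic_on S"
proof -
  have "\<exists>D. ((\<lambda>x. f (u x, v x)) has_field_derivative D) (at x)" if x: "x \<in> S" for x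
  proof -
    have 1: "(u has_derivative (\<lambda>h. deriv u x * h)) (at x)" "(v has_derivative (\<lambda>h. deriv v x * h)) (at x)"
      using u v S x holomorphic_derivI has_field_derivative_def by blast+
    from holomorphic2_onE[OF f sub[OF x]] obtain a b where
      2: "(f has_derivative (\<lambda>p. a * fst p + b * snd p)) (at (u x, v x))" .
    from has_derivative_compose[OF has_derivative_Pair[OF 1] 2]
    have "((\<lambda>x. f (u x, v x)) has_derivative (\<lambda>h. a * (deriv u x * h) + b * (deriv v x * h))) (at x)" by simp
    also have "(\<lambda>h. a * (deriv u x * h) + b * (deriv v x * h)) = (*) (a * deriv u x + b * deriv v x)"
      by (auto simp: algebra_simps)
    finally show ?thesis unfolding has_field_derivative_def by blast
  qed
  then show ?thesis using S
    by (auto simp: holomorphic_on_open)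
qed

text \<open>Osgood's lemma: joint continuity of the first partial derivative follows by applying Cauchy's
  inequality to differences of slices.\<close>

lemma holomorphic2_on_separately:
  assumes W: "open W" and cont: "continuous_on W f"
    and 1: "\<And>x y. (x, y) \<in> W \<Longrightarrow> (\<lambda>x. f (x, y)) field_differentiable (at x)"
    and 2: "\<And>x y. (x, y) \<in> W \<Longrightarrow> (\<lambda>y. f (x, y)) field_differentiable (at y)"
  shows "holomorphic2_on f W"
proof (rule holomorphic2_onI[OF W])
  fix q assume q: "q \<in> W"
  obtain x0 y0 where q0: "q = (x0, y0)" by (cases q)
  obtain A B where AB: "open A" "open B" "x0 \<in> A" "y0 \<in> B" "A \<times> B \<subseteq> W"
    using W q q0 open_prod_elim[of W q] by (metis SigmaE2)
  obtain r where r: "r > 0" "cball x0 (2*r) \<subseteq> A" using AB(1,3)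
    by (metis open_contains_cball_eq field_sum_of_halves half_gt_zero_iff mult_2)
  obtain s where s: "s > 0" "cball y0 s \<subseteq> B" using AB by (meson open_contains_cball_eq)
  let ?f = "\<lambda>x y. f (x, y)"
  let ?fx = "\<lambda>x y. deriv (\<lambda>x. f (x, y)) x"
  let ?X = "ball x0 r" and ?Y = "ball y0 s"
  have inW: "(x, y) \<in> W" if "x \<in> cball x0 (2*r)" "y \<in> cball y0 s" for x y
    using that r s AB by blast
  have hol: "(\<lambda>x. f (x, y)) holomorphic_on ball x0 (2*r)" if "y \<in> cball y0 s" for y
    using that by (auto simp: holomorphic_on_def intro!: field_differentiable_at_within 1 inW)
  have K: "compact (cball x0 (2*r) \<times> cball y0 s)" by (simp add: compact_Times)
  have uc: "uniformly_continuous_on (cball x0 (2*r) \<times> cball y0 s) f"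
    by (rule compact_uniformly_continuous[OF continuous_on_subset[OF cont] K]) (auto intro: inW)
  \<comment> \<open>Cauchy's inequality on circles of radius \<open>r/2\<close> turns uniform
    continuity of \<open>f\<close> into continuity of the \<open>x\<close>-derivative in
    \<open>y\<close>, uniformly in \<open>x\<close>.\<close>
  have step: "\<exists>d>0. \<forall>x\<in>?X. \<forall>y\<in>?Y. dist y y1 < d \<longrightarrow> dist (?fx x y) (?fx x y1) \<le> e"
    if "e > 0" "y1 \<in> ?Y" for e y1
  proof -
    have "e * (r/2) > 0" using that r by simp
    with uc obtain d where d: "d > 0" "\<And>p p'. p \<in> cball x0 (2*r) \<times> cball y0 s \<Longrightarrow>
       p' \<in> cball x0 (2*r) \<times> cball y0 s \<Longrightarrow> dist p' p < d \<Longrightarrow> dist (f p') (f p) < e * (r/2)"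
      unfolding uniformly_continuous_on_def by meson
    show ?thesis
    proof (intro exI[of _ d] conjI ballI impI d)
      fix x y assume xy: "x \<in> ?X" "y \<in> ?Y" "dist y y1 < d"
      have sub: "cball x (r/2) \<subseteq> ball x0 (2*r)"
      proof
        fix z assume "z \<in> cball x (r/2)"
        then show "z \<in> ball x0 (2*r)" using xy(1) r(1) dist_triangle[of x0 z x] by auto
      qed
      have h: "(\<lambda>x. f (x, y) - f (x, y1)) holomorphic_on ball x0 (2*r)"
        using xy that by (intro holomorphic_intros hol) auto
      have "cmod ((deriv ^^ 1) (\<lambda>x. f (x, y) - f (x, y1)) x) \<le> fact 1 * (e * (r/2)) / (r/2) ^ 1"
      proof (rule Cauchy_inequality)
        show "(\<lambda>x. f (x, y) - f (x, y1)) holomorphic_on ball x (r/2)"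
          using h sub by (meson holomorphic_on_subset ball_subset_cball order_trans)
        show "continuous_on (cball x (r/2)) (\<lambda>x. f (x, y) - f (x, y1))"
          using h sub by (meson holomorphic_on_subset holomorphic_on_imp_continuous_on)
        show "0 < r/2" using r by simp
        fix x' assume "cmod (x - x') = r/2"
        then have "x' \<in> ball x0 (2*r)" using sub by (auto simp: dist_norm)
        then have "dist (f (x', y)) (f (x', y1)) < e * (r/2)"
          using xy that by (intro d) (auto simp: dist_Pair_Pair)
        then show "cmod (f (x', y) - f (x', y1)) \<le> e * (r/2)" by (simp add: dist_norm)
      qed
      then have "cmod (deriv (\<lambda>x. f (x, y) - f (x, y1)) x) \<le> e" using r by simp
      also have "deriv (\<lambda>x. f (x, y) - f (x, y1)) x = ?fx x y - ?fx x y1"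
        using xy that r by (intro deriv_diff 1 inW) auto
      finally show "dist (?fx x y) (?fx x y1) \<le> e" by (simp add: dist_norm)
    qed
  qed
  \<comment> \<open>\<open>has_derivative_partialsI\<close> asks for joint continuity of the
    derivative in the second component only, hence the swapped pairs \<open>(y, x)\<close>.\<close>
  have contd: "continuous (at (y0, x0) within ?Y \<times> ?X) (\<lambda>(y, x). blinfun_mult_right (?fx x y))"
  proof -
    have "((\<lambda>(y, x). ?fx x y) \<longlongrightarrow> ?fx x0 y0) (at (y0, x0) within ?Y \<times> ?X)"
    proof (rule tendstoI)
      fix e :: real assume e: "e > 0"
      from step[of "e/3" y0] e s obtain d where d: "d > 0"
        "\<And>x y. x \<in> ?X \<Longrightarrow> y \<in> ?Y \<Longrightarrow> dist y y0 < d \<Longrightarrow> dist (?fx x y) (?fx x y0) \<le> e/3"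
        by (metis centre_in_ball divide_pos_pos zero_less_numeral)
      have "(\<lambda>x. ?fx x y0) holomorphic_on ball x0 (2*r)"
        using hol[of y0] s holomorphic_deriv by auto
      then have "isCont (\<lambda>x. ?fx x y0) x0"
        using r by (metis centre_in_ball continuous_on_eq_continuous_at holomorphic_on_imp_continuous_on mult_pos_pos open_ball zero_less_numeral)
      then obtain d' where d': "d' > 0" "\<And>x. dist x x0 < d' \<Longrightarrow> dist (?fx x y0) (?fx x0 y0) < e/3"
        using e unfolding continuous_at_eps_delta by (metis divide_pos_pos zero_less_numeral)
      show "\<forall>\<^sub>F p in at (y0, x0) within ?Y \<times> ?X. dist (case p of (y, x) \<Rightarrow> ?fx x y) (?fx x0 y0) < e"
        unfolding eventually_at
      proof (intro exI[of _ "min d d'"] conjI ballI impI)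
        fix p assume p: "p \<in> ?Y \<times> ?X" "p \<noteq> (y0, x0) \<and> dist p (y0, x0) < min d d'"
        obtain x y where xy: "p = (y, x)" by (cases p)
        have "dist x x0 < min d d'" "dist y y0 < min d d'"
          using p(2) xy dist_fst_le[of p "(y0,x0)"] dist_snd_le[of p "(y0,x0)"] by auto
        then have "dist (?fx x y) (?fx x y0) \<le> e/3" "dist (?fx x y0) (?fx x0 y0) < e/3"
          using d d' p(1) xy by auto
        then have "dist (?fx x y) (?fx x0 y0) < e"
          using dist_triangle[of "?fx x y" "?fx x0 y0" "?fx x y0"] e by linarith
        then show "dist (case p of (y, x) \<Rightarrow> ?fx x y) (?fx x0 y0) < e" using xy by simp
      qed (use d d' in auto)
    qed
    then have "((\<lambda>p. blinfun_mult_right (case p of (y, x) \<Rightarrow> ?fx x y)) \<longlongrightarrow> blinfun_mult_right (?fx x0 y0))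
       (at (y0, x0) within ?Y \<times> ?X)"
      by (rule bounded_linear.tendsto[OF bounded_linear_blinfun_mult_right])
    then show ?thesis by (simp add: continuous_within case_prod_beta')
  qed
  have "((\<lambda>(y, x). ?f x y) has_derivative
      (\<lambda>(ty, tx). deriv (\<lambda>y. f (x0, y)) y0 * ty + blinfun_mult_right (?fx x0 y0) tx))
      (at (y0, x0) within ?Y \<times> ?X)"
  proof (rule has_derivative_partialsI)
    have "((\<lambda>y. f (x0, y)) has_field_derivative deriv (\<lambda>y. f (x0, y)) y0) (at y0)"
      by (rule field_differentiable_derivI[OF 2]) (use inW r s in auto)
    then show "((\<lambda>y. f (x0, y)) has_derivative (*) (deriv (\<lambda>y. f (x0, y)) y0)) (at y0 within ?Y)"
      unfolding has_field_derivative_def by (rule has_derivative_at_withinI)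
    show "((\<lambda>x. f (x, y)) has_derivative blinfun_apply (blinfun_mult_right (?fx x y))) (at x within ?X)"
      if "y \<in> ?Y" "x \<in> ?X" for y x
    proof -
      have "((\<lambda>x. f (x, y)) has_field_derivative ?fx x y) (at x)"
        by (rule field_differentiable_derivI[OF 1]) (use inW r s that in auto)
      then have "((\<lambda>x. f (x, y)) has_derivative (*) (?fx x y)) (at x within ?X)"
        unfolding has_field_derivative_def by (rule has_derivative_at_withinI)
      then show ?thesis by (simp add: blinfun_mult_right.rep_eq)
    qed
  qed (use r s contd in auto)
  then have "((\<lambda>(y, x). ?f x y) has_derivative
      (\<lambda>(ty, tx). deriv (\<lambda>y. f (x0, y)) y0 * ty + blinfun_mult_right (?fx x0 y0) tx))
      (at (snd (x0, y0), fst (x0, y0)))"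
    using r s at_within_open[of "(y0, x0)" "?Y \<times> ?X"] by (simp add: open_Times)
  moreover have "((\<lambda>q. (snd q, fst q)) has_derivative (\<lambda>q. (snd q, fst q))) (at (x0, y0))"
    by (intro has_derivative_Pair has_derivative_snd has_derivative_fst has_derivative_ident)
  ultimately have "((\<lambda>q. (\<lambda>(y, x). ?f x y) (snd q, fst q)) has_derivative
     (\<lambda>p. (\<lambda>(ty, tx). deriv (\<lambda>y. f (x0, y)) y0 * ty + blinfun_mult_right (?fx x0 y0) tx) (snd p, fst p))) (at (x0, y0))"
    by (rule has_derivative_compose[rotated])
  then have "(f has_derivative (\<lambda>p. ?fx x0 y0 * fst p + deriv (\<lambda>y. f (x0, y)) y0 * snd p)) (at q)"
    by (simp add: q0 add.commute mult.commute)
  then show "\<exists>a b. (f has_derivative (\<lambda>p. a * fst p + b * snd p)) (at q)" by blast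
qed

text \<open>The interior of the zero set is also relatively closed: if a ball inside
  \<open>W\<close> meets it, any point of the ball is joined to the common part by a complex line,
  and the one-variable identity theorem applies on the preimage of the ball, which is
  convex.\<close>

lemma holomorphic2_on_identity:
  assumes h: "holomorphic2_on h W" and W: "connected W"
    and V: "open V" "V \<subseteq> W" "V \<noteq> {}" "\<And>q. q \<in> V \<Longrightarrow> h q = 0" and q: "q \<in> W"
  shows "h q = 0"
proof -
  have oW: "open W" using h by (simp add: holomorphic2_on_def)
  define Z where "Z = interior {q \<in> W. h q = 0}"
  have line: "ball q e \<subseteq> Z" if "ball q e \<subseteq> W" "ball q e \<inter> Z \<noteq> {}" for q e
  proof -
    from that(2) obtain p where p: "p \<in> ball q e" "p \<in> Z" by blast
    obtain d where d: "d > 0" "ball p d \<subseteq> {q \<in> W. h q = 0}"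
      using p(2) unfolding Z_def mem_interior by blast
    have "h p' = 0" if p': "p' \<in> ball q e" for p'
    proof -
      define l where "l t = (fst p + t * (fst p' - fst p), snd p + t * (snd p' - snd p))" for t :: complex
      have cl: "continuous_on UNIV l" unfolding l_def by (intro continuous_intros)
      define T where "T = l -` ball q e"
      have oT: "open T" unfolding T_def using cl by (simp add: open_vimage)
      have "convex T" unfolding convex_alt
      proof (intro ballI allI impI)
        fix x y u assume xy: "x \<in> T" "y \<in> T" and u: "0 \<le> u \<and> u \<le> (1::real)"
        have "l ((1 - u) *\<^sub>R x + u *\<^sub>R y) = (1 - u) *\<^sub>R l x + u *\<^sub>R l y"
          by (auto simp: l_def algebra_simps scaleR_conv_of_real)
        moreover have "(1 - u) *\<^sub>R l x + u *\<^sub>R l y \<in> ball q e"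
          using convex_ball[of q e] xy u unfolding convex_alt T_def by auto
        ultimately show "(1 - u) *\<^sub>R x + u *\<^sub>R y \<in> T" by (simp add: T_def)
      qed
      then have cT: "connected T" by (rule convex_connected)
      have hol: "(\<lambda>t. h (l t)) holomorphic_on T"
        unfolding l_def
        by (rule holomorphic2_on_curve[OF h _ _ oT])
          (use \<open>ball q e \<subseteq> W\<close> in \<open>auto simp: T_def l_def intro!: holomorphic_intros\<close>)
      have l0: "l 0 = p" "l 1 = p'" by (auto simp: l_def)
      define S where "S = T \<inter> l -` ball p d"
      have "open S" unfolding S_def using cl oT by (simp add: open_vimage open_Int)
      moreover have "0 \<in> S" "1 \<in> T" using p p' l0 d by (auto simp: S_def T_def)
      moreover have "h (l t) = 0" if "t \<in> S" for t using that d by (auto simp: S_def)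
      ultimately have "h (l 1) = 0"
        by (intro analytic_continuation_open[of S T "\<lambda>t. h (l t)" "\<lambda>_. 0" 1] oT cT hol)
          (auto simp: S_def)
      then show ?thesis using l0 by simp
    qed
    then have "ball q e \<subseteq> {q \<in> W. h q = 0}" using that by blast
    then show ?thesis unfolding Z_def by (simp add: interior_maximal)
  qed
  have "open Z" by (simp add: Z_def)
  moreover have "open (W - Z)"
    unfolding open_contains_ball
  proof
    fix q assume q: "q \<in> W - Z"
    then obtain e where "e > 0" "ball q e \<subseteq> W" using oW open_contains_ball by blast
    moreover have "q \<in> ball q e" using \<open>e > 0\<close> by simp
    ultimately show "\<exists>e>0. ball q e \<subseteq> W - Z" using line[of q e] q by blast
  qed
  moreover have "W \<subseteq> Z \<union> (W - Z)" "Z \<inter> (W - Z) \<inter> W = {}" by auto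
  moreover have "Z \<inter> W \<noteq> {}"
  proof -
    have "V \<subseteq> Z" unfolding Z_def by (rule interior_maximal) (use V in auto)
    then show ?thesis using V by blast
  qed
  ultimately have "(W - Z) \<inter> W = {}" using W unfolding connected_def by blast
  then have "q \<in> Z" using q by blast
  then show ?thesis unfolding Z_def using interior_subset by blast
qed

lemma holomorphic2_on_nonzero_dense:
  assumes h: "holomorphic2_on h W" and W: "connected W" and nz: "\<exists>w\<in>W. h w \<noteq> 0"
    and V: "open V" "V \<inter> W \<noteq> {}"
  shows "\<exists>w\<in>V \<inter> W. h w \<noteq> 0"
proof (rule ccontr)
  assume "\<not> ?thesis"
  moreover have "open (V \<inter> W)" using h V by (auto simp: holomorphic2_on_def)
  ultimately show False using holomorphic2_on_identity[OF h W, of "V \<inter> W"] V nz by blast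
qed

text \<open>Along each coordinate line the limit is a locally uniform limit of holomorphic functions
  of one variable; since it is also continuous, Osgood's lemma gives joint holomorphy.\<close>

lemma holomorphic2_on_uniform_limit:
  assumes W: "open W" and f: "\<And>n. holomorphic2_on (f n) W" and lim: "uniform_limit W f g sequentially"
  shows "holomorphic2_on g W"
proof (rule holomorphic2_on_separately[OF W])
  show "continuous_on W g"
    by (rule uniform_limit_theorem[OF _ lim])
      (auto intro!: always_eventually holomorphic2_on_imp_continuous_on f)
  have slice: "(\<lambda>t. g (u t, v t)) field_differentiable (at t0)"
    if u: "u holomorphic_on UNIV" and v: "v holomorphic_on UNIV" and t0: "(u t0, v t0) \<in> W"
    for u v t0
  proof -
    define T where "T = (\<lambda>t. (u t, v t)) -` W"
    have "continuous_on UNIV (\<lambda>t. (u t, v t))"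
      by (intro continuous_intros holomorphic_on_imp_continuous_on u v)
    then have oT: "open T" unfolding T_def using W by (simp add: open_vimage)
    have "t0 \<in> T" using t0 by (simp add: T_def)
    have "(\<lambda>t. g (u t, v t)) holomorphic_on T"
    proof (rule holomorphic_uniform_sequence[OF oT])
      show "(\<lambda>t. f n (u t, v t)) holomorphic_on T" for n
        by (rule holomorphic2_on_curve[OF f _ _ oT])
          (use u v in \<open>auto intro: holomorphic_on_subset simp: T_def\<close>)
      fix x assume "x \<in> T"
      then obtain d where d: "d > 0" "cball x d \<subseteq> T" using oT open_contains_cball by blast
      have "uniform_limit ((\<lambda>t. (u t, v t)) ` cball x d) f g sequentially"
        by (rule uniform_limit_on_subset[OF lim]) (use d in \<open>auto simp: T_def\<close>)
      then have "uniform_limit (cball x d) (\<lambda>n t. f n (u t, v t)) (\<lambda>t. g (u t, v t)) sequentially"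
        unfolding uniform_limit_iff by auto
      then show "\<exists>d>0. cball x d \<subseteq> T \<and> uniform_limit (cball x d) (\<lambda>n t. f n (u t, v t)) (\<lambda>t. g (u t, v t)) sequentially"
        using d by blast
    qed
    then show ?thesis using oT \<open>t0 \<in> T\<close> holomorphic_on_imp_differentiable_at by blast
  qed
  show "(\<lambda>x. g (x, y)) field_differentiable at x" if "(x, y) \<in> W" for x y
    using slice[of "\<lambda>t. t" "\<lambda>_. y" x] that by simp
  show "(\<lambda>y. g (x, y)) field_differentiable at y" if "(x, y) \<in> W" for x y
    using slice[of "\<lambda>_. x" "\<lambda>t. t" y] that by simp
qed

text \<open>On each disk of radius \<open>\<rho> < 1 / C\<close> the Weierstrass test applies with
  ratio \<open>C * \<rho>\<close>. Serves both for dividing out a power of \<open>z\<close> and for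
  the extension across the disk.\<close>

lemma holomorphic2_on_power_series:
  assumes S: "open S" and A: "\<And>n. A n holomorphic_on S"
    and bnd: "\<And>n x. x \<in> S \<Longrightarrow> norm (A n x) \<le> M * C ^ n" and C: "C > 0"
  shows "holomorphic2_on (\<lambda>q. \<Sum>n. A n (fst q) * snd q ^ n) (S \<times> ball 0 (1 / C))" (is "holomorphic2_on ?g ?W")
proof (rule holomorphic2_on_local)
  fix q assume q: "q \<in> ?W"
  define \<rho> where "\<rho> = (norm (snd q) + 1 / C) / 2"
  have \<rho>: "norm (snd q) < \<rho>" "\<rho> < 1 / C" "0 \<le> \<rho>" using q C by (auto simp: \<rho>_def field_simps)
  define V where "V = S \<times> ball (0::complex) \<rho>"
  have V: "open V" "q \<in> V" "V \<subseteq> ?W" using S q \<rho> by (auto simp: V_def open_Times)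
  have M: "M \<ge> 0" using bnd[of "fst q" 0] q order_trans[OF norm_ge_zero[of "A 0 (fst q)"]] by (auto simp: mem_Times_iff)
  have C\<rho>: "0 \<le> C * \<rho>" "C * \<rho> < 1" using \<rho> C by (auto simp: field_simps)
  have "uniform_limit V (\<lambda>n q. \<Sum>i<n. A i (fst q) * snd q ^ i) ?g sequentially"
  proof (rule Weierstrass_m_test)
    show "norm (A n (fst p) * snd p ^ n) \<le> M * (C * \<rho>) ^ n" if "p \<in> V" for n p
    proof -
      have "norm (A n (fst p) * snd p ^ n) \<le> (M * C ^ n) * \<rho> ^ n"
        unfolding norm_mult norm_power
        using that bnd[of "fst p" n] M C by (intro mult_mono power_mono) (auto simp: V_def)
      then show ?thesis by (simp add: power_mult_distrib mult_ac)
    qed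
    show "summable (\<lambda>n. M * (C * \<rho>) ^ n)"
      using C\<rho> by (intro summable_mult summable_geometric) auto
  qed
  then have "holomorphic2_on ?g V"
  proof (rule holomorphic2_on_uniform_limit[OF V(1), rotated])
    fix n show "holomorphic2_on (\<lambda>q. \<Sum>i<n. A i (fst q) * snd q ^ i) V"
    proof (induction n)
      case (Suc n)
      have "holomorphic2_on (\<lambda>q. A n (fst q)) V"
        by (rule holomorphic2_on_fst_comp[OF A S V(1)]) (auto simp: V_def)
      then show ?case using Suc V(1) by (auto intro!: holomorphic2_intros)
    qed (use V in auto)
  qed
  then show "\<exists>V. q \<in> V \<and> V \<subseteq> ?W \<and> holomorphic2_on ?g V" using V by blast
qed

text \<open>Difference quotients in \<open>z\<close> are holomorphic in both variables. They
  converge locally uniformly to the derivative, because Taylor's formula bounds the error by the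
  second derivative, and Cauchy's inequality bounds the latter by the maximum of
  \<open>h\<close>.\<close>

lemma holomorphic2_on_deriv_snd:
  assumes h: "holomorphic2_on h W"
  shows "holomorphic2_on (\<lambda>q. deriv (\<lambda>z. h (fst q, z)) (snd q)) W"
proof (rule holomorphic2_on_local)
  fix q assume q: "q \<in> W"
  have oW: "open W" using h by (simp add: holomorphic2_on_def)
  obtain x0 y0 where q0: "q = (x0, y0)" by (cases q)
  obtain A B where AB: "open A" "open B" "x0 \<in> A" "y0 \<in> B" "A \<times> B \<subseteq> W"
    using oW q q0 open_prod_elim[of W q] by (metis SigmaE2)
  obtain r where r: "r > 0" "cball x0 r \<subseteq> A" using AB by (meson open_contains_cball_eq)
  obtain s0 where s0: "s0 > 0" "cball y0 s0 \<subseteq> B" using AB by (meson open_contains_cball_eq)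
  \<comment> \<open>Three lengths \<open>s\<close>: the point lies within \<open>s\<close> of
    \<open>y0\<close>, the shifted point within \<open>2 * s\<close>, and a Cauchy circle of radius
    \<open>s\<close> about that stays within \<open>3 * s\<close>.\<close>
  define s where "s = s0 / 3"
  have s: "s > 0" "cball y0 (3 * s) \<subseteq> B" using s0 by (auto simp: s_def)
  have "compact (h ` (cball x0 r \<times> cball y0 (3 * s)))"
    by (intro compact_continuous_image compact_Times compact_cball
          continuous_on_subset[OF holomorphic2_on_imp_continuous_on[OF h]])
      (use AB r s in blast)
  then obtain M where M: "\<And>x y. x \<in> cball x0 r \<Longrightarrow> y \<in> cball y0 (3 * s) \<Longrightarrow> norm (h (x, y)) \<le> M"
    using compact_imp_bounded bounded_iff by (metis (no_types, lifting) SigmaI image_eqI)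
  define V where "V = ball x0 r \<times> ball y0 s"
  have V: "open V" "q \<in> V" "V \<subseteq> W"
  proof -
    have "ball x0 r \<subseteq> A" using r by (meson ball_subset_cball order_trans)
    moreover have "ball y0 s \<subseteq> cball y0 (3 * s)" using s by auto
    ultimately show "V \<subseteq> W" using s(2) AB(5) unfolding V_def by (meson Sigma_mono order_trans)
  qed (use r s q0 in \<open>auto simp: V_def open_Times\<close>)
  have hol: "(\<lambda>y. h (x, y)) holomorphic_on ball y0 (3 * s)" if "x \<in> ball x0 r" for x
  proof (rule holomorphic2_on_curve[OF h])
    show "(x, y) \<in> W" if y: "y \<in> ball y0 (3 * s)" for y
    proof -
      have "x \<in> A" "y \<in> B" using y that r(2) s(2) \<open>x \<in> ball x0 r\<close> by (auto simp: subset_iff)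
      then show ?thesis using AB(5) by blast
    qed
  qed (auto intro!: holomorphic_intros)
  have inW: "(x, y) \<in> W" if "dist x0 x \<le> r" "dist y0 y \<le> 3 * s" for x y
  proof -
    have "x \<in> A" "y \<in> B" using r(2) s(2) that by (auto simp: subset_iff)
    then show ?thesis using AB(5) by blast
  qed
  define t where "t n = complex_of_real (s / (real n + 2))" for n
  have nt: "norm (t n) = s / (real n + 2)" for n unfolding t_def norm_of_real using s(1) by simp
  have "s / (real n + 2) < s" "0 < s / (real n + 2)" for n
    using s(1) by (auto simp: divide_less_eq)
  then have t: "norm (t n) < s" "0 < norm (t n)" for n by (simp_all only: nt)
  then have t: "t n \<noteq> 0" "norm (t n) < s" for n by (metis norm_zero less_irrefl, blast)
  define Q where "Q n p = (h (fst p, snd p + t n) - h p) / t n" for n p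
  define D where "D p = deriv (\<lambda>z. h (fst p, z)) (snd p)" for p
  have est: "norm (Q n p - D p) \<le> 2 * M / s ^ 2 * norm (t n)" if p: "p \<in> V" for n p
  proof -
    obtain x y where xy: "p = (x, y)" "x \<in> ball x0 r" "y \<in> ball y0 s" using p by (cases p) (auto simp: V_def)
    define f where "f i = (deriv ^^ i) (\<lambda>y. h (x, y))" for i
    have f2: "norm (f (Suc 1) z) \<le> 2 * M / s ^ 2" if z: "z \<in> ball y0 (2 * s)" for z
    proof -
      have sub: "cball z s \<subseteq> ball y0 (3 * s)"
      proof
        fix w assume "w \<in> cball z s"
        then show "w \<in> ball y0 (3 * s)" using z dist_triangle[of y0 w z] by auto
      qed
      have "norm ((deriv ^^ 2) (\<lambda>y. h (x, y)) z) \<le> fact 2 * M / s ^ 2"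
      proof (rule Cauchy_inequality)
        show "(\<lambda>y. h (x, y)) holomorphic_on ball z s"
          using hol[OF xy(2)] sub by (meson ball_subset_cball holomorphic_on_subset order_trans)
        show "continuous_on (cball z s) (\<lambda>y. h (x, y))"
          using hol[OF xy(2)] sub by (meson holomorphic_on_subset holomorphic_on_imp_continuous_on)
        fix w assume "norm (z - w) = s"
        then have "w \<in> ball y0 (3 * s)" using sub by (auto simp: dist_norm)
        then show "norm (h (x, w)) \<le> M" using M xy by auto
      qed (use s in auto)
      then show ?thesis by (simp add: f_def numeral_2_eq_2)
    qed
    have "norm (f 0 (y + t n) - (\<Sum>i\<le>1. f i y * (y + t n - y) ^ i / fact i))
         \<le> 2 * M / s ^ 2 * norm (y + t n - y) ^ Suc 1 / fact 1"
    proof (rule complex_Taylor[of "ball y0 (2 * s)"])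
      fix i z assume "z \<in> ball y0 (2 * s)"
      then have "f i holomorphic_on ball y0 (3 * s)" "z \<in> ball y0 (3 * s)"
        unfolding f_def using hol[OF xy(2)] s by (auto intro!: holomorphic_higher_deriv)
      then show "(f i has_field_derivative f (Suc i) z) (at z within ball y0 (2 * s))"
        using holomorphic_derivI[of "f i" "ball y0 (3 * s)" z "ball y0 (2 * s)"] by (simp add: f_def)
    next
      show "y \<in> ball y0 (2 * s)" using xy s by auto
      have "dist y0 (y + t n) \<le> dist y0 y + norm (t n)"
        using dist_triangle[of y0 "y + t n" y] by (simp add: dist_norm)
      then show "y + t n \<in> ball y0 (2 * s)" using xy t(2)[of n] by auto
    qed (use f2 in auto)
    then have "norm (h (x, y + t n) - h (x, y) - D p * t n) \<le> 2 * M / s ^ 2 * norm (t n) ^ 2"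
      by (simp add: f_def D_def xy numeral_2_eq_2 algebra_simps)
    then have "norm ((h (x, y + t n) - h (x, y) - D p * t n) / t n) \<le> 2 * M / s ^ 2 * norm (t n)"
      using t(1)[of n] by (simp add: norm_divide field_simps power2_eq_square)
    also have "(h (x, y + t n) - h (x, y) - D p * t n) / t n = Q n p - D p"
      using t(1)[of n] by (simp add: Q_def xy field_simps)
    finally show ?thesis .
  qed
  have "uniform_limit V Q D sequentially"
  proof (rule uniform_limitI)
    fix e :: real assume e: "e > 0"
    have "(\<lambda>n. 2 * M / s ^ 2 * norm (t n)) \<longlonglongrightarrow> 2 * M / s ^ 2 * 0"
      unfolding nt by (intro tendsto_intros) real_asymp
    then have "\<forall>\<^sub>F n in sequentially. 2 * M / s ^ 2 * norm (t n) < e"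
      using e by (auto intro: order_tendstoD)
    then show "\<forall>\<^sub>F n in sequentially. \<forall>x\<in>V. dist (Q n x) (D x) < e"
      by eventually_elim (intro ballI, unfold dist_norm, rule le_less_trans[OF est])
  qed
  moreover have "holomorphic2_on (Q n) V" for n
  proof -
    have "holomorphic2_on (\<lambda>p. h (fst p, snd p + t n)) V"
    proof (rule holomorphic2_on_compose[OF h])
      fix p assume "p \<in> V"
      moreover have "dist y0 (snd p + t n) \<le> dist y0 (snd p) + norm (t n)"
        using dist_triangle[of y0 "snd p + t n" "snd p"] by (simp add: dist_norm)
      ultimately show "(fst p, snd p + t n) \<in> W" using t(2)[of n] s(1)
        by (intro inW) (auto simp: V_def)
    qed (use V in \<open>auto intro!: holomorphic2_intros\<close>)
    then show ?thesis unfolding Q_def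
      using t V by (intro holomorphic2_intros holomorphic2_on_subset[OF h]) auto
  qed
  ultimately have "holomorphic2_on D V" using holomorphic2_on_uniform_limit[OF V(1), of Q D] by blast
  then show "\<exists>V. q \<in> V \<and> V \<subseteq> W \<and> holomorphic2_on (\<lambda>q. deriv (\<lambda>z. h (fst q, z)) (snd q)) V"
    using V unfolding D_def by blast
qed

lemma holomorphic2_on_higher_deriv_snd:
  assumes h: "holomorphic2_on h W"
  shows "holomorphic2_on (\<lambda>q. (deriv ^^ n) (\<lambda>z. h (fst q, z)) (snd q)) W"
proof (induction n)
  case 0 then show ?case using h by simp
next
  case (Suc n)
  from holomorphic2_on_deriv_snd[OF this] show ?case by simp
qed

text \<open>The coefficients are the \<open>z\<close>-derivatives along \<open>z = 0\<close> divided
  by factorials, hence holomorphic in \<open>x\<close>; the geometric bound is Cauchy's inequality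
  on the circle of radius \<open>\<rho>\<close>, uniform over the compact set
  \<open>K\<close>.\<close>

lemma holomorphic2_on_taylor:
  assumes h: "holomorphic2_on h (S \<times> ball 0 c)" and S: "open S" and c: "0 < \<rho>" "\<rho> < c"
    and K: "compact K" "K \<subseteq> S"
  obtains A M where "\<And>n. A n holomorphic_on S"
    "\<And>x z. x \<in> S \<Longrightarrow> z \<in> ball 0 c \<Longrightarrow> (\<lambda>n. A n x * z ^ n) sums h (x, z)"
    "\<And>n x. x \<in> K \<Longrightarrow> norm (A n x) \<le> M * (1 / \<rho>) ^ n"
proof -
  define A where "A n x = (deriv ^^ n) (\<lambda>z. h (x, z)) 0 / fact n" for n x
  have slice: "(\<lambda>z. h (x, z)) holomorphic_on ball 0 c" if "x \<in> S" for x
    by (rule holomorphic2_on_curve[OF h]) (use that in \<open>auto intro!: holomorphic_intros\<close>)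
  have 1: "A n holomorphic_on S" for n
    unfolding A_def
    by (intro holomorphic_intros, rule holomorphic2_on_curve[OF holomorphic2_on_higher_deriv_snd[OF h], simplified])
      (use S c in \<open>auto intro!: holomorphic_intros\<close>)
  have 2: "(\<lambda>n. A n x * z ^ n) sums h (x, z)" if "x \<in> S" "z \<in> ball 0 c" for x z
    using holomorphic_power_series[OF slice[OF that(1)] that(2)] by (simp add: A_def)
  have "compact (h ` (K \<times> cball 0 \<rho>))"
    by (intro compact_continuous_image compact_Times K compact_cball
          continuous_on_subset[OF holomorphic2_on_imp_continuous_on[OF h]])
      (use K c in auto)
  then obtain M where M: "\<And>x y. x \<in> K \<Longrightarrow> y \<in> cball 0 \<rho> \<Longrightarrow> norm (h (x, y)) \<le> M"
    using compact_imp_bounded bounded_iff by (metis (no_types, lifting) SigmaI image_eqI)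
  have 3: "norm (A n x) \<le> M * (1 / \<rho>) ^ n" if x: "x \<in> K" for n x
  proof -
    have "norm ((deriv ^^ n) (\<lambda>z. h (x, z)) 0) \<le> fact n * M / \<rho> ^ n"
    proof (rule Cauchy_inequality)
      show "(\<lambda>z. h (x, z)) holomorphic_on ball 0 \<rho>"
        using slice x K c by (meson holomorphic_on_subset subset_ball less_imp_le subsetD)
      show "continuous_on (cball 0 \<rho>) (\<lambda>z. h (x, z))"
        by (rule holomorphic_on_imp_continuous_on, rule holomorphic_on_subset[OF slice]) (use x K c in auto)
    qed (use M x c in auto)
    then show ?thesis by (simp add: A_def norm_divide field_simps)
  qed
  show ?thesis by (rule that[OF 1 2 3])
qed

lemma holomorphic_nonzero_punctured:
  assumes f: "f holomorphic_on ball a s" and s: "0 < s" and nz: "\<exists>x\<in>ball a s. f x \<noteq> 0"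
  obtains r where "0 < r" "r \<le> s" "\<And>x. x \<in> ball a r - {a} \<Longrightarrow> f x \<noteq> 0"
proof (cases "f a = 0")
  case True
  obtain b where b: "b \<in> ball a s" "f b \<noteq> 0" using nz by blast
  obtain r where "0 < r" "ball a r \<subseteq> ball a s" "\<And>z. z \<in> ball a r - {a} \<Longrightarrow> f z \<noteq> 0"
    by (rule isolated_zeros[OF f open_ball connected_ball _ True b]) (use s in auto)
  then show ?thesis using that[of "min r s"] s by auto
next
  case False
  have "continuous (at a) f"
    using f s by (metis centre_in_ball continuous_on_eq_continuous_at holomorphic_on_imp_continuous_on open_ball)
  from continuous_at_avoid[OF this False] obtain e where "e > 0" "\<And>y. dist a y < e \<Longrightarrow> f y \<noteq> 0" by blast
  then show ?thesis using that[of "min e s"] s by auto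
qed

text \<open>\<open>d\<close> is the generic vanishing order along \<open>z = 0\<close>.\<close>

lemma holomorphic2_on_factor_snd:
  assumes h: "holomorphic2_on h (ball a s \<times> ball 0 c)" and s: "0 < s" and c: "0 < c"
    and nz: "\<exists>q\<in>ball a s \<times> ball 0 c. h q \<noteq> 0"
  obtains d s' c' h' where "0 < s'" "s' \<le> s" "0 < c'" "c' \<le> c"
    "holomorphic2_on h' (ball a s' \<times> ball 0 c')"
    "\<And>x z. x \<in> ball a s' \<Longrightarrow> z \<in> ball 0 c' \<Longrightarrow> h (x, z) = z ^ d * h' (x, z)"
    "\<And>x. x \<in> ball a s' - {a} \<Longrightarrow> h' (x, 0) \<noteq> 0"
proof -
  have sub: "cball a (s/2) \<subseteq> ball a s" and c2: "0 < c/2" "c/2 < c" using s c by auto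
  obtain A M where A: "\<And>n. A n holomorphic_on ball a s"
    and sums: "\<And>x z. x \<in> ball a s \<Longrightarrow> z \<in> ball 0 c \<Longrightarrow> (\<lambda>n. A n x * z ^ n) sums h (x, z)"
    and bnd: "\<And>n x. x \<in> cball a (s/2) \<Longrightarrow> norm (A n x) \<le> M * (1 / (c/2)) ^ n"
    by (rule holomorphic2_on_taylor[OF h open_ball c2 compact_cball sub], rule that)
  have ex: "\<exists>n. \<exists>x\<in>ball a s. A n x \<noteq> 0"
  proof (rule ccontr)
    assume "\<not> ?thesis"
    then have "h (x, z) = 0" if "x \<in> ball a s" "z \<in> ball 0 c" for x z
      using sums[OF that] that sums_unique2[OF _ sums_zero] by simp
    then show False using nz by auto
  qed
  define d where "d = (LEAST n. \<exists>x\<in>ball a s. A n x \<noteq> 0)"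
  have d: "\<exists>x\<in>ball a s. A d x \<noteq> 0" unfolding d_def using ex by (rule LeastI_ex)
  have less: "A n x = 0" if "n < d" "x \<in> ball a s" for n x
    using that not_less_Least unfolding d_def by blast
  \<comment> \<open>Zeros of \<open>A d\<close> are isolated, so after shrinking only the centre can
    be one; \<open>h' (x, 0)\<close> is just \<open>A d x\<close>. The bound \<open>s/2\<close>
    below keeps \<open>x\<close> where the coefficients are estimated.\<close>
  obtain r where r: "0 < r" "r \<le> s" "\<And>x. x \<in> ball a r - {a} \<Longrightarrow> A d x \<noteq> 0"
    using holomorphic_nonzero_punctured[OF A s d] by blast
  define s' where "s' = min r (s/2)"
  have s': "0 < s'" "s' \<le> s" "s' \<le> r" "s' \<le> s/2" using r s by (auto simp: s'_def)
  define h' where "h' q = (\<Sum>n. A (n + d) (fst q) * snd q ^ n)" for q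
  have 1: "holomorphic2_on h' (ball a s' \<times> ball 0 (1 / (2/c)))"
    unfolding h'_def
  proof (rule holomorphic2_on_power_series)
    show "A (n + d) holomorphic_on ball a s'" for n
      by (rule holomorphic_on_subset[OF A]) (use s' in auto)
    show "norm (A (n + d) x) \<le> (M * (2/c) ^ d) * (2/c) ^ n" if "x \<in> ball a s'" for n x
      using bnd[of x "n + d"] that s' by (simp add: power_add mult_ac)
  qed (use c in auto)
  have 2: "h (x, z) = z ^ d * h' (x, z)" if "x \<in> ball a s'" "z \<in> ball 0 (c/2)" for x z
  proof -
    have S: "(\<lambda>n. A n x * z ^ n) sums h (x, z)" using that s' c by (intro sums) auto
    have "(\<lambda>n. A (n + d) x * z ^ (n + d)) sums (h (x, z) - (\<Sum>i<d. A i x * z ^ i))"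
      by (rule sums_split_initial_segment[OF S])
    moreover have "(\<Sum>i<d. A i x * z ^ i) = 0" using less that s' by (intro sum.neutral) auto
    ultimately have T: "(\<lambda>n. z ^ d * (A (n + d) x * z ^ n)) sums h (x, z)"
      by (simp add: power_add mult_ac)
    show ?thesis
    proof (cases "z = 0")
      case True
      then show ?thesis
      proof (cases "d = 0")
        case True
        then show ?thesis using sums_unique[OF S] by (simp add: h'_def)
      next
        case False
        then show ?thesis using sums_unique2[OF T] True by (simp add: power_0_left)
      qed
    next
      case False
      then have "summable (\<lambda>n. A (n + d) x * z ^ n)"
        using sums_summable[OF T] by simp
      from suminf_mult[OF this, of "z ^ d"] show ?thesis
        using sums_unique[OF T] by (simp add: h'_def)
    qed
  qed
  have 3: "h' (x, 0) = A d x" for x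
    by (simp add: h'_def)
  show ?thesis
    by (rule that[of s' "c/2" h' d]) (use s' c 1 2 r in \<open>auto simp: 3\<close>)
qed

section \<open>Zeros and poles of families of holomorphic functions\<close>

lemma holomorphic_divide_zero:
  assumes f: "f holomorphic_on S" and S: "open S" "connected S" and a: "a \<in> S" "f a = 0"
    and nz: "\<exists>x\<in>S. f x \<noteq> 0"
  obtains n g where "0 < (n::nat)" "g holomorphic_on S" "\<And>x. x \<in> S \<Longrightarrow> f x = (x - a) ^ n * g x" "g a \<noteq> 0"
proof -
  from zorder_exist_zero[OF f S a(1) nz] a(2) obtain r where n: "zorder f a > 0"
    and r: "r > 0" "cball a r \<subseteq> S" and h: "zor_poly f a holomorphic_on cball a r"
    and eq: "\<And>w. w \<in> cball a r \<Longrightarrow> f w = zor_poly f a w * (w - a) ^ nat (zorder f a) \<and> zor_poly f a w \<noteq> 0"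
    by (auto split: if_splits)
  define n where "n = nat (zorder f a)"
  define g where "g x = (if x = a then zor_poly f a a else f x / (x - a) ^ n)" for x
  have ge: "g x = zor_poly f a x" if "x \<in> ball a r" for x
    using eq[of x] that by (auto simp: g_def n_def)
  have "g holomorphic_on ball a r"
    by (rule holomorphic_transform[OF holomorphic_on_subset[OF h]]) (use ge in auto)
  moreover have "g holomorphic_on S - {a}"
    by (rule holomorphic_transform[of "\<lambda>x. f x / (x - a) ^ n"])
      (auto simp: g_def intro!: holomorphic_intros holomorphic_on_subset[OF f])
  moreover have "ball a r \<union> (S - {a}) = S" using r a by auto
  ultimately have "g holomorphic_on S"
    using holomorphic_on_Un[OF _ _ open_ball open_delete[OF S(1)]] by metis
  moreover have "f x = (x - a) ^ n * g x" if "x \<in> S" for x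
    using a n by (auto simp: g_def n_def power_0_left)
  moreover have "g a \<noteq> 0" using eq[of a] r by (auto simp: g_def)
  ultimately show ?thesis using that[of n g] n by (auto simp: n_def)
qed

text \<open>Induction on the number of distinct zeros in \<open>K\<close>, finite by compactness;
  each step divides out one zero with its full multiplicity.\<close>

lemma holomorphic_factor_poly:
  fixes f :: "complex \<Rightarrow> complex"
  assumes f: "f holomorphic_on S" and S: "open S" "connected S" and K: "compact K" "K \<subseteq> S"
    and nz: "\<exists>x\<in>S. f x \<noteq> 0"
  obtains Q e where "Q \<noteq> 0" "\<And>x. poly Q x = 0 \<Longrightarrow> x \<in> K" "e holomorphic_on S"
    "\<And>x. x \<in> S \<Longrightarrow> f x = poly Q x * e x" "\<And>x. x \<in> K \<Longrightarrow> e x \<noteq> 0"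
proof -
  have "\<exists>Q e. Q \<noteq> 0 \<and> (\<forall>x. poly Q x = 0 \<longrightarrow> x \<in> K) \<and> e holomorphic_on S \<and>
    (\<forall>x\<in>S. f x = poly Q x * e x) \<and> (\<forall>x\<in>K. e x \<noteq> 0)"
    using f nz
  proof (induction "card {x\<in>K. f x = 0}" arbitrary: f rule: less_induct)
    case (less f)
    show ?case
    proof (cases "\<exists>a\<in>K. f a = 0")
      case False
      then show ?thesis using less.prems by (intro exI[of _ 1] exI[of _ f]) auto
    next
      case True
      then obtain a where a: "a \<in> K" "f a = 0" by blast
      have nc: "\<not> f constant_on S" using a K less.prems(2) unfolding constant_on_def by (metis subsetD)
      obtain n g where g: "0 < (n::nat)" "g holomorphic_on S"
        "\<And>x. x \<in> S \<Longrightarrow> f x = (x - a) ^ n * g x" "g a \<noteq> 0"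
        using holomorphic_divide_zero[OF less.prems(1) S _ a(2) less.prems(2)] a K by blast
      have fin: "finite {x\<in>K. f x = 0}"
        by (rule holomorphic_compact_finite_zeros[OF less.prems(1) S K nc])
      have "{x\<in>K. g x = 0} \<subset> {x\<in>K. f x = 0}" using g a K by auto
      then have c: "card {x\<in>K. g x = 0} < card {x\<in>K. f x = 0}" using fin by (simp add: psubset_card_mono)
      have "\<exists>x\<in>S. g x \<noteq> 0" using g(4) a K by blast
      from less.hyps[OF c g(2) this] obtain Q e where Q: "Q \<noteq> 0" "\<forall>x. poly Q x = 0 \<longrightarrow> x \<in> K" "e holomorphic_on S"
        "\<forall>x\<in>S. g x = poly Q x * e x" "\<forall>x\<in>K. e x \<noteq> 0" by (elim exE conjE) (rule that)
      show ?thesis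
      proof (intro exI conjI allI impI ballI)
        show "[:-a, 1:] ^ n * Q \<noteq> 0" using Q(1) by simp
        show "x \<in> K" if "poly ([:-a, 1:] ^ n * Q) x = 0" for x using that Q(2) a by auto
        show "f x = poly ([:-a, 1:] ^ n * Q) x * e x" if "x \<in> S" for x
          using g(3)[OF that] Q(4) that by (simp add: mult.assoc)
      qed (use Q in auto)
    qed
  qed
  then show ?thesis using that by blast
qed

lemma poly_eq_prod_roots:
  fixes Q :: "complex poly"
  obtains a where "\<And>x. poly Q x = lead_coeff Q * (\<Prod>i<degree Q. x - a i)"
proof -
  obtain a where "smult (lead_coeff Q) (\<Prod>i<degree Q. [:- a i, 1:]) = Q"
    by (rule complex_poly_decompose')
  then have "poly (smult (lead_coeff Q) (\<Prod>i<degree Q. [:- a i, 1:])) x = poly Q x" for x by simp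
  then have "poly Q x = lead_coeff Q * (\<Prod>i<degree Q. x - a i)" for x
    by (simp add: poly_prod)
  then show ?thesis using that by blast
qed

lemma winding_number_compose_circlepath:
  assumes f: "f holomorphic_on S" and S: "open S" "sphere c r \<subseteq> S" and r: "0 < r"
    and nz: "\<And>x. x \<in> sphere c r \<Longrightarrow> f x \<noteq> 0"
  shows "winding_number (f \<circ> circlepath c r) 0 = 1 / (2 * pi * \<i>) * contour_integral (circlepath c r) (\<lambda>w. deriv f w / f w)"
proof -
  have an: "f analytic_on S" using f S by (simp add: analytic_on_open)
  have pi: "path_image (circlepath c r) \<subseteq> S" using S r by (simp add: path_image_circlepath)
  have v: "valid_path (f \<circ> circlepath c r)"
    by (rule valid_path_compose_analytic[OF _ an pi]) simp
  have "0 \<notin> path_image (f \<circ> circlepath c r)"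
    using nz r by (auto simp: path_image_compose path_image_circlepath)
  from winding_number_valid_path[OF v this] show ?thesis
    by (simp add: contour_integral_comp_analyticW[OF an _ pi])
qed

lemma open_cball_extend:
  fixes c :: complex
  assumes "open T" "cball c r \<subseteq> T" "0 < r"
  obtains r' where "r < r'" "ball c r' \<subseteq> T"
proof -
  obtain d where d: "d > 0" "(\<Union>x\<in>cball c r. ball x d) \<subseteq> T"
    using compact_subset_open_imp_ball_epsilon_subset[OF compact_cball assms(1,2)] .
  have "ball c (r + d) \<subseteq> T"
  proof
    fix x assume x: "x \<in> ball c (r + d)"
    show "x \<in> T"
    proof (cases "x \<in> cball c r")
      case False
      \<comment> \<open>Radial projection of \<open>x\<close> onto the circle; its distance from
        \<open>x\<close> is \<open>norm (x - c) - r\<close>.\<close>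
      define y where "y = c + of_real (r / norm (x - c)) * (x - c)"
      have n: "norm (x - c) > r" using False by (simp add: dist_norm norm_minus_commute)
      have xc: "x \<noteq> c" using n assms(3) by auto
      have "norm (y - c) = r" using n assms(3) by (auto simp: y_def norm_mult norm_divide)
      moreover have "x - y = of_real (1 - r / norm (x - c)) * (x - c)"
        by (simp add: y_def algebra_simps)
      then have "norm (x - y) = \<bar>1 - r / norm (x - c)\<bar> * norm (x - c)"
        by (simp only: norm_mult norm_of_real)
      then have "norm (x - y) = norm (x - c) - r" using n assms(3) xc
        by (simp add: left_diff_distrib)
      moreover have "norm (x - c) < r + d" using x by (simp add: dist_norm norm_minus_commute)
      ultimately have "y \<in> cball c r" "x \<in> ball y d" by (auto simp: dist_norm norm_minus_commute)
      then show ?thesis using d(2) by blast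
    qed (use assms in auto)
  qed
  then show ?thesis using that[of "r + d"] d by simp
qed

text \<open>Argument principle for a function in factored form. Splitting off one root adds
  \<open>1 / (w - a)\<close> to the logarithmic derivative, whose integral is
  \<open>2 * pi * \<i>\<close>; once no root is left, the logarithmic derivative is holomorphic in
  the larger disk and Cauchy's theorem gives \<open>0\<close>.\<close>

lemma log_derivative_integral_eq_degree:
  assumes e: "e holomorphic_on ball c r'" and r: "0 < r" "r < r'"
    and ez: "\<And>x. x \<in> ball c r' \<Longrightarrow> e x \<noteq> 0"
    and Q: "Q \<noteq> 0" "\<And>x. poly Q x = 0 \<Longrightarrow> x \<in> ball c r"
  shows "((\<lambda>w. deriv (\<lambda>x. poly Q x * e x) w / (poly Q w * e w)) has_contour_integral
    2 * pi * \<i> * of_nat (degree Q)) (circlepath c r)"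
  using Q
proof (induction "degree Q" arbitrary: Q)
  case 0
  obtain q where q: "Q = [:q:]" "q \<noteq> 0" using 0 by (metis degree_eq_zeroE pCons_0_0)
  have "((\<lambda>w. deriv (\<lambda>x. q * e x) w / (q * e w)) has_contour_integral 0) (circlepath c r)"
  proof (rule Cauchy_theorem_disc_simple[of _ c r'])
    show "(\<lambda>w. deriv (\<lambda>x. q * e x) w / (q * e w)) holomorphic_on ball c r'"
      using q ez e by (auto intro!: holomorphic_intros)
  qed (use r in \<open>auto simp: path_image_circlepath\<close>)
  then show ?case using q by simp
next
  case (Suc n)
  have "\<not> constant (poly Q)" using Suc(2) by (subst constant_degree) auto
  then obtain a where a: "poly Q a = 0" using fundamental_theorem_of_algebra by blast
  then obtain P where P: "Q = [:-a, 1:] * P" unfolding poly_eq_0_iff_dvd by blast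
  have P0: "P \<noteq> 0" using P Suc by auto
  have dP: "degree Q = Suc (degree P)" using P0 unfolding P by (subst degree_mult_eq) auto
  have IH: "((\<lambda>w. deriv (\<lambda>x. poly P x * e x) w / (poly P w * e w)) has_contour_integral
    2 * pi * \<i> * of_nat (degree P)) (circlepath c r)"
    by (rule Suc(1)) (use Suc dP P P0 in auto)
  have aball: "a \<in> ball c r" using Suc(4) a by blast
  then have "winding_number (circlepath c r) a = 1"
    by (intro winding_number_circlepath) (simp add: dist_norm norm_minus_commute)
  moreover have "a \<notin> path_image (circlepath c r)" using aball r by (auto simp: path_image_circlepath)
  ultimately have "((\<lambda>w. 1 / (w - a)) has_contour_integral 2 * pi * \<i>) (circlepath c r)"
    using has_contour_integral_winding_number[of "circlepath c r" a] by simp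
  from has_contour_integral_add[OF this IH]
  have "((\<lambda>w. 1 / (w - a) + deriv (\<lambda>x. poly P x * e x) w / (poly P w * e w)) has_contour_integral
     2 * pi * \<i> * of_nat (degree Q)) (circlepath c r)"
    by (simp add: dP algebra_simps)
  then show ?case
  proof (rule has_contour_integral_eq)
    fix w assume "w \<in> path_image (circlepath c r)"
    then have w: "w \<in> sphere c r" using r by (simp add: path_image_circlepath)
    then have Pw: "poly P w \<noteq> 0" "w \<noteq> a" "e w \<noteq> 0"
      using Suc(4)[of w] aball P ez[of w] r by auto
    have dd: "((\<lambda>x. poly P x * e x) has_field_derivative deriv (\<lambda>x. poly P x * e x) w) (at w)"
      by (rule holomorphic_derivI[of _ "ball c r'"]) (use w r e in \<open>auto intro!: holomorphic_intros\<close>)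
    have "((\<lambda>x. (x - a) * (poly P x * e x)) has_field_derivative
        (poly P w * e w + (w - a) * deriv (\<lambda>x. poly P x * e x) w)) (at w)"
      by (rule derivative_eq_intros dd refl | simp)+
    then have "deriv (\<lambda>x. (x - a) * (poly P x * e x)) w = poly P w * e w + (w - a) * deriv (\<lambda>x. poly P x * e x) w"
      by (rule DERIV_imp_deriv)
    moreover have "(\<lambda>x. poly Q x * e x) = (\<lambda>x. (x - a) * (poly P x * e x))"
      by (auto simp: P algebra_simps)
    moreover have "poly Q w = (w - a) * poly P w" by (simp add: P algebra_simps)
    moreover have "1 / u + D / B = (B + u * D) / (u * B)" if "u \<noteq> 0" "B \<noteq> 0" for u B D :: complex
      using that by (simp add: field_simps)
    ultimately show "1 / (w - a) + deriv (\<lambda>x. poly P x * e x) w / (poly P w * e w) =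
      deriv (\<lambda>x. poly Q x * e x) w / (poly Q w * e w)"
      using Pw by (simp add: mult.assoc)
  qed
qed

text \<open>Turns the winding number, which is stable under perturbation and bounded along a test
  sequence, into an algebraic count of zeros.\<close>

lemma winding_number_eq_degree:
  assumes e: "e holomorphic_on S" and S: "open S" "cball c r \<subseteq> S" and r: "0 < r"
    and ez: "\<And>x. x \<in> cball c r \<Longrightarrow> e x \<noteq> 0"
    and Q: "Q \<noteq> 0" "\<And>x. poly Q x = 0 \<Longrightarrow> x \<in> ball c r"
    and f: "\<And>x. x \<in> S \<Longrightarrow> f x = poly Q x * e x"
  shows "winding_number (f \<circ> circlepath c r) 0 = of_nat (degree Q)"
proof -
  have "open (S \<inter> e -` (- {0}))"
    by (rule continuous_open_preimage[OF holomorphic_on_imp_continuous_on[OF e] S(1)]) auto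
  then obtain r' where r': "r < r'" "ball c r' \<subseteq> S \<inter> e -` (- {0})"
    by (rule open_cball_extend[OF _ _ r]) (use S ez in auto)
  have ss: "sphere c r \<subseteq> S" using S by auto
  have "winding_number (f \<circ> circlepath c r) 0 = winding_number ((\<lambda>x. poly Q x * e x) \<circ> circlepath c r) 0"
    proof (rule winding_number_cong)
    fix t :: real
    have "circlepath c r t \<in> sphere c r" using r by (simp add: circlepath dist_norm norm_mult)
    then show "(f \<circ> circlepath c r) t = ((\<lambda>x. poly Q x * e x) \<circ> circlepath c r) t"
      using ss f by auto
  qed
  also have "\<dots> = 1 / (2 * pi * \<i>) *
      contour_integral (circlepath c r) (\<lambda>w. deriv (\<lambda>x. poly Q x * e x) w / (poly Q w * e w))"
    by (rule winding_number_compose_circlepath[OF _ S(1) ss r])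
      (use ez Q(2) e in \<open>force intro!: holomorphic_intros\<close>)+
  also have "contour_integral (circlepath c r) (\<lambda>w. deriv (\<lambda>x. poly Q x * e x) w / (poly Q w * e w))
     = 2 * pi * \<i> * of_nat (degree Q)"
    by (rule contour_integral_unique, rule log_derivative_integral_eq_degree[of e c r'])
      (use r' r e Q in \<open>auto intro: holomorphic_on_subset\<close>)
  finally show ?thesis by (simp add: o_def)
qed

text \<open>Zeros counted with multiplicity, encoded by a polynomial factor of bounded degree. In
  this form the count is additive under products, and pole orders can be compared with orders of
  polynomial roots.\<close>

definition zeros_at_most :: "(complex \<Rightarrow> complex) \<Rightarrow> complex set \<Rightarrow> nat \<Rightarrow> bool" where
  "zeros_at_most f V n \<longleftrightarrow> (\<exists>Q e. Q \<noteq> 0 \<and> degree Q \<le> n \<and> e holomorphic_on V \<and>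
     (\<forall>x\<in>V. e x \<noteq> 0) \<and> (\<forall>x\<in>V. f x = poly Q x * e x))"

lemma zeros_at_most_mult:
  assumes "zeros_at_most f V n" "zeros_at_most g V m"
  shows "zeros_at_most (\<lambda>x. f x * g x) V (n + m)"
proof -
  obtain P d Q e where "P \<noteq> 0" "degree P \<le> n" "d holomorphic_on V" "\<forall>x\<in>V. d x \<noteq> 0" "\<forall>x\<in>V. f x = poly P x * d x"
    "Q \<noteq> 0" "degree Q \<le> m" "e holomorphic_on V" "\<forall>x\<in>V. e x \<noteq> 0" "\<forall>x\<in>V. g x = poly Q x * e x"
    using assms unfolding zeros_at_most_def by blast
  then show ?thesis unfolding zeros_at_most_def
    by (intro exI[of _ "P * Q"] exI[of _ "\<lambda>x. d x * e x"])
      (auto simp: degree_mult_eq intro!: holomorphic_intros)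
qed

lemma zeros_at_most_nonzero:
  "f holomorphic_on V \<Longrightarrow> (\<And>x. x \<in> V \<Longrightarrow> f x \<noteq> 0) \<Longrightarrow> zeros_at_most f V 0"
  unfolding zeros_at_most_def by (intro exI[of _ 1] exI[of _ f]) auto

lemma zeros_at_most_power:
  "zeros_at_most f V n \<Longrightarrow> zeros_at_most (\<lambda>x. f x ^ k) V (k * n)"
  by (induction k) (auto intro: zeros_at_most_nonzero zeros_at_most_mult)

lemma zeros_at_most_poly: "Q \<noteq> 0 \<Longrightarrow> zeros_at_most (poly Q) V (degree Q)"
  unfolding zeros_at_most_def by (intro exI[of _ Q] exI[of _ "\<lambda>_. 1"]) auto

lemma zeros_at_most_subset: "zeros_at_most f V n \<Longrightarrow> U \<subseteq> V \<Longrightarrow> zeros_at_most f U n"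
  unfolding zeros_at_most_def by (blast intro: holomorphic_on_subset)

text \<open>Rouche's theorem: on the circle the values of \<open>g\<close> stay so close to those of
  \<open>f\<close> that the winding numbers coincide, and these are the degrees of the polynomial
  factors. One \<open>n\<close> therefore serves for all such \<open>g\<close>.\<close>

lemma zeros_at_most_perturb:
  assumes f: "f holomorphic_on S" and S: "open S" "cball c r \<subseteq> S" and r: "0 < r"
    and nz: "\<And>x. x \<in> sphere c r \<Longrightarrow> f x \<noteq> 0"
  obtains n where "\<And>g. g holomorphic_on S \<Longrightarrow> (\<And>x. x \<in> sphere c r \<Longrightarrow> norm (g x - f x) < norm (f x)) \<Longrightarrow>
     zeros_at_most g (ball c r) n"
proof -
  obtain r' where r': "r < r'" "ball c r' \<subseteq> S" by (rule open_cball_extend[OF S r])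
  have fac: "\<exists>Q e. Q \<noteq> 0 \<and> e holomorphic_on ball c r' \<and> (\<forall>x\<in>ball c r'. g x = poly Q x * e x) \<and>
     (\<forall>x\<in>cball c r. e x \<noteq> 0) \<and> winding_number (g \<circ> circlepath c r) 0 = of_nat (degree Q)"
    if g: "g holomorphic_on S" and gz: "\<And>x. x \<in> sphere c r \<Longrightarrow> g x \<noteq> 0" for g
  proof -
    have h: "g holomorphic_on ball c r'" using g r' by (blast intro: holomorphic_on_subset)
    have p: "c + of_real r \<in> sphere c r" using r by (simp add: dist_norm)
    have cb: "cball c r \<subseteq> ball c r'" using r' by auto
    have "\<exists>x\<in>ball c r'. g x \<noteq> 0"
      by (rule bexI[of _ "c + of_real r"]) (use p gz r' in auto)
    from holomorphic_factor_poly[OF h open_ball connected_ball compact_cball cb this]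
    obtain Q e where Q: "Q \<noteq> 0" "\<And>x. poly Q x = 0 \<Longrightarrow> x \<in> cball c r" "e holomorphic_on ball c r'"
      "\<And>x. x \<in> ball c r' \<Longrightarrow> g x = poly Q x * e x" "\<And>x. x \<in> cball c r \<Longrightarrow> e x \<noteq> 0" by blast
    have Qb: "x \<in> ball c r" if "poly Q x = 0" for x
    proof -
      have "x \<in> cball c r" "x \<notin> sphere c r" using Q(2)[OF that] Q(4)[of x] gz[of x] that cb by auto
      then show ?thesis by auto
    qed
    have "winding_number (g \<circ> circlepath c r) 0 = of_nat (degree Q)"
      by (rule winding_number_eq_degree[OF Q(3) open_ball cb r Q(5) Q(1) Qb Q(4)])
    then show ?thesis using Q by blast
  qed
  have ss: "path_image (circlepath c r) \<subseteq> S" using r S by (auto simp: path_image_circlepath)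
  have pathg: "path (g \<circ> circlepath c r)" if "g holomorphic_on S" for g
    using path_continuous_image[OF path_circlepath continuous_on_subset[OF holomorphic_on_imp_continuous_on[OF that] ss]] .
  obtain P where P: "winding_number (f \<circ> circlepath c r) 0 = of_nat (degree (P :: complex poly))"
    using fac[OF f nz] by blast
  show ?thesis
  proof (rule that[of "degree P"])
    fix g assume g: "g holomorphic_on S" and less: "\<And>x. x \<in> sphere c r \<Longrightarrow> norm (g x - f x) < norm (f x)"
    have gz: "g x \<noteq> 0" if "x \<in> sphere c r" for x using less[OF that] by auto
    from fac[OF g gz] obtain Q e where Q: "Q \<noteq> 0" "e holomorphic_on ball c r'" "\<forall>x\<in>ball c r'. g x = poly Q x * e x"
     "\<forall>x\<in>cball c r. e x \<noteq> 0" "winding_number (g \<circ> circlepath c r) 0 = of_nat (degree Q)" by blast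
    have sph: "circlepath c r t \<in> sphere c r" for t using r by (simp add: circlepath dist_norm norm_mult)
    have "winding_number (g \<circ> circlepath c r) 0 = winding_number (f \<circ> circlepath c r) 0"
      by (rule winding_number_nearby_loops_eq)
        (use pathg f g less sph in \<open>auto simp: pathfinish_def pathstart_def circlepath\<close>)
    then have "degree Q = degree P" using Q P by simp
    then show "zeros_at_most g (ball c r) (degree P)"
      unfolding zeros_at_most_def using Q r'
      by (intro exI[of _ Q] exI[of _ e]) (auto intro: holomorphic_on_subset)
  qed
qed

lemma analytic_on_poly: "poly Q analytic_on S" for Q :: "complex poly"
  by (rule analytic_on_subset[of _ UNIV]) (auto simp: analytic_on_open intro!: holomorphic_intros)

lemma meromorphic_on_singularity:
  assumes "f meromorphic_on A" "z \<in> A"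
  shows "isolated_singularity_at f z" "not_essential f z"
  using assms by (meson meromorphic_on_meromorphic_at meromorphic_at_iff)+

text \<open>If the pole order \<open>n\<close> exceeded the root order \<open>k\<close>, then
  \<open>u w * (w - p) ^ n\<close> would have two limits at \<open>p\<close>: the nonzero value of
  \<open>zor_poly\<close>, and \<open>0\<close>, because \<open>u w * (w - p) ^ k\<close> stays
  bounded by the relation with \<open>G\<close>.\<close>

lemma zorder_pole_le_order:
  fixes Q :: "complex poly"
  assumes u: "u meromorphic_on {p}" "is_pole u p" and Q: "Q \<noteq> 0"
    and V: "open V" "p \<in> V" and G: "G holomorphic_on V" and e: "e holomorphic_on V" "\<And>x. x \<in> V \<Longrightarrow> e x \<noteq> 0"
    and eq: "\<And>x. x \<in> V - {p} \<Longrightarrow> poly Q x \<noteq> 0 \<Longrightarrow> u x * (poly Q x * e x) = G x"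
  shows "nat (- zorder u p) \<le> order p Q"
proof (rule ccontr)
  define k where "k = order p Q"
  define n where "n = nat (- zorder u p)"
  assume "\<not> ?thesis"
  then have nk: "k < n" by (simp add: k_def n_def)
  obtain R where R: "Q = [:-p, 1:] ^ k * R" "\<not> [:-p, 1:] dvd R"
    using order_decomp[OF Q] unfolding k_def by blast
  then have Rp: "poly R p \<noteq> 0" by (simp add: poly_eq_0_iff_dvd)
  have iso: "isolated_singularity_at u p" "not_essential u p"
    using u(1) by (simp_all add: meromorphic_at_iff)
  have "\<exists>\<^sub>F w in at p. u w \<noteq> 0"
    using non_zero_neighbour_pole[OF u(2)] by (simp add: eventually_frequently)
  from zorder_exist[OF iso this] obtain r where gp: "zor_poly u p p \<noteq> 0" and r: "r > 0"
    and g: "zor_poly u p holomorphic_on cball p r"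
    and ug: "\<And>w. w \<in> cball p r - {p} \<Longrightarrow> u w = zor_poly u p w * (w - p) powi zorder u p" by auto
  define g where "g = zor_poly u p"
  define m where "m x = G x / (poly R x * e x)" for x
  have cm: "isCont m p"
  proof -
    have "isCont G p" "isCont e p"
      using G e V by (metis continuous_on_eq_continuous_at holomorphic_on_imp_continuous_on)+
    then show ?thesis unfolding m_def using Rp e(2) V by (intro continuous_intros) auto
  qed
  have cg: "isCont g p"
    using g r unfolding g_def by (metis centre_in_ball ball_subset_cball continuous_on_eq_continuous_at
        continuous_on_subset holomorphic_on_imp_continuous_on open_ball)
  have ev: "\<forall>\<^sub>F w in at p. m w * (w - p) ^ (n - k) = g w"
  proof -
    have "\<forall>\<^sub>F w in at p. poly R w \<noteq> 0"
      using tendsto_imp_eventually_ne[OF poly_isCont[unfolded isCont_def] Rp] .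
    moreover have "\<forall>\<^sub>F w in at p. w \<in> V - {p}" using V by (rule eventually_at_in_open)
    moreover have "\<forall>\<^sub>F w in at p. w \<in> ball p r - {p}" using r by (intro eventually_at_in_open) auto
    ultimately show ?thesis
    proof eventually_elim
      case (elim w)
      have wp: "w - p \<noteq> 0" using elim by auto
      have Qw: "poly Q w = (w - p) ^ k * poly R w" by (simp add: R(1))
      have "u w = g w * (w - p) powi zorder u p" using ug[of w] elim by (auto simp: g_def)
      also have "(w - p) powi zorder u p = inverse ((w - p) ^ n)"
        using nk by (simp add: n_def power_int_def power_inverse)
      finally have uw: "u w * (w - p) ^ n = g w" using wp by simp
      have "G w = (u w * (w - p) ^ k) * (poly R w * e w)"
        using eq[of w] elim wp by (simp add: Qw mult_ac)
      moreover have "poly R w * e w \<noteq> 0" using elim e(2)[of w] by simp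
      ultimately have "m w = u w * (w - p) ^ k" unfolding m_def by simp
      then have "m w * (w - p) ^ (n - k) = u w * ((w - p) ^ k * (w - p) ^ (n - k))" by simp
      also have "\<dots> = g w" using nk uw by (simp flip: power_add)
      finally show ?case .
    qed
  qed
  have "(\<lambda>w. m w * (w - p) ^ (n - k)) \<midarrow>p\<rightarrow> m p * (p - p) ^ (n - k)"
    using cm unfolding isCont_def by (intro tendsto_intros) auto
  then have "g \<midarrow>p\<rightarrow> 0" using nk Lim_transform_eventually[OF _ ev] by (simp add: power_0_left)
  moreover have "g \<midarrow>p\<rightarrow> g p" using cg by (simp add: isCont_def)
  ultimately have "g p = 0" using LIM_unique by blast
  then show False using gp by (simp add: g_def)
qed

text \<open>A pole in \<open>V i\<close> must be absorbed by a root of the polynomial part of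
  \<open>H i\<close> of at least the same order. \<open>remove_sings\<close> supplies the correct
  values at removable singularities, where the relation with \<open>H i\<close> may say nothing
  about \<open>u\<close>.\<close>

lemma remove_sings_poles_at_most:
  assumes D: "open D" and I: "finite I" and V: "\<And>i. i \<in> I \<Longrightarrow> open (V i)" and cov: "D \<subseteq> (\<Union>i\<in>I. V i)"
    and H: "\<And>i. i \<in> I \<Longrightarrow> zeros_at_most (H i) (V i) (n i)" and G: "\<And>i. i \<in> I \<Longrightarrow> G i holomorphic_on V i"
    and eq: "\<And>i x. i \<in> I \<Longrightarrow> x \<in> V i \<Longrightarrow> H i x \<noteq> 0 \<Longrightarrow> u x * H i x = G i x"
  shows "u meromorphic_on D" "remove_sings u meromorphic_on D"
    "poles_at_most (remove_sings u) D (\<Sum>i\<in>I. n i)"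
proof -
  define R where "R i p \<longleftrightarrow> fst p \<noteq> 0 \<and> degree (fst p) \<le> n i \<and> snd p holomorphic_on V i \<and>
     (\<forall>x\<in>V i. snd p x \<noteq> 0) \<and> (\<forall>x\<in>V i. H i x = poly (fst p) x * snd p x)" for i p
  have "\<forall>i\<in>I. \<exists>p. R i p"
  proof
    fix i assume "i \<in> I"
    from H[OF this] show "\<exists>p. R i p"
      unfolding zeros_at_most_def R_def by (elim exE) (rule_tac x = "(Q, e)" in exI, simp)
  qed
  from bchoice[OF this] obtain q where "\<forall>i\<in>I. R i (q i)" by blast
  then have Q: "\<And>i. i \<in> I \<Longrightarrow> fst (q i) \<noteq> 0" "\<And>i. i \<in> I \<Longrightarrow> degree (fst (q i)) \<le> n i"
    and e: "\<And>i. i \<in> I \<Longrightarrow> snd (q i) holomorphic_on V i" "\<And>i x. i \<in> I \<Longrightarrow> x \<in> V i \<Longrightarrow> snd (q i) x \<noteq> 0"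
    and HQ: "\<And>i x. i \<in> I \<Longrightarrow> x \<in> V i \<Longrightarrow> H i x = poly (fst (q i)) x * snd (q i) x"
    unfolding R_def by simp_all
  have mer: "u meromorphic_on {x}" if x: "i \<in> I" "x \<in> V i" for i x
  proof -
    have "\<forall>\<^sub>F w in at x. poly (fst (q i)) w \<noteq> 0"
    proof -
      have "finite ({w. poly (fst (q i)) w = 0} - {x})" using poly_roots_finite[OF Q(1)[OF x(1)]] by simp
      then have "open (- ({w. poly (fst (q i)) w = 0} - {x}))" by (intro open_Compl finite_imp_closed)
      from eventually_at_in_open[OF this, of x] show ?thesis by (auto elim: eventually_mono)
    qed
    moreover have "\<forall>\<^sub>F w in at x. w \<in> V i - {x}" using V x by (intro eventually_at_in_open) auto
    ultimately have ev: "\<forall>\<^sub>F w in at x. G i w / (poly (fst (q i)) w * snd (q i) w) = u w"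
    proof eventually_elim
      case (elim w)
      have "H i w \<noteq> 0" using elim HQ[OF x(1)] e(2)[OF x(1)] by simp
      moreover from eq[OF x(1) _ this] have "u w * H i w = G i w" using elim by blast
      ultimately show ?case using HQ[OF x(1), of w] elim by (metis DiffD1 nonzero_mult_div_cancel_right)
    qed
    have an: "G i analytic_on {x}" "snd (q i) analytic_on {x}" "poly (fst (q i)) analytic_on {x}"
      subgoal unfolding analytic_at using G V x by blast
      subgoal unfolding analytic_at using e(1) V x by blast
      subgoal by (rule analytic_on_poly)
      done
    have "(\<lambda>w. G i w / (poly (fst (q i)) w * snd (q i) w)) meromorphic_on {x}"
      by (intro meromorphic_intros analytic_on_imp_meromorphic_on an)
    then show ?thesis
      using meromorphic_on_cong[of "{x}" "\<lambda>w. G i w / (poly (fst (q i)) w * snd (q i) w)" u "{x}"] ev by auto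
  qed
  show um: "u meromorphic_on D"
    unfolding meromorphic_on_meromorphic_at[of u D] using mer cov by blast
  then show "remove_sings u meromorphic_on D" by (rule remove_sings_meromorphic)
  define P where "P = {z\<in>D. is_pole (remove_sings u) z}"
  have isor: "is_pole (remove_sings u) z = is_pole u z" "zorder (remove_sings u) z = zorder u z"
    if "z \<in> D" for z
    using meromorphic_on_singularity[OF um that]
    by (auto simp: is_pole_remove_sings_iff zorder_remove_sings)
  have key: "nat (- zorder (remove_sings u) p) \<le> order p (fst (q i))" if "p \<in> P" "i \<in> I" "p \<in> V i" for p i
  proof -
    have p: "is_pole u p" "p \<in> D" using that isor by (auto simp: P_def)
    have "nat (- zorder u p) \<le> order p (fst (q i))"
      by (rule zorder_pole_le_order[OF mer[OF that(2,3)] p(1) Q(1) V that(3) G e])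
        (use that eq HQ e in auto)
    then show ?thesis using isor p by simp
  qed
  have pos: "nat (- zorder (remove_sings u) p) > 0" if "p \<in> P" for p
  proof -
    have "isolated_singularity_at u p" "is_pole u p"
      using that isor meromorphic_on_singularity(1)[OF um] by (auto simp: P_def)
    from isolated_pole_imp_neg_zorder[OF this] show ?thesis using that isor by (auto simp: P_def)
  qed
  have fin: "finite P"
  proof (rule finite_subset)
    show "P \<subseteq> (\<Union>i\<in>I. {x. poly (fst (q i)) x = 0})"
    proof
      fix p assume p: "p \<in> P"
      then obtain i where i: "i \<in> I" "p \<in> V i" using cov by (auto simp: P_def)
      then have "order p (fst (q i)) \<noteq> 0" using key[OF p i] pos[OF p] by linarith
      then show "p \<in> (\<Union>i\<in>I. {x. poly (fst (q i)) x = 0})" using i order_root by blast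
    qed
    show "finite (\<Union>i\<in>I. {x. poly (fst (q i)) x = 0})" using I Q poly_roots_finite by blast
  qed
  \<comment> \<open>A pole lying in several \<open>V i\<close> is counted for each of them, which
    only enlarges the bound; after exchanging the sums each inner sum counts roots of a single
    polynomial.\<close>
  have "(\<Sum>p\<in>P. nat (- zorder (remove_sings u) p)) \<le> (\<Sum>p\<in>P. \<Sum>i\<in>I. order p (fst (q i)))"
  proof (rule sum_mono)
    fix p assume p: "p \<in> P"
    then obtain i where i: "i \<in> I" "p \<in> V i" using cov by (auto simp: P_def)
    have "nat (- zorder (remove_sings u) p) \<le> order p (fst (q i))" by (rule key[OF p i])
    also have "\<dots> \<le> (\<Sum>i\<in>I. order p (fst (q i)))" using I i by (intro member_le_sum) auto
    finally show "nat (- zorder (remove_sings u) p) \<le> (\<Sum>i\<in>I. order p (fst (q i)))" .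
  qed
  also have "\<dots> = (\<Sum>i\<in>I. \<Sum>p\<in>P. order p (fst (q i)))" by (rule sum.swap)
  also have "\<dots> \<le> (\<Sum>i\<in>I. n i)"
  proof (rule sum_mono)
    fix i assume i: "i \<in> I"
    have "(\<Sum>p\<in>P. order p (fst (q i))) = (\<Sum>p\<in>P \<inter> {x. poly (fst (q i)) x = 0}. order p (fst (q i)))"
      using fin by (intro sum.mono_neutral_right) (auto simp: order_root)
    also have "\<dots> \<le> (\<Sum>p | poly (fst (q i)) p = 0. order p (fst (q i)))"
      using poly_roots_finite[OF Q(1)[OF i]] by (intro sum_mono2) auto
    also have "\<dots> \<le> degree (fst (q i))" by (rule sum_order_le_degree[OF Q(1)[OF i]])
    also have "\<dots> \<le> n i" using Q i by blast
    finally show "(\<Sum>p\<in>P. order p (fst (q i))) \<le> n i" .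
  qed
  finally show "poles_at_most (remove_sings u) D (\<Sum>i\<in>I. n i)"
    using fin unfolding poles_at_most_def P_def by simp
qed

text \<open>Superfluous factors are padded with the root \<open>0\<close>.\<close>

lemma poles_at_most_clear:
  assumes u: "u meromorphic_on D" and D: "open D" and N: "poles_at_most u D N"
  obtains b U where "\<And>i. i < N \<Longrightarrow> b i \<in> D \<or> b i = 0" "U holomorphic_on D"
    "\<And>x. x \<in> D \<Longrightarrow> u analytic_on {x} \<Longrightarrow> U x = (\<Prod>i<N. x - b i) * u x"
proof -
  define P where "P = {z\<in>D. is_pole u z}"
  define k where "k z = nat (- zorder u z)" for z
  have P: "finite P" "(\<Sum>z\<in>P. k z) \<le> N" using N by (auto simp: poles_at_most_def P_def k_def)
  define Q where "Q = (\<Prod>z\<in>P. [:-z, 1:] ^ k z)"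
  have Qw: "poly Q w = (\<Prod>z\<in>P. (w - z) ^ k z)" for w by (simp add: Q_def poly_prod)
  have dQ: "degree Q = (\<Sum>z\<in>P. k z)"
    unfolding Q_def by (subst degree_prod_sum_eq) (auto simp: degree_power_eq)
  have lQ: "lead_coeff Q = 1" unfolding Q_def by (simp add: lead_coeff_prod lead_coeff_power)
  obtain a where a: "\<And>x. poly Q x = lead_coeff Q * (\<Prod>i<degree Q. x - a i)" using poly_eq_prod_roots by blast
  define v where "v x = poly Q x * u x" for x
  have vm: "v meromorphic_on D" unfolding v_def
    by (intro meromorphic_on_mult u analytic_on_imp_meromorphic_on analytic_on_poly)
  \<comment> \<open>All singularities of \<open>v\<close> are removable: at a pole the factor
    \<open>(w - p) ^ k p\<close> of \<open>Q\<close> cancels the negative power exactly.\<close>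
  have lim: "\<exists>c. v \<midarrow>p\<rightarrow> c" if p: "p \<in> D" for p
  proof (cases "is_pole u p")
    case False
    have "not_essential u p" by (rule meromorphic_on_singularity[OF u p])
    then obtain c where "u \<midarrow>p\<rightarrow> c" using False unfolding not_essential_def by blast
    then have "v \<midarrow>p\<rightarrow> poly Q p * c" unfolding v_def by (intro tendsto_intros)
    then show ?thesis by blast
  next
    case True
    then have pP: "p \<in> P" using p by (simp add: P_def)
    have iso: "isolated_singularity_at u p" "not_essential u p"
      by (rule meromorphic_on_singularity[OF u p])+
    have "\<exists>\<^sub>F w in at p. u w \<noteq> 0"
      using non_zero_neighbour_pole[OF True] by (simp add: eventually_frequently)
    from zorder_exist[OF iso this] obtain r where r: "r > 0"
      and g: "zor_poly u p holomorphic_on cball p r"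
      and ug: "\<And>w. w \<in> cball p r - {p} \<Longrightarrow> u w = zor_poly u p w * (w - p) powi zorder u p" by auto
    have neg: "zorder u p < 0" using isolated_pole_imp_neg_zorder[OF iso(1) True] .
    define R where "R w = (\<Prod>z\<in>P - {p}. (w - z) ^ k z)" for w
    have "\<forall>\<^sub>F w in at p. w \<in> ball p r - {p}" using r by (intro eventually_at_in_open) auto
    then have ev: "\<forall>\<^sub>F w in at p. R w * zor_poly u p w = v w"
    proof eventually_elim
      case (elim w)
      have "(w - p) powi zorder u p = inverse ((w - p) ^ k p)"
        using neg by (simp add: k_def power_int_def power_inverse)
      moreover have "poly Q w = (w - p) ^ k p * R w"
        unfolding Qw R_def using P(1) pP by (rule prod.remove)
      moreover have "u w = zor_poly u p w * (w - p) powi zorder u p" using ug[of w] elim by auto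
      ultimately show ?case using elim by (simp add: v_def)
    qed
    have "isCont (zor_poly u p) p"
      using g r by (metis centre_in_ball ball_subset_cball continuous_on_eq_continuous_at
        continuous_on_subset holomorphic_on_imp_continuous_on open_ball)
    then have "(\<lambda>w. R w * zor_poly u p w) \<midarrow>p\<rightarrow> R p * zor_poly u p p"
      unfolding R_def isCont_def by (intro tendsto_intros)
    then show ?thesis using Lim_transform_eventually[OF _ ev] by blast
  qed
  have "remove_sings v analytic_on {p}" if "p \<in> D" for p
    using lim[OF that] meromorphic_on_singularity(1)[OF vm that] remove_sings_analytic_at by blast
  then have hol: "remove_sings v holomorphic_on D"
    by (meson analytic_on_analytic_at analytic_imp_holomorphic)
  have ve: "remove_sings v x = poly Q x * u x" if "x \<in> D" "u analytic_on {x}" for x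
  proof -
    have "v analytic_on {x}" unfolding v_def by (intro analytic_on_mult analytic_on_poly that)
    then show ?thesis by (simp add: v_def)
  qed
  define d where "d = degree Q"
  have dN: "d \<le> N" using P dQ by (simp add: d_def)
  define b where "b i = (if i < d then a i else 0)" for i
  have roots: "b i \<in> D \<or> b i = 0" for i
  proof (cases "i < d")
    case True
    then have "poly Q (a i) = 0" using a[of "a i"] by (auto simp: d_def)
    then have "a i \<in> P" using P(1) by (auto simp: Qw)
    then show ?thesis using True by (simp add: b_def P_def)
  qed (simp add: b_def)
  have pr: "(\<Prod>i<N. x - b i) = x ^ (N - d) * poly Q x" for x
  proof -
    have "(\<Prod>i<N. x - b i) = (\<Prod>i<d. x - b i) * (\<Prod>i\<in>{d..<N}. x - b i)"
      using dN by (metis prod.atLeastLessThan_concat atLeast0LessThan le0)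
    also have "(\<Prod>i<d. x - b i) = poly Q x" unfolding a lQ by (simp add: b_def d_def)
    also have "(\<Prod>i\<in>{d..<N}. x - b i) = x ^ (N - d)" by (simp add: b_def)
    finally show ?thesis by simp
  qed
  show ?thesis
    by (rule that[of b "\<lambda>x. x ^ (N - d) * remove_sings v x"])
      (use roots hol ve in \<open>auto simp: pr intro!: holomorphic_intros\<close>)
qed

section \<open>Growth of the poles of the Laurent coefficients\<close>

text \<open>Harnack's inequality for the positive harmonic function \<open>-ln \<bar>f\<bar>\<close>, via the Schwarz lemma.\<close>

lemma nonvanishing_power_bounds:
  assumes f: "f holomorphic_on ball a (2 * r)" and r: "0 < r"
    and f1: "\<And>x. x \<in> ball a (2 * r) \<Longrightarrow> f x \<noteq> 0 \<and> norm (f x) < 1" and x: "x \<in> cball a r"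
  shows "norm (f a) ^ 3 \<le> norm (f x)" "norm (f x) \<le> norm (f a) powr (1/3)"
proof -
  obtain h where h: "h holomorphic_on ball a (2 * r)" and hf: "\<And>x. x \<in> ball a (2 * r) \<Longrightarrow> exp (h x) = f x"
    using holomorphic_logarithm_exists[OF convex_ball open_ball f, of a] f1 r by auto
  have nf: "norm (f x) = exp (Re (h x))" if "x \<in> ball a (2 * r)" for x
    using hf[OF that] by (metis norm_exp_eq_Re)
  have neg: "Re (h x) < 0" if "x \<in> ball a (2 * r)" for x
    using nf[OF that] f1[OF that] by simp
  define \<sigma> where "\<sigma> = - Re (h a)"
  have \<sigma>: "\<sigma> > 0" using neg[of a] r by (simp add: \<sigma>_def)
  define v where "v t = h (a + of_real (2 * r) * t) - \<i> * of_real (Im (h a))" for t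
  have inb: "a + of_real (2 * r) * t \<in> ball a (2 * r)" if "norm t < 1" for t :: complex
    using that r by (simp add: dist_norm norm_mult)
  have vneg: "Re (v t) < 0" if "norm t < 1" for t
    using neg[OF inb[OF that]] by (simp add: v_def)
  have v0: "v 0 = - of_real \<sigma>" by (simp add: v_def \<sigma>_def complex_eq_iff)
  have hv: "v holomorphic_on ball 0 1"
    unfolding v_def
    by (intro holomorphic_intros holomorphic_on_compose_gen[OF _ h, unfolded o_def])
      (use inb in \<open>auto intro!: holomorphic_intros\<close>)
  define t0 where "t0 = (x - a) / of_real (2 * r)"
  have t0: "norm t0 \<le> 1/2" "a + of_real (2 * r) * t0 = x"
    using x r by (auto simp: t0_def norm_divide dist_norm norm_minus_commute field_simps)
  \<comment> \<open>Moebius map of the left half-plane to the unit disk, taking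
    \<open>v 0 = - \<sigma>\<close> to \<open>0\<close>. The Schwarz lemma at
    \<open>norm t0 \<le> 1/2\<close> yields Harnack's constants
    \<open>(1 + 1/2) / (1 - 1/2) = 3\<close> and \<open>1/3\<close>.\<close>
  define g where "g t = (v t + of_real \<sigma>) / (v t - of_real \<sigma>)" for t
  have den: "v t - of_real \<sigma> \<noteq> 0" if "norm t < 1" for t
    using vneg[OF that] \<sigma> by (auto simp: complex_eq_iff)
  have sq: "(Re w + \<sigma>)\<^sup>2 + (Im w)\<^sup>2 = (norm (w + of_real \<sigma>))\<^sup>2"
    "(Re w - \<sigma>)\<^sup>2 + (Im w)\<^sup>2 = (norm (w - of_real \<sigma>))\<^sup>2" for w
    by (simp_all add: cmod_power2)
  have "norm (g t0) \<le> norm t0"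
  proof (rule Schwarz_Lemma(1))
    show "g holomorphic_on ball 0 1" unfolding g_def
      using den by (intro holomorphic_intros hv) auto
    show "g 0 = 0" by (simp add: g_def v0)
    fix t :: complex assume t: "norm t < 1"
    have "(norm (v t + of_real \<sigma>))\<^sup>2 < (norm (v t - of_real \<sigma>))\<^sup>2"
      unfolding sq[symmetric] using vneg[OF t] \<sigma> by (simp add: power2_eq_square algebra_simps mult_pos_neg)
    then have "norm (v t + of_real \<sigma>) < norm (v t - of_real \<sigma>)"
      by (simp add: power_less_imp_less_base)
    then show "norm (g t) < 1" unfolding g_def norm_divide using den[OF t] by simp
  qed (use t0 in auto)
  then have "norm (g t0) \<le> 1/2" using t0 by simp
  then have "2 * norm (v t0 + of_real \<sigma>) \<le> norm (v t0 - of_real \<sigma>)"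
    using den[of t0] t0 by (simp add: g_def norm_divide field_simps)
  then have "(2 * norm (v t0 + of_real \<sigma>))\<^sup>2 \<le> (norm (v t0 - of_real \<sigma>))\<^sup>2"
    by (intro power_mono) auto
  then have s4: "4 * ((Re (v t0) + \<sigma>)\<^sup>2 + (Im (v t0))\<^sup>2) \<le> (Re (v t0) - \<sigma>)\<^sup>2 + (Im (v t0))\<^sup>2"
    unfolding sq by (simp add: power_mult_distrib)
  have "(2 * (Re (v t0) + \<sigma>))\<^sup>2 \<le> (\<sigma> - Re (v t0))\<^sup>2"
  proof -
    have gen: "X \<le> Y" if "X = 4 * a" "Y = b" "0 \<le> c" "4 * (a + c) \<le> b + c" for X Y a b c :: real
      using that by simp
    have "(2 * (Re (v t0) + \<sigma>))\<^sup>2 = 4 * (Re (v t0) + \<sigma>)\<^sup>2" by (subst power_mult_distrib) simp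
    then show ?thesis by (rule gen[OF _ power2_commute zero_le_power2 s4])
  qed
  then have "\<bar>2 * (Re (v t0) + \<sigma>)\<bar> \<le> \<bar>\<sigma> - Re (v t0)\<bar>" by (simp only: abs_le_square_iff)
  moreover have "Re (v t0) < 0" using vneg[of t0] t0 by simp
  ultimately have "\<bar>2 * (Re (v t0) + \<sigma>)\<bar> \<le> \<sigma> - Re (v t0)" using \<sigma> by simp
  then have "- 3 * \<sigma> \<le> Re (v t0)" "Re (v t0) \<le> - \<sigma> / 3" by auto
  moreover have "Re (v t0) = Re (h x)" using t0(2) by (simp add: v_def)
  ultimately have *: "- 3 * \<sigma> \<le> Re (h x)" "Re (h x) \<le> - \<sigma> / 3" by simp_all
  have xb: "x \<in> ball a (2 * r)" "a \<in> ball a (2 * r)" using x r by auto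
  have "norm (f a) ^ 3 = exp (- 3 * \<sigma>)" using nf[OF xb(2)] by (simp add: \<sigma>_def flip: exp_of_nat_mult)
  then show "norm (f a) ^ 3 \<le> norm (f x)" using nf[OF xb(1)] * by simp
  have "norm (f a) powr (1/3) = exp (- \<sigma> / 3)"
    unfolding nf[OF xb(2)] by (simp add: powr_def \<sigma>_def)
  then show "norm (f x) \<le> norm (f a) powr (1/3)" using nf[OF xb(1)] * by simp
qed

section \<open>Maximum principle, Taylor coefficients and subsequences\<close>

lemma bound_from_annulus:
  assumes F: "F holomorphic_on ball 0 r2" and r: "0 < r1" "r1 < r2"
    and B: "\<And>x. r1 < norm x \<Longrightarrow> norm x < r2 \<Longrightarrow> norm (F x) \<le> B" and x: "x \<in> ball 0 r2"
  shows "norm (F x) \<le> B"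
proof -
  define \<rho> where "\<rho> = (max (norm x) r1 + r2) / 2"
  have \<rho>: "norm x < \<rho>" "r1 < \<rho>" "\<rho> < r2" using x r by (auto simp: \<rho>_def)
  show ?thesis
  proof (rule maximum_modulus_frontier[of F "cball 0 \<rho>"])
    show "F holomorphic_on interior (cball 0 \<rho>)"
      by (rule holomorphic_on_subset[OF F]) (use \<rho> in auto)
    show "continuous_on (closure (cball 0 \<rho>)) F"
      by (rule holomorphic_on_imp_continuous_on, rule holomorphic_on_subset[OF F]) (use \<rho> in auto)
    show "norm (F z) \<le> B" if "z \<in> frontier (cball 0 \<rho>)" for z
      using that \<rho> by (intro B) (auto simp: frontier_cball)
  qed (use \<rho> in auto)
qed

lemma higher_deriv_sum:
  fixes f :: "'i \<Rightarrow> complex \<Rightarrow> complex"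
  assumes "finite I" "\<And>i. i \<in> I \<Longrightarrow> f i holomorphic_on S" "open S" "z \<in> S"
  shows "(deriv ^^ n) (\<lambda>x. \<Sum>i\<in>I. f i x) z = (\<Sum>i\<in>I. (deriv ^^ n) (f i) z)"
  using assms(1,2)
proof (induction I rule: finite_induct)
  case empty
  have "(deriv ^^ n) (\<lambda>x::complex. 0 :: complex) z = 0" by (induction n arbitrary: z) auto
  then show ?case by simp
next
  case (insert i I)
  have "(deriv ^^ n) (\<lambda>x. f i x + (\<Sum>i\<in>I. f i x)) z = (deriv ^^ n) (f i) z + (deriv ^^ n) (\<lambda>x. \<Sum>i\<in>I. f i x) z"
    by (rule higher_deriv_add[OF _ _ assms(3,4)]) (use insert in \<open>auto intro!: holomorphic_intros\<close>)
  then show ?case using insert by simp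
qed

text \<open>The value does not depend on \<open>z\<close>: the top Taylor coefficient of a monic
  polynomial can be taken at \<open>c\<close> although its roots are merely close to
  \<open>c\<close>.\<close>

lemma higher_deriv_monic_poly:
  fixes P :: "complex poly"
  assumes "lead_coeff P = 1"
  shows "(deriv ^^ degree P) (poly P) z = fact (degree P)"
proof -
  have "deriv (poly Q) = poly (pderiv Q)" for Q :: "complex poly"
    by (rule ext, rule DERIV_imp_deriv, rule poly_DERIV)
  then have "(deriv ^^ n) (poly P) = poly ((pderiv ^^ n) P)" for n
    by (induction n) auto
  moreover have "(pderiv ^^ degree P) P = [:fact (degree P):]"
  proof (rule poly_eqI)
    fix n show "coeff ((pderiv ^^ degree P) P) n = coeff [:fact (degree P):] n"
      using assms by (cases n) (auto simp: coeff_higher_pderiv pochhammer_fact coeff_eq_0)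
  qed
  ultimately show ?thesis by simp
qed

lemma lipschitz_at_centre:
  assumes h: "h holomorphic_on ball a (2 * r)" and r: "0 < r"
    and B: "\<And>x. x \<in> ball a (2 * r) \<Longrightarrow> norm (h x) \<le> K" and x: "x \<in> cball a r"
  shows "norm (h x - h a) \<le> (2 * K / r) * norm (x - a)"
proof (rule field_differentiable_bound[OF convex_cball])
  fix z assume z: "z \<in> cball a r"
  have sub: "cball z (r/2) \<subseteq> ball a (2 * r)"
  proof
    fix y assume "y \<in> cball z (r/2)"
    then show "y \<in> ball a (2 * r)" using z r dist_triangle[of a y z] by auto
  qed
  show "(h has_field_derivative deriv h z) (at z within cball a r)"
    by (rule holomorphic_derivI[OF h open_ball]) (use z r in auto)
  have "norm ((deriv ^^ 1) h z) \<le> fact 1 * K / (r/2) ^ 1"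
  proof (rule Cauchy_inequality)
    show "h holomorphic_on ball z (r/2)"
      using h sub by (meson ball_subset_cball holomorphic_on_subset order_trans)
    show "continuous_on (cball z (r/2)) h"
      using h sub by (meson holomorphic_on_subset holomorphic_on_imp_continuous_on)
    fix y assume "norm (z - y) = r/2"
    then have "y \<in> cball z (r/2)" by (simp add: dist_norm)
    then show "norm (h y) \<le> K" using sub B by blast
  qed (use r in auto)
  then show "norm (deriv h z) \<le> 2 * K / r" by (simp add: field_simps)
qed (use x r in auto)

text \<open>Dichotomy along a subsequence: each \<open>c i\<close> tends to \<open>0\<close> either at least as fast as a fixed
  positive power of \<open>s\<close> or more slowly than any positive power of \<open>s\<close>.\<close>

lemma fast_slow_subsequence:
  fixes c :: "'i \<Rightarrow> nat \<Rightarrow> real" and s :: "nat \<Rightarrow> real"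
  assumes I: "finite I" and s: "\<And>k. 0 < s k" "\<And>k. s k < 1"
  obtains \<sigma> F \<gamma> where "strict_mono (\<sigma> :: nat \<Rightarrow> nat)" "F \<subseteq> I" "0 < (\<gamma>::real)" "\<gamma> \<le> 1"
    "\<And>i k. i \<in> F \<Longrightarrow> c i (\<sigma> k) \<le> s (\<sigma> k) powr \<gamma>"
    "\<And>i \<eta>. i \<in> I - F \<Longrightarrow> 0 < \<eta> \<Longrightarrow> \<forall>\<^sub>F k in sequentially. s (\<sigma> k) powr \<eta> \<le> c i (\<sigma> k)"
proof -
  have "\<exists>\<sigma> F \<gamma>. strict_mono (\<sigma> :: nat \<Rightarrow> nat) \<and> F \<subseteq> I \<and> 0 < (\<gamma>::real) \<and> \<gamma> \<le> 1 \<and>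
    (\<forall>i\<in>F. \<forall>k. c i (\<sigma> k) \<le> s (\<sigma> k) powr \<gamma>) \<and>
    (\<forall>i\<in>I - F. \<forall>\<eta>>0. \<forall>\<^sub>F k in sequentially. s (\<sigma> k) powr \<eta> \<le> c i (\<sigma> k))"
    using I
  proof (induction I rule: finite_induct)
    case empty
    show ?case by (intro exI[of _ id] exI[of _ "{}"] exI[of _ 1]) (auto simp: strict_mono_def)
  next
    case (insert j I)
    then obtain \<sigma> F \<gamma> where IH: "strict_mono (\<sigma> :: nat \<Rightarrow> nat)" "F \<subseteq> I" "0 < (\<gamma>::real)" "\<gamma> \<le> 1"
      "\<And>i k. i \<in> F \<Longrightarrow> c i (\<sigma> k) \<le> s (\<sigma> k) powr \<gamma>"
      "\<And>i \<eta>. i \<in> I - F \<Longrightarrow> 0 < \<eta> \<Longrightarrow> \<forall>\<^sub>F k in sequentially. s (\<sigma> k) powr \<eta> \<le> c i (\<sigma> k)"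
      by blast
    show ?case
    proof (cases "\<exists>\<gamma>'>0. infinite {k. c j (\<sigma> k) \<le> s (\<sigma> k) powr \<gamma>'}")
      case True
      then obtain \<gamma>' where \<gamma>': "\<gamma>' > 0" "infinite {k. c j (\<sigma> k) \<le> s (\<sigma> k) powr \<gamma>'}" by blast
      from infinite_enumerate[OF \<gamma>'(2)] obtain \<tau> where \<tau>: "strict_mono (\<tau> :: nat \<Rightarrow> nat)"
        "\<And>k. c j (\<sigma> (\<tau> k)) \<le> s (\<sigma> (\<tau> k)) powr \<gamma>'" by auto
      show ?thesis
      proof (intro exI[of _ "\<sigma> \<circ> \<tau>"] exI[of _ "insert j F"] exI[of _ "min \<gamma> \<gamma>'"] conjI ballI allI impI)
        show "strict_mono (\<sigma> \<circ> \<tau>)" using IH(1) \<tau>(1) by (rule strict_mono_o)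
        fix i k assume i: "i \<in> insert j F"
        \<comment> \<open>Since \<open>0 < s n < 1\<close>, lowering the exponent weakens the upper
          bound, so the minimum serves the old indices and the new one alike.\<close>
        have mono: "s n powr x \<le> s n powr min \<gamma> \<gamma>'" if "min \<gamma> \<gamma>' \<le> x" for x n
          using s[of n] that by (simp add: powr_mono')
        show "c i ((\<sigma> \<circ> \<tau>) k) \<le> s ((\<sigma> \<circ> \<tau>) k) powr min \<gamma> \<gamma>'"
        proof (cases "i = j")
          case True
          then show ?thesis using order_trans[OF \<tau>(2)[of k] mono[of \<gamma>']] by simp
        next
          case False
          then show ?thesis using order_trans[OF IH(5)[of i "\<tau> k"] mono[of \<gamma>]] i by simp
        qed
      next
        fix i \<eta> assume "i \<in> insert j I - insert j F" "(0::real) < \<eta>"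
        then have "\<forall>\<^sub>F k in sequentially. s (\<sigma> k) powr \<eta> \<le> c i (\<sigma> k)" by (intro IH) auto
        then show "\<forall>\<^sub>F k in sequentially. s ((\<sigma> \<circ> \<tau>) k) powr \<eta> \<le> c i ((\<sigma> \<circ> \<tau>) k)"
          using eventually_subseq[OF \<tau>(1)] by auto
      qed (use IH \<gamma>' in auto)
    next
      \<comment> \<open>For every exponent only finitely many terms are fast, so \<open>j\<close> is
        slow along the present subsequence already.\<close>
      case False
      show ?thesis
      proof (intro exI[of _ \<sigma>] exI[of _ F] exI[of _ \<gamma>] conjI ballI allI impI)
        fix i \<eta> assume i: "i \<in> insert j I - F" "(0::real) < \<eta>"
        show "\<forall>\<^sub>F k in sequentially. s (\<sigma> k) powr \<eta> \<le> c i (\<sigma> k)"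
        proof (cases "i = j")
          case True
          have "finite {k. c j (\<sigma> k) \<le> s (\<sigma> k) powr \<eta>}" using False i by blast
          then have "\<forall>\<^sub>F k in sequentially. k \<notin> {k. c j (\<sigma> k) \<le> s (\<sigma> k) powr \<eta>}"
            by (simp add: eventually_cofinite flip: cofinite_eq_sequentially)
          then show ?thesis by eventually_elim (use True in auto)
        qed (use i IH in auto)
      qed (use IH in auto)
    qed
  qed
  then obtain \<sigma> F \<gamma> where X: "strict_mono (\<sigma> :: nat \<Rightarrow> nat)" "F \<subseteq> I" "0 < (\<gamma>::real)" "\<gamma> \<le> 1"
    "\<forall>i\<in>F. \<forall>k. c i (\<sigma> k) \<le> s (\<sigma> k) powr \<gamma>"
    "\<forall>i\<in>I - F. \<forall>\<eta>>0. \<forall>\<^sub>F k in sequentially. s (\<sigma> k) powr \<eta> \<le> c i (\<sigma> k)"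
    by (elim exE conjE) (rule that)
  show ?thesis by (rule that[OF X(1-4)]) (use X(5,6) in blast)+
qed

lemma uniform_limit_prod_roots:
  fixes a :: "nat \<Rightarrow> nat \<Rightarrow> complex"
  assumes S: "bounded S" and a: "\<And>i. i < l \<Longrightarrow> (\<lambda>k. a k i) \<longlonglongrightarrow> a' i"
  shows "uniform_limit S (\<lambda>k x. \<Prod>i<l. x - a k i) (\<lambda>x. \<Prod>i<l. x - a' i) sequentially"
  using a
proof (induction l)
  case 0
  then show ?case by (simp add: uniform_limit_const)
next
  case (Suc l)
  have bd: "bounded ((\<lambda>x. \<Prod>i<n. x - a' i) ` S)" for n
  proof (rule bounded_subset)
    show "(\<lambda>x. \<Prod>i<n. x - a' i) ` S \<subseteq> (\<lambda>x. \<Prod>i<n. x - a' i) ` closure S"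
      using closure_subset by blast
    show "bounded ((\<lambda>x. \<Prod>i<n. x - a' i) ` closure S)"
      by (intro compact_imp_bounded compact_continuous_image continuous_intros) (use S in auto)
  qed
  have "bounded ((\<lambda>x. x - a' l) ` S)" using S by (rule bounded_translation_minus)
  moreover have "uniform_limit S (\<lambda>k x. x - a k l) (\<lambda>x. x - a' l) sequentially"
  proof (rule uniform_limitI)
    fix e :: real assume "e > 0"
    then have "\<forall>\<^sub>F k in sequentially. dist (a k l) (a' l) < e" using Suc.prems[of l] by (auto dest: tendstoD)
    then show "\<forall>\<^sub>F k in sequentially. \<forall>x\<in>S. dist (x - a k l) (x - a' l) < e"
      by eventually_elim (auto simp: dist_norm norm_minus_commute)
  qed
  ultimately show ?case using uniform_lim_mult[OF Suc.IH _ bd] Suc.prems by simp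
qed

text \<open>Abstract form of the situation on an annulus:
  \<open>(\<Prod>i<l. x - a k i) * e k x\<close> stands for the difference of the
  \<open>k\<close>-th function and the limit, with nonvanishing part \<open>e k\<close>, and
  \<open>U k\<close> for the holomorphic extension to the disk of the series evaluated there, after
  the poles \<open>b k i\<close> of the restriction are cleared. The limits \<open>a' i\<close>,
  \<open>b' i\<close> stay off the annulus, and \<open>small\<close> makes all tails geometric with
  ratio at most \<open>1/2\<close>.\<close>

locale laurent_data =
  fixes r1 r2 M C :: real and A :: "nat \<Rightarrow> complex \<Rightarrow> complex" and a b :: "nat \<Rightarrow> nat \<Rightarrow> complex"
    and a' b' :: "nat \<Rightarrow> complex" and e U :: "nat \<Rightarrow> complex \<Rightarrow> complex" and l N :: nat
  assumes r: "0 < r1" "r1 < r2"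
    and A: "\<And>n. A n holomorphic_on {x. r1 < norm x \<and> norm x < r2}"
    and A_bound: "\<And>n x. r1 < norm x \<Longrightarrow> norm x < r2 \<Longrightarrow> norm (A n x) \<le> M * C ^ n" and C: "0 < C"
    and e: "\<And>k. e k holomorphic_on ball 0 r2" and e_nz: "\<And>k x. x \<in> ball 0 r2 \<Longrightarrow> e k x \<noteq> 0"
    and a: "\<And>i. i < l \<Longrightarrow> (\<lambda>k. a k i) \<longlonglongrightarrow> a' i"
    and b: "\<And>i. i < N \<Longrightarrow> (\<lambda>k. b k i) \<longlonglongrightarrow> b' i"
    and a': "\<And>i. i < l \<Longrightarrow> norm (a' i) \<le> r1 \<or> r2 \<le> norm (a' i)"
    and b': "\<And>i. i < N \<Longrightarrow> norm (b' i) \<le> r1 \<or> r2 \<le> norm (b' i)"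
    and U: "\<And>k. U k holomorphic_on ball 0 r2"
    and lim0: "uniform_limit {x. r1 < norm x \<and> norm x < r2} (\<lambda>k x. (\<Prod>i<l. x - a k i) * e k x) (\<lambda>_. 0) sequentially"
    and small: "\<And>k x. r1 < norm x \<Longrightarrow> norm x < r2 \<Longrightarrow> C * norm ((\<Prod>i<l. x - a k i) * e k x) \<le> 1/2"
    and U_eq: "\<And>k x. r1 < norm x \<Longrightarrow> norm x < r2 \<Longrightarrow>
      U k x = (\<Prod>i<N. x - b k i) * (\<Sum>n. A n x * ((\<Prod>i<l. x - a k i) * e k x) ^ n)"
begin

definition "Ann = {x :: complex. r1 < norm x \<and> norm x < r2}"
definition "w k x = (\<Prod>i<l. x - a k i)"
definition "q k x = (\<Prod>i<N. x - b k i)"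
definition "\<delta> k x = w k x * e k x"
text \<open>On the annulus this is \<open>q k\<close> times the tail of the series from index
  \<open>m\<close> on.\<close>

definition "rem k m x = U k x - q k x * (\<Sum>j<m. A j x * \<delta> k x ^ j)"
definition "Roots = a' ` {..<l} \<union> b' ` {..<N}"

lemma AnnD: "x \<in> Ann \<Longrightarrow> r1 < norm x" "x \<in> Ann \<Longrightarrow> norm x < r2" "x \<in> Ann \<Longrightarrow> x \<in> ball 0 r2"
  by (auto simp: Ann_def)

lemma bounded_Ann: "bounded Ann" unfolding Ann_def bounded_iff by (intro exI[of _ r2]) auto

lemma M_nonneg: "0 \<le> M"
proof -
  have "norm (A 0 (of_real ((r1 + r2) / 2))) \<le> M * C ^ 0"
    using r by (intro A_bound) (auto simp: norm_of_real simp del: of_real_add of_real_divide)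
  then show ?thesis using order_trans[OF norm_ge_zero] by fastforce
qed

lemma hol_wq: "w k holomorphic_on S" "q k holomorphic_on S"
  unfolding w_def q_def by (intro holomorphic_intros)+

lemma hol_\<delta>: "\<delta> k holomorphic_on ball 0 r2"
  unfolding \<delta>_def by (intro holomorphic_intros hol_wq e)

lemma rem_Suc: "rem k m x = q k x * (A m x * \<delta> k x ^ m) + rem k (Suc m) x"
  by (simp add: rem_def algebra_simps)

text \<open>Comparison with a geometric series of ratio \<open>t = C * norm (\<delta> k x)\<close>;
  the factor \<open>2\<close> is the bound for \<open>1 / (1 - t)\<close> when
  \<open>t \<le> 1/2\<close>.\<close>

lemma rem_bound:
  assumes x: "x \<in> Ann"
  shows "norm (rem k m x) \<le> norm (q k x) * (2 * M * C ^ m * norm (\<delta> k x) ^ m)"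
proof -
  define t where "t = C * norm (\<delta> k x)"
  have t: "0 \<le> t" "t \<le> 1/2" using small[OF AnnD(1)[OF x] AnnD(2)[OF x], of k] C by (auto simp: t_def \<delta>_def w_def)
  have bd: "norm (A n x * \<delta> k x ^ n) \<le> M * t ^ n" for n
  proof -
    have "norm (A n x * \<delta> k x ^ n) \<le> (M * C ^ n) * norm (\<delta> k x) ^ n"
      unfolding norm_mult norm_power by (intro mult_right_mono A_bound AnnD x) auto
    then show ?thesis by (simp add: t_def power_mult_distrib mult_ac)
  qed
  have sm: "summable (\<lambda>n. M * t ^ n)" using t by (intro summable_mult summable_geometric) auto
  have sm2: "summable (\<lambda>n. A n x * \<delta> k x ^ n)"
    by (rule summable_comparison_test[OF _ sm]) (use bd in auto)
  have "U k x = q k x * (\<Sum>n. A n x * \<delta> k x ^ n)"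
    using U_eq[OF AnnD(1)[OF x] AnnD(2)[OF x]] by (simp add: q_def \<delta>_def w_def)
  also have "(\<Sum>n. A n x * \<delta> k x ^ n) = (\<Sum>n. A (n + m) x * \<delta> k x ^ (n + m)) + (\<Sum>j<m. A j x * \<delta> k x ^ j)"
    by (rule suminf_split_initial_segment[OF sm2])
  finally have "rem k m x = q k x * (\<Sum>n. A (n + m) x * \<delta> k x ^ (n + m))"
    by (simp add: rem_def algebra_simps)
  moreover have "norm (\<Sum>n. A (n + m) x * \<delta> k x ^ (n + m)) \<le> (\<Sum>n. M * t ^ (n + m))"
    by (intro norm_suminf_le bd summable_ignore_initial_segment[OF sm])
  moreover have "(\<Sum>n. M * t ^ (n + m)) \<le> 2 * M * t ^ m"
  proof -
    have g: "(\<lambda>n. M * t ^ m * t ^ n) sums (M * t ^ m * (1 / (1 - t)))"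
      using t by (intro sums_mult geometric_sums) auto
    have "(\<Sum>n. M * t ^ (n + m)) = M * t ^ m * (1 / (1 - t))"
      using sums_unique[OF g] by (simp add: power_add mult_ac)
    also have "\<dots> \<le> M * t ^ m * 2"
      using t M_nonneg by (intro mult_left_mono) (auto simp: field_simps)
    finally show ?thesis by (simp add: mult_ac)
  qed
  ultimately have "norm (rem k m x) \<le> norm (q k x) * (2 * M * t ^ m)"
    by (simp add: norm_mult mult_left_mono)
  then show ?thesis by (simp add: t_def power_mult_distrib mult_ac)
qed

lemma roots_bounded:
  obtains R where "1 \<le> R" "\<And>k i x. i < l \<Longrightarrow> x \<in> ball 0 r2 \<Longrightarrow> norm (x - a k i) \<le> R"
    "\<And>k i x. i < N \<Longrightarrow> x \<in> ball 0 r2 \<Longrightarrow> norm (x - b k i) \<le> R"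
proof -
  have "\<exists>R. \<forall>i<n. \<forall>k. norm (c k i) \<le> R" if "\<And>i. i < n \<Longrightarrow> (\<lambda>k. c k i) \<longlonglongrightarrow> c' i"
    for n and c :: "nat \<Rightarrow> nat \<Rightarrow> complex" and c'
    using that
  proof (induction n)
    case (Suc n)
    then obtain R where R: "\<forall>i<n. \<forall>k. norm (c k i) \<le> R" by force
    have "Bseq (\<lambda>k. c k n)" using Suc.prems[of n] by (meson convergentI convergent_imp_Bseq lessI)
    then obtain K where "\<And>k. norm (c k n) \<le> K" unfolding Bseq_def by blast
    then show ?case using R by (intro exI[of _ "max R K"]) (auto simp: less_Suc_eq le_max_iff_disj)
  qed auto
  from this[of l a a'] this[of N b b'] a b obtain R1 R2
    where R: "\<forall>i<l. \<forall>k. norm (a k i) \<le> R1" "\<forall>i<N. \<forall>k. norm (b k i) \<le> R2" by auto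
  define R where "R = 1 + r2 + \<bar>R1\<bar> + \<bar>R2\<bar>"
  have tri: "norm (x - y) \<le> R" if "norm x < r2" "norm y \<le> \<bar>R1\<bar> \<or> norm y \<le> \<bar>R2\<bar>" for x y :: complex
    using norm_triangle_ineq4[of x y] that by (auto simp: R_def)
  show ?thesis
  proof (rule that[of R])
    show "1 \<le> R" using r by (simp add: R_def)
    show "norm (x - a k i) \<le> R" if "i < l" "x \<in> ball 0 r2" for i k x
      using that R(1) by (intro tri disjI1 order_trans[OF _ abs_ge_self]) auto
    show "norm (x - b k i) \<le> R" if "i < N" "x \<in> ball 0 r2" for i k x
      using that R(2) by (intro tri disjI2 order_trans[OF _ abs_ge_self]) auto
  qed
qed

lemma wq_bounded:
  obtains K where "1 \<le> K" "\<And>k x. x \<in> ball 0 r2 \<Longrightarrow> norm (w k x) \<le> K" "\<And>k x. x \<in> ball 0 r2 \<Longrightarrow> norm (q k x) \<le> K"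
proof -
  obtain R where R: "1 \<le> R" "\<And>k i x. i < l \<Longrightarrow> x \<in> ball 0 r2 \<Longrightarrow> norm (x - a k i) \<le> R"
    "\<And>k i x. i < N \<Longrightarrow> x \<in> ball 0 r2 \<Longrightarrow> norm (x - b k i) \<le> R" using roots_bounded by blast
  have "norm (w k x) \<le> R ^ l" if "x \<in> ball 0 r2" for k x
    using prod_mono[of "{..<l}" "\<lambda>i. norm (x - a k i)" "\<lambda>_. R"] R that by (simp add: w_def prod_norm)
  moreover have "norm (q k x) \<le> R ^ N" if "x \<in> ball 0 r2" for k x
    using prod_mono[of "{..<N}" "\<lambda>i. norm (x - b k i)" "\<lambda>_. R"] R that by (simp add: q_def prod_norm)
  moreover have "R ^ l \<le> R ^ (l + N)" "R ^ N \<le> R ^ (l + N)" "1 \<le> R ^ (l + N)"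
    using R(1) by (auto intro: power_increasing one_le_power)
  ultimately show ?thesis using that[of "R ^ (l + N)"] order_trans by meson
qed

text \<open>The remainder multiplied by the denominators \<open>Q j\<close> of the lower
  coefficients. Written with the numerators \<open>H j\<close> it is holomorphic on the whole disk,
  whereas the \<open>A j\<close> are given on the annulus only.\<close>

definition cleared :: "(nat \<Rightarrow> complex poly) \<Rightarrow> (nat \<Rightarrow> complex \<Rightarrow> complex) \<Rightarrow> nat \<Rightarrow> nat \<Rightarrow> complex \<Rightarrow> complex" where
  "cleared Q H n k x = poly (\<Prod>j<n. Q j) x * U k x -
     q k x * (\<Sum>j<n. H j x * poly (\<Prod>i\<in>{..<n} - {j}. Q i) x * \<delta> k x ^ j)"

lemma cleared_holomorphic:
  "(\<And>j. j < n \<Longrightarrow> H j holomorphic_on ball 0 r2) \<Longrightarrow> cleared Q H n k holomorphic_on ball 0 r2"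
  unfolding cleared_def by (intro holomorphic_intros U hol_wq hol_\<delta>) auto

text \<open>\<open>B j\<close> is an arbitrary value instead of \<open>A j x\<close>, so that the
  identity also applies inside the disk, with the quotient \<open>H j x / poly (Q j) x\<close> in
  place of the coefficient.\<close>

lemma cleared_eq:
  assumes "\<And>j. j < n \<Longrightarrow> H j x = poly (Q j) x * B j"
  shows "cleared Q H n k x = poly (\<Prod>j<n. Q j) x * (U k x - q k x * (\<Sum>j<n. B j * \<delta> k x ^ j))"
proof -
  have "H j x * poly (\<Prod>i\<in>{..<n} - {j}. Q i) x = poly (\<Prod>j<n. Q j) x * B j" if "j < n" for j
  proof -
    have "(\<Prod>j<n. Q j) = Q j * (\<Prod>i\<in>{..<n} - {j}. Q i)" using that by (intro prod.remove) auto
    then show ?thesis using assms[OF that] by (simp add: mult_ac)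
  qed
  then have "(\<Sum>j<n. H j x * poly (\<Prod>i\<in>{..<n} - {j}. Q i) x * \<delta> k x ^ j)
     = poly (\<Prod>j<n. Q j) x * (\<Sum>j<n. B j * \<delta> k x ^ j)"
    unfolding sum_distrib_left by (intro sum.cong) (auto simp: mult_ac)
  then show ?thesis by (simp add: cleared_def algebra_simps)
qed

lemma poly_bounded:
  fixes Q :: "complex poly"
  obtains K where "0 < K" "\<And>x. x \<in> ball 0 r2 \<Longrightarrow> norm (poly Q x) \<le> K"
proof -
  have "compact (poly Q ` cball 0 r2)" by (intro compact_continuous_image continuous_intros) auto
  then obtain K where K: "\<And>x. x \<in> cball 0 r2 \<Longrightarrow> norm (poly Q x) \<le> K"
    using compact_imp_bounded bounded_iff by (metis image_eqI)
  have "norm (poly Q x) \<le> \<bar>K\<bar> + 1" if "x \<in> ball 0 r2" for x using K[of x] that by simp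
  moreover have "0 < \<bar>K\<bar> + 1" using abs_ge_zero[of K] by linarith
  ultimately show ?thesis by (intro that[of "\<bar>K\<bar> + 1"])
qed

text \<open>As \<open>e k\<close> has no zeros, the quotient by \<open>e k x ^ n\<close> is
  holomorphic; on the annulus the remainder bound and the boundedness of \<open>w k\<close> and
  \<open>q k\<close> control it, and the maximum principle carries the estimate to the disk. The
  gain is the factor \<open>norm (e k x) ^ n\<close>, which is small there for large
  \<open>k\<close>.\<close>

lemma cleared_bound:
  assumes H: "\<And>j. j < n \<Longrightarrow> H j holomorphic_on ball 0 r2"
    "\<And>j x. j < n \<Longrightarrow> x \<in> Ann \<Longrightarrow> H j x = poly (Q j) x * A j x"
  obtains K where "0 < K" "\<And>k x. x \<in> ball 0 r2 \<Longrightarrow> norm (cleared Q H n k x) \<le> K * norm (e k x) ^ n"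
proof -
  obtain K where K: "1 \<le> K" "\<And>k x. x \<in> ball 0 r2 \<Longrightarrow> norm (w k x) \<le> K"
    "\<And>k x. x \<in> ball 0 r2 \<Longrightarrow> norm (q k x) \<le> K" using wq_bounded by blast
  obtain P where P: "0 < P" "\<And>x. x \<in> ball 0 r2 \<Longrightarrow> norm (poly (\<Prod>j<n. Q j) x) \<le> P" using poly_bounded by blast
  define B where "B = P * (K * (2 * M * C ^ n * K ^ n))"
  have B: "0 \<le> B" using P K M_nonneg C by (simp add: B_def)
  have "norm (cleared Q H n k x / e k x ^ n) \<le> B" if "x \<in> ball 0 r2" for k x
  proof (rule bound_from_annulus[OF _ r _ that])
    show "(\<lambda>x. cleared Q H n k x / e k x ^ n) holomorphic_on ball 0 r2"
      using e_nz by (intro holomorphic_intros cleared_holomorphic H e) auto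
    fix x :: complex assume "r1 < norm x" "norm x < r2"
    then have x: "x \<in> Ann" by (simp add: Ann_def)
    have "cleared Q H n k x = poly (\<Prod>j<n. Q j) x * rem k n x"
      unfolding rem_def by (rule cleared_eq) (use H x in auto)
    then have "norm (cleared Q H n k x) \<le> P * (K * (2 * M * C ^ n * (K * norm (e k x)) ^ n))"
      unfolding norm_mult using P(1) K(1) C M_nonneg P(2)[OF AnnD(3)[OF x]] K(2,3)[OF AnnD(3)[OF x]]
      by (auto simp: \<delta>_def norm_mult
          intro!: mult_mono order_trans[OF rem_bound[OF x]] power_mono mult_right_mono mult_nonneg_nonneg)
    also have "\<dots> = B * norm (e k x) ^ n" by (simp add: B_def power_mult_distrib mult_ac)
    finally show "norm (cleared Q H n k x / e k x ^ n) \<le> B"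
      using e_nz[OF AnnD(3)[OF x], of k] by (simp add: norm_divide norm_power divide_le_eq)
  qed
  then have le: "norm (cleared Q H n k x) \<le> B * norm (e k x) ^ n" if "x \<in> ball 0 r2" for k x
    using that e_nz[OF that, of k] by (simp add: norm_divide norm_power divide_le_eq)
  have "norm (cleared Q H n k x) \<le> (B + 1) * norm (e k x) ^ n" if "x \<in> ball 0 r2" for k x
    by (rule order_trans[OF le[OF that] mult_right_mono]) auto
  then show ?thesis using B by (intro that[of "B + 1"]) auto
qed

text \<open>By induction the lower coefficients have polynomial denominators. The cleared
  \<open>n\<close>-th remainder divided by \<open>e k ^ n\<close> converges uniformly on the annulus
  to a polynomial multiple of \<open>A n\<close>, hence by the maximum principle uniformly on the
  disk, and its limit is the required numerator.\<close>

lemma coeff_meromorphic: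
  "\<exists>Q H. Q \<noteq> 0 \<and> (\<forall>x. poly Q x = 0 \<longrightarrow> x \<in> Roots) \<and> H holomorphic_on ball 0 r2 \<and>
     (\<forall>x\<in>Ann. H x = poly Q x * A n x)"
proof (induction n rule: less_induct)
  case (less n)
  define P where "P j p \<longleftrightarrow> fst p \<noteq> 0 \<and> (\<forall>x. poly (fst p) x = 0 \<longrightarrow> x \<in> Roots) \<and>
    snd p holomorphic_on ball 0 r2 \<and> (\<forall>x\<in>Ann. snd p x = poly (fst p) x * A j x)" for j p
  have "\<forall>j\<in>{..<n}. \<exists>p. P j p"
  proof
    fix j assume "j \<in> {..<n}"
    then show "\<exists>p. P j p" using less[of j] unfolding P_def by auto
  qed
  from bchoice[OF this] obtain p where p: "\<forall>j\<in>{..<n}. P j (p j)" by blast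
  define Q where "Q j = fst (p j)" for j
  define H where "H j = snd (p j)" for j
  have Q: "Q j \<noteq> 0" "poly (Q j) x = 0 \<Longrightarrow> x \<in> Roots" "H j holomorphic_on ball 0 r2"
    "x \<in> Ann \<Longrightarrow> H j x = poly (Q j) x * A j x" if "j < n" for j x
    using p that unfolding P_def Q_def H_def by auto
  define F where "F k x = cleared Q H n k x / e k x ^ n" for k x
  define G where "G x = poly (\<Prod>j<n. Q j) x * (\<Prod>i<N. x - b' i) * (\<Prod>i<l. x - a' i) ^ n * A n x" for x
  have Fhol: "F k holomorphic_on ball 0 r2" for k
    unfolding F_def using e_nz by (intro holomorphic_intros cleared_holomorphic Q e) auto
  obtain K where K: "1 \<le> K" "\<And>k x. x \<in> ball 0 r2 \<Longrightarrow> norm (w k x) \<le> K"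
    "\<And>k x. x \<in> ball 0 r2 \<Longrightarrow> norm (q k x) \<le> K" using wq_bounded by blast
  obtain P where P: "0 < P" "\<And>x. x \<in> ball 0 r2 \<Longrightarrow> norm (poly (\<Prod>j<n. Q j) x) \<le> P" using poly_bounded by blast
  define B where "B = P * (K * (2 * M * C ^ Suc n * K ^ n))"
  \<comment> \<open>Splitting off the \<open>n\<close>-th term leaves a remainder with one more
    factor \<open>\<delta> k x\<close>; this factor tends to \<open>0\<close> uniformly on the
    annulus.\<close>
  have est: "norm (F k x - poly (\<Prod>j<n. Q j) x * q k x * w k x ^ n * A n x) \<le> B * norm (\<delta> k x)"
    if x: "x \<in> Ann" for k x
  proof -
    have ez: "e k x \<noteq> 0" by (rule e_nz[OF AnnD(3)[OF x]])
    have "cleared Q H n k x = poly (\<Prod>j<n. Q j) x * rem k n x"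
      unfolding rem_def by (rule cleared_eq) (use Q x in auto)
    then have "F k x - poly (\<Prod>j<n. Q j) x * q k x * w k x ^ n * A n x
        = poly (\<Prod>j<n. Q j) x * (rem k (Suc n) x / e k x ^ n)"
      using ez unfolding rem_Suc[of k n] by (simp add: F_def \<delta>_def power_mult_distrib field_simps)
    moreover have "norm (rem k (Suc n) x / e k x ^ n) \<le> K * (2 * M * C ^ Suc n * K ^ n) * norm (\<delta> k x)"
    proof -
      have "norm (rem k (Suc n) x) \<le> norm (q k x) * (2 * M * C ^ Suc n * norm (\<delta> k x) ^ Suc n)"
        by (rule rem_bound[OF x])
      also have "\<dots> \<le> K * (2 * M * C ^ Suc n * norm (\<delta> k x) ^ Suc n)"
        using K(3)[OF AnnD(3)[OF x]] M_nonneg C by (intro mult_right_mono) auto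
      also have "\<dots> = K * (2 * M * C ^ Suc n * norm (w k x) ^ n) * norm (\<delta> k x) * norm (e k x) ^ n"
        by (simp add: \<delta>_def norm_mult power_mult_distrib mult_ac)
      also have "\<dots> \<le> K * (2 * M * C ^ Suc n * K ^ n) * norm (\<delta> k x) * norm (e k x) ^ n"
        using K(1,2) AnnD(3)[OF x] M_nonneg C by (intro mult_right_mono mult_left_mono power_mono) auto
      finally show ?thesis using ez by (simp add: norm_divide norm_power divide_le_eq)
    qed
    ultimately have "norm (F k x - poly (\<Prod>j<n. Q j) x * q k x * w k x ^ n * A n x)
        \<le> P * (K * (2 * M * C ^ Suc n * K ^ n) * norm (\<delta> k x))"
      using P(2)[OF AnnD(3)[OF x]] P(1) by (simp only: norm_mult) (intro mult_mono, auto)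
    then show ?thesis by (simp only: B_def mult.assoc)
  qed
  have bdA: "bounded (A n ` Ann)"
    unfolding bounded_iff using A_bound by (intro exI[of _ "M * C ^ n"]) (auto simp: Ann_def)
  have bdcont: "bounded (g ` Ann)" if "continuous_on UNIV g" for g :: "complex \<Rightarrow> complex"
  proof (rule bounded_subset)
    show "g ` Ann \<subseteq> g ` closure Ann" using closure_subset by blast
    show "bounded (g ` closure Ann)"
      by (intro compact_imp_bounded compact_continuous_image continuous_on_subset[OF that])
        (use bounded_Ann in auto)
  qed
  have l1: "uniform_limit Ann (\<lambda>k x. F k x - poly (\<Prod>j<n. Q j) x * q k x * w k x ^ n * A n x) (\<lambda>_. 0) sequentially"
  proof (rule uniform_limitI)
    fix \<eta> :: real assume \<eta>: "\<eta> > 0"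
    define B' where "B' = \<bar>B\<bar> + 1"
    have "\<forall>\<^sub>F k in sequentially. \<forall>x\<in>Ann. dist (\<delta> k x) 0 < \<eta> / B'"
      using lim0 \<eta> unfolding Ann_def[symmetric] \<delta>_def w_def by (intro uniform_limitD) (auto simp: B'_def)
    then show "\<forall>\<^sub>F k in sequentially. \<forall>x\<in>Ann. dist (F k x - poly (\<Prod>j<n. Q j) x * q k x * w k x ^ n * A n x) 0 < \<eta>"
    proof eventually_elim
      case (elim k)
      show ?case
      proof
        fix x assume x: "x \<in> Ann"
        have "norm (F k x - poly (\<Prod>j<n. Q j) x * q k x * w k x ^ n * A n x) \<le> B * norm (\<delta> k x)" by (rule est[OF x])
        also have "\<dots> \<le> B' * norm (\<delta> k x)" by (intro mult_right_mono) (auto simp: B'_def)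
        also have "\<dots> < \<eta>" using elim x by (auto simp: B'_def field_simps)
        finally show "dist (F k x - poly (\<Prod>j<n. Q j) x * q k x * w k x ^ n * A n x) 0 < \<eta>" by simp
      qed
    qed
  qed
  have l2: "uniform_limit Ann (\<lambda>k x. poly (\<Prod>j<n. Q j) x * q k x * w k x ^ n * A n x) G sequentially"
    unfolding G_def q_def w_def
  proof (intro uniform_lim_mult uniform_limit_const bdA)
    have "uniform_limit Ann (\<lambda>k x. (\<Prod>i<l. x - a k i) ^ m) (\<lambda>x. (\<Prod>i<l. x - a' i) ^ m) sequentially" for m
    proof (induction m)
      case (Suc m)
      then show ?case unfolding power_Suc
        by (intro uniform_lim_mult uniform_limit_prod_roots bounded_Ann a bdcont continuous_intros)
    qed (simp add: uniform_limit_const)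
    then show "uniform_limit Ann (\<lambda>k x. (\<Prod>i<l. x - a k i) ^ n) (\<lambda>x. (\<Prod>i<l. x - a' i) ^ n) sequentially" .
  qed (intro uniform_limit_prod_roots bounded_Ann b bdcont continuous_intros | assumption)+
  have FG: "uniform_limit Ann F G sequentially"
    using uniform_limit_add[OF l1 l2] by simp
  \<comment> \<open>Differences \<open>F m - F n\<close> are holomorphic on the disk, so their size
    on the annulus bounds them everywhere. The limit function is thereby obtained on the disk
    without knowing it in advance.\<close>
  have "uniformly_Cauchy_on (ball 0 r2) F"
    unfolding uniformly_Cauchy_on_def
  proof (intro allI impI)
    fix \<eta> :: real assume "\<eta> > 0"
    then have "\<eta>/2 > 0" by simp
    have "uniformly_Cauchy_on Ann F"
      using FG uniformly_convergent_Cauchy uniformly_convergent_on_def by blast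
    then obtain K where K: "\<And>x m n. x \<in> Ann \<Longrightarrow> m \<ge> K \<Longrightarrow> n \<ge> K \<Longrightarrow> dist (F m x) (F n x) < \<eta>/2"
      using \<open>\<eta>/2 > 0\<close> unfolding uniformly_Cauchy_on_def by meson
    show "\<exists>K. \<forall>x\<in>ball 0 r2. \<forall>m\<ge>K. \<forall>n\<ge>K. dist (F m x) (F n x) < \<eta>"
    proof (intro exI[of _ K] ballI allI impI)
      fix x m n assume x: "x \<in> ball (0::complex) r2" and mn: "K \<le> m" "K \<le> n"
      have "norm (F m x - F n x) \<le> \<eta>/2"
      proof (rule bound_from_annulus[OF _ r _ x])
        show "(\<lambda>x. F m x - F n x) holomorphic_on ball 0 r2" by (intro holomorphic_intros Fhol)
        show "norm (F m y - F n y) \<le> \<eta>/2" if "r1 < norm y" "norm y < r2" for y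
          using K[of y m n] that mn by (simp add: Ann_def dist_norm)
      qed
      then show "dist (F m x) (F n x) < \<eta>" using \<open>\<eta>/2 > 0\<close> by (simp add: dist_norm)
    qed
  qed
  then obtain L where L: "uniform_limit (ball 0 r2) F L sequentially"
    using Cauchy_uniformly_convergent uniformly_convergent_on_def by blast
  have Lhol: "L holomorphic_on ball 0 r2"
  proof (rule holomorphic_uniform_sequence[OF open_ball Fhol])
    fix x :: complex assume "x \<in> ball 0 r2"
    then obtain d where d: "d > 0" "cball x d \<subseteq> ball 0 r2" using open_contains_cball open_ball by blast
    then show "\<exists>d>0. cball x d \<subseteq> ball 0 r2 \<and> uniform_limit (cball x d) F L sequentially"
      using uniform_limit_on_subset[OF L d(2)] by blast
  qed
  have LG: "L x = G x" if "x \<in> Ann" for x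
    using tendsto_uniform_limitI[OF L AnnD(3)[OF that]] tendsto_uniform_limitI[OF FG that] LIMSEQ_unique by blast
  \<comment> \<open>The product of all earlier denominators enters here: its degree may grow
    exponentially, and only its zero set is used later.\<close>
  define R where "R = (\<Prod>j<n. Q j) * (\<Prod>i<N. [:- b' i, 1:]) * (\<Prod>i<l. [:- a' i, 1:]) ^ n"
  have Rp: "poly R x = poly (\<Prod>j<n. Q j) x * (\<Prod>i<N. x - b' i) * (\<Prod>i<l. x - a' i) ^ n" for x
    by (simp add: R_def poly_prod)
  show ?case
  proof (intro exI conjI allI impI ballI)
    show "R \<noteq> 0" using Q(1) by (auto simp: R_def)
    show "x \<in> Roots" if "poly R x = 0" for x
    proof -
      have "(\<exists>j<n. poly (Q j) x = 0) \<or> (\<exists>i<N. x = b' i) \<or> (\<exists>i<l. x = a' i)"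
        using that by (auto simp: Rp poly_prod)
      then show ?thesis using Q(2) by (auto simp: Roots_def)
    qed
    show "L x = poly R x * A n x" if "x \<in> Ann" for x using LG[OF that] by (simp add: Rp G_def)
  qed (rule Lhol)
qed

end

section \<open>Comparison of Taylor coefficients at a limit point\<close>

context laurent_data
begin

text \<open>\<open>QQ n\<close> and \<open>HH n\<close> are the two components of one and the same
  chosen pair, so that they satisfy the defining relation jointly.\<close>

definition "QQ n = fst (SOME p. fst p \<noteq> 0 \<and> (\<forall>x. poly (fst p) x = 0 \<longrightarrow> x \<in> Roots) \<and>
    snd p holomorphic_on ball 0 r2 \<and> (\<forall>x\<in>Ann. snd p x = poly (fst p) x * A n x))"
definition "HH n = snd (SOME p. fst p \<noteq> 0 \<and> (\<forall>x. poly (fst p) x = 0 \<longrightarrow> x \<in> Roots) \<and>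
    snd p holomorphic_on ball 0 r2 \<and> (\<forall>x\<in>Ann. snd p x = poly (fst p) x * A n x))"

lemma QQ_HH:
  "QQ n \<noteq> 0" "poly (QQ n) x = 0 \<Longrightarrow> x \<in> Roots" "HH n holomorphic_on ball 0 r2"
  "x \<in> Ann \<Longrightarrow> HH n x = poly (QQ n) x * A n x"
proof -
  from coeff_meromorphic[of n] have "\<exists>p. fst p \<noteq> 0 \<and> (\<forall>x. poly (fst p) x = 0 \<longrightarrow> x \<in> Roots) \<and>
    snd p holomorphic_on ball 0 r2 \<and> (\<forall>x\<in>Ann. snd p x = poly (fst p) x * A n x)" by simp
  from someI_ex[OF this]
  show "QQ n \<noteq> 0" "poly (QQ n) x = 0 \<Longrightarrow> x \<in> Roots" "HH n holomorphic_on ball 0 r2"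
  "x \<in> Ann \<Longrightarrow> HH n x = poly (QQ n) x * A n x"
    unfolding QQ_def HH_def by blast+
qed

text \<open>On the middle circle of the annulus the polynomial part \<open>w k\<close> is bounded
  below for large \<open>k\<close>, because the limit roots avoid the annulus; there
  \<open>e k = \<delta> k / w k\<close> tends to \<open>0\<close>, and the maximum principle extends
  this to the disk inside.\<close>

lemma e_tendsto_0:
  assumes \<eta>: "0 < \<eta>"
  shows "\<forall>\<^sub>F k in sequentially. \<forall>x\<in>ball 0 ((r1 + r2) / 2). norm (e k x) < \<eta>"
proof -
  define \<rho> where "\<rho> = (r1 + r2) / 2"
  have \<rho>: "r1 < \<rho>" "\<rho> < r2" "0 < \<rho>" using r by (auto simp: \<rho>_def)
  define w' where "w' x = (\<Prod>i<l. x - a' i)" for x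
  have sub: "sphere 0 \<rho> \<subseteq> Ann" using \<rho> by (auto simp: Ann_def)
  have "w' x \<noteq> 0" if "x \<in> sphere 0 \<rho>" for x
    using a' sub that unfolding w'_def by (fastforce simp: Ann_def)
  moreover have "continuous_on (sphere 0 \<rho>) w'" unfolding w'_def by (intro continuous_intros)
  moreover have "sphere (0::complex) \<rho> \<noteq> {}" using \<rho> by simp
  ultimately obtain x0 where x0: "x0 \<in> sphere 0 \<rho>" "\<And>x. x \<in> sphere 0 \<rho> \<Longrightarrow> norm (w' x0) \<le> norm (w' x)"
    using continuous_attains_inf[of "sphere 0 \<rho>" "\<lambda>x. norm (w' x)"] continuous_on_norm compact_sphere by blast
  define c where "c = norm (w' x0) / 2"
  have c: "c > 0" using x0 \<open>\<And>x. x \<in> sphere 0 \<rho> \<Longrightarrow> w' x \<noteq> 0\<close> by (simp add: c_def)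
  have "uniform_limit (ball 0 r2) w w' sequentially"
    unfolding w_def w'_def by (rule uniform_limit_prod_roots[OF bounded_ball a])
  then have "\<forall>\<^sub>F k in sequentially. \<forall>x\<in>ball 0 r2. dist (w k x) (w' x) < c" using c by (rule uniform_limitD)
  moreover have "\<forall>\<^sub>F k in sequentially. \<forall>x\<in>Ann. dist (\<delta> k x) 0 < c * (\<eta> / 2)"
    using lim0 c \<eta> unfolding Ann_def[symmetric] \<delta>_def w_def by (intro uniform_limitD) auto
  ultimately show ?thesis
  proof eventually_elim
    case (elim k)
    have sph: "norm (e k x) \<le> \<eta> / 2" if x: "x \<in> sphere 0 \<rho>" for x
    proof -
      have "norm (w' x) - norm (w k x) \<le> norm (w k x - w' x)" by (metis norm_minus_commute norm_triangle_ineq2)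
      moreover have "norm (w k x - w' x) < c" using elim(1) x \<rho> by (auto simp: dist_norm)
      moreover have "2 * c \<le> norm (w' x)" using x0(2)[OF x] by (simp add: c_def)
      ultimately have wk: "c \<le> norm (w k x)" by linarith
      have "c * norm (e k x) \<le> norm (w k x) * norm (e k x)" using wk by (intro mult_right_mono) auto
      also have "\<dots> = norm (\<delta> k x)" by (simp add: \<delta>_def norm_mult)
      also have "\<dots> \<le> c * (\<eta> / 2)" using bspec[OF elim(2) subsetD[OF sub x]] by simp
      finally show ?thesis using c by simp
    qed
    show ?case
    proof
      fix x :: complex assume x: "x \<in> ball 0 ((r1 + r2) / 2)"
      have "norm (e k x) \<le> \<eta> / 2"
      proof (rule maximum_modulus_frontier[of "e k" "cball 0 \<rho>"])
        show "e k holomorphic_on interior (cball 0 \<rho>)"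
          by (rule holomorphic_on_subset[OF e]) (use \<rho> in auto)
        show "continuous_on (closure (cball 0 \<rho>)) (e k)"
          by (rule holomorphic_on_imp_continuous_on, rule holomorphic_on_subset[OF e]) (use \<rho> in auto)
        show "norm (e k z) \<le> \<eta> / 2" if "z \<in> frontier (cball 0 \<rho>)" for z
          using that \<rho> by (intro sph) (auto simp: frontier_cball)
        show "x \<in> cball 0 \<rho>" using x by (simp add: \<rho>_def)
      qed simp
      then show "norm (e k x) < \<eta>" using \<eta> by simp
    qed
  qed
qed

text \<open>The Taylor coefficient of index \<open>card Fb + card Fa * m\<close> at \<open>c\<close> is compared in the identity for the
  \<open>m\<close>-th remainder, divided by \<open>e\<close> to the power \<open>m\<close>.  The roots in \<open>Fa\<close>, \<open>Fb\<close> converge to \<open>c\<close> fast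
  compared with \<open>s\<close>, all others slowly; \<open>\<rho> = s powr \<gamma>\<close> is the radius on which Cauchy's
  inequality is applied.\<close>

lemma leading_coeff_zero:
  fixes c :: complex and \<sigma> :: "nat \<Rightarrow> nat" and G :: "nat \<Rightarrow> complex \<Rightarrow> complex" and p :: "nat \<Rightarrow> nat"
  defines "s k \<equiv> norm (e (\<sigma> k) c)"
  assumes \<sigma>: "strict_mono \<sigma>" and r0: "0 < r0" "ball c (2 * r0) \<subseteq> ball 0 ((r1 + r2) / 2)"
    and iso: "\<And>x. x \<in> Roots \<Longrightarrow> x \<in> ball c (2 * r0) \<Longrightarrow> x = c"
    and Fa: "Fa \<subseteq> {..<l}" and Fb: "Fb \<subseteq> {..<N}" and \<gamma>: "0 < \<gamma>" "\<gamma> \<le> 1"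
    and fasta: "\<And>i k. i \<in> Fa \<Longrightarrow> norm (a (\<sigma> k) i - c) \<le> s k powr \<gamma>"
    and fastb: "\<And>i k. i \<in> Fb \<Longrightarrow> norm (b (\<sigma> k) i - c) \<le> s k powr \<gamma>"
    and slowa: "\<And>i \<eta>. i \<in> {..<l} - Fa \<Longrightarrow> 0 < \<eta> \<Longrightarrow> \<forall>\<^sub>F k in sequentially. s k powr \<eta> \<le> norm (a (\<sigma> k) i - c)"
    and slowb: "\<And>i \<eta>. i \<in> {..<N} - Fb \<Longrightarrow> 0 < \<eta> \<Longrightarrow> \<forall>\<^sub>F k in sequentially. s k powr \<eta> \<le> norm (b (\<sigma> k) i - c)"
    and L: "l \<le> L" "3 \<le> \<gamma> * (real L - real l)" and L1: "N \<le> L1"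
    and p: "\<And>j. j < m \<Longrightarrow> p j = L * j + L1" "L * m + L1 < p m"
    and G: "\<And>j. j \<le> m \<Longrightarrow> G j holomorphic_on ball c (2 * r0)"
    and GH: "\<And>j x. j \<le> m \<Longrightarrow> x \<in> ball c (2 * r0) \<Longrightarrow> (x - c) ^ p j * HH j x = poly (QQ j) x * G j x"
  shows "G m c = 0"
proof (rule ccontr)
  assume Gm: "G m c \<noteq> 0"
  let ?D = "ball c (2 * r0)"
  have Dsub: "?D \<subseteq> ball 0 r2"
    by (rule order_trans[OF r0(2) subset_ball]) (use r in simp)
  have cD: "c \<in> ?D" using r0 by simp
  have rD: "cball c r0 \<subseteq> ?D" using r0 by auto
  \<comment> \<open>The number of fast factors in \<open>q * w ^ m\<close>, and thus the degree of
    \<open>fast k\<close> below.\<close>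
  define \<kappa> where "\<kappa> = card Fb + card Fa * m"
  have fin: "finite Fa" "finite Fb" using Fa Fb by (auto intro: finite_subset)
  have cards: "card Fa \<le> l" "card Fb \<le> N" using Fa Fb card_mono[of "{..<l}" Fa] card_mono[of "{..<N}" Fb] by auto
  have p_mono: "p j \<le> p m" if "j \<le> m" for j
  proof (cases "j = m")
    case False
    then have "L * j \<le> L * m" using that by simp
    then show ?thesis using p(1)[of j] p(2) False that by linarith
  qed simp
  have \<kappa>p: "\<kappa> < p m"
  proof -
    have "card Fa * m \<le> L * m" using cards L by (intro mult_right_mono) auto
    then show ?thesis using p(2) cards L1 unfolding \<kappa>_def by linarith
  qed
  obtain R where R: "1 \<le> R" "\<And>k i x. i < l \<Longrightarrow> x \<in> ball 0 r2 \<Longrightarrow> norm (x - a k i) \<le> R"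
    "\<And>k i x. i < N \<Longrightarrow> x \<in> ball 0 r2 \<Longrightarrow> norm (x - b k i) \<le> R" using roots_bounded by blast
  have "\<exists>K\<ge>0. \<forall>x\<in>cball c r0. norm (G j x) \<le> K" if "j \<le> m" for j
  proof -
    have "compact (G j ` cball c r0)"
      by (intro compact_continuous_image compact_cball holomorphic_on_imp_continuous_on
          holomorphic_on_subset[OF G[OF that] rD])
    then obtain K where "\<And>x. x \<in> cball c r0 \<Longrightarrow> norm (G j x) \<le> K"
      using compact_imp_bounded bounded_iff by (metis image_eqI)
    then show ?thesis by (intro exI[of _ "max 0 K"]) (auto simp: le_max_iff_disj)
  qed
  then have "\<forall>j\<in>{..m}. \<exists>K\<ge>0. \<forall>x\<in>cball c r0. norm (G j x) \<le> K" by auto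
  from bchoice[OF this] obtain KG where "\<forall>j\<in>{..m}. 0 \<le> KG j \<and> (\<forall>x\<in>cball c r0. norm (G j x) \<le> KG j)" by blast
  then have KG: "\<And>j. j \<le> m \<Longrightarrow> KG j \<ge> 0"
    "\<And>j x. j \<le> m \<Longrightarrow> x \<in> cball c r0 \<Longrightarrow> norm (G j x) \<le> KG j" by auto

  \<comment> \<open>\<open>fast k\<close> is kept as a monic polynomial, whose coefficient of order
    \<open>\<kappa>\<close> is known; \<open>slow k\<close> is kept as a function, to be bounded
    from below at \<open>c\<close>.\<close>
  define fast where "fast k = (\<Prod>i\<in>Fb. [:- b (\<sigma> k) i, 1:]) * (\<Prod>i\<in>Fa. [:- a (\<sigma> k) i, 1:]) ^ m" for k
  define slow where "slow k x = (\<Prod>i\<in>{..<N} - Fb. x - b (\<sigma> k) i) * (\<Prod>i\<in>{..<l} - Fa. x - a (\<sigma> k) i) ^ m" for k x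
  have fast_deg: "degree (fast k) = \<kappa>" "lead_coeff (fast k) = 1" for k
  proof -
    have nz: "(\<Prod>i\<in>Fb. [:- b (\<sigma> k) i, 1:]) \<noteq> 0" "(\<Prod>i\<in>Fa. [:- a (\<sigma> k) i, 1:]) \<noteq> 0" using fin by auto
    then have "(\<Prod>i\<in>Fa. [:- a (\<sigma> k) i, 1:]) ^ m \<noteq> 0" by simp
    from degree_mult_eq[OF nz(1) this] show "degree (fast k) = \<kappa>"
      unfolding fast_def \<kappa>_def by (simp add: degree_power_eq[OF nz(2)] degree_prod_sum_eq mult.commute)
    show "lead_coeff (fast k) = 1"
      unfolding fast_def lead_coeff_mult lead_coeff_power lead_coeff_prod by simp
  qed
  have fast_eq: "poly (fast k) x = (\<Prod>i\<in>Fb. x - b (\<sigma> k) i) * (\<Prod>i\<in>Fa. x - a (\<sigma> k) i) ^ m" for k x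
    by (simp add: fast_def poly_prod)
  have split_a: "w (\<sigma> k) x = (\<Prod>i\<in>{..<l} - Fa. x - a (\<sigma> k) i) * (\<Prod>i\<in>Fa. x - a (\<sigma> k) i)" for k x
    unfolding w_def using Fa by (intro prod.subset_diff) auto
  have split_b: "q (\<sigma> k) x = (\<Prod>i\<in>{..<N} - Fb. x - b (\<sigma> k) i) * (\<Prod>i\<in>Fb. x - b (\<sigma> k) i)" for k x
    unfolding q_def using Fb by (intro prod.subset_diff) auto
  have fs: "q (\<sigma> k) x * w (\<sigma> k) x ^ m = poly (fast k) x * slow k x" for k x
    unfolding split_a split_b fast_eq slow_def by (simp add: power_mult_distrib mult_ac)

  define h where "h k x = slow k x * G m x" for k x
  define tm where "tm k j x = q (\<sigma> k) x * w (\<sigma> k) x ^ j * (x - c) ^ (p m - p j) * G j x / e (\<sigma> k) x ^ (m - j)" for k j x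
  \<comment> \<open>The remainder after the \<open>m\<close>-th term, multiplied by
    \<open>(x - c) ^ p m / e ^ m\<close>. The \<open>G j\<close> replace the coefficients, so every
    summand is holomorphic at \<open>c\<close>.\<close>
  define \<Phi> where "\<Phi> k x = (x - c) ^ p m * U (\<sigma> k) x / e (\<sigma> k) x ^ m - (\<Sum>j<m. tm k j x) - poly (fast k) x * h k x" for k x
  let ?T = "\<lambda>F. (deriv ^^ \<kappa>) F c"
  have enz: "e k x \<noteq> 0" if "x \<in> ?D" for k x using e_nz Dsub that by blast
  have ehol: "e k holomorphic_on ?D" for k by (rule holomorphic_on_subset[OF e Dsub])
  have Uhol: "U k holomorphic_on ?D" for k by (rule holomorphic_on_subset[OF U Dsub])
  have slowhol: "slow k holomorphic_on S" for k S unfolding slow_def by (intro holomorphic_intros)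
  have hhol: "h k holomorphic_on ?D" for k unfolding h_def by (intro holomorphic_intros slowhol G) simp
  have thol: "tm k j holomorphic_on ?D" if "j < m" for k j
    unfolding tm_def using enz that by (intro holomorphic_intros hol_wq G ehol) auto
  have UEhol: "(\<lambda>x. (x - c) ^ p m * U (\<sigma> k) x / e (\<sigma> k) x ^ m) holomorphic_on ?D" for k
    using enz by (intro holomorphic_intros Uhol ehol) auto
  have fasthol: "poly (fast k) holomorphic_on S" for k S by (intro holomorphic_intros)
  have \<Phi>hol: "\<Phi> k holomorphic_on ?D" for k
    unfolding \<Phi>_def by (intro holomorphic_intros UEhol hhol thol) auto

  have cauchy: "norm (?T F) \<le> fact \<kappa> * B / \<rho> ^ \<kappa>"
    if "F holomorphic_on ?D" "0 < \<rho>" "\<rho> \<le> r0" "\<And>x. norm (x - c) = \<rho> \<Longrightarrow> norm (F x) \<le> B" for F \<rho> B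
  proof (rule Cauchy_inequality)
    have sub: "cball c \<rho> \<subseteq> ?D" using that r0 by auto
    show "F holomorphic_on ball c \<rho>" using that(1) sub by (meson ball_subset_cball holomorphic_on_subset order_trans)
    show "continuous_on (cball c \<rho>) F" using that(1) sub by (meson holomorphic_on_imp_continuous_on holomorphic_on_subset)
  qed (use that in \<open>auto simp: norm_minus_commute\<close>)

  \<comment> \<open>Solves the identity for the value of interest. The term with \<open>U\<close>
    vanishes at \<open>c\<close> to order \<open>p m > \<kappa>\<close> and contributes nothing;
    \<open>fast k\<close> is monic of degree \<open>\<kappa>\<close>, so replacing
    \<open>h k x\<close> by \<open>h k c\<close> isolates
    \<open>fact \<kappa> * h k c\<close>.\<close>
  have split: "fact \<kappa> * h k c = - ?T (\<Phi> k) - (\<Sum>j<m. ?T (tm k j)) - ?T (\<lambda>x. poly (fast k) x * (h k x - h k c))" for k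
  proof -
    let ?F = "\<lambda>x. (x - c) ^ p m * U (\<sigma> k) x / e (\<sigma> k) x ^ m"
    have z: "?T ?F = 0"
    proof -
      have "?F holomorphic_on ?D" by (rule UEhol)
      have hh: "(\<lambda>x. U (\<sigma> k) x / e (\<sigma> k) x ^ m) holomorphic_on ?D"
        using enz by (intro holomorphic_intros Uhol ehol) auto
      have "compact ((\<lambda>x. U (\<sigma> k) x / e (\<sigma> k) x ^ m) ` cball c r0)"
        by (intro compact_continuous_image compact_cball holomorphic_on_imp_continuous_on
            holomorphic_on_subset[OF hh rD])
      then obtain K where K: "\<And>x. x \<in> cball c r0 \<Longrightarrow> norm (U (\<sigma> k) x / e (\<sigma> k) x ^ m) \<le> K"
        using compact_imp_bounded bounded_iff by (metis (no_types, lifting) image_eqI)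
      \<comment> \<open>Cauchy's inequality on shrinking circles: the numerator is of order
        \<open>t ^ p m\<close> and the denominator is \<open>t ^ \<kappa>\<close>, which leaves at
        least one factor \<open>t\<close>.\<close>
      have bd: "norm (?T ?F) \<le> (fact \<kappa> * K) * t" if t: "0 < t" "t \<le> min 1 r0" for t
      proof -
        have K0: "0 \<le> K" using order_trans[OF norm_ge_zero K[of c]] r0 by simp
        have "norm (?T ?F) \<le> fact \<kappa> * (t ^ p m * K) / t ^ \<kappa>"
        proof (rule cauchy[OF UEhol])
          fix x assume x: "norm (x - c) = t"
          then have "x \<in> cball c r0" using t by (simp add: dist_norm norm_minus_commute)
          from mult_left_mono[OF K[OF this], of "t ^ p m"] show "norm ((x - c) ^ p m * U (\<sigma> k) x / e (\<sigma> k) x ^ m) \<le> t ^ p m * K"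
            using x t by (simp add: norm_mult norm_divide norm_power)
        qed (use t in auto)
        also have "\<dots> = fact \<kappa> * K * t ^ (p m - \<kappa>)"
          using \<kappa>p t by (simp add: power_diff)
        also have "\<dots> \<le> fact \<kappa> * K * t ^ 1"
          using \<kappa>p t K0 by (intro mult_left_mono power_decreasing) auto
        finally show ?thesis by simp
      qed
      show ?thesis
      proof (rule ccontr)
        assume "?T ?F \<noteq> 0"
        then have pos: "0 < norm (?T ?F)" by simp
        have K0: "0 \<le> fact \<kappa> * K" using order_trans[OF norm_ge_zero K[of c]] r0 by simp
        define t where "t = min (min 1 r0) (norm (?T ?F) / (2 * (fact \<kappa> * K + 1)))"
        have t: "0 < t" "t \<le> min 1 r0" using pos K0 r0 by (auto simp: t_def)
        have "t \<le> norm (?T ?F) / (2 * (fact \<kappa> * K + 1))" by (simp add: t_def)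
        then have "2 * ((fact \<kappa> * K + 1) * t) \<le> norm (?T ?F)" using K0 by (simp add: field_simps)
        moreover have "(fact \<kappa> * K) * t \<le> (fact \<kappa> * K + 1) * t" using t by (simp add: algebra_simps)
        ultimately show False using bd[OF t] pos by linarith
      qed
    qed
    have eq: "?F = (\<lambda>x. ((\<Phi> k x + (\<Sum>j<m. tm k j x)) + poly (fast k) x * (h k x - h k c)) + h k c * poly (fast k) x)"
      by (rule ext) (simp add: \<Phi>_def algebra_simps)
    have "?T ?F = ?T (\<Phi> k) + (\<Sum>j<m. ?T (tm k j)) + ?T (\<lambda>x. poly (fast k) x * (h k x - h k c)) + h k c * ?T (poly (fast k))"
    proof -
      let ?A1 = "\<lambda>x. \<Sum>j<m. tm k j x"
      let ?A2 = "\<lambda>x. \<Phi> k x + ?A1 x"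
      let ?A3 = "\<lambda>x. poly (fast k) x * (h k x - h k c)"
      have hol: "?A1 holomorphic_on ?D" "?A2 holomorphic_on ?D" "?A3 holomorphic_on ?D"
        by (intro holomorphic_intros \<Phi>hol thol hhol fasthol; simp)+
      have "?T ?F = ?T (\<lambda>x. ?A2 x + ?A3 x) + ?T (\<lambda>x. h k c * poly (fast k) x)"
        unfolding eq by (rule higher_deriv_add[of _ ?D]) (use hol cD in \<open>auto intro!: holomorphic_intros\<close>)
      also have "?T (\<lambda>x. ?A2 x + ?A3 x) = ?T ?A2 + ?T ?A3"
        by (rule higher_deriv_add[OF hol(2,3) open_ball cD])
      also have "?T ?A2 = ?T (\<Phi> k) + ?T ?A1"
        by (rule higher_deriv_add[OF \<Phi>hol hol(1) open_ball cD])
      also have "?T ?A1 = (\<Sum>j<m. ?T (tm k j))"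
        by (rule higher_deriv_sum[of _ _ ?D]) (use thol cD in auto)
      also have "?T (\<lambda>x. h k c * poly (fast k) x) = h k c * ?T (poly (fast k))"
        by (rule higher_deriv_cmult[OF fasthol cD open_ball])
      finally show ?thesis .
    qed
    moreover have "?T (poly (fast k)) = fact \<kappa>"
      using higher_deriv_monic_poly[OF fast_deg(2)] by (simp add: fast_deg)
    moreover have "x * y = - A - B - D" if "F = A + B + D + y * d" "d = x" "F = 0" for A B D F d x y :: complex
      using that by algebra
    ultimately show ?thesis using z by blast
  qed

  have s_pos: "0 < s k" for k using enz[OF cD] by (simp add: s_def)
  have ev_small: "\<forall>\<^sub>F k in sequentially. \<forall>x\<in>?D. norm (e (\<sigma> k) x) < \<eta>" if "0 < \<eta>" for \<eta>
    using eventually_subseq[OF \<sigma> e_tendsto_0[OF that]] r0(2) by (auto elim!: eventually_mono)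
  have s_lim: "s \<longlonglongrightarrow> 0"
  proof (rule tendstoI)
    fix \<eta> :: real assume "\<eta> > 0"
    from ev_small[OF this] show "\<forall>\<^sub>F k in sequentially. dist (s k) 0 < \<eta>"
      by eventually_elim (use cD in \<open>auto simp: s_def\<close>)
  qed
  have powr_lim: "(\<lambda>k. s k powr x) \<longlonglongrightarrow> 0" if "0 < x" for x
    using tendsto_powr'[OF s_lim tendsto_const[of x]] that s_pos by (simp add: less_imp_le)

  \<comment> \<open>The remainder of index \<open>Suc m\<close> carries \<open>e ^ Suc m\<close>, so
    one factor \<open>e\<close> survives the division by \<open>e ^ m\<close>.\<close>
  obtain K0 where K0: "0 < K0" "\<And>k x. x \<in> ball 0 r2 \<Longrightarrow> norm (cleared QQ HH (Suc m) k x) \<le> K0 * norm (e k x) ^ Suc m"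
    by (rule cleared_bound[of "Suc m" HH QQ]) (use QQ_HH in auto)
  define P where "P = (\<Prod>j<Suc m. QQ j)"
  have Pnz: "poly P x \<noteq> 0" if "x \<in> ?D" "x \<noteq> c" for x
    using that iso QQ_HH(2) by (auto simp: P_def poly_prod)
  obtain cQ where cQ: "0 < cQ" "\<And>x. x \<in> sphere c r0 \<Longrightarrow> cQ \<le> norm (poly P x)"
  proof -
    have "sphere c r0 \<noteq> {}" using r0 by simp
    then obtain x0 where x0: "x0 \<in> sphere c r0" "\<And>x. x \<in> sphere c r0 \<Longrightarrow> norm (poly P x0) \<le> norm (poly P x)"
      using continuous_attains_inf[of "sphere c r0" "\<lambda>x. norm (poly P x)"]
        continuous_on_norm[OF continuous_on_poly[OF continuous_on_id]] compact_sphere by (metis id_apply)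
    have "poly P x0 \<noteq> 0" using x0(1) r0(1) rD by (intro Pnz) auto
    then show thesis using x0 by (intro that[of "norm (poly P x0)"]) auto
  qed
  \<comment> \<open>On the fixed circle of radius \<open>r0\<close> the denominators
    \<open>QQ j\<close> have no zeros, so \<open>\<Phi>\<close> is the cleared remainder divided by
    the polynomial \<open>P\<close>, which is bounded below there.\<close>
  have \<Phi>bound: "norm (\<Phi> k x) \<le> r0 ^ p m * K0 * norm (e (\<sigma> k) x) / cQ" if x: "norm (x - c) = r0" for k x
  proof -
    have xs: "x \<in> sphere c r0" using x by (simp add: dist_norm norm_minus_commute)
    then have xD: "x \<in> ?D" "x \<noteq> c" using r0(1) rD by auto
    define B where "B j = HH j x / poly (QQ j) x" for j
    have Qj: "poly (QQ j) x \<noteq> 0" for j using QQ_HH(2)[of j x] iso[of x] xD by auto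
    have HB: "HH j x = poly (QQ j) x * B j" for j using Qj by (simp add: B_def)
    have GB: "G j x = (x - c) ^ p j * B j" if "j \<le> m" for j
      using GH[OF that xD(1)] Qj[of j] by (simp add: HB)
    have E: "e (\<sigma> k) x \<noteq> 0" by (rule enz[OF xD(1)])
    define Z where "Z = (x - c) ^ p m / e (\<sigma> k) x ^ m"
    have t: "tm k j x = Z * (q (\<sigma> k) x * (B j * \<delta> (\<sigma> k) x ^ j))" if j: "j < m" for j
    proof -
      have "(x - c) ^ p m = (x - c) ^ (p m - p j) * (x - c) ^ p j"
        using p_mono[of j] j by (simp flip: power_add)
      moreover have "e (\<sigma> k) x ^ m = e (\<sigma> k) x ^ (m - j) * e (\<sigma> k) x ^ j" using j by (simp flip: power_add)
      ultimately show ?thesis using E GB[of j] j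
        by (simp add: tm_def Z_def \<delta>_def power_mult_distrib)
    qed
    have h: "poly (fast k) x * h k x = Z * (q (\<sigma> k) x * (B m * \<delta> (\<sigma> k) x ^ m))"
    proof -
      have "poly (fast k) x * h k x = (q (\<sigma> k) x * w (\<sigma> k) x ^ m) * G m x" unfolding h_def fs by simp
      then show ?thesis using E GB[of m] by (simp add: Z_def \<delta>_def power_mult_distrib)
    qed
    have "\<Phi> k x = Z * (U (\<sigma> k) x - q (\<sigma> k) x * (\<Sum>j<Suc m. B j * \<delta> (\<sigma> k) x ^ j))"
      unfolding \<Phi>_def h using t by (simp add: Z_def sum_distrib_left algebra_simps)
    moreover have "cleared QQ HH (Suc m) (\<sigma> k) x = poly P x * (U (\<sigma> k) x - q (\<sigma> k) x * (\<Sum>j<Suc m. B j * \<delta> (\<sigma> k) x ^ j))"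
      unfolding P_def by (rule cleared_eq) (rule HB)
    ultimately have "\<Phi> k x * poly P x = Z * cleared QQ HH (Suc m) (\<sigma> k) x" by simp
    then have "norm (\<Phi> k x) * norm (poly P x) = norm Z * norm (cleared QQ HH (Suc m) (\<sigma> k) x)"
      by (metis norm_mult)
    also have "\<dots> \<le> norm Z * (K0 * norm (e (\<sigma> k) x) ^ Suc m)"
      using xD Dsub by (intro mult_left_mono K0) auto
    also have "\<dots> = r0 ^ p m * K0 * norm (e (\<sigma> k) x)"
      using E by (simp add: Z_def norm_divide norm_power x)
    finally have "norm (\<Phi> k x) * norm (poly P x) \<le> r0 ^ p m * K0 * norm (e (\<sigma> k) x)" .
    moreover have "norm (\<Phi> k x) * cQ \<le> norm (\<Phi> k x) * norm (poly P x)" using cQ(2)[OF xs] by (intro mult_left_mono) auto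
    ultimately show ?thesis using cQ(1) by (simp add: le_divide_eq)
  qed

  \<comment> \<open>The weaker of two gains: \<open>1/3\<close> comes from Harnack's upper bound in
    the estimate of \<open>\<Phi>\<close>, and \<open>\<gamma>\<close> from the radius
    \<open>\<rho>\<close> in the other two estimates.\<close>
  define \<gamma>' where "\<gamma>' = min \<gamma> (1/3)"
  have \<gamma>': "0 < \<gamma>'" "\<gamma>' \<le> \<gamma>" "\<gamma>' \<le> 1/3" using \<gamma> by (auto simp: \<gamma>'_def)
  define B1 where "B1 = fact \<kappa> * (r0 ^ p m * K0 / cQ) / r0 ^ \<kappa>"
  define B2 where "B2 j = fact \<kappa> * (R ^ N * 2 ^ card Fb * (R ^ l * 2 ^ card Fa) ^ j * KG j)" for j
  define KS where "KS = R ^ N * (R ^ l) ^ m * KG m"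
  define B3 where "B3 = fact \<kappa> * (2 ^ \<kappa> * (4 * KS / r0))"
  define Bt where "Bt = B1 + (\<Sum>j<m. B2 j) + B3"
  have prod_le: "(\<Prod>i\<in>I. norm (x - y i)) \<le> R ^ n" if "I \<subseteq> {..<n}" "\<And>i. i \<in> I \<Longrightarrow> norm (x - y i) \<le> R" for I n x and y :: "nat \<Rightarrow> complex"
  proof -
    have "(\<Prod>i\<in>I. norm (x - y i)) \<le> (\<Prod>i\<in>I. R)" using that by (intro prod_mono) auto
    also have "\<dots> = R ^ card I" by simp
    also have "\<dots> \<le> R ^ n" using card_mono[OF _ that(1)] R(1) by (intro power_increasing) auto
    finally show ?thesis .
  qed
  have slow_le: "norm (\<Prod>i\<in>{..<N} - Fb. x - b (\<sigma> k) i) \<le> R ^ N" "norm (\<Prod>i\<in>{..<l} - Fa. x - a (\<sigma> k) i) \<le> R ^ l"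
    if "x \<in> ?D" for k x
    unfolding prod_norm[symmetric] using that Dsub R by (auto intro!: prod_le)

  have "\<forall>\<^sub>F k in sequentially. s k < 1" using s_lim by (rule order_tendstoD) simp
  moreover have "\<forall>\<^sub>F k in sequentially. s k powr \<gamma> < r0/2" using powr_lim[OF \<gamma>(1)] r0 by (intro order_tendstoD) auto
  moreover have "\<forall>\<^sub>F k in sequentially. \<forall>x\<in>?D. norm (e (\<sigma> k) x) < 1" by (rule ev_small) simp
  ultimately have main: "\<forall>\<^sub>F k in sequentially. fact \<kappa> * norm (h k c) \<le> Bt * s k powr \<gamma>'"
  proof eventually_elim
    case (elim k)
    define \<rho> where "\<rho> = s k powr \<gamma>"
    have \<rho>: "0 < \<rho>" "\<rho> < r0/2" "\<rho> \<le> r0" using s_pos[of k] elim r0 by (auto simp: \<rho>_def)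
    have \<rho>1: "\<rho> \<le> 1" using elim s_pos[of k] \<gamma> powr_mono'[of 0 \<gamma> "s k"] by (simp add: \<rho>_def)
    have sx: "s k powr x \<le> s k powr \<gamma>'" if "\<gamma>' \<le> x" for x using elim s_pos[of k] that by (intro powr_mono') auto
    \<comment> \<open>The lower bound is the price for negative powers of \<open>e\<close>; its
      exponent \<open>3\<close> is the one in the assumption on \<open>L\<close>.\<close>
    have eb: "s k ^ 3 \<le> norm (e (\<sigma> k) x)" "norm (e (\<sigma> k) x) \<le> s k powr (1/3)" if "x \<in> cball c r0" for x
      unfolding s_def by (rule nonvanishing_power_bounds[OF ehol r0(1) _ that], use enz elim in blast)+
    have i1: "norm (?T (\<Phi> k)) \<le> B1 * s k powr (1/3)"
    proof -
      have "norm (?T (\<Phi> k)) \<le> fact \<kappa> * (r0 ^ p m * K0 * s k powr (1/3) / cQ) / r0 ^ \<kappa>"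
      proof (rule cauchy[OF \<Phi>hol r0(1)])
        fix x assume x: "norm (x - c) = r0"
        have "norm (\<Phi> k x) \<le> r0 ^ p m * K0 * norm (e (\<sigma> k) x) / cQ" by (rule \<Phi>bound[OF x])
        also have "\<dots> \<le> r0 ^ p m * K0 * s k powr (1/3) / cQ"
          using r0 K0 cQ x by (intro divide_right_mono mult_left_mono eb) (auto simp: dist_norm norm_minus_commute)
        finally show "norm (\<Phi> k x) \<le> r0 ^ p m * K0 * s k powr (1/3) / cQ" .
      qed simp
      then show ?thesis by (simp add: B1_def mult_ac)
    qed
    have fastx: "norm (\<Prod>i\<in>Fb. x - b (\<sigma> k) i) \<le> (2 * \<rho>) ^ card Fb" "norm (\<Prod>i\<in>Fa. x - a (\<sigma> k) i) \<le> (2 * \<rho>) ^ card Fa"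
      if x: "norm (x - c) = \<rho>" for x
    proof -
      have tri: "norm (x - y) \<le> 2 * \<rho>" if "norm (y - c) \<le> \<rho>" for y
        using norm_triangle_ineq4[of "x - c" "y - c"] that x by simp
      have "(\<Prod>i\<in>Fb. norm (x - b (\<sigma> k) i)) \<le> (\<Prod>i\<in>Fb. 2 * \<rho>)"
        using tri[OF fastb[of _ k, folded \<rho>_def]] by (intro prod_mono) auto
      then show "norm (\<Prod>i\<in>Fb. x - b (\<sigma> k) i) \<le> (2 * \<rho>) ^ card Fb" by (simp add: prod_norm)
      have "(\<Prod>i\<in>Fa. norm (x - a (\<sigma> k) i)) \<le> (\<Prod>i\<in>Fa. 2 * \<rho>)"
        using tri[OF fasta[of _ k, folded \<rho>_def]] by (intro prod_mono) auto
      then show "norm (\<Prod>i\<in>Fa. x - a (\<sigma> k) i) \<le> (2 * \<rho>) ^ card Fa" by (simp add: prod_norm)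
    qed
    have xin: "x \<in> cball c r0" "x \<in> ?D" if "norm (x - c) = \<rho>" for x
      using that \<rho> rD by (auto simp: dist_norm norm_minus_commute)
    have i2: "norm (?T (tm k j)) \<le> B2 j * \<rho>" if j: "j < m" for j
    proof -
      define Y where "Y = (R ^ N * (2 * \<rho>) ^ card Fb) * (R ^ l * (2 * \<rho>) ^ card Fa) ^ j * \<rho> ^ (p m - p j) * KG j"
      have Y: "Y = (R ^ N * 2 ^ card Fb * (R ^ l * 2 ^ card Fa) ^ j * KG j) * \<rho> ^ (card Fb + card Fa * j + (p m - p j))"
        by (simp add: Y_def power_mult_distrib power_add power_mult)
      have c1: "norm (?T (tm k j)) \<le> fact \<kappa> * (Y / (s k ^ 3) ^ (m - j)) / \<rho> ^ \<kappa>"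
      proof (rule cauchy[OF thol[OF j] \<rho>(1,3)])
        fix x assume x: "norm (x - c) = \<rho>"
        have "norm (q (\<sigma> k) x) \<le> R ^ N * (2 * \<rho>) ^ card Fb"
          unfolding split_b norm_mult using slow_le(1)[OF xin(2)[OF x]] fastx[OF x] R(1) by (intro mult_mono) auto
        moreover have "norm (w (\<sigma> k) x) \<le> R ^ l * (2 * \<rho>) ^ card Fa"
          unfolding split_a norm_mult using slow_le(2)[OF xin(2)[OF x]] fastx[OF x] R(1) by (intro mult_mono) auto
        ultimately have "norm (q (\<sigma> k) x * w (\<sigma> k) x ^ j * (x - c) ^ (p m - p j) * G j x) \<le> Y"
          unfolding Y_def norm_mult norm_power x using KG[of j] xin(1)[OF x] j \<rho> R(1)
          by (intro mult_mono power_mono) (auto intro!: mult_nonneg_nonneg)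
        moreover have "(s k ^ 3) ^ (m - j) \<le> norm (e (\<sigma> k) x) ^ (m - j)"
          using eb(1)[OF xin(1)[OF x]] s_pos[of k] by (intro power_mono) auto
        ultimately show "norm (tm k j x) \<le> Y / (s k ^ 3) ^ (m - j)"
          unfolding tm_def norm_divide[of "_ * _"] norm_power[of "e _ _"] using s_pos[of k] by (intro frac_le) (auto intro: order_trans[OF norm_ge_zero])
      qed
      \<comment> \<open>Exponent count. With \<open>d = m - j\<close> and
        \<open>g = L - card Fa\<close>, the slope \<open>L\<close> of the exponents provides
        \<open>g * d\<close> powers of \<open>\<rho>\<close> beyond the \<open>\<kappa>\<close> lost
        in Cauchy's inequality, and \<open>\<rho> ^ g \<le> s k ^ 3\<close> pays for Harnack's lower
        bound. The additional factor \<open>\<rho>\<close> is the strict inequality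
        \<open>L * m + L1 < p m\<close>.\<close>
      have pw: "\<rho> ^ (card Fb + card Fa * j + (p m - p j)) \<le> \<rho> * \<rho> ^ \<kappa> * (s k ^ 3) ^ (m - j)"
      proof -
        obtain d where d: "m = j + d" "d > 0" using j less_imp_add_positive by blast
        obtain g where g: "L = card Fa + g" using L(1) cards(1) by (metis le_iff_add order_trans)
        have pj: "p j = L * j + L1" "L * m + L1 < p m" using p j by auto
        have "1 + \<kappa> + g * d \<le> card Fb + card Fa * j + (p m - p j)"
          using pj unfolding d g \<kappa>_def by (simp add: algebra_simps)
        then have "\<rho> ^ (card Fb + card Fa * j + (p m - p j)) \<le> \<rho> ^ (1 + \<kappa> + g * d)"
          using \<rho> \<rho>1 by (intro power_decreasing) auto
        also have "\<dots> = \<rho> * \<rho> ^ \<kappa> * (\<rho> ^ g) ^ d" by (simp add: power_add power_mult)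
        also have "\<dots> \<le> \<rho> * \<rho> ^ \<kappa> * (s k ^ 3) ^ d"
        proof (intro mult_left_mono power_mono)
          have "real l + real g \<ge> real L" using g cards by simp
          then have "\<gamma> * (real L - real l) \<le> \<gamma> * real g" using \<gamma> by (intro mult_left_mono) auto
          then have "3 \<le> \<gamma> * real g" using L(2) by linarith
          then have "s k powr (\<gamma> * real g) \<le> s k powr 3" using elim s_pos[of k] by (intro powr_mono') auto
          also have "s k powr 3 = s k ^ 3" using s_pos[of k] powr_realpow[of "s k" 3] by simp
          also have "s k powr (\<gamma> * real g) = \<rho> ^ g" using s_pos[of k] by (simp add: \<rho>_def powr_powr[symmetric] powr_realpow)
          finally show "\<rho> ^ g \<le> s k ^ 3" .
        qed (use \<rho> in auto)
        finally show ?thesis by (simp add: d)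
      qed
      define Z where "Z = R ^ N * 2 ^ card Fb * (R ^ l * 2 ^ card Fa) ^ j * KG j"
      define S where "S = (s k ^ 3) ^ (m - j)"
      have "0 \<le> Z" using R(1) KG(1)[of j] j by (simp add: Z_def)
      then have "Y \<le> Z * (\<rho> * \<rho> ^ \<kappa> * S)"
        unfolding Y Z_def[symmetric] S_def by (intro mult_left_mono pw)
      moreover have S: "0 < S" using s_pos[of k] by (simp add: S_def)
      ultimately have "Y / S \<le> Z * \<rho> * \<rho> ^ \<kappa>" by (simp add: divide_le_eq mult_ac)
      then have "fact \<kappa> * (Y / S) / \<rho> ^ \<kappa> \<le> fact \<kappa> * (Z * \<rho> * \<rho> ^ \<kappa>) / \<rho> ^ \<kappa>"
        using \<rho> by (intro divide_right_mono mult_left_mono) auto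
      also have "\<dots> = B2 j * \<rho>" using \<rho> by (simp add: B2_def Z_def)
      finally show ?thesis using c1 by (simp add: S_def)
    qed
    \<comment> \<open>Each of the \<open>\<kappa>\<close> fast factors is at most
      \<open>2 * \<rho>\<close> on the circle, which balances \<open>\<rho> ^ \<kappa>\<close>; the
      Lipschitz bound for \<open>h k\<close> gains the remaining \<open>\<rho>\<close>.\<close>
    have i3: "norm (?T (\<lambda>x. poly (fast k) x * (h k x - h k c))) \<le> B3 * \<rho>"
    proof -
      have KS0: "0 \<le> KS" using R(1) KG(1)[of m] by (simp add: KS_def)
      have hb: "norm (h k x) \<le> KS" if "x \<in> cball c r0" for x
      proof -
        have xD: "x \<in> ?D" using that rD by blast
        show ?thesis unfolding h_def slow_def KS_def norm_mult norm_power
          using slow_le[OF xD] KG[of m] that R(1) by (intro mult_mono power_mono) (auto intro!: mult_nonneg_nonneg)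
      qed
      have "norm (?T (\<lambda>x. poly (fast k) x * (h k x - h k c))) \<le> fact \<kappa> * ((2 * \<rho>) ^ \<kappa> * ((4 * KS / r0) * \<rho>)) / \<rho> ^ \<kappa>"
      proof (rule cauchy[OF _ \<rho>(1,3)])
        show "(\<lambda>x. poly (fast k) x * (h k x - h k c)) holomorphic_on ?D" by (intro holomorphic_intros fasthol hhol)
        fix x assume x: "norm (x - c) = \<rho>"
        have "norm (h k x - h k c) \<le> (2 * KS / (r0/2)) * norm (x - c)"
        proof (rule lipschitz_at_centre)
          show "h k holomorphic_on ball c (2 * (r0/2))" by (rule holomorphic_on_subset[OF hhol]) (use r0 in auto)
        qed (use r0 hb x \<rho> in \<open>auto simp: dist_norm norm_minus_commute\<close>)
        then have "norm (h k x - h k c) \<le> (4 * KS / r0) * \<rho>" using x by simp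
        moreover have "norm (poly (fast k) x) \<le> (2 * \<rho>) ^ \<kappa>"
          unfolding fast_eq norm_mult norm_power \<kappa>_def power_add power_mult using fastx[OF x] \<rho>
          by (intro mult_mono power_mono) auto
        ultimately show "norm (poly (fast k) x * (h k x - h k c)) \<le> (2 * \<rho>) ^ \<kappa> * ((4 * KS / r0) * \<rho>)"
          unfolding norm_mult using \<rho> by (intro mult_mono) auto
      qed
      also have "\<dots> = B3 * \<rho>" using \<rho> by (simp add: B3_def power_mult_distrib)
      finally show ?thesis .
    qed
    have nn: "0 \<le> B1" "0 \<le> B3" "\<And>j. j < m \<Longrightarrow> 0 \<le> B2 j"
      using r0 K0 cQ R(1) KG(1) by (auto simp: B1_def B2_def B3_def KS_def intro!: mult_nonneg_nonneg divide_nonneg_nonneg)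
    have "fact \<kappa> * norm (h k c) = norm (fact \<kappa> * h k c)" by (simp add: norm_mult)
    also have "\<dots> \<le> norm (?T (\<Phi> k)) + norm (\<Sum>j<m. ?T (tm k j)) + norm (?T (\<lambda>x. poly (fast k) x * (h k x - h k c)))"
      unfolding split by (intro order_trans[OF norm_triangle_ineq4] add_right_mono) (use norm_triangle_ineq4[of "- ?T (\<Phi> k)"] in simp)
    also have "\<dots> \<le> B1 * s k powr (1/3) + (\<Sum>j<m. B2 j * \<rho>) + B3 * \<rho>"
      by (intro add_mono i1 i3 order_trans[OF norm_sum] sum_mono i2) auto
    also have "\<dots> \<le> B1 * s k powr \<gamma>' + (\<Sum>j<m. B2 j * s k powr \<gamma>') + B3 * s k powr \<gamma>'"
      unfolding \<rho>_def using nn \<gamma>' by (intro add_mono mult_left_mono sum_mono sx) auto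
    also have "\<dots> = Bt * s k powr \<gamma>'" by (simp add: Bt_def algebra_simps sum_distrib_right)
    finally show ?case .
  qed

  \<comment> \<open>Upper bound for the number of slow factors in \<open>slow k\<close>. Each of
    them is eventually at least \<open>s powr \<eta>\<close>, and \<open>\<eta>\<close> is so small
    that the whole product still exceeds \<open>s powr (\<gamma>' / 2)\<close>.\<close>
  define n where "n = N + l * m"
  define \<eta> where "\<eta> = \<gamma>' / (2 * (real n + 1))"
  have \<eta>: "0 < \<eta>" "\<eta> * real n \<le> \<gamma>' / 2" using \<gamma>' by (auto simp: \<eta>_def field_simps)
  have "\<forall>\<^sub>F k in sequentially. \<forall>i\<in>{..<l} - Fa. s k powr \<eta> \<le> norm (a (\<sigma> k) i - c)"
    using slowa \<eta>(1) by (intro eventually_ball_finite) auto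
  moreover have "\<forall>\<^sub>F k in sequentially. \<forall>i\<in>{..<N} - Fb. s k powr \<eta> \<le> norm (b (\<sigma> k) i - c)"
    using slowb \<eta>(1) by (intro eventually_ball_finite) auto
  moreover have "\<forall>\<^sub>F k in sequentially. s k < 1" using s_lim by (rule order_tendstoD) simp
  ultimately have lower: "\<forall>\<^sub>F k in sequentially. s k powr (\<gamma>' / 2) \<le> norm (slow k c)"
  proof eventually_elim
    case (elim k)
    have t: "0 \<le> s k powr \<eta>" "s k powr \<eta> \<le> 1"
      using elim s_pos[of k] \<eta>(1) powr_mono'[of 0 \<eta> "s k"] by auto
    have pl: "(s k powr \<eta>) ^ n' \<le> (\<Prod>i\<in>I. norm (c - y i))" if "I \<subseteq> {..<n'}" "\<And>i. i \<in> I \<Longrightarrow> s k powr \<eta> \<le> norm (y i - c)"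
      for I n' and y :: "nat \<Rightarrow> complex"
    proof -
      have "(s k powr \<eta>) ^ n' \<le> (s k powr \<eta>) ^ card I"
        using t card_mono[OF _ that(1)] by (intro power_decreasing) auto
      also have "\<dots> = (\<Prod>i\<in>I. s k powr \<eta>)" by simp
      also have "\<dots> \<le> (\<Prod>i\<in>I. norm (c - y i))" using that t by (intro prod_mono) (auto simp: norm_minus_commute)
      finally show ?thesis .
    qed
    have "s k powr (\<gamma>' / 2) \<le> s k powr (\<eta> * real n)" using \<eta> elim s_pos[of k] by (intro powr_mono') auto
    also have "\<dots> = (s k powr \<eta>) ^ n" using s_pos[of k] by (simp add: powr_powr[symmetric] powr_realpow)
    also have "\<dots> = (s k powr \<eta>) ^ N * ((s k powr \<eta>) ^ l) ^ m" by (simp add: n_def power_add power_mult)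
    also have "\<dots> \<le> (\<Prod>i\<in>{..<N} - Fb. norm (c - b (\<sigma> k) i)) * (\<Prod>i\<in>{..<l} - Fa. norm (c - a (\<sigma> k) i)) ^ m"
      using t elim by (intro mult_mono power_mono pl zero_le_power prod_nonneg) auto
    also have "\<dots> = norm (slow k c)" by (simp add: slow_def norm_mult norm_power prod_norm)
    finally show ?case .
  qed
  have "(\<lambda>k. Bt * s k powr (\<gamma>' / 2)) \<longlonglongrightarrow> Bt * 0" using \<gamma>'(1) by (intro tendsto_intros powr_lim) auto
  then have "\<forall>\<^sub>F k in sequentially. Bt * s k powr (\<gamma>' / 2) < fact \<kappa> * norm (G m c)"
    using Gm by (intro order_tendstoD) auto
  \<comment> \<open>The upper bound has order \<open>s powr \<gamma>'\<close>, the lower bound order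
    \<open>s powr (\<gamma>' / 2)\<close>; after cancelling, \<open>norm (G m c)\<close> would be
    smaller than a sequence tending to \<open>0\<close>.\<close>
  with main lower have "\<forall>\<^sub>F k in sequentially. False"
  proof eventually_elim
    case (elim k)
    have "fact \<kappa> * (s k powr (\<gamma>' / 2) * norm (G m c)) \<le> fact \<kappa> * norm (h k c)"
      using elim(2) by (auto simp: h_def norm_mult intro!: mult_left_mono mult_right_mono)
    also have "\<dots> \<le> Bt * s k powr \<gamma>'" by (rule elim(1))
    also have "s k powr \<gamma>' = s k powr (\<gamma>' / 2) * s k powr (\<gamma>' / 2)" by (simp flip: powr_add)
    finally have "s k powr (\<gamma>' / 2) * (fact \<kappa> * norm (G m c)) \<le> s k powr (\<gamma>' / 2) * (Bt * s k powr (\<gamma>' / 2))"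
      by (simp add: mult_ac)
    then show False using elim(3) s_pos[of k] by simp
  qed
  then show False by simp
qed

end

section \<open>Linear bound for the pole orders and the global factor\<close>

context laurent_data
begin

lemma finite_Roots: "finite Roots" by (simp add: Roots_def)

text \<open>Strong induction on \<open>m\<close>. Take the least \<open>p\<close> for which
  \<open>(x - c) ^ p\<close> makes the quotient of \<open>HH m\<close> by \<open>QQ m\<close>
  holomorphic at \<open>c\<close>. If it exceeded \<open>L * m + N\<close>, comparing Taylor
  coefficients would force the numerator to vanish at \<open>c\<close>, so that \<open>p\<close>
  could be lowered.\<close>

lemma pole_order_linear:
  assumes c: "norm c \<le> r1"
  obtains d n0 where "0 < d" "ball c d \<subseteq> ball 0 r2" "\<And>x. x \<in> Roots \<Longrightarrow> x \<in> ball c d \<Longrightarrow> x = c"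
    "\<And>m. \<exists>g. g holomorphic_on ball c d \<and>
      (\<forall>x\<in>ball c d. (x - c) ^ (n0 * (m + 1)) * HH m x = poly (QQ m) x * g x)"
proof -
  have "c \<in> ball 0 ((r1 + r2) / 2)" using c r by simp
  then obtain d1 where d1: "d1 > 0" "ball c d1 \<subseteq> ball 0 ((r1 + r2) / 2)" by (meson open_ball open_contains_ball)
  obtain d2 where d2: "d2 > 0" "\<And>x. x \<in> Roots \<Longrightarrow> x \<noteq> c \<Longrightarrow> d2 \<le> dist c x"
    using finite_set_avoid[OF finite_Roots, of c] by blast
  define r0 where "r0 = min d1 d2 / 2"
  have r0: "0 < r0" "ball c (2 * r0) \<subseteq> ball 0 ((r1 + r2) / 2)"
    using d1 d2(1) subset_ball[of "2 * r0" d1 c] by (auto simp: r0_def)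
  have iso: "x = c" if "x \<in> Roots" "x \<in> ball c (2 * r0)" for x
    using d2(2)[OF that(1)] that(2) by (force simp: r0_def)
  let ?D = "ball c (2 * r0)"
  have Dsub: "?D \<subseteq> ball 0 r2" by (rule order_trans[OF r0(2) subset_ball]) (use r in simp)
  have cD: "c \<in> ?D" using r0 by simp
  \<comment> \<open>The index shift makes \<open>s\<close> lie strictly between \<open>0\<close> and
    \<open>1\<close> from the start, as the choice of the subsequence requires.\<close>
  obtain K where K: "\<forall>k\<ge>K. \<forall>x\<in>ball 0 ((r1 + r2) / 2). norm (e k x) < 1"
    using e_tendsto_0[of 1] unfolding eventually_sequentially by auto
  have s1: "0 < norm (e (k + K) c)" "norm (e (k + K) c) < 1" for k
    using e_nz[OF subsetD[OF Dsub cD], of "k + K"] K subsetD[OF r0(2) cD] by auto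
  \<comment> \<open>Zeros and poles are indexed together by a sum type, so that one subsequence and
    one exponent \<open>\<gamma>\<close> serve both.\<close>
  define cc where "cc i k = (case i of Inl i \<Rightarrow> norm (a (k + K) i - c) | Inr i \<Rightarrow> norm (b (k + K) i - c))"
    for i :: "nat + nat" and k
  obtain \<sigma> F \<gamma> where \<sigma>: "strict_mono (\<sigma> :: nat \<Rightarrow> nat)" and F: "F \<subseteq> Inl ` {..<l} \<union> Inr ` {..<N}" and \<gamma>: "0 < (\<gamma>::real)" "\<gamma> \<le> 1"
    and fast: "\<And>i k. i \<in> F \<Longrightarrow> cc i (\<sigma> k) \<le> norm (e (\<sigma> k + K) c) powr \<gamma>"
    and slow: "\<And>i \<eta>. i \<in> (Inl ` {..<l} \<union> Inr ` {..<N}) - F \<Longrightarrow> 0 < \<eta> \<Longrightarrow>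
       \<forall>\<^sub>F k in sequentially. norm (e (\<sigma> k + K) c) powr \<eta> \<le> cc i (\<sigma> k)"
    by (rule fast_slow_subsequence[of "Inl ` {..<l} \<union> Inr ` {..<N}" "\<lambda>k. norm (e (k + K) c)" cc])
      (use s1 in auto)
  define Fa where "Fa = {i. Inl i \<in> F}"
  define Fb where "Fb = {i. Inr i \<in> F}"
  have Fab: "Fa \<subseteq> {..<l}" "Fb \<subseteq> {..<N}" using F by (auto simp: Fa_def Fb_def)
  have \<sigma>K: "strict_mono (\<lambda>k. \<sigma> k + K)" using \<sigma> by (simp add: strict_mono_def)
  have fasta: "norm (a (\<sigma> k + K) i - c) \<le> norm (e (\<sigma> k + K) c) powr \<gamma>" if "i \<in> Fa" for i k
    using fast[of "Inl i" k] that by (simp add: cc_def Fa_def)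
  have fastb: "norm (b (\<sigma> k + K) i - c) \<le> norm (e (\<sigma> k + K) c) powr \<gamma>" if "i \<in> Fb" for i k
    using fast[of "Inr i" k] that by (simp add: cc_def Fb_def)
  have slowa: "\<forall>\<^sub>F k in sequentially. norm (e (\<sigma> k + K) c) powr \<eta> \<le> norm (a (\<sigma> k + K) i - c)"
    if "i \<in> {..<l} - Fa" "0 < \<eta>" for i \<eta>
    using slow[of "Inl i" \<eta>] that by (simp add: cc_def Fa_def)
  have slowb: "\<forall>\<^sub>F k in sequentially. norm (e (\<sigma> k + K) c) powr \<eta> \<le> norm (b (\<sigma> k + K) i - c)"
    if "i \<in> {..<N} - Fb" "0 < \<eta>" for i \<eta>
    using slow[of "Inr i" \<eta>] that by (simp add: cc_def Fb_def)
  \<comment> \<open>The summand \<open>l\<close> covers the fast zeros entering the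
    \<open>m\<close>-th power, and \<open>3 / \<gamma>\<close> pays for Harnack's exponent at radius
    \<open>s powr \<gamma>\<close>.\<close>
  define L where "L = l + nat \<lceil>3 / \<gamma>\<rceil>"
  have L: "l \<le> L" "3 \<le> \<gamma> * (real L - real l)"
  proof -
    have "3 / \<gamma> \<le> real (nat \<lceil>3 / \<gamma>\<rceil>)" by linarith
    then have "3 \<le> \<gamma> * real (nat \<lceil>3 / \<gamma>\<rceil>)" using \<gamma> by (simp only: pos_divide_le_eq mult.commute)
    then show "3 \<le> \<gamma> * (real L - real l)" by (simp only: L_def of_nat_add add_diff_cancel_left')
  qed (simp add: L_def)
  define PB where "PB m p g \<longleftrightarrow> g holomorphic_on ?D \<and> (\<forall>x\<in>?D. (x - c) ^ p * HH m x = poly (QQ m) x * g x)" for m p g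
  have HHD: "HH m holomorphic_on ?D" for m by (rule holomorphic_on_subset[OF QQ_HH(3) Dsub])
  have raise: "\<exists>g. PB m p' g" if "PB m p g" "p \<le> p'" for m p p' g
  proof (intro exI[of _ "\<lambda>x. (x - c) ^ (p' - p) * g x"])
    have "(x - c) ^ p' = (x - c) ^ (p' - p) * (x - c) ^ p" for x :: complex
      using that(2) by (simp flip: power_add)
    then show "PB m p' (\<lambda>x. (x - c) ^ (p' - p) * g x)"
      using that(1) unfolding PB_def by (auto intro!: holomorphic_intros)
  qed
  have PB_ex: "\<exists>p g. PB m p g" for m
  proof -
    obtain S where S: "QQ m = [:-c, 1:] ^ order c (QQ m) * S" "\<not> [:-c, 1:] dvd S"
      using order_decomp[OF QQ_HH(1)] by blast
    have Snz: "poly S x \<noteq> 0" if "x \<in> ?D" for x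
    proof
      assume "poly S x = 0"
      then have "poly (QQ m) x = 0" by (subst S(1)) simp
      then have "x = c" using QQ_HH(2) iso that by blast
      then show False using \<open>poly S x = 0\<close> S(2) by (simp add: poly_eq_0_iff_dvd)
    qed
    have "PB m (order c (QQ m)) (\<lambda>x. HH m x / poly S x)"
      unfolding PB_def
    proof (intro conjI ballI)
      show "(\<lambda>x. HH m x / poly S x) holomorphic_on ?D" using Snz by (intro holomorphic_intros HHD) auto
      fix x assume "x \<in> ?D"
      moreover have "poly (QQ m) x = (x - c) ^ order c (QQ m) * poly S x" by (subst S(1)) simp
      ultimately show "(x - c) ^ order c (QQ m) * HH m x = poly (QQ m) x * (HH m x / poly S x)"
        using Snz[of x] by simp
    qed
    then show ?thesis by blast
  qed
  \<comment> \<open>A numerator vanishing at \<open>c\<close> contains a factor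
    \<open>x - c\<close>, which cancels against the power on the left. The cancelled relation holds
    off \<open>c\<close> and extends to \<open>c\<close> by the identity theorem.\<close>
  have lower: "\<exists>g'. PB m p g'" if g: "PB m (Suc p) g" "g c = 0" for m p g
  proof (cases "\<exists>x\<in>?D. g x \<noteq> 0")
    case True
    have gh: "g holomorphic_on ?D" using g by (simp add: PB_def)
    obtain n h where h: "0 < (n::nat)" "h holomorphic_on ?D" "\<And>x. x \<in> ?D \<Longrightarrow> g x = (x - c) ^ n * h x"
      using holomorphic_divide_zero[OF gh open_ball connected_ball cD g(2) True] by blast
    define g' where "g' x = (x - c) ^ (n - 1) * h x" for x
    have g'h: "g' holomorphic_on ?D" unfolding g'_def by (intro holomorphic_intros h)
    have gg: "g x = (x - c) * g' x" if "x \<in> ?D" for x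
      using h(1) h(3)[OF that] by (cases n) (auto simp: g'_def)
    have off: "(x - c) ^ p * HH m x = poly (QQ m) x * g' x" if "x \<in> ?D" "x \<noteq> c" for x
    proof -
      have "(x - c) * ((x - c) ^ p * HH m x) = (x - c) * (poly (QQ m) x * g' x)"
        using g(1) that gg[OF that(1)] by (auto simp: PB_def mult_ac)
      then show ?thesis using that(2) by simp
    qed
    have "(x - c) ^ p * HH m x - poly (QQ m) x * g' x = 0" if "x \<in> ?D" for x
    proof (rule analytic_continuation_open[of "?D - {c}" ?D "\<lambda>x. (x - c) ^ p * HH m x - poly (QQ m) x * g' x" "\<lambda>_. 0"])
      have "c + of_real r0 \<in> ?D - {c}" using r0(1) by (auto simp: dist_norm)
      then show "?D - {c} \<noteq> {}" by blast
      show "(\<lambda>x. (x - c) ^ p * HH m x - poly (QQ m) x * g' x) holomorphic_on ?D"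
        by (intro holomorphic_intros HHD g'h)
    qed (use off that in \<open>auto intro: open_delete\<close>)
    then show ?thesis using g'h unfolding PB_def by (intro exI[of _ g']) auto
  next
    case False
    have "HH m x = 0" if x: "x \<in> ?D" for x
    proof (rule analytic_continuation_open[of "?D - {c}" ?D "HH m" "\<lambda>_. 0"])
      have "c + of_real r0 \<in> ?D - {c}" using r0(1) by (auto simp: dist_norm)
      then show "?D - {c} \<noteq> {}" by blast
      show "HH m y = 0" if "y \<in> ?D - {c}" for y
        using g(1) False that by (auto simp: PB_def)
    qed (use x HHD in \<open>auto intro: open_delete\<close>)
    then have "PB m p (\<lambda>_. 0)" by (simp add: PB_def)
    then show ?thesis by blast
  qed
  have claim: "\<exists>g. PB m (L * m + N) g" for m
  proof (induction m rule: less_induct)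
    case (less m)
    then have "\<forall>j\<in>{..<m}. \<exists>g. PB j (L * j + N) g" by auto
    from bchoice[OF this] obtain Gs where Gs: "\<forall>j\<in>{..<m}. PB j (L * j + N) (Gs j)" by blast
    define p0 where "p0 = (LEAST p. \<exists>g. PB m p g)"
    have "\<exists>g. PB m p0 g" unfolding p0_def by (rule LeastI_ex) (rule PB_ex)
    then obtain g where g: "PB m p0 g" by blast
    have "p0 \<le> L * m + N"
    proof (rule ccontr)
      assume n: "\<not> p0 \<le> L * m + N"
      define G where "G j = (if j < m then Gs j else g)" for j
      define p where "p j = (if j < m then L * j + N else p0)" for j
      have GP: "PB j (p j) (G j)" if "j \<le> m" for j using that Gs g by (auto simp: G_def p_def)
      have "G m c = 0"
      proof (rule leading_coeff_zero[OF \<sigma>K r0 iso Fab \<gamma> fasta fastb slowa slowb L order_refl, of m p G])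
        show "p j = L * j + N" if "j < m" for j using that by (simp add: p_def)
        show "L * m + N < p m" using n by (simp add: p_def)
        show "G j holomorphic_on ?D" if "j \<le> m" for j using GP[OF that] by (simp add: PB_def)
        show "(x - c) ^ p j * HH j x = poly (QQ j) x * G j x" if "j \<le> m" "x \<in> ?D" for j x
          using GP[OF that(1)] that(2) by (simp add: PB_def)
      qed auto
      then have "g c = 0" by (simp add: G_def)
      moreover obtain p' where p': "p0 = Suc p'" using n by (cases p0) auto
      ultimately have "\<exists>g'. PB m p' g'" using lower[of m p' g] g by simp
      then have "p0 \<le> p'" unfolding p0_def by (rule Least_le)
      then show False using p' by simp
    qed
    then show ?case using raise[OF g] by blast
  qed
  show ?thesis
  \<comment> \<open>The exponent is rounded up to a multiple of \<open>m + 1\<close> to match the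
    power of the common factor \<open>W\<close>.\<close>
  proof (rule that[of "2 * r0" "L + N"])
    show "\<exists>g. g holomorphic_on ?D \<and> (\<forall>x\<in>?D. (x - c) ^ ((L + N) * (m + 1)) * HH m x = poly (QQ m) x * g x)" for m
    proof -
      obtain g where "PB m (L * m + N) g" using claim by blast
      from raise[OF this, of "(L + N) * (m + 1)"] show ?thesis by (auto simp: PB_def algebra_simps)
    qed
  qed (use r0 Dsub iso in auto)
qed

text \<open>The exponent \<open>n0\<close> dominates the local rates at the finitely many limit
  points in the disk, so one power of the same polynomial clears each coefficient at all of them.
  The singularities left in the quotient are removable.\<close>

lemma coefficients_extend:
  obtains \<Lambda> n0 B where "finite \<Lambda>" "\<Lambda> \<subseteq> cball 0 r1" "0 < (n0::nat)" "\<And>n. B n holomorphic_on ball 0 r2"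
    "\<And>n x. x \<in> Ann \<Longrightarrow> B n x = ((\<Prod>c\<in>\<Lambda>. x - c) ^ n0) ^ (n + 1) * A n x"
proof -
  define \<Lambda> where "\<Lambda> = Roots \<inter> cball 0 r1"
  have fin: "finite \<Lambda>" using finite_Roots by (simp add: \<Lambda>_def)
  have Rb: "x \<in> \<Lambda>" if "x \<in> Roots" "x \<in> ball 0 r2" for x
    using that a' b' by (auto simp: \<Lambda>_def Roots_def) force+
  define P where "P c p \<longleftrightarrow> 0 < fst p \<and> ball c (fst p) \<subseteq> ball 0 r2 \<and> (\<forall>x\<in>Roots. x \<in> ball c (fst p) \<longrightarrow> x = c) \<and>
    (\<forall>m. \<exists>g. g holomorphic_on ball c (fst p) \<and>
      (\<forall>x\<in>ball c (fst p). (x - c) ^ (snd p * (m + 1)) * HH m x = poly (QQ m) x * g x))"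
    for c :: complex and p :: "real \<times> nat"
  have "\<forall>c\<in>\<Lambda>. \<exists>p. P c p"
  proof
    fix c assume "c \<in> \<Lambda>"
    then have "norm c \<le> r1" by (simp add: \<Lambda>_def)
    then show "\<exists>p. P c p"
    proof (rule pole_order_linear)
      fix d n0
      assume "0 < d" "ball c d \<subseteq> ball 0 r2" "\<And>x. x \<in> Roots \<Longrightarrow> x \<in> ball c d \<Longrightarrow> x = c"
       "\<And>m. \<exists>g. g holomorphic_on ball c d \<and>
         (\<forall>x\<in>ball c d. (x - c) ^ (n0 * (m + 1)) * HH m x = poly (QQ m) x * g x)"
      then show ?thesis unfolding P_def by (intro exI[of _ "(d, n0)"]) simp
    qed
  qed
  from bchoice[OF this] obtain pp where pp: "\<And>c. c \<in> \<Lambda> \<Longrightarrow> P c (pp c)" by blast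
  \<comment> \<open>The summand \<open>1\<close> makes the exponent positive, so that
    \<open>W\<close> vanishes at every point of \<open>\<Lambda>\<close>.\<close>
  define n0 where "n0 = (\<Sum>c\<in>\<Lambda>. snd (pp c)) + 1"
  have n0: "snd (pp c) \<le> n0" if "c \<in> \<Lambda>" for c
  proof -
    have "snd (pp c) \<le> (\<Sum>c\<in>\<Lambda>. snd (pp c))" by (rule member_le_sum[OF that]) (use fin in auto)
    then show ?thesis by (simp add: n0_def)
  qed
  define W where "W x = (\<Prod>c\<in>\<Lambda>. x - c) ^ n0" for x
  define f where "f n x = W x ^ (n + 1) * HH n x / poly (QQ n) x" for n x
  have Qnz: "poly (QQ n) x \<noteq> 0" if "x \<in> ball 0 r2 - \<Lambda>" for n x using QQ_HH(2) Rb that by blast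
  have oB: "open (ball 0 r2 - \<Lambda>)" using fin by (simp add: finite_imp_closed open_Diff)
  have fhol: "f n holomorphic_on ball 0 r2 - \<Lambda>" for n
    unfolding f_def W_def using Qnz
    by (intro holomorphic_intros holomorphic_on_subset[OF QQ_HH(3)]) auto
  have fan: "f n analytic_on {x}" if "x \<in> ball 0 r2 - \<Lambda>" for n x
    using fhol oB that analytic_at by blast
  have an: "remove_sings (f n) analytic_on {x}" if x: "x \<in> ball 0 r2" for n x
  proof (cases "x \<in> \<Lambda>")
    case False
    have "remove_sings (f n) holomorphic_on ball 0 r2 - \<Lambda>"
      by (rule holomorphic_transform[OF fhol[of n]]) (use fan[of _ n] in auto)
    then show ?thesis using oB x False analytic_at by blast
  next
    case True
    have PP: "P x (pp x)" by (rule pp[OF True])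
    then obtain g where g: "g holomorphic_on ball x (fst (pp x))"
      "\<And>y. y \<in> ball x (fst (pp x)) \<Longrightarrow> (y - x) ^ (snd (pp x) * (n + 1)) * HH n y = poly (QQ n) y * g y"
      unfolding P_def by blast
    have d: "0 < fst (pp x)" "ball x (fst (pp x)) \<subseteq> ball 0 r2" "\<And>y. y \<in> Roots \<Longrightarrow> y \<in> ball x (fst (pp x)) \<Longrightarrow> y = x"
      using PP unfolding P_def by blast+
    define k where "k = snd (pp x) * (n + 1)"
    define V where "V y = (\<Prod>c\<in>\<Lambda> - {x}. y - c) ^ (n0 * (n + 1)) * (y - x) ^ (n0 * (n + 1) - k)" for y
    have k: "k \<le> n0 * (n + 1)" unfolding k_def by (rule mult_le_mono1[OF n0[OF True]])
    have WV: "W y ^ (n + 1) = V y * (y - x) ^ k" for y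
    proof -
      have "W y ^ (n + 1) = (\<Prod>c\<in>\<Lambda>. y - c) ^ (n0 * (n + 1))" unfolding W_def by (simp only: power_mult)
      also have "(\<Prod>c\<in>\<Lambda>. y - c) = (y - x) * (\<Prod>c\<in>\<Lambda> - {x}. y - c)" using fin True by (rule prod.remove)
      also have "\<dots> ^ (n0 * (n + 1)) = (\<Prod>c\<in>\<Lambda> - {x}. y - c) ^ (n0 * (n + 1)) * (y - x) ^ (n0 * (n + 1))"
        by (simp add: power_mult_distrib mult.commute)
      also have "(y - x) ^ (n0 * (n + 1)) = (y - x) ^ (n0 * (n + 1) - k) * (y - x) ^ k" using k by (simp flip: power_add)
      finally show ?thesis by (simp add: V_def)
    qed
    have "\<forall>\<^sub>F y in at x. y \<in> ball x (fst (pp x)) - {x}" using d by (intro eventually_at_in_open) auto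
    then have ev: "\<forall>\<^sub>F y in at x. V y * g y = f n y"
    proof eventually_elim
      case (elim y)
      then have "poly (QQ n) y \<noteq> 0" using QQ_HH(2) d(3) by blast
      moreover have "(y - x) ^ k * HH n y = poly (QQ n) y * g y" using g(2) elim by (simp add: k_def)
      moreover have "f n y = V y * ((y - x) ^ k * HH n y) / poly (QQ n) y" unfolding f_def WV by simp
      ultimately show ?case by simp
    qed
    have "isCont g x" using g(1) d(1)
      by (metis centre_in_ball continuous_on_eq_continuous_at holomorphic_on_imp_continuous_on open_ball)
    then have "(\<lambda>y. V y * g y) \<midarrow>x\<rightarrow> V x * g x" unfolding V_def isCont_def by (intro tendsto_intros)
    then have lim: "f n \<midarrow>x\<rightarrow> V x * g x" by (rule Lim_transform_eventually[OF _ ev])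
    have "isolated_singularity_at (f n) x"
    proof -
      have "f n holomorphic_on ball x (fst (pp x)) - {x}"
      proof (rule holomorphic_on_subset[OF fhol])
        show "ball x (fst (pp x)) - {x} \<subseteq> ball 0 r2 - \<Lambda>" using d by (auto simp: \<Lambda>_def)
      qed
      then show ?thesis unfolding isolated_singularity_at_def using d(1)
        by (intro exI[of _ "fst (pp x)"]) (simp add: analytic_on_open open_delete)
    qed
    then show ?thesis using lim by (rule remove_sings_analytic_at)
  qed
  show ?thesis
  proof (rule that[of \<Lambda> n0 "\<lambda>n. remove_sings (f n)"])
    show "remove_sings (f n) holomorphic_on ball 0 r2" for n
      using an by (meson analytic_on_analytic_at analytic_imp_holomorphic)
    fix n x assume x: "x \<in> Ann"
    then have "x \<in> ball 0 r2 - \<Lambda>" by (auto simp: Ann_def \<Lambda>_def)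
    then show "remove_sings (f n) x = ((\<Prod>c\<in>\<Lambda>. x - c) ^ n0) ^ (n + 1) * A n x"
      using fan[of x n] Qnz[of x n] QQ_HH(4)[OF x, of n] by (simp add: f_def W_def)
  qed (use fin in \<open>auto simp: \<Lambda>_def n0_def\<close>)
qed

end

lemma open_prod_contains_polydisc:
  fixes x y :: complex
  assumes "open S" "(x, y) \<in> S"
  obtains s c where "0 < s" "0 < c" "ball x s \<times> ball y c \<subseteq> S"
proof -
  obtain A B where AB: "open A" "open B" "(x, y) \<in> A \<times> B" "A \<times> B \<subseteq> S"
    using open_prod_elim[OF assms] .
  obtain s where s: "0 < s" "ball x s \<subseteq> A" using AB open_contains_ball by (metis SigmaD1)
  obtain c where c: "0 < c" "ball y c \<subseteq> B" using AB open_contains_ball by (metis SigmaD2)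
  show ?thesis using that[OF s(1) c(1)] s c AB by blast
qed

section \<open>Extension along the test sequence\<close>

text \<open>In the coordinate \<open>z = y - \<phi>0 x\<close> the function \<open>f\<close> is \<open>g / (z ^ d * h)\<close> near \<open>(x0, 0)\<close>,
  where \<open>h\<close> does not vanish at \<open>(x, 0)\<close> for \<open>x \<noteq> x0\<close>.\<close>

definition polar_form ::
  "(complex \<times> complex \<Rightarrow> complex) \<Rightarrow> (complex \<Rightarrow> complex) \<Rightarrow> complex set \<Rightarrow> complex \<Rightarrow> real \<Rightarrow> real \<Rightarrow> nat \<Rightarrow>
   (complex \<times> complex \<Rightarrow> complex) \<Rightarrow> (complex \<times> complex \<Rightarrow> complex) \<Rightarrow> bool" where
  "polar_form f \<phi>0 S x0 s c d g h \<longleftrightarrow> 0 < s \<and> 0 < c \<and> ball x0 s \<subseteq> S \<and>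
     holomorphic2_on g (ball x0 s \<times> ball 0 c) \<and> holomorphic2_on h (ball x0 s \<times> ball 0 c) \<and>
     (\<forall>x\<in>ball x0 s - {x0}. h (x, 0) \<noteq> 0) \<and>
     (\<forall>x\<in>ball x0 s. \<forall>z\<in>ball 0 c. z ^ d * h (x, z) \<noteq> 0 \<longrightarrow> f (x, \<phi>0 x + z) * (z ^ d * h (x, z)) = g (x, z))"

lemma polar_form_exists:
  assumes f: "meromorphic2_on f R" and \<phi>0: "\<phi>0 holomorphic_on S" and S: "open S"
    and x0: "x0 \<in> S" "(x0, \<phi>0 x0) \<in> R"
  obtains s c d g h where "polar_form f \<phi>0 S x0 s c d g h"
proof -
  obtain W g0 h0 where W: "connected W" "(x0, \<phi>0 x0) \<in> W" "W \<subseteq> R" and g0: "holomorphic2_on g0 W"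
    and h0: "holomorphic2_on h0 W" and nz: "\<exists>w\<in>W. h0 w \<noteq> 0" and eq: "\<And>w. w \<in> W \<Longrightarrow> h0 w \<noteq> 0 \<Longrightarrow> f w = g0 w / h0 w"
    using f x0(2) unfolding meromorphic2_on_def by meson
  have oW: "open W" using g0 by (simp add: holomorphic2_on_def)
  have shol: "holomorphic2_on (\<lambda>q. \<phi>0 (fst q) + snd q) (S \<times> UNIV)"
    using \<phi>0 S by (intro holomorphic2_on_add holomorphic2_on_fst_comp[of \<phi>0 S]) (auto simp: open_Times)
  define T where "T = {q \<in> S \<times> UNIV. (fst q, \<phi>0 (fst q) + snd q) \<in> W}"
  have cont: "continuous_on (S \<times> UNIV) (\<lambda>q. (fst q, \<phi>0 (fst q) + snd q))"
    by (intro continuous_intros holomorphic2_on_imp_continuous_on[OF shol] continuous_on_fst continuous_on_id)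
  have "T = (S \<times> UNIV) \<inter> (\<lambda>q. (fst q, \<phi>0 (fst q) + snd q)) -` W" by (auto simp: T_def)
  then have oT: "open T" using continuous_open_preimage[OF cont _ oW] S by (simp add: open_Times)
  have "(x0, 0) \<in> T" using x0 W by (simp add: T_def)
  then obtain s c where sc: "0 < s" "0 < c" "ball x0 s \<times> ball 0 c \<subseteq> T"
    by (rule open_prod_contains_polydisc[OF oT])
  let ?P = "ball x0 s \<times> ball (0::complex) c"
  have PS: "ball x0 s \<subseteq> S"
  proof
    fix x assume "x \<in> ball x0 s"
    then have "(x, 0) \<in> ball x0 s \<times> ball (0::complex) c" using sc(2) by simp
    then have "(x, 0) \<in> T" using sc(3) by blast
    then show "x \<in> S" by (simp add: T_def)
  qed
  have oP: "open ?P" by (simp add: open_Times)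
  have inW: "(fst q, \<phi>0 (fst q) + snd q) \<in> W" if "q \<in> ?P" for q using sc that by (auto simp: T_def)
  have sP: "holomorphic2_on (\<lambda>q. \<phi>0 (fst q) + snd q) ?P"
    by (rule holomorphic2_on_subset[OF shol oP]) (use PS in auto)
  have g: "holomorphic2_on (\<lambda>q. g0 (fst q, \<phi>0 (fst q) + snd q)) ?P"
    by (rule holomorphic2_on_compose[OF g0 holomorphic2_on_fst[OF oP] sP inW])
  have h: "holomorphic2_on (\<lambda>q. h0 (fst q, \<phi>0 (fst q) + snd q)) ?P"
    by (rule holomorphic2_on_compose[OF h0 holomorphic2_on_fst[OF oP] sP inW])
  \<comment> \<open>The sheared polydisk contains an open piece of \<open>W\<close> around the point
    of the limit graph, and the nonzero set of \<open>h0\<close> is dense in the connected set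
    \<open>W\<close>.\<close>
  have nzq: "\<exists>q\<in>?P. h0 (fst q, \<phi>0 (fst q) + snd q) \<noteq> 0"
  proof -
    define V where "V = {p \<in> ball x0 s \<times> UNIV. snd p - \<phi>0 (fst p) \<in> ball 0 c}"
    have "continuous_on (ball x0 s \<times> UNIV) (\<lambda>p. snd p - \<phi>0 (fst p))"
      by (intro continuous_intros continuous_on_compose2[OF holomorphic_on_imp_continuous_on[OF \<phi>0]])
        (use PS in auto)
    then have "open ((ball x0 s \<times> UNIV) \<inter> (\<lambda>p. snd p - \<phi>0 (fst p)) -` ball 0 c)"
      by (rule continuous_open_preimage) (simp_all add: open_Times)
    moreover have "(ball x0 s \<times> UNIV) \<inter> (\<lambda>p. snd p - \<phi>0 (fst p)) -` ball 0 c = V" by (auto simp: V_def)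
    ultimately have "open V" by simp
    moreover have "(x0, \<phi>0 x0) \<in> V \<inter> W" using W sc by (simp add: V_def)
    ultimately obtain p where p: "p \<in> V \<inter> W" "h0 p \<noteq> 0"
      using holomorphic2_on_nonzero_dense[OF h0 W(1) nz, of V] by blast
    have "(fst p, snd p - \<phi>0 (fst p)) \<in> ?P" using p by (cases p) (auto simp: V_def)
    then show ?thesis using p(2) by (intro bexI[of _ "(fst p, snd p - \<phi>0 (fst p))"]) simp
  qed
  show ?thesis
  proof (rule holomorphic2_on_factor_snd[OF h sc(1,2) nzq])
    fix d s' c' h'
    assume h': "0 < s'" "s' \<le> s" "0 < c'" "c' \<le> c" "holomorphic2_on h' (ball x0 s' \<times> ball 0 c')"
      and he: "\<And>x z. x \<in> ball x0 s' \<Longrightarrow> z \<in> ball 0 c' \<Longrightarrow>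
        h0 (fst (x, z), \<phi>0 (fst (x, z)) + snd (x, z)) = z ^ d * h' (x, z)"
      and hz: "\<And>x. x \<in> ball x0 s' - {x0} \<Longrightarrow> h' (x, 0) \<noteq> 0"
    have "polar_form f \<phi>0 S x0 s' c' d (\<lambda>q. g0 (fst q, \<phi>0 (fst q) + snd q)) h'"
      unfolding polar_form_def
    proof (intro conjI ballI impI)
      show "holomorphic2_on (\<lambda>q. g0 (fst q, \<phi>0 (fst q) + snd q)) (ball x0 s' \<times> ball 0 c')"
        by (rule holomorphic2_on_subset[OF g]) (use h' in \<open>auto simp: open_Times\<close>)
      fix x z assume xz: "x \<in> ball x0 s'" "z \<in> ball 0 c'" "z ^ d * h' (x, z) \<noteq> 0"
      then have "(x, \<phi>0 x + z) \<in> W" using inW[of "(x, z)"] h' by auto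
      then show "f (x, \<phi>0 x + z) * (z ^ d * h' (x, z)) = g0 (fst (x, z), \<phi>0 (fst (x, z)) + snd (x, z))"
        using eq[of "(x, \<phi>0 x + z)"] he[OF xz(1,2)] xz(3) by auto
    qed (use h' hz PS in auto)
    then show ?thesis by (rule that)
  qed
qed

section \<open>Regular points and the Laurent expansion along the limit graph\<close>

definition polar_regular where
  "polar_regular f \<phi>0 S x \<longleftrightarrow> (\<exists>s c d g h. polar_form f \<phi>0 S x s c d g h \<and> h (x, 0) \<noteq> 0)"

lemma polar_regular_punctured:
  assumes pf: "polar_form f \<phi>0 S x0 s c d g h" and x: "x \<in> ball x0 s - {x0}"
  shows "polar_regular f \<phi>0 S x"
proof -
  obtain s' where s': "0 < s'" "ball x s' \<subseteq> ball x0 s - {x0}"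
    using x open_delete[OF open_ball, of x0 s x0] open_contains_ball by blast
  then have "polar_form f \<phi>0 S x s' c d g h"
    using pf unfolding polar_form_def
    by (auto intro!: holomorphic2_on_subset[of _ "ball x0 s \<times> ball 0 c"] open_Times)
  then show ?thesis using pf x unfolding polar_regular_def polar_form_def by blast
qed

text \<open>Around each point of \<open>K\<close> at most the centre of the disk is irregular, so
  finitely many disks covering \<open>K\<close> leave finitely many irregular points.\<close>

lemma finite_polar_irregular:
  assumes K: "compact K" and ex: "\<And>x. x \<in> K \<Longrightarrow> \<exists>s c d g h. polar_form f \<phi>0 S x s c d g h"
  shows "finite {x \<in> K. \<not> polar_regular f \<phi>0 S x}"
proof -
  have "\<forall>x\<in>K. \<exists>s. \<exists>c d g h. polar_form f \<phi>0 S x s c d g h" using ex by blast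
  from bchoice[OF this] obtain s where s: "\<forall>x\<in>K. \<exists>c d g h. polar_form f \<phi>0 S x (s x) c d g h" by blast
  have "K \<subseteq> (\<Union>x\<in>K. ball x (s x))"
  proof
    fix x assume x: "x \<in> K"
    then have "0 < s x" using s unfolding polar_form_def by blast
    then have "x \<in> ball x (s x)" by simp
    then show "x \<in> (\<Union>x\<in>K. ball x (s x))" using x by blast
  qed
  from compactE_image[OF K _ this] obtain C where C: "C \<subseteq> K" "finite C" "K \<subseteq> (\<Union>x\<in>C. ball x (s x))" by auto
  have "{x \<in> K. \<not> polar_regular f \<phi>0 S x} \<subseteq> C"
  proof
    fix x assume x: "x \<in> {x \<in> K. \<not> polar_regular f \<phi>0 S x}"
    then obtain y where y: "y \<in> C" "x \<in> ball y (s y)" using C by blast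
    then obtain c d g h where pf: "polar_form f \<phi>0 S y (s y) c d g h" using s C(1) by blast
    have "x = y" using polar_regular_punctured[OF pf, of x] y(2) x by auto
    then show "x \<in> C" using y(1) by simp
  qed
  then show ?thesis using C(2) finite_subset by blast
qed

lemma interval_avoiding_finite:
  assumes "finite (F :: real set)" "t1 < t2"
  obtains r1 r2 where "t1 < r1" "r1 < r2" "r2 < t2" "{r1..r2} \<inter> F = {}"
proof -
  have "infinite {t1<..<t2}" using assms(2) by simp
  then obtain t where t: "t \<in> {t1<..<t2}" "t \<notin> F" using assms(1) by (metis finite_subset subsetI)
  have "open ({t1<..<t2} - F)" using assms(1) by (simp add: finite_imp_closed open_Diff)
  then obtain e where e: "e > 0" "cball t e \<subseteq> {t1<..<t2} - F" using t open_contains_cball by (metis DiffI)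
  have "t - e \<in> cball t e" "t + e \<in> cball t e" using e(1) by (auto simp: dist_real_def)
  then have "t1 < t - e" "t + e < t2" using e(2) by (auto simp: subset_iff)
  moreover have "{t - e..t + e} \<inter> F = {}" using e(2) by (auto simp: dist_real_def subset_iff)
  ultimately show ?thesis using e(1) by (intro that[of "t - e" "t + e"]) auto
qed

text \<open>At regular points the local denominator is a power of \<open>z\<close> times a unit. By
  compactness one power \<open>z ^ D\<close> and one radius suffice over all of \<open>K\<close>;
  the product extends holomorphically over \<open>z = 0\<close> and is expanded there.\<close>

lemma polar_regular_expansion:
  assumes K: "compact K" "K \<noteq> {}" and reg: "\<And>x. x \<in> K \<Longrightarrow> polar_regular f \<phi>0 S x"
  obtains T D A M C where "open T" "K \<subseteq> T" "T \<subseteq> S" "\<And>n. A n holomorphic_on T" "0 < (C::real)"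
    "\<And>n x. x \<in> K \<Longrightarrow> norm (A n x) \<le> M * C ^ n"
    "\<And>x z. x \<in> T \<Longrightarrow> z \<noteq> 0 \<Longrightarrow> C * norm z < 1 \<Longrightarrow> (\<lambda>n. A n x * z ^ n) sums (z ^ D * f (x, \<phi>0 x + z))"
    "holomorphic2_on (\<lambda>q. f (fst q, \<phi>0 (fst q) + snd q)) {q. fst q \<in> T \<and> snd q \<noteq> 0 \<and> C * norm (snd q) < 1}"
proof -
  have ex: "\<exists>s c d G. 0 < s \<and> 0 < c \<and> ball x s \<subseteq> S \<and> holomorphic2_on G (ball x s \<times> ball 0 c) \<and>
    (\<forall>y\<in>ball x s. \<forall>z\<in>ball 0 c. z \<noteq> 0 \<longrightarrow> f (y, \<phi>0 y + z) * z ^ d = G (y, z))" if xK: "x \<in> K" for x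
  proof -
    obtain s c d g h where pf: "polar_form f \<phi>0 S x s c d g h" and hx: "h (x, 0) \<noteq> 0"
      using reg[OF xK] unfolding polar_regular_def by blast
    note pf = pf[unfolded polar_form_def]
    let ?P = "ball x s \<times> ball (0::complex) c"
    have "open (?P \<inter> h -` (- {0}))"
      by (rule continuous_open_preimage[OF holomorphic2_on_imp_continuous_on]) (use pf in \<open>auto simp: open_Times\<close>)
    moreover have "?P \<inter> h -` (- {0}) = {q \<in> ?P. h q \<noteq> 0}" by auto
    ultimately have "open {q \<in> ?P. h q \<noteq> 0}" by simp
    moreover have "(x, 0) \<in> {q \<in> ?P. h q \<noteq> 0}" using pf hx by simp
    ultimately obtain s' c' where sc: "0 < s'" "0 < c'" "ball x s' \<times> ball 0 c' \<subseteq> {q \<in> ?P. h q \<noteq> 0}"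
      by (rule open_prod_contains_polydisc)
    have hol: "holomorphic2_on (\<lambda>q. g q / h q) (ball x s' \<times> ball 0 c')"
      using pf sc by (intro holomorphic2_on_divide) (auto intro!: holomorphic2_on_subset[of _ ?P] open_Times)
    have "ball x s' \<subseteq> ball x s"
    proof
      fix y assume "y \<in> ball x s'"
      then have "(y, 0) \<in> ball x s' \<times> ball (0::complex) c'" using sc by simp
      then show "y \<in> ball x s" using sc(3) by blast
    qed
    moreover have "f (y, \<phi>0 y + z) * z ^ d = g (y, z) / h (y, z)"
      if "y \<in> ball x s'" "z \<in> ball 0 c'" "z \<noteq> 0" for y z
    proof -
      have yz: "y \<in> ball x s" "z \<in> ball 0 c" "h (y, z) \<noteq> 0" using sc(3) that by blast+
      then have "f (y, \<phi>0 y + z) * (z ^ d * h (y, z)) = g (y, z)" using pf that(3) by simp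
      then show ?thesis using yz(3) by (simp add: field_simps)
    qed
    ultimately show ?thesis using sc(1,2) hol pf
      by (intro exI[of _ s'] exI[of _ c'] exI[of _ d] exI[of _ "\<lambda>q. g q / h q"]) auto
  qed
  define Pr where "Pr x p \<longleftrightarrow> (case p of (s, c, d, G) \<Rightarrow> 0 < s \<and> 0 < c \<and> ball x s \<subseteq> S \<and> holomorphic2_on G (ball x s \<times> ball 0 c) \<and>
    (\<forall>y\<in>ball x s. \<forall>z\<in>ball 0 c. z \<noteq> 0 \<longrightarrow> f (y, \<phi>0 y + z) * z ^ d = G (y, z)))"
    for x and p :: "real \<times> real \<times> nat \<times> (complex \<times> complex \<Rightarrow> complex)"
  have "\<forall>x\<in>K. \<exists>p. Pr x p"
  proof
    fix x assume "x \<in> K"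
    from ex[OF this] show "\<exists>p. Pr x p"
      by (elim exE) (rule_tac x = "(s, c, d, G)" in exI, simp add: Pr_def)
  qed
  from bchoice[OF this] obtain pr where pr: "\<And>x. x \<in> K \<Longrightarrow> Pr x (pr x)" by blast
  define s c d G where "s x = fst (pr x)" and "c x = fst (snd (pr x))" and "d x = fst (snd (snd (pr x)))"
    and "G x = snd (snd (snd (pr x)))" for x
  have P: "0 < s x" "0 < c x" "ball x (s x) \<subseteq> S" "holomorphic2_on (G x) (ball x (s x) \<times> ball 0 (c x))"
    "\<And>y z. y \<in> ball x (s x) \<Longrightarrow> z \<in> ball 0 (c x) \<Longrightarrow> z \<noteq> 0 \<Longrightarrow> f (y, \<phi>0 y + z) * z ^ d x = G x (y, z)"
    if "x \<in> K" for x
    using pr[OF that] unfolding Pr_def s_def c_def d_def G_def by (auto split: prod.splits)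
  have "K \<subseteq> (\<Union>x\<in>K. ball x (s x))" using P(1) by force
  from compactE_image[OF K(1) _ this] obtain I where I: "I \<subseteq> K" "finite I" "K \<subseteq> (\<Union>x\<in>I. ball x (s x))" by auto
  have Ine: "I \<noteq> {}" using I(3) K(2) by auto
  define T where "T = (\<Union>x\<in>I. ball x (s x))"
  define D where "D = Max (d ` I)"
  define c0 where "c0 = Min (c ` I)"
  have c0: "0 < c0" "\<And>x. x \<in> I \<Longrightarrow> c0 \<le> c x" using I Ine P(2) by (auto simp: c0_def)
  have D: "d x \<le> D" if "x \<in> I" for x using I that by (simp add: D_def)
  have oT: "open T" "K \<subseteq> T" "T \<subseteq> S" using I P(3) by (auto simp: T_def)
  \<comment> \<open>The value at \<open>z = 0\<close> is defined as a limit and not through a local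
    representation, so that the local representations agree automatically.\<close>
  define F where "F q = (if snd q \<noteq> 0 then snd q ^ D * f (fst q, \<phi>0 (fst q) + snd q)
     else Lim (at 0) (\<lambda>z. z ^ D * f (fst q, \<phi>0 (fst q) + z)))" for q
  have loc: "F q = snd q ^ (D - d x) * G x q" if x: "x \<in> I" and q: "q \<in> ball x (s x) \<times> ball 0 c0" for x q
  proof -
    have xK: "x \<in> K" using x I by blast
    have q': "fst q \<in> ball x (s x)" "snd q \<in> ball 0 c0" using q by auto
    have nz: "z ^ D * f (fst q, \<phi>0 (fst q) + z) = z ^ (D - d x) * G x (fst q, z)"
      if "z \<in> ball 0 c0" "z \<noteq> 0" for z :: complex
    proof -
      have "f (fst q, \<phi>0 (fst q) + z) * z ^ d x = G x (fst q, z)"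
        using P(5)[OF xK q'(1), of z] that c0(2)[OF x] by auto
      moreover have "z ^ D = z ^ (D - d x) * z ^ d x" using D[OF x] by (simp flip: power_add)
      ultimately show ?thesis by (simp add: mult_ac)
    qed
    show ?thesis
    proof (cases "snd q = 0")
      case False
      then show ?thesis using nz[OF q'(2)] by (simp add: F_def)
    next
      case True
      have "(\<lambda>z. z ^ (D - d x) * G x (fst q, z)) holomorphic_on ball 0 c0"
      proof (rule holomorphic_on_mult)
        show "(\<lambda>z. G x (fst q, z)) holomorphic_on ball 0 c0"
        proof (rule holomorphic2_on_curve[OF P(4)[OF xK], where u = "\<lambda>_. fst q" and v = "\<lambda>z. z"])
          show "(fst q, z) \<in> ball x (s x) \<times> ball 0 (c x)" if "z \<in> ball 0 c0" for z :: complex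
            using that q'(1) less_le_trans[OF _ c0(2)[OF x], of "norm z"] by simp
        qed (auto intro: holomorphic_intros)
      qed (intro holomorphic_intros)
      then have "continuous_on (ball 0 c0) (\<lambda>z. z ^ (D - d x) * G x (fst q, z))"
        by (rule holomorphic_on_imp_continuous_on)
      then have "isCont (\<lambda>z. z ^ (D - d x) * G x (fst q, z)) 0"
        unfolding continuous_on_eq_continuous_at[OF open_ball] using c0(1) by simp
      then have lim: "(\<lambda>z. z ^ (D - d x) * G x (fst q, z)) \<midarrow>0\<rightarrow> 0 ^ (D - d x) * G x (fst q, 0)"
        by (simp add: isCont_def)
      have "\<forall>\<^sub>F z in at 0. z \<in> ball 0 c0 - {0}" using c0(1) by (intro eventually_at_in_open) auto
      then have ev: "\<forall>\<^sub>F z in at 0. z ^ (D - d x) * G x (fst q, z) = z ^ D * f (fst q, \<phi>0 (fst q) + z)"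
        by eventually_elim (simp add: nz)
      have "(\<lambda>z. z ^ D * f (fst q, \<phi>0 (fst q) + z)) \<midarrow>0\<rightarrow> 0 ^ (D - d x) * G x (fst q, 0)"
        by (rule Lim_transform_eventually[OF lim ev])
      then have "F q = 0 ^ (D - d x) * G x (fst q, 0)" using True by (simp add: F_def tendsto_Lim)
      moreover have "(fst q, 0) = q" using True by (metis prod.collapse)
      ultimately show ?thesis using True by simp
    qed
  qed
  have Fhol: "holomorphic2_on F (T \<times> ball 0 c0)"
  proof (rule holomorphic2_on_local)
    fix q :: "complex \<times> complex" assume "q \<in> T \<times> ball 0 c0"
    then obtain x where x: "x \<in> I" "q \<in> ball x (s x) \<times> ball 0 c0" by (auto simp: T_def)
    have o: "open (ball x (s x) \<times> ball (0::complex) c0)" by (simp add: open_Times)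
    have "holomorphic2_on (G x) (ball x (s x) \<times> ball 0 c0)"
      by (rule holomorphic2_on_subset[OF P(4) o]) (use x(1) I(1) less_le_trans[OF _ c0(2)[OF x(1)]] in auto)
    then have "holomorphic2_on (\<lambda>q. snd q ^ (D - d x) * G x q) (ball x (s x) \<times> ball 0 c0)"
      using o by (intro holomorphic2_intros)
    then have "holomorphic2_on F (ball x (s x) \<times> ball 0 c0)"
      by (rule holomorphic2_on_cong) (use loc[OF x(1)] in auto)
    then show "\<exists>V. q \<in> V \<and> V \<subseteq> T \<times> ball 0 c0 \<and> holomorphic2_on F V"
      using x by (intro exI[of _ "ball x (s x) \<times> ball 0 c0"]) (auto simp: T_def)
  qed
  have c2: "0 < c0/2" "c0/2 < c0" using c0(1) by auto
  obtain A M where A: "\<And>n. A n holomorphic_on T"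
    "\<And>x z. x \<in> T \<Longrightarrow> z \<in> ball 0 c0 \<Longrightarrow> (\<lambda>n. A n x * z ^ n) sums F (x, z)"
    "\<And>n x. x \<in> K \<Longrightarrow> norm (A n x) \<le> M * (1 / (c0/2)) ^ n"
    by (rule holomorphic2_on_taylor[OF Fhol oT(1) c2 K(1) oT(2)], rule that)
  have zc: "z \<in> ball 0 c0" if "1 / (c0/2) * norm z < 1" for z :: complex using that c0(1) by (simp add: field_simps)
  have oQ: "open {q :: complex \<times> complex. fst q \<in> T \<and> snd q \<noteq> 0 \<and> 1 / (c0/2) * norm (snd q) < 1}"
  proof -
    have "{q :: complex \<times> complex. fst q \<in> T \<and> snd q \<noteq> 0 \<and> 1 / (c0/2) * norm (snd q) < 1} = T \<times> (ball 0 (c0/2) - {0})"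
      using c0(1) by (auto simp: field_simps)
    then show ?thesis using oT by (simp add: open_Times open_delete)
  qed
  show ?thesis
  proof (rule that[OF oT A(1) _ A(3)])
    show "0 < 1 / (c0/2)" using c0(1) by simp
    show "(\<lambda>n. A n x * z ^ n) sums (z ^ D * f (x, \<phi>0 x + z))"
      if "x \<in> T" "z \<noteq> 0" "1 / (c0/2) * norm z < 1" for x z
      using A(2)[OF that(1) zc[OF that(3)]] that(2) by (simp add: F_def)
    have "holomorphic2_on (\<lambda>q. F q / snd q ^ D) {q. fst q \<in> T \<and> snd q \<noteq> 0 \<and> 1 / (c0/2) * norm (snd q) < 1}"
      using oQ zc by (intro holomorphic2_intros holomorphic2_on_subset[OF Fhol]) auto
    then show "holomorphic2_on (\<lambda>q. f (fst q, \<phi>0 (fst q) + snd q)) {q. fst q \<in> T \<and> snd q \<noteq> 0 \<and> 1 / (c0/2) * norm (snd q) < 1}"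
      by (rule holomorphic2_on_cong) (auto simp: F_def)
  qed
qed

section \<open>Subsequences with convergent zeros and poles\<close>

lemma simultaneous_convergent_subsequence:
  fixes x :: "nat \<Rightarrow> nat \<Rightarrow> complex"
  assumes "\<And>i k. i < n \<Longrightarrow> norm (x k i) \<le> R"
  obtains \<sigma> x' where "strict_mono (\<sigma> :: nat \<Rightarrow> nat)" "\<And>i. i < n \<Longrightarrow> (\<lambda>k. x (\<sigma> k) i) \<longlonglongrightarrow> x' i"
proof -
  have "\<exists>\<sigma> x'. strict_mono (\<sigma> :: nat \<Rightarrow> nat) \<and> (\<forall>i<n. (\<lambda>k. x (\<sigma> k) i) \<longlonglongrightarrow> x' i)"
    using assms
  proof (induction n)
    case 0
    show ?case by (rule exI[of _ id]) (simp add: strict_mono_def)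
  next
    case (Suc n)
    then obtain \<sigma> x' where IH: "strict_mono (\<sigma> :: nat \<Rightarrow> nat)" "\<And>i. i < n \<Longrightarrow> (\<lambda>k. x (\<sigma> k) i) \<longlonglongrightarrow> x' i"
      by (metis less_SucI)
    have "bounded (range (\<lambda>k. x (\<sigma> k) n))" using Suc.prems[of n] unfolding bounded_iff by auto
    then obtain y \<tau> where \<tau>: "strict_mono (\<tau> :: nat \<Rightarrow> nat)" "((\<lambda>k. x (\<sigma> k) n) \<circ> \<tau>) \<longlonglongrightarrow> y"
      using bounded_imp_convergent_subsequence by blast
    show ?case
    proof (intro exI[of _ "\<sigma> \<circ> \<tau>"] exI[of _ "x'(n := y)"] conjI allI impI)
      show "strict_mono (\<sigma> \<circ> \<tau>)" using IH(1) \<tau>(1) by (rule strict_mono_o)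
      fix i assume "i < Suc n"
      show "(\<lambda>k. x ((\<sigma> \<circ> \<tau>) k) i) \<longlonglongrightarrow> (x'(n := y)) i"
      proof (cases "i = n")
        case True
        then show ?thesis using \<tau>(2) by (simp add: o_def)
      next
        case False
        then have "i < n" using \<open>i < Suc n\<close> by simp
        from LIMSEQ_subseq_LIMSEQ[OF IH(2)[OF this] \<tau>(1)] show ?thesis using False by (simp add: o_def)
      qed
    qed
  qed
  then show ?thesis using that by blast
qed

lemma infinitely_often_constant:
  fixes l :: "nat \<Rightarrow> nat"
  assumes "\<And>k. l k \<le> L"
  obtains \<sigma> l0 where "strict_mono (\<sigma> :: nat \<Rightarrow> nat)" "\<And>k. l (\<sigma> k) = l0"
proof -
  have "finite (range l)" using assms by (meson finite_atMost finite_subset image_subsetI atMost_iff)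
  then obtain l0 where "infinite {k. l k = l0}"
    using pigeonhole_infinite[of UNIV l] by auto
  from infinite_enumerate[OF this] show ?thesis using that by auto
qed

text \<open>The number of zeros of \<open>\<phi> k - \<phi>0\<close> in the unit disk is its winding number along the unit circle.\<close>

lemma test_sequence_factor:
  assumes ts: "test_sequence \<epsilon> \<phi> \<phi>0" and \<epsilon>: "0 < \<epsilon>"
  obtains L k0 where "\<And>k. k0 \<le> k \<Longrightarrow> \<exists>l a e. l \<le> (L::nat) \<and> (\<forall>i<l. norm (a i) < 1) \<and> e holomorphic_on ball 0 (1 + \<epsilon>) \<and>
    (\<forall>x\<in>cball 0 1. e x \<noteq> 0) \<and> (\<forall>x\<in>ball 0 (1 + \<epsilon>). \<phi> k x - \<phi>0 x = (\<Prod>i<l. x - a i) * e x)"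
proof -
  have hol: "\<phi> k holomorphic_on ball 0 (1 + \<epsilon>)" if "k \<ge> 1" for k using ts that by (simp add: test_sequence_def)
  have hol0: "\<phi>0 holomorphic_on ball 0 (1 + \<epsilon>)" using ts by (simp add: test_sequence_def)
  obtain B where B: "\<forall>\<^sub>F k in sequentially. norm (winding_number ((\<lambda>\<zeta>. \<phi> k \<zeta> - \<phi>0 \<zeta>) \<circ> circlepath 0 1) 0) \<le> B"
    using ts unfolding test_sequence_def by blast
  have nz: "\<forall>\<^sub>F k in sequentially. \<forall>\<zeta>\<in>sphere 0 1. \<phi> k \<zeta> - \<phi>0 \<zeta> \<noteq> 0"
    using ts unfolding test_sequence_def by blast
  obtain k0 where k0: "\<And>k. k \<ge> k0 \<Longrightarrow> norm (winding_number ((\<lambda>\<zeta>. \<phi> k \<zeta> - \<phi>0 \<zeta>) \<circ> circlepath 0 1) 0) \<le> B \<and>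
     (\<forall>\<zeta>\<in>sphere 0 1. \<phi> k \<zeta> - \<phi>0 \<zeta> \<noteq> 0)"
    using eventually_conj[OF B nz] unfolding eventually_sequentially by auto
  have cb: "cball (0::complex) 1 \<subseteq> ball 0 (1 + \<epsilon>)" using \<epsilon> by auto
  show ?thesis
  proof (rule that[of "max 1 k0" "nat \<lfloor>B\<rfloor>"])
    fix k assume k: "max 1 k0 \<le> k"
    define \<delta> where "\<delta> x = \<phi> k x - \<phi>0 x" for x
    have \<delta>h: "\<delta> holomorphic_on ball 0 (1 + \<epsilon>)" unfolding \<delta>_def using k by (intro holomorphic_intros hol hol0) auto
    have \<delta>s: "\<delta> x \<noteq> 0" if "x \<in> sphere 0 1" for x using k0[of k] k that by (auto simp: \<delta>_def)
    have "\<exists>x\<in>ball 0 (1 + \<epsilon>). \<delta> x \<noteq> 0" by (rule bexI[of _ 1]) (use \<delta>s \<epsilon> in auto)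
    from holomorphic_factor_poly[OF \<delta>h open_ball connected_ball compact_cball cb this]
    obtain Q e where Q: "Q \<noteq> 0" "\<And>x. poly Q x = 0 \<Longrightarrow> x \<in> cball 0 1" "e holomorphic_on ball 0 (1 + \<epsilon>)"
      "\<And>x. x \<in> ball 0 (1 + \<epsilon>) \<Longrightarrow> \<delta> x = poly Q x * e x" "\<And>x. x \<in> cball 0 1 \<Longrightarrow> e x \<noteq> 0" by blast
    have Qb: "x \<in> ball 0 1" if "poly Q x = 0" for x
    proof -
      have x: "x \<in> cball 0 1" by (rule Q(2)[OF that])
      then have "\<delta> x = 0" using Q(4)[OF subsetD[OF cb x]] that by simp
      then have "x \<notin> sphere 0 1" using \<delta>s by blast
      then show ?thesis using x by auto
    qed
    have "winding_number (\<delta> \<circ> circlepath 0 1) 0 = of_nat (degree Q)"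
      by (rule winding_number_eq_degree[OF Q(3) open_ball cb _ Q(5) Q(1) Qb Q(4)]) auto
    then have "real (degree Q) \<le> B" using k0[of k] k by (simp add: \<delta>_def[abs_def])
    then have dB: "degree Q \<le> nat \<lfloor>B\<rfloor>" by (simp add: le_nat_floor)
    obtain a where a: "\<And>x. poly Q x = lead_coeff Q * (\<Prod>i<degree Q. x - a i)" using poly_eq_prod_roots by blast
    have an: "norm (a i) < 1" if "i < degree Q" for i
    proof -
      have "poly Q (a i) = 0" using that by (subst a) auto
      then show ?thesis using Qb by fastforce
    qed
    show "\<exists>l a e. l \<le> nat \<lfloor>B\<rfloor> \<and> (\<forall>i<l. norm (a i) < 1) \<and> e holomorphic_on ball 0 (1 + \<epsilon>) \<and>
      (\<forall>x\<in>cball 0 1. e x \<noteq> 0) \<and> (\<forall>x\<in>ball 0 (1 + \<epsilon>). \<phi> k x - \<phi>0 x = (\<Prod>i<l. x - a i) * e x)"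
    proof (intro exI conjI)
      show "(\<lambda>x. lead_coeff Q * e x) holomorphic_on ball 0 (1 + \<epsilon>)" by (intro holomorphic_intros Q)
      show "\<forall>x\<in>cball 0 1. lead_coeff Q * e x \<noteq> 0" using Q by auto
      show "\<forall>x\<in>ball 0 (1 + \<epsilon>). \<phi> k x - \<phi>0 x = (\<Prod>i<degree Q. x - a i) * (lead_coeff Q * e x)"
        using Q(4) a by (simp add: \<delta>_def mult_ac)
    qed (use dB an in auto)
  qed
qed

text \<open>Three successive subsequences: the number of zeros becomes constant, the zeros converge
  because they lie in the unit disk, and the clearing roots \<open>b k i\<close> converge because
  they lie in a bounded disk.\<close>

lemma test_sequence_data:
  assumes ts: "test_sequence \<epsilon> \<phi> \<phi>0" and \<epsilon>: "0 < \<epsilon>"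
    and ext: "\<And>k. 1 \<le> k \<Longrightarrow> \<exists>u. restriction_extends_to f R (ball 0 (1 + \<epsilon>)) (\<phi> k) u \<and> poles_at_most u (ball 0 (1 + \<epsilon>)) N"
  obtains \<sigma> l a a' b b' e u U where "strict_mono (\<sigma> :: nat \<Rightarrow> nat)" "\<And>k. 1 \<le> \<sigma> k"
    "\<And>k. restriction_extends_to f R (ball 0 (1 + \<epsilon>)) (\<phi> (\<sigma> k)) (u k)"
    "\<And>k. U k holomorphic_on ball 0 (1 + \<epsilon>)"
    "\<And>k x. x \<in> ball 0 (1 + \<epsilon>) \<Longrightarrow> u k analytic_on {x} \<Longrightarrow> U k x = (\<Prod>i<N. x - b k i) * u k x"
    "\<And>i. i < N \<Longrightarrow> (\<lambda>k. b k i) \<longlonglongrightarrow> b' i" "\<And>i. i < (l::nat) \<Longrightarrow> (\<lambda>k. a k i) \<longlonglongrightarrow> a' i"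
    "\<And>k. e k holomorphic_on ball 0 (1 + \<epsilon>)" "\<And>k x. x \<in> cball 0 1 \<Longrightarrow> e k x \<noteq> 0"
    "\<And>k x. x \<in> ball 0 (1 + \<epsilon>) \<Longrightarrow> \<phi> (\<sigma> k) x - \<phi>0 x = (\<Prod>i<l. x - a k i) * e k x"
proof -
  let ?D = "ball (0::complex) (1 + \<epsilon>)"
  obtain L k0 where fac: "\<And>k. k0 \<le> k \<Longrightarrow> \<exists>l a e. l \<le> (L::nat) \<and> (\<forall>i<l. norm (a i) < 1) \<and> e holomorphic_on ?D \<and>
    (\<forall>x\<in>cball 0 1. e x \<noteq> 0) \<and> (\<forall>x\<in>?D. \<phi> k x - \<phi>0 x = (\<Prod>i<l. x - a i) * e x)"
    by (rule test_sequence_factor[OF ts \<epsilon>], rule that)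
  define k1 where "k1 = max 1 k0"
  define P where "P k p \<longleftrightarrow> (case p of (l, a, e) \<Rightarrow> l \<le> L \<and> (\<forall>i<l. norm (a i) < 1) \<and> e holomorphic_on ?D \<and>
    (\<forall>x\<in>cball 0 1. e x \<noteq> 0) \<and> (\<forall>x\<in>?D. \<phi> (k + k1) x - \<phi>0 x = (\<Prod>i<l. x - a i) * e x))"
    for k and p :: "nat \<times> (nat \<Rightarrow> complex) \<times> (complex \<Rightarrow> complex)"
  have "\<exists>p. P k p" for k
  proof -
    have "k0 \<le> k + k1" by (simp add: k1_def)
    from fac[OF this] show ?thesis by (elim exE) (rule_tac x = "(l, a, e)" in exI, simp add: P_def)
  qed
  then obtain p where p: "\<And>k. P k (p k)" by metis
  define l a e where "l k = fst (p k)" and "a k = fst (snd (p k))" and "e k = snd (snd (p k))" for k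
  have P: "l k \<le> L" "i < l k \<Longrightarrow> norm (a k i) < 1" "e k holomorphic_on ?D" "x \<in> cball 0 1 \<Longrightarrow> e k x \<noteq> 0"
    "x \<in> ?D \<Longrightarrow> \<phi> (k + k1) x - \<phi>0 x = (\<Prod>i<l k. x - a k i) * e k x" for k i x
    using p[of k] unfolding P_def l_def a_def e_def by (auto split: prod.splits)
  define T where "T k q \<longleftrightarrow> (case q of (u, b, U) \<Rightarrow> restriction_extends_to f R ?D (\<phi> (k + k1)) u \<and>
     (\<forall>i<N. norm (b i) \<le> 1 + \<epsilon>) \<and> U holomorphic_on ?D \<and>
     (\<forall>x\<in>?D. u analytic_on {x} \<longrightarrow> U x = (\<Prod>i<N. x - b i) * u x))"
    for k and q :: "(complex \<Rightarrow> complex) \<times> (nat \<Rightarrow> complex) \<times> (complex \<Rightarrow> complex)"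
  have "\<exists>q. T k q" for k
  proof -
    have "1 \<le> k + k1" by (simp add: k1_def)
    from ext[OF this] obtain u where u: "restriction_extends_to f R ?D (\<phi> (k + k1)) u" "poles_at_most u ?D N" by blast
    have um: "u meromorphic_on ?D" using u(1) by (simp add: restriction_extends_to_def)
    show ?thesis
    proof (rule poles_at_most_clear[OF um open_ball u(2)])
      fix b U assume bU: "\<And>i. i < N \<Longrightarrow> b i \<in> ?D \<or> b i = 0" "U holomorphic_on ?D"
        "\<And>x. x \<in> ?D \<Longrightarrow> u analytic_on {x} \<Longrightarrow> U x = (\<Prod>i<N. x - b i) * u x"
      have "norm (b i) \<le> 1 + \<epsilon>" if "i < N" for i using bU(1)[OF that] \<epsilon> by auto
      then show ?thesis using bU u(1) unfolding T_def by (intro exI[of _ "(u, b, U)"]) simp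
    qed
  qed
  then obtain q where q: "\<And>k. T k (q k)" by metis
  define u b U where "u k = fst (q k)" and "b k = fst (snd (q k))" and "U k = snd (snd (q k))" for k
  have Q: "restriction_extends_to f R ?D (\<phi> (k + k1)) (u k)" "i < N \<Longrightarrow> norm (b k i) \<le> 1 + \<epsilon>"
    "U k holomorphic_on ?D" "x \<in> ?D \<Longrightarrow> u k analytic_on {x} \<Longrightarrow> U k x = (\<Prod>i<N. x - b k i) * u k x" for k i x
    using q[of k] unfolding T_def u_def b_def U_def by (auto split: prod.splits)
  obtain \<sigma>1 l0 where \<sigma>1: "strict_mono (\<sigma>1 :: nat \<Rightarrow> nat)" "\<And>k. l (\<sigma>1 k) = l0"
    using infinitely_often_constant[of l L] P(1) by blast
  have "norm (a (\<sigma>1 k) i) \<le> 1" if "i < l0" for i k using P(2)[of i "\<sigma>1 k"] that \<sigma>1(2) by auto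
  then obtain \<sigma>2 a' where \<sigma>2: "strict_mono (\<sigma>2 :: nat \<Rightarrow> nat)" "\<And>i. i < l0 \<Longrightarrow> (\<lambda>k. a (\<sigma>1 (\<sigma>2 k)) i) \<longlonglongrightarrow> a' i"
    using simultaneous_convergent_subsequence[of l0 "\<lambda>k. a (\<sigma>1 k)" 1] by blast
  have "norm (b (\<sigma>1 (\<sigma>2 k)) i) \<le> 1 + \<epsilon>" if "i < N" for i k using Q(2)[OF that] by simp
  then obtain \<sigma>3 b' where \<sigma>3: "strict_mono (\<sigma>3 :: nat \<Rightarrow> nat)" "\<And>i. i < N \<Longrightarrow> (\<lambda>k. b (\<sigma>1 (\<sigma>2 (\<sigma>3 k))) i) \<longlonglongrightarrow> b' i"
    using simultaneous_convergent_subsequence[of N "\<lambda>k. b (\<sigma>1 (\<sigma>2 k))" "1 + \<epsilon>"] by blast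
  define s where "s k = \<sigma>1 (\<sigma>2 (\<sigma>3 k))" for k
  show ?thesis
  proof (rule that[of "\<lambda>k. s k + k1" "\<lambda>k. u (s k)" "\<lambda>k. U (s k)" "\<lambda>k. b (s k)" b' l0 "\<lambda>k. a (s k)" a' "\<lambda>k. e (s k)"])
    show "strict_mono (\<lambda>k. s k + k1)" using \<sigma>1(1) \<sigma>2(1) \<sigma>3(1) by (simp add: strict_mono_def s_def)
    show "1 \<le> s k + k1" for k by (simp add: k1_def)
    show "(\<lambda>k. b (s k) i) \<longlonglongrightarrow> b' i" if "i < N" for i using \<sigma>3(2)[OF that] by (simp add: s_def)
    show "(\<lambda>k. a (s k) i) \<longlonglongrightarrow> a' i" if "i < l0" for i
      using LIMSEQ_subseq_LIMSEQ[OF \<sigma>2(2)[OF that] \<sigma>3(1)] by (simp add: s_def o_def)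
    show "\<phi> (s k + k1) x - \<phi>0 x = (\<Prod>i<l0. x - a (s k) i) * e (s k) x" if "x \<in> ?D" for k x
      using P(5)[OF that, of "s k"] \<sigma>1(2) by (simp add: s_def)
  qed (use P Q in auto)
qed

lemma has_regular_value_holomorphic:
  "holomorphic2_on f W \<Longrightarrow> q \<in> W \<Longrightarrow> has_regular_value f q (f q)"
  unfolding has_regular_value_def meromorphic_eq_def
  by (intro exI[of _ W] exI[of _ f]) (auto simp: closure_subset)

lemma holomorphic2_on_shear:
  assumes F: "holomorphic2_on (\<lambda>q. f (fst q, \<phi>0 (fst q) + snd q)) V" and \<phi>0: "\<phi>0 holomorphic_on S" "open S"
    and W: "open W" "\<And>q. q \<in> W \<Longrightarrow> fst q \<in> S \<and> (fst q, snd q - \<phi>0 (fst q)) \<in> V"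
  shows "holomorphic2_on f W"
proof -
  have "holomorphic2_on (\<lambda>q. snd q - \<phi>0 (fst q)) W"
    using W \<phi>0 by (intro holomorphic2_intros holomorphic2_on_fst_comp[of \<phi>0 S]) auto
  from holomorphic2_on_compose[OF F holomorphic2_on_fst[OF W(1)] this] W(2)
  show ?thesis by (auto intro: holomorphic2_on_cong)
qed

text \<open>The Laurent coefficients \<open>A n\<close> of \<open>z ^ D * f (x, \<phi>0 x + z)\<close> on an annulus become holomorphic in the
  disk after multiplication with \<open>W ^ (n + 1)\<close>: the orders of their poles grow at most linearly.\<close>

theorem extension_along_test_sequence:
  assumes \<epsilon>: "0 < \<epsilon>" and f: "meromorphic2_on f (ring_domain \<epsilon>)" and ts: "test_sequence \<epsilon> \<phi> \<phi>0"
    and ext: "\<And>k. 1 \<le> k \<Longrightarrow> \<exists>u. restriction_extends_to f (ring_domain \<epsilon>) (ball 0 (1 + \<epsilon>)) (\<phi> k) u \<and>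
           poles_at_most u (ball 0 (1 + \<epsilon>)) N"
  obtains r1 r2 D \<Lambda> n0 B M C where "0 < r1" "1 - \<epsilon> < r1" "r1 < r2" "r2 < 1"
    "finite \<Lambda>" "\<Lambda> \<subseteq> cball 0 r1" "0 < (n0::nat)" "\<And>n. B n holomorphic_on ball 0 r2" "0 < (C::real)"
    "\<And>n x. x \<in> ball 0 r2 \<Longrightarrow> norm (B n x) \<le> M * C ^ n"
    "\<And>x z. r1 < norm x \<Longrightarrow> norm x < r2 \<Longrightarrow> z \<noteq> 0 \<Longrightarrow> C * norm z < 1 \<Longrightarrow>
      (\<lambda>n. B n x * (z / (\<Prod>c\<in>\<Lambda>. x - c) ^ n0) ^ n) sums ((\<Prod>c\<in>\<Lambda>. x - c) ^ n0 * (z ^ D * f (x, \<phi>0 x + z)))"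
    "holomorphic2_on f {q. r1 < norm (fst q) \<and> norm (fst q) < r2 \<and> snd q \<noteq> \<phi>0 (fst q) \<and> C * norm (snd q - \<phi>0 (fst q)) < 1}"
proof -
  let ?D = "ball (0::complex) (1 + \<epsilon>)"
  have \<phi>0: "\<phi>0 holomorphic_on ?D" "\<phi>0 ` ?D \<subseteq> ball 0 1" using ts by (auto simp: test_sequence_def)
  have \<phi>1: "\<phi> k holomorphic_on ?D" "\<phi> k ` ?D \<subseteq> ball 0 1" if "1 \<le> k" for k using ts that by (auto simp: test_sequence_def)
  define S where "S = {x :: complex. 1 - \<epsilon> < norm x \<and> norm x < 1 + \<epsilon>}"
  have oS: "open S" unfolding S_def by (intro open_Collect_conj open_Collect_less continuous_intros)
  have SD: "S \<subseteq> ?D" by (auto simp: S_def)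
  have \<phi>0S: "\<phi>0 holomorphic_on S" by (rule holomorphic_on_subset[OF \<phi>0(1) SD])
  have ring: "(x, y) \<in> ring_domain \<epsilon>" if "x \<in> S" "norm y < 1" for x y using that by (simp add: S_def ring_domain_def)
  have n0: "norm (\<phi>0 x) < 1" if "x \<in> ?D" for x using \<phi>0(2) that by fastforce

  obtain \<sigma> l a a' b b' e u U where \<sigma>: "strict_mono (\<sigma> :: nat \<Rightarrow> nat)" "\<And>k. 1 \<le> \<sigma> k"
    and u: "\<And>k. restriction_extends_to f (ring_domain \<epsilon>) ?D (\<phi> (\<sigma> k)) (u k)"
    and U: "\<And>k. U k holomorphic_on ?D"
    and Uu: "\<And>k x. x \<in> ?D \<Longrightarrow> u k analytic_on {x} \<Longrightarrow> U k x = (\<Prod>i<N. x - b k i) * u k x"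
    and b: "\<And>i. i < N \<Longrightarrow> (\<lambda>k. b k i) \<longlonglongrightarrow> b' i" and a: "\<And>i. i < (l::nat) \<Longrightarrow> (\<lambda>k. a k i) \<longlonglongrightarrow> a' i"
    and e: "\<And>k. e k holomorphic_on ?D" "\<And>k x. x \<in> cball 0 1 \<Longrightarrow> e k x \<noteq> 0"
    and \<delta>: "\<And>k x. x \<in> ?D \<Longrightarrow> \<phi> (\<sigma> k) x - \<phi>0 x = (\<Prod>i<l. x - a k i) * e k x"
    by (rule test_sequence_data[OF ts \<epsilon> ext], assumption) (rule that)

  \<comment> \<open>The annulus has to lie in the unit disk, over the ring and away from
    \<open>0\<close>; \<open>t2\<close> and \<open>t3\<close> divide the interval from
    \<open>t1\<close> to \<open>1\<close> into thirds.\<close>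
  define t1 where "t1 = max (1 - \<epsilon>) 0"
  define t2 where "t2 = (2 * t1 + 1) / 3"
  define t3 where "t3 = (t1 + 2) / 3"
  have t: "0 \<le> t1" "1 - \<epsilon> \<le> t1" "t1 < t2" "t2 < t3" "t3 < 1" using \<epsilon> by (auto simp: t1_def t2_def t3_def)
  define K0 where "K0 = {x :: complex. t2 \<le> norm x \<and> norm x \<le> t3}"
  have cK: "compact {x :: complex. p \<le> norm x \<and> norm x \<le> q}" for p q
  proof -
    have "{x :: complex. p \<le> norm x \<and> norm x \<le> q} = cball 0 q - ball 0 p" by auto
    then show ?thesis by (simp add: compact_diff)
  qed
  have K0S: "K0 \<subseteq> S" using t \<epsilon> by (auto simp: K0_def S_def)
  have pf: "\<exists>s c d g h. polar_form f \<phi>0 S x s c d g h" if "x \<in> S" for x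
  proof -
    have "(x, \<phi>0 x) \<in> ring_domain \<epsilon>" using that n0 SD by (intro ring) auto
    then show ?thesis using polar_form_exists[OF f \<phi>0S oS that] by metis
  qed
  define Bad where "Bad = {x \<in> K0. \<not> polar_regular f \<phi>0 S x}"
  have "finite Bad" unfolding Bad_def using pf K0S by (intro finite_polar_irregular) (auto simp: K0_def cK)
  \<comment> \<open>Moduli the annulus must avoid: irregular points of \<open>f\<close> along the
    limit graph, and limits of the zeros and poles.\<close>
  define E where "E = norm ` (Bad \<union> a' ` {..<l} \<union> b' ` {..<N})"
  have "finite E" using \<open>finite Bad\<close> by (simp add: E_def)
  then obtain r1 r2 where r: "t2 < r1" "r1 < r2" "r2 < t3" "{r1..r2} \<inter> E = {}"
    by (rule interval_avoiding_finite[OF _ t(4)])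
  have r': "0 < r1" "1 - \<epsilon> < r1" "r2 < 1" using r t by auto
  define K where "K = {x :: complex. r1 \<le> norm x \<and> norm x \<le> r2}"
  have K: "compact K" "K \<noteq> {}"
    using r r' cK[of r1 r2] by (auto simp: K_def intro!: exI[of _ "of_real r1"])
  have reg: "polar_regular f \<phi>0 S x" if "x \<in> K" for x
  proof (rule ccontr)
    assume "\<not> ?thesis"
    then have "x \<in> Bad" using that r by (auto simp: Bad_def K_def K0_def)
    then have "norm x \<in> E" by (simp add: E_def)
    then show False using r(4) that by (auto simp: K_def)
  qed
  obtain T D A M C where T: "open T" "K \<subseteq> T" "T \<subseteq> S" and A: "\<And>n. A n holomorphic_on T" and C: "0 < (C::real)"
    and Ab: "\<And>n x. x \<in> K \<Longrightarrow> norm (A n x) \<le> M * C ^ n"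
    and sums: "\<And>x z. x \<in> T \<Longrightarrow> z \<noteq> 0 \<Longrightarrow> C * norm z < 1 \<Longrightarrow> (\<lambda>n. A n x * z ^ n) sums (z ^ D * f (x, \<phi>0 x + z))"
    and F: "holomorphic2_on (\<lambda>q. f (fst q, \<phi>0 (fst q) + snd q)) {q. fst q \<in> T \<and> snd q \<noteq> 0 \<and> C * norm (snd q) < 1}"
    by (rule polar_regular_expansion[OF K reg], assumption) (rule that)
  define \<Omega> where "\<Omega> c = {q. r1 < norm (fst q) \<and> norm (fst q) < r2 \<and> snd q \<noteq> \<phi>0 (fst q) \<and> c * norm (snd q - \<phi>0 (fst q)) < 1}" for c :: real
  have AnnT: "x \<in> T" "x \<in> K" "x \<in> S" "x \<in> ?D" if "r1 < norm x" "norm x < r2" for x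
  proof -
    show "x \<in> K" using that by (simp add: K_def)
    then show "x \<in> T" using T(2) by blast
    then show "x \<in> S" using T(3) by blast
    then show "x \<in> ?D" using SD by blast
  qed
  have \<Omega>hol: "holomorphic2_on f (\<Omega> c)" if "C \<le> c" for c
  proof (rule holomorphic2_on_shear[OF F \<phi>0S oS])
    define Y where "Y = {x :: complex. r1 < norm x \<and> norm x < r2}"
    have oY: "open Y" unfolding Y_def by (intro open_Collect_conj open_Collect_less continuous_intros)
    have c\<phi>: "continuous_on (Y \<times> UNIV) (\<lambda>q. snd q - \<phi>0 (fst q))"
      by (intro continuous_intros continuous_on_compose2[OF holomorphic_on_imp_continuous_on[OF \<phi>0S]])
        (auto simp: Y_def AnnT)
    have "open ((Y \<times> UNIV) \<inter> (\<lambda>q. snd q - \<phi>0 (fst q)) -` {z. z \<noteq> 0 \<and> c * norm z < 1})"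
    proof (rule continuous_open_preimage[OF c\<phi>])
      show "open {z :: complex. z \<noteq> 0 \<and> c * norm z < 1}"
        by (intro open_Collect_conj open_Collect_less open_Collect_neq continuous_intros)
    qed (simp add: oY open_Times)
    moreover have "(Y \<times> UNIV) \<inter> (\<lambda>q. snd q - \<phi>0 (fst q)) -` {z. z \<noteq> 0 \<and> c * norm z < 1} = \<Omega> c"
      by (auto simp: Y_def \<Omega>_def)
    ultimately show "open (\<Omega> c)" by simp
    fix q assume q: "q \<in> \<Omega> c"
    have "C * norm (snd q - \<phi>0 (fst q)) \<le> c * norm (snd q - \<phi>0 (fst q))" using that by (intro mult_right_mono) auto
    moreover have "c * norm (snd q - \<phi>0 (fst q)) < 1" using q by (simp add: \<Omega>_def)
    ultimately have "C * norm (snd q - \<phi>0 (fst q)) < 1" by linarith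
    then show "fst q \<in> S \<and> (fst q, snd q - \<phi>0 (fst q)) \<in> {q. fst q \<in> T \<and> snd q \<noteq> 0 \<and> C * norm (snd q) < 1}"
      using q AnnT by (auto simp: \<Omega>_def)
  qed

  have unif: "uniform_limit ?D (\<lambda>k x. \<phi> (\<sigma> k) x - \<phi>0 x) (\<lambda>_. 0) sequentially"
  proof (rule uniform_limitI)
    fix \<eta> :: real assume "0 < \<eta>"
    have "\<forall>\<^sub>F k in sequentially. \<forall>x\<in>?D. dist (\<phi> k x) (\<phi>0 x) < \<eta>"
      using ts \<open>0 < \<eta>\<close> unfolding test_sequence_def by (intro uniform_limitD) auto
    from eventually_subseq[OF \<sigma>(1) this]
    show "\<forall>\<^sub>F k in sequentially. \<forall>x\<in>?D. dist (\<phi> (\<sigma> k) x - \<phi>0 x) 0 < \<eta>" by (simp add: dist_norm)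
  qed
  have root_out: "norm (c i) \<le> r1 \<or> r2 \<le> norm (c i)" if "norm (c i) \<in> E" for c :: "nat \<Rightarrow> complex" and i
  proof (rule ccontr)
    assume "\<not> ?thesis"
    then have "norm (c i) \<in> {r1..r2}" by auto
    then show False using that r(4) by blast
  qed
  have ev_a: "\<forall>\<^sub>F k in sequentially. \<forall>i\<in>{..<l}. \<not> (r1 < norm (a k i) \<and> norm (a k i) < r2)"
  proof (intro eventually_ball_finite ballI)
    fix i assume i: "i \<in> {..<l}"
    have "norm (a' i) \<notin> {r1..r2}" using i r(4) by (auto simp: E_def)
    moreover have "(\<lambda>k. norm (a k i)) \<longlonglongrightarrow> norm (a' i)" using a i by (intro tendsto_norm) auto
    ultimately have "\<forall>\<^sub>F k in sequentially. norm (a k i) \<in> - {r1..r2}"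
      by (intro topological_tendstoD) auto
    then show "\<forall>\<^sub>F k in sequentially. \<not> (r1 < norm (a k i) \<and> norm (a k i) < r2)" by eventually_elim auto
  qed simp
  have ev_s: "\<forall>\<^sub>F k in sequentially. \<forall>x\<in>?D. dist (\<phi> (\<sigma> k) x - \<phi>0 x) 0 < 1 / (2 * C)"
    using unif C by (intro uniform_limitD) auto
  \<comment> \<open>From \<open>k1\<close> on no zero of the difference lies over the open annulus,
    and the difference is at most \<open>1 / (2 * C)\<close>, so the graphs run where
    \<open>f\<close> is holomorphic and the expansion converges.\<close>
  obtain k1 where k1: "\<And>k. k1 \<le> k \<Longrightarrow> (\<forall>i\<in>{..<l}. \<not> (r1 < norm (a k i) \<and> norm (a k i) < r2)) \<and>
      (\<forall>x\<in>?D. dist (\<phi> (\<sigma> k) x - \<phi>0 x) 0 < 1 / (2 * C))"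
    using eventually_conj[OF ev_a ev_s] unfolding eventually_sequentially by auto
  have sm: "C * norm (\<phi> (\<sigma> (k + k1)) x - \<phi>0 x) \<le> 1/2" if "x \<in> ?D" for k x
  proof -
    have "dist (\<phi> (\<sigma> (k + k1)) x - \<phi>0 x) 0 < 1 / (2 * C)" using k1[of "k + k1"] that by auto
    then show ?thesis using C by (simp add: field_simps)
  qed
  have b02: "ball 0 r2 \<subseteq> cball (0::complex) 1" "ball 0 r2 \<subseteq> ?D" using r' \<epsilon> by auto
  have \<delta>h: "(\<lambda>x. \<phi> (\<sigma> k) x - \<phi>0 x) holomorphic_on ?D" for k by (intro holomorphic_intros \<phi>1 \<phi>0 \<sigma>)
  \<comment> \<open>The expansion is that of \<open>z ^ D * f\<close>; its restriction to a graph is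
    extended by the cleared restriction of \<open>f\<close> times the \<open>D\<close>-th power of
    the difference.\<close>
  interpret laurent_data r1 r2 M C A "\<lambda>k. a (k + k1)" "\<lambda>k. b (k + k1)" a' b' "\<lambda>k. e (k + k1)"
    "\<lambda>k x. (\<phi> (\<sigma> (k + k1)) x - \<phi>0 x) ^ D * U (k + k1) x" l N
  proof
    show "A n holomorphic_on {x. r1 < norm x \<and> norm x < r2}" for n
      by (rule holomorphic_on_subset[OF A]) (auto simp: AnnT)
    show "norm (A n x) \<le> M * C ^ n" if "r1 < norm x" "norm x < r2" for n x using Ab AnnT that by auto
    show "e (k + k1) holomorphic_on ball 0 r2" for k by (rule holomorphic_on_subset[OF e(1) b02(2)])
    show "e (k + k1) x \<noteq> 0" if "x \<in> ball 0 r2" for k x using e(2) b02(1) that by blast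
    show "(\<lambda>k. a (k + k1) i) \<longlonglongrightarrow> a' i" if "i < l" for i using a[OF that] by (rule LIMSEQ_ignore_initial_segment)
    show "(\<lambda>k. b (k + k1) i) \<longlonglongrightarrow> b' i" if "i < N" for i using b[OF that] by (rule LIMSEQ_ignore_initial_segment)
    show "norm (a' i) \<le> r1 \<or> r2 \<le> norm (a' i)" if "i < l" for i using that by (intro root_out) (auto simp: E_def)
    show "norm (b' i) \<le> r1 \<or> r2 \<le> norm (b' i)" if "i < N" for i using that by (intro root_out) (auto simp: E_def)
    show "(\<lambda>x. (\<phi> (\<sigma> (k + k1)) x - \<phi>0 x) ^ D * U (k + k1) x) holomorphic_on ball 0 r2" for k
      by (rule holomorphic_on_subset[OF _ b02(2)]) (intro holomorphic_intros \<delta>h U \<phi>1 \<phi>0 \<sigma>)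
    show "uniform_limit {x. r1 < norm x \<and> norm x < r2} (\<lambda>k x. (\<Prod>i<l. x - a (k + k1) i) * e (k + k1) x) (\<lambda>_. 0) sequentially"
    proof (rule uniform_limitI)
      fix \<eta> :: real assume "0 < \<eta>"
      from sequentially_offset[OF uniform_limitD[OF unif this], of k1]
      show "\<forall>\<^sub>F k in sequentially. \<forall>x\<in>{x. r1 < norm x \<and> norm x < r2}. dist ((\<Prod>i<l. x - a (k + k1) i) * e (k + k1) x) 0 < \<eta>"
        by eventually_elim (use \<delta> AnnT in auto)
    qed
    fix k x assume x: "r1 < norm (x :: complex)" "norm x < r2"
    let ?d = "\<lambda>x. \<phi> (\<sigma> (k + k1)) x - \<phi>0 x"
    have de: "(\<Prod>i<l. y - a (k + k1) i) * e (k + k1) y = ?d y" if "r1 < norm y" "norm y < r2" for y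
      using \<delta>[OF AnnT(4)[OF that], of "k + k1"] by simp
    show "C * norm ((\<Prod>i<l. x - a (k + k1) i) * e (k + k1) x) \<le> 1/2"
      unfolding de[OF x] by (rule sm[OF AnnT(4)[OF x]])
    have dnz: "?d y \<noteq> 0" if y: "r1 < norm y" "norm y < r2" for y
    proof -
      have "y - a (k + k1) i \<noteq> 0" if "i < l" for i
        using k1[of "k + k1"] that y by auto
      moreover have "e (k + k1) y \<noteq> 0" using y r' by (intro e(2)) auto
      ultimately show ?thesis unfolding de[OF y, symmetric] by auto
    qed
    have in\<Omega>: "(y, \<phi> (\<sigma> (k + k1)) y) \<in> \<Omega> C" if y: "r1 < norm y" "norm y < r2" for y
      using y dnz[OF y] sm[OF AnnT(4)[OF y], of k] by (simp add: \<Omega>_def)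
    \<comment> \<open>Over the annulus \<open>f\<close> is holomorphic near the graph, so its value
      there is regular and the extension has to assume it.\<close>
    have uf: "u (k + k1) y = f (y, \<phi> (\<sigma> (k + k1)) y)" if y: "r1 < norm y" "norm y < r2" for y
    proof -
      have "has_regular_value f (y, \<phi> (\<sigma> (k + k1)) y) (f (y, \<phi> (\<sigma> (k + k1)) y))"
        by (rule has_regular_value_holomorphic[OF \<Omega>hol[OF order_refl] in\<Omega>[OF y]])
      moreover have "norm (\<phi> (\<sigma> (k + k1)) y) < 1" using \<phi>1(2)[OF \<sigma>(2), of "k + k1"] AnnT(4)[OF y] by fastforce
      then have "(y, \<phi> (\<sigma> (k + k1)) y) \<in> ring_domain \<epsilon>" by (rule ring[OF AnnT(3)[OF y]])
      ultimately show ?thesis using u[of "k + k1"] AnnT(4)[OF y] unfolding restriction_extends_to_def by blast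
    qed
    have "(\<lambda>y. f (y, \<phi> (\<sigma> (k + k1)) y)) holomorphic_on {y. r1 < norm y \<and> norm y < r2}"
      by (rule holomorphic2_on_curve[OF \<Omega>hol[OF order_refl]])
        (use in\<Omega> AnnT in \<open>auto intro!: holomorphic_intros open_Collect_conj open_Collect_less continuous_intros
          holomorphic_on_subset[OF \<phi>1(1)[OF \<sigma>(2)]]\<close>)
    then have "u (k + k1) holomorphic_on {y. r1 < norm y \<and> norm y < r2}"
      by (rule holomorphic_transform) (use uf in auto)
    moreover have "open {y :: complex. r1 < norm y \<and> norm y < r2}"
      by (intro open_Collect_conj open_Collect_less continuous_intros)
    ultimately have "u (k + k1) analytic_on {x}" using x analytic_at by blast
    then have "U (k + k1) x = (\<Prod>i<N. x - b (k + k1) i) * f (x, \<phi> (\<sigma> (k + k1)) x)"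
      using Uu[OF AnnT(4)[OF x]] uf[OF x] by simp
    moreover have "(\<Sum>n. A n x * ?d x ^ n) = ?d x ^ D * f (x, \<phi> (\<sigma> (k + k1)) x)"
      using sums_unique[OF sums[OF AnnT(1)[OF x] dnz[OF x]]] sm[OF AnnT(4)[OF x], of k] by simp
    ultimately show "?d x ^ D * U (k + k1) x = (\<Prod>i<N. x - b (k + k1) i) * (\<Sum>n. A n x * ((\<Prod>i<l. x - a (k + k1) i) * e (k + k1) x) ^ n)"
      unfolding de[OF x] by simp
  qed (use r r' C in auto)
  obtain \<Lambda> n0 B where \<Lambda>: "finite \<Lambda>" "\<Lambda> \<subseteq> cball 0 r1" "0 < (n0::nat)" and B: "\<And>n. B n holomorphic_on ball 0 r2"
    and BA: "\<And>n x. x \<in> Ann \<Longrightarrow> B n x = ((\<Prod>c\<in>\<Lambda>. x - c) ^ n0) ^ (n + 1) * A n x"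
    by (rule coefficients_extend) (rule that)
  define W where "W x = (\<Prod>c\<in>\<Lambda>. x - c) ^ n0" for x
  have "compact (W ` cball 0 r2)" unfolding W_def by (intro compact_continuous_image continuous_intros) auto
  then obtain W0 where W0: "\<And>x. x \<in> cball 0 r2 \<Longrightarrow> norm (W x) \<le> W0"
    using compact_imp_bounded bounded_iff by (metis image_eqI)
  \<comment> \<open>A bound at least \<open>1\<close> for \<open>W\<close>: enlarging
    \<open>C\<close> to \<open>Wm * C\<close> absorbs the factors \<open>W ^ (n + 1)\<close> in the
    coefficients \<open>B n\<close>.\<close>
  define Wm where "Wm = max 1 W0"
  have Wm: "1 \<le> Wm" "\<And>x. x \<in> ball 0 r2 \<Longrightarrow> norm (W x) \<le> Wm"
    using order_trans[OF W0 max.cobounded2] by (auto simp: Wm_def)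
  show ?thesis
  proof (rule that[of r1 r2 \<Lambda> n0 B "Wm * C" "Wm * M" D])
    show "0 < Wm * C" using Wm C by simp
    show "norm (B n x) \<le> Wm * M * (Wm * C) ^ n" if x: "x \<in> ball 0 r2" for n x
    proof (rule bound_from_annulus[OF B r'(1) r(2) _ x])
      fix y :: complex assume y: "r1 < norm y" "norm y < r2"
      have "norm (B n y) = norm (W y) ^ (n + 1) * norm (A n y)"
        using BA[of y n] y by (simp add: W_def Ann_def norm_mult norm_power)
      also have "\<dots> \<le> Wm ^ (n + 1) * (M * C ^ n)"
        using Wm Ab[OF AnnT(2)[OF y]] y by (intro mult_mono power_mono) auto
      finally show "norm (B n y) \<le> Wm * M * (Wm * C) ^ n" by (simp add: power_mult_distrib mult_ac)
    qed
    have CC: "C \<le> Wm * C" using Wm(1) C by simp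
    show "holomorphic2_on f {q. r1 < norm (fst q) \<and> norm (fst q) < r2 \<and> snd q \<noteq> \<phi>0 (fst q) \<and> Wm * C * norm (snd q - \<phi>0 (fst q)) < 1}"
      using \<Omega>hol[OF CC] by (simp add: \<Omega>_def)
    fix x z :: complex assume x: "r1 < norm x" "norm x < r2" and z: "z \<noteq> 0" "Wm * C * norm z < 1"
    have "C * norm z \<le> Wm * C * norm z" using CC by (intro mult_right_mono) auto
    then have "C * norm z < 1" using z(2) by simp
    from sums_mult[OF sums[OF AnnT(1)[OF x] z(1) this], of "W x"]
    have s: "(\<lambda>n. W x * (A n x * z ^ n)) sums (W x * (z ^ D * f (x, \<phi>0 x + z)))" .
    have "W x \<noteq> 0"
    proof -
      have "x - c \<noteq> 0" if "c \<in> \<Lambda>" for c using that \<Lambda>(2) x by auto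
      then show ?thesis unfolding W_def using \<Lambda>(1) by auto
    qed
    then have "B n x * (z / W x) ^ n = W x * (A n x * z ^ n)" for n
      using BA[of x n] x by (simp add: W_def[symmetric] Ann_def power_divide)
    then show "(\<lambda>n. B n x * (z / (\<Prod>c\<in>\<Lambda>. x - c) ^ n0) ^ n) sums ((\<Prod>c\<in>\<Lambda>. x - c) ^ n0 * (z ^ D * f (x, \<phi>0 x + z)))"
      using s by (simp add: W_def)
  qed (use r r' \<Lambda> B in auto)
qed

section \<open>Identity of meromorphic functions of two variables\<close>

lemma zero_at_closure_point:
  fixes k :: "'a::metric_space \<Rightarrow> complex"
  assumes k: "continuous_on U k" and U: "open U" "q \<in> U" and q: "q \<in> closure A"
    and z: "\<And>w. w \<in> A \<Longrightarrow> w \<in> U \<Longrightarrow> k w = 0"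
  shows "k q = 0"
proof (rule ccontr)
  assume nz: "k q \<noteq> 0"
  have "open (U \<inter> k -` (- {0}))" by (rule continuous_open_preimage[OF k U(1)]) auto
  moreover have "q \<in> U \<inter> k -` (- {0})" using nz U(2) by simp
  ultimately have "(U \<inter> k -` (- {0})) \<inter> A \<noteq> {}" using q by (auto simp: closure_iff_nhds_not_empty)
  then show False using z by blast
qed

lemma open_subset_closure_Int:
  "open S \<Longrightarrow> S \<subseteq> closure A \<Longrightarrow> S \<subseteq> closure (S \<inter> A)"
  using open_Int_closure_subset[of S A] by blast

lemma meromorphic2_onE:
  assumes "meromorphic2_on f R" "q \<in> R"
  obtains W g h where "connected W" "open W" "q \<in> W" "W \<subseteq> R" "holomorphic2_on g W" "holomorphic2_on h W"
    "\<exists>w\<in>W. h w \<noteq> 0" "\<And>w. w \<in> W \<Longrightarrow> h w \<noteq> 0 \<Longrightarrow> f w = g w / h w"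
proof -
  from assms obtain W g h where W: "connected W" "q \<in> W" "W \<subseteq> R" "holomorphic2_on g W" "holomorphic2_on h W"
    "\<exists>w\<in>W. h w \<noteq> 0" "\<forall>w\<in>W. h w \<noteq> 0 \<longrightarrow> f w = g w / h w"
    unfolding meromorphic2_on_def by meson
  have "open W" using W(4) by (simp add: holomorphic2_on_def)
  then show ?thesis using W by (intro that[of W g h]) auto
qed

lemma holomorphic2_on_closure_nonzero:
  assumes h: "holomorphic2_on h W" "connected W" "\<exists>w\<in>W. h w \<noteq> 0" and q: "q \<in> W"
  shows "q \<in> closure {w \<in> W. h w \<noteq> 0}"
  unfolding closure_iff_nhds_not_empty
proof (intro allI impI)
  fix A V assume "V \<subseteq> A" "open V" "q \<in> V"
  then have "\<exists>w\<in>V \<inter> W. h w \<noteq> 0" using q by (intro holomorphic2_on_nonzero_dense[OF h]) auto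
  then show "{w \<in> W. h w \<noteq> 0} \<inter> A \<noteq> {}" using \<open>V \<subseteq> A\<close> by blast
qed

lemma open_nonzero_set:
  assumes "holomorphic2_on h W"
  shows "open {w \<in> W. h w \<noteq> 0}"
proof -
  have "open (W \<inter> h -` (- {0}))"
    by (rule continuous_open_preimage[OF holomorphic2_on_imp_continuous_on[OF assms]])
      (use assms in \<open>auto simp: holomorphic2_on_def\<close>)
  moreover have "W \<inter> h -` (- {0}) = {w \<in> W. h w \<noteq> 0}" by auto
  ultimately show ?thesis by simp
qed

text \<open>Two relations \<open>f * T = S\<close> that hold on dense sets are compatible.  Since the intersection of two dense sets may be
  empty, both are first transferred to a local quotient representing \<open>f\<close>.\<close>

lemma meromorphic2_transfer:
  assumes f: "meromorphic2_on f R" and U: "open U" "U \<subseteq> R"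
    and h1: "holomorphic2_on T1 U" "holomorphic2_on S1 U" and d1: "U \<subseteq> closure {w \<in> U. f w * T1 w = S1 w}"
    and h2: "holomorphic2_on T2 U" "holomorphic2_on S2 U" and d2: "U \<subseteq> closure {w \<in> U. f w * T2 w = S2 w}"
    and q: "q \<in> U"
  shows "T1 q * S2 q = T2 q * S1 q"
proof -
  obtain W g h where W: "connected W" "open W" "q \<in> W" "W \<subseteq> R" "holomorphic2_on g W" "holomorphic2_on h W"
    "\<exists>w\<in>W. h w \<noteq> 0" "\<And>w. w \<in> W \<Longrightarrow> h w \<noteq> 0 \<Longrightarrow> f w = g w / h w"
    using meromorphic2_onE[OF f subsetD[OF U(2) q]] by blast
  define Z where "Z = U \<inter> {w \<in> W. h w \<noteq> 0}"
  have oZ: "open Z" using open_nonzero_set[OF W(6)] U(1) by (auto simp: Z_def)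
  have qZ: "q \<in> closure Z"
    using open_Int_closure_subset[OF U(1), of "{w \<in> W. h w \<noteq> 0}"] holomorphic2_on_closure_nonzero[OF W(6,1,7,3)] q
    by (auto simp: Z_def)
  have sub: "Z \<subseteq> U" "Z \<subseteq> W" by (auto simp: Z_def)
  have rel: "g w * T w = S w * h w"
    if hT: "holomorphic2_on T U" "holomorphic2_on S U" and d: "U \<subseteq> closure {w \<in> U. f w * T w = S w}" and w: "w \<in> Z" for T S w
  proof -
    have hh: "holomorphic2_on T Z" "holomorphic2_on S Z" "holomorphic2_on g Z" "holomorphic2_on h Z"
      using hT W(5,6) sub oZ by (auto intro: holomorphic2_on_subset)
    have "g w * T w - S w * h w = 0"
    proof (rule zero_at_closure_point[of Z "\<lambda>w. g w * T w - S w * h w"])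
      show "continuous_on Z (\<lambda>w. g w * T w - S w * h w)"
        by (intro holomorphic2_on_imp_continuous_on holomorphic2_intros hh)
      show "w \<in> closure {w \<in> U. f w * T w = S w}" using d w sub by blast
      show "g v * T v - S v * h v = 0" if "v \<in> {w \<in> U. f w * T w = S w}" "v \<in> Z" for v
      proof -
        have "g v = f v * h v" "S v = f v * T v" using that W(8)[of v] by (auto simp: Z_def)
        then show ?thesis by simp
      qed
    qed (use oZ w in auto)
    then show ?thesis by simp
  qed
  have "T1 q * S2 q - T2 q * S1 q = 0"
  proof (rule zero_at_closure_point[OF _ U(1) q qZ])
    show "continuous_on U (\<lambda>w. T1 w * S2 w - T2 w * S1 w)"
      by (intro holomorphic2_on_imp_continuous_on holomorphic2_intros h1 h2)
    fix w assume w: "w \<in> Z" "w \<in> U"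
    have "h w * (T1 w * S2 w) = h w * (T2 w * S1 w)"
      using rel[OF h1 d1 w(1)] rel[OF h2 d2 w(1)] by (metis mult.assoc mult.commute)
    then show "T1 w * S2 w - T2 w * S1 w = 0" using w(1) by (simp add: Z_def)
  qed
  then show ?thesis by simp
qed

text \<open>The part of \<open>V\<close> interior to the closure of the agreement set is open and
  relatively closed. On a ball where \<open>f\<close> is a quotient \<open>g / h\<close>, the
  relation amounts to the holomorphic equation \<open>g * T = S * h\<close>, which spreads by the
  identity theorem and gives back the relation wherever \<open>h\<close> does not vanish.\<close>

lemma meromorphic2_identity:
  assumes f: "meromorphic2_on f R" and V: "open V" "connected V" "V \<subseteq> R"
    and hol: "holomorphic2_on T V" "holomorphic2_on S V"
    and N: "open N" "N \<subseteq> V" "N \<noteq> {}" "\<And>w. w \<in> N \<Longrightarrow> f w * T w = S w"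
  shows "V \<subseteq> closure {w \<in> V. f w * T w = S w}"
proof -
  define A where "A = {w \<in> V. f w * T w = S w}"
  define \<Omega> where "\<Omega> = V \<inter> interior (closure A)"
  have o\<Omega>: "open \<Omega>" using V by (simp add: \<Omega>_def open_Int)
  have "N \<subseteq> A" using N by (auto simp: A_def)
  then have "N \<subseteq> interior (closure A)" using N(1) closure_subset[of A] by (intro interior_maximal) auto
  then have N\<Omega>: "N \<subseteq> \<Omega>" using N(2) by (simp add: \<Omega>_def)
  have step: "\<exists>e>0. ball q e \<subseteq> \<Omega> \<or> ball q e \<subseteq> V - \<Omega>" if q: "q \<in> V" for q
  proof -
    obtain W g h where W: "connected W" "open W" "q \<in> W" "W \<subseteq> R" "holomorphic2_on g W" "holomorphic2_on h W"
      "\<exists>w\<in>W. h w \<noteq> 0" "\<And>w. w \<in> W \<Longrightarrow> h w \<noteq> 0 \<Longrightarrow> f w = g w / h w"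
      using meromorphic2_onE[OF f subsetD[OF V(3) q]] by blast
    have "open (W \<inter> V)" "q \<in> W \<inter> V" using W V q by auto
    then obtain e where e: "e > 0" "ball q e \<subseteq> W \<inter> V" using open_contains_ball by blast
    let ?B = "ball q e"
    have "?B \<subseteq> \<Omega>" if ne: "?B \<inter> \<Omega> \<noteq> {}"
    proof -
      have hh: "holomorphic2_on T ?B" "holomorphic2_on S ?B" "holomorphic2_on g ?B" "holomorphic2_on h ?B"
        using hol W(5,6) e by (auto intro: holomorphic2_on_subset)
      define Z where "Z = (?B \<inter> \<Omega>) \<inter> {w \<in> W. h w \<noteq> 0}"
      have oZ: "open Z" using open_nonzero_set[OF W(6)] o\<Omega> by (auto simp: Z_def)
      have "Z \<noteq> {}"
        using holomorphic2_on_nonzero_dense[OF W(6,1,7), of "?B \<inter> \<Omega>"] ne o\<Omega> e by (auto simp: Z_def)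
      have ZB: "Z \<subseteq> ?B" by (auto simp: Z_def)
      define k where "k w = g w * T w - S w * h w" for w
      have kh: "holomorphic2_on k ?B" unfolding k_def by (intro holomorphic2_intros hh)
      have kZ: "k w = 0" if w: "w \<in> Z" for w
      proof (rule zero_at_closure_point[of Z k w A])
        show "continuous_on Z k"
          by (rule continuous_on_subset[OF holomorphic2_on_imp_continuous_on[OF kh] ZB])
        show "w \<in> closure A" using w interior_subset by (auto simp: Z_def \<Omega>_def)
        show "k v = 0" if "v \<in> A" "v \<in> Z" for v
        proof -
          have "g v = f v * h v" "S v = f v * T v" using that W(8)[of v] by (auto simp: Z_def A_def)
          then show ?thesis by (simp add: k_def)
        qed
      qed (use oZ w in auto)
      have kB: "k w = 0" if "w \<in> ?B" for w
        by (rule holomorphic2_on_identity[OF kh connected_ball oZ ZB \<open>Z \<noteq> {}\<close> kZ that])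
      have "?B \<subseteq> closure A"
      proof
        fix w assume w: "w \<in> ?B"
        have "{v \<in> W. h v \<noteq> 0} \<inter> ?B \<subseteq> A"
        proof
          fix v assume v: "v \<in> {v \<in> W. h v \<noteq> 0} \<inter> ?B"
          then have "g v = f v * h v" "h v \<noteq> 0" "g v * T v = S v * h v" using kB[of v] W(8)[of v] by (auto simp: k_def)
          then have "h v * (f v * T v) = h v * S v" by (simp add: mult_ac)
          then have "f v * T v = S v" using \<open>h v \<noteq> 0\<close> by simp
          then show "v \<in> A" using v e by (auto simp: A_def)
        qed
        moreover have "w \<in> closure ({v \<in> W. h v \<noteq> 0} \<inter> ?B)"
        proof -
          have "w \<in> W" using w e by blast
          then have "w \<in> ?B \<inter> closure {v \<in> W. h v \<noteq> 0}"
            using holomorphic2_on_closure_nonzero[OF W(6,1,7), of w] w by simp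
          then show ?thesis
            using open_Int_closure_subset[OF open_ball, of q e "{v \<in> W. h v \<noteq> 0}"] by (auto simp: Int_commute)
        qed
        ultimately show "w \<in> closure A" using closure_mono by blast
      qed
      then have "?B \<subseteq> interior (closure A)" by (simp add: interior_maximal)
      then show ?thesis using e by (auto simp: \<Omega>_def)
    qed
    then show ?thesis using e by (intro exI[of _ e]) blast
  qed
  have "open (V - \<Omega>)"
    unfolding open_contains_ball
  proof
    fix q assume q: "q \<in> V - \<Omega>"
    then obtain e where "e > 0" "ball q e \<subseteq> \<Omega> \<or> ball q e \<subseteq> V - \<Omega>" using step by blast
    moreover have "q \<in> ball q e" using \<open>e > 0\<close> by simp
    ultimately show "\<exists>e>0. ball q e \<subseteq> V - \<Omega>" using q by blast
  qed
  moreover have "V \<subseteq> \<Omega> \<union> (V - \<Omega>)" "\<Omega> \<inter> (V - \<Omega>) \<inter> V = {}" "\<Omega> \<inter> V \<noteq> {}" using N N\<Omega> by auto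
  ultimately have "(V - \<Omega>) \<inter> V = {}" using V(2) o\<Omega> unfolding connected_def by blast
  then show ?thesis using interior_subset by (auto simp: \<Omega>_def A_def)
qed

text \<open>Let \<open>g\<close> be the holomorphic representative giving the regular value. The two
  dense relations yield \<open>T * g = S\<close>, while \<open>u * T = S\<close> holds along the
  graph near \<open>\<zeta>\<close>; cancelling \<open>T\<close> shows that \<open>u\<close> tends
  to \<open>v\<close>.\<close>

lemma remove_sings_eq_regular_value:
  assumes f: "meromorphic2_on f R" and U: "open U" "U \<subseteq> R"
    and h: "holomorphic2_on T U" "holomorphic2_on S U" and d: "U \<subseteq> closure {w \<in> U. f w * T w = S w}"
    and \<psi>: "isCont \<psi> \<zeta>"
    and ev: "\<forall>\<^sub>F x in at \<zeta>. (x, \<psi> x) \<in> U \<and> T (x, \<psi> x) \<noteq> 0 \<and> u x * T (x, \<psi> x) = S (x, \<psi> x)"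
    and v: "has_regular_value f (\<zeta>, \<psi> \<zeta>) v"
  shows "remove_sings u \<zeta> = v"
proof -
  obtain W g where W: "(\<zeta>, \<psi> \<zeta>) \<in> W" "holomorphic2_on g W" "W \<subseteq> closure {w \<in> W. f w = g w}" "g (\<zeta>, \<psi> \<zeta>) = v"
    using v unfolding has_regular_value_def meromorphic_eq_def by blast
  have oW: "open W" using W(2) by (simp add: holomorphic2_on_def)
  have oUW: "open (U \<inter> W)" using U oW by (simp add: open_Int)
  have c\<psi>: "isCont (\<lambda>x. (x, \<psi> x)) \<zeta>" using \<psi> by (intro continuous_intros) auto
  have eq: "T w * g w = 1 * S w" if w: "w \<in> U \<inter> W" for w
  proof (rule meromorphic2_transfer[OF f oUW])
    show "U \<inter> W \<subseteq> closure {w \<in> U \<inter> W. f w * T w = S w}"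
    proof -
      have "U \<inter> W \<subseteq> closure ((U \<inter> W) \<inter> {w \<in> U. f w * T w = S w})"
        using d by (intro open_subset_closure_Int oUW) auto
      also have "(U \<inter> W) \<inter> {w \<in> U. f w * T w = S w} = {w \<in> U \<inter> W. f w * T w = S w}" by auto
      finally show ?thesis .
    qed
    show "U \<inter> W \<subseteq> closure {w \<in> U \<inter> W. f w * 1 = g w}"
    proof -
      have "U \<inter> W \<subseteq> closure ((U \<inter> W) \<inter> {w \<in> W. f w = g w})"
        using W(3) by (intro open_subset_closure_Int oUW) auto
      also have "(U \<inter> W) \<inter> {w \<in> W. f w = g w} = {w \<in> U \<inter> W. f w * 1 = g w}" by auto
      finally show ?thesis .
    qed
  qed (use U w h W(2) oUW in \<open>auto intro: holomorphic2_on_subset\<close>)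
  have "\<forall>\<^sub>F x in at \<zeta>. (x, \<psi> x) \<in> W"
    using c\<psi> oW W(1) unfolding isCont_def by (auto dest: topological_tendstoD)
  with ev have ev2: "\<forall>\<^sub>F x in at \<zeta>. g (x, \<psi> x) = u x"
  proof eventually_elim
    case (elim x)
    then have "T (x, \<psi> x) * g (x, \<psi> x) = S (x, \<psi> x)" using eq[of "(x, \<psi> x)"] by simp
    then have "T (x, \<psi> x) * g (x, \<psi> x) = T (x, \<psi> x) * u x" using elim by (simp add: mult.commute)
    then show ?case using elim by simp
  qed
  have "isCont g (\<zeta>, \<psi> \<zeta>)"
    using holomorphic2_on_imp_continuous_on[OF W(2)] W(1) oW by (simp add: continuous_on_eq_continuous_at)
  then have "isCont (\<lambda>x. g (x, \<psi> x)) \<zeta>" by (rule isCont_o2[OF c\<psi>])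
  then have lim: "(\<lambda>x. g (x, \<psi> x)) \<midarrow>\<zeta>\<rightarrow> v" using W(4) by (simp add: isCont_def)
  have "u \<midarrow>\<zeta>\<rightarrow> v" by (rule Lim_transform_eventually[OF lim ev2])
  then show ?thesis by (rule remove_sings_eqI)
qed

lemma zeros_at_most_eventually_nonzero:
  assumes "zeros_at_most H V n" "open V" "x \<in> V"
  shows "\<forall>\<^sub>F y in at x. H y \<noteq> 0"
proof -
  obtain Q e where Q: "Q \<noteq> 0" "\<forall>x\<in>V. e x \<noteq> 0" "\<forall>x\<in>V. H x = poly Q x * e x"
    using assms(1) unfolding zeros_at_most_def by blast
  have "finite ({w. poly Q w = 0} - {x})" using poly_roots_finite[OF Q(1)] by simp
  then have "open (- ({w. poly Q w = 0} - {x}))" by (intro open_Compl finite_imp_closed)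
  then have "\<forall>\<^sub>F y in at x. y \<in> - ({w. poly Q w = 0} - {x}) - {x}" by (rule eventually_at_in_open) simp
  from this eventually_at_in_open[OF assms(2,3)]
  show ?thesis by eventually_elim (use Q in auto)
qed

section \<open>The pinched extension and its restrictions to graphs\<close>

text \<open>Rouche's theorem on the circle of radius \<open>s / 2\<close>: \<open>h (x, 0)\<close>
  can vanish only at the centre, so it is bounded below there, and uniform continuity makes
  \<open>h (x, \<beta> x)\<close> close to it for every small \<open>\<beta>\<close>.\<close>

lemma polar_form_zeros:
  assumes pf: "polar_form f \<phi>0 S x0 s c d g h"
  obtains \<delta> n where "0 < \<delta>" "\<delta> \<le> c"
    "\<And>\<beta>. \<beta> holomorphic_on ball x0 s \<Longrightarrow> (\<And>x. x \<in> ball x0 s \<Longrightarrow> norm (\<beta> x) < \<delta>) \<Longrightarrow>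
       zeros_at_most (\<lambda>x. h (x, \<beta> x)) (ball x0 (s / 2)) n"
proof -
  have s: "0 < s" "0 < c" and h: "holomorphic2_on h (ball x0 s \<times> ball 0 c)"
    and nz: "\<And>x. x \<in> ball x0 s \<Longrightarrow> x \<noteq> x0 \<Longrightarrow> h (x, 0) \<noteq> 0"
    using pf by (auto simp: polar_form_def)
  have h0: "(\<lambda>x. h (x, 0)) holomorphic_on ball x0 s"
    by (rule holomorphic2_on_curve[OF h]) (use s in \<open>auto intro!: holomorphic_intros\<close>)
  have sph: "h (x, 0) \<noteq> 0" if "x \<in> sphere x0 (s / 2)" for x
  proof -
    have "x \<in> ball x0 s" "x \<noteq> x0" using that s by auto
    then show ?thesis by (rule nz)
  qed
  obtain n where n: "\<And>g. g holomorphic_on ball x0 s \<Longrightarrow>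
     (\<And>x. x \<in> sphere x0 (s / 2) \<Longrightarrow> norm (g x - h (x, 0)) < norm (h (x, 0))) \<Longrightarrow> zeros_at_most g (ball x0 (s / 2)) n"
    by (rule zeros_at_most_perturb[OF h0, of x0 "s / 2"]) (use s sph in auto)
  have sne: "sphere x0 (s / 2) \<noteq> {}" using s by simp
  have c0: "continuous_on (sphere x0 (s / 2)) (\<lambda>x. norm (h (x, 0)))"
    by (intro continuous_intros continuous_on_subset[OF holomorphic_on_imp_continuous_on[OF h0]]) (use s in auto)
  obtain y where y: "y \<in> sphere x0 (s / 2)" "\<And>x. x \<in> sphere x0 (s / 2) \<Longrightarrow> norm (h (y, 0)) \<le> norm (h (x, 0))"
    using continuous_attains_inf[OF compact_sphere sne c0] by blast
  have m: "0 < norm (h (y, 0))" using sph[OF y(1)] by simp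
  let ?K = "cball x0 (s / 2) \<times> cball (0::complex) (c / 2)"
  have "uniformly_continuous_on ?K h"
    by (intro compact_uniformly_continuous compact_Times compact_cball
        continuous_on_subset[OF holomorphic2_on_imp_continuous_on[OF h]]) (use s in auto)
  then obtain \<delta> where \<delta>: "0 < \<delta>" "\<And>p q. p \<in> ?K \<Longrightarrow> q \<in> ?K \<Longrightarrow> dist p q < \<delta> \<Longrightarrow> dist (h p) (h q) < norm (h (y, 0))"
    using m unfolding uniformly_continuous_on_def by metis
  show ?thesis
  proof (rule that[of "min \<delta> (c / 2)" n])
    fix \<beta> assume \<beta>: "\<beta> holomorphic_on ball x0 s" "\<And>x. x \<in> ball x0 s \<Longrightarrow> norm (\<beta> x) < min \<delta> (c / 2)"
    have b: "norm (\<beta> x) < \<delta>" "norm (\<beta> x) < c / 2" if "x \<in> ball x0 s" for x using \<beta>(2)[OF that] by auto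
    show "zeros_at_most (\<lambda>x. h (x, \<beta> x)) (ball x0 (s / 2)) n"
    proof (rule n)
      show "(\<lambda>x. h (x, \<beta> x)) holomorphic_on ball x0 s"
      proof (rule holomorphic2_on_curve[OF h _ \<beta>(1)])
        fix x assume "x \<in> ball x0 s"
        then show "(x, \<beta> x) \<in> ball x0 s \<times> ball 0 c" using b[of x] s by auto
      qed (auto intro!: holomorphic_intros)
      fix x assume x: "x \<in> sphere x0 (s / 2)"
      then have xb: "x \<in> ball x0 s" using s by auto
      have "dist (h (x, \<beta> x)) (h (x, 0)) < norm (h (y, 0))"
        by (rule \<delta>(2)) (use x b[OF xb] s in \<open>auto simp: dist_Pair_Pair\<close>)
      then show "norm (h (x, \<beta> x) - h (x, 0)) < norm (h (x, 0))" using y(2)[OF x] by (simp add: dist_norm)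
    qed
  qed (use s \<delta> in auto)
qed

text \<open>The polar form gives the relation wherever \<open>T\<close> is nonzero. \<open>T\<close>
  lives on a connected set, the sheared polydisk, without vanishing identically, so these points are
  dense.\<close>

lemma polar_form_dense:
  assumes pf: "polar_form f \<phi>0 S x0 s c d g h" and \<phi>0: "\<phi>0 holomorphic_on S" and S: "open S" and R: "open R"
  defines "U \<equiv> {q. fst q \<in> ball x0 s \<and> norm (snd q - \<phi>0 (fst q)) < c} \<inter> R"
  defines "T \<equiv> \<lambda>q. (snd q - \<phi>0 (fst q)) ^ d * h (fst q, snd q - \<phi>0 (fst q))"
  defines "G \<equiv> \<lambda>q. g (fst q, snd q - \<phi>0 (fst q))"
  shows "open U" "holomorphic2_on T U" "holomorphic2_on G U" "U \<subseteq> closure {w \<in> U. f w * T w = G w}"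
proof -
  define B where "B = {q. fst q \<in> ball x0 s \<and> norm (snd q - \<phi>0 (fst q)) < c}"
  have s: "0 < s" "0 < c" "ball x0 s \<subseteq> S" and gh: "holomorphic2_on g (ball x0 s \<times> ball 0 c)" "holomorphic2_on h (ball x0 s \<times> ball 0 c)"
    and nz: "\<And>x. x \<in> ball x0 s \<Longrightarrow> x \<noteq> x0 \<Longrightarrow> h (x, 0) \<noteq> 0"
    and eq: "\<And>x z. x \<in> ball x0 s \<Longrightarrow> z \<in> ball 0 c \<Longrightarrow> z ^ d * h (x, z) \<noteq> 0 \<Longrightarrow> f (x, \<phi>0 x + z) * (z ^ d * h (x, z)) = g (x, z)"
    using pf by (auto simp: polar_form_def)
  have \<phi>h: "\<phi>0 holomorphic_on ball x0 s" by (rule holomorphic_on_subset[OF \<phi>0 s(3)])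
  have oC: "open (ball x0 s \<times> (UNIV :: complex set))" by (simp add: open_Times)
  have zC: "holomorphic2_on (\<lambda>q. snd q - \<phi>0 (fst q)) (ball x0 s \<times> UNIV)"
    by (intro holomorphic2_intros holomorphic2_on_fst_comp[OF \<phi>h] oC) auto
  have "open ((ball x0 s \<times> UNIV) \<inter> (\<lambda>q. snd q - \<phi>0 (fst q)) -` ball 0 c)"
    by (rule continuous_open_preimage[OF holomorphic2_on_imp_continuous_on[OF zC] oC]) auto
  moreover have "(ball x0 s \<times> UNIV) \<inter> (\<lambda>q. snd q - \<phi>0 (fst q)) -` ball 0 c = B" by (auto simp: B_def)
  ultimately have oB: "open B" by simp
  have zB: "holomorphic2_on (\<lambda>q. snd q - \<phi>0 (fst q)) B"
    by (rule holomorphic2_on_subset[OF zC oB]) (auto simp: B_def)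
  have cB: "holomorphic2_on (\<lambda>q. k (fst q, snd q - \<phi>0 (fst q))) B" if "holomorphic2_on k (ball x0 s \<times> ball 0 c)" for k
    by (rule holomorphic2_on_compose[OF that holomorphic2_on_fst[OF oB] zB]) (auto simp: B_def)
  have TB: "holomorphic2_on T B" unfolding T_def by (intro holomorphic2_intros zB cB[OF gh(2)])
  have GB: "holomorphic2_on G B" unfolding G_def by (rule cB[OF gh(1)])
  have UB: "U \<subseteq> B" "U = B \<inter> R" by (auto simp: U_def B_def)
  show oU: "open U" using oB R by (simp add: UB open_Int)
  show "holomorphic2_on T U" "holomorphic2_on G U" using TB GB oU UB(1) by (auto intro: holomorphic2_on_subset)
  have "connected ((\<lambda>q. (fst q, \<phi>0 (fst q) + snd q)) ` (ball x0 s \<times> ball 0 c))"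
  proof (rule connected_continuous_image)
    show "continuous_on (ball x0 s \<times> ball 0 c) (\<lambda>q. (fst q, \<phi>0 (fst q) + snd q))"
      by (intro continuous_intros continuous_on_compose2[OF holomorphic_on_imp_continuous_on[OF \<phi>h]]) auto
  qed (simp add: connected_Times)
  moreover have "(\<lambda>q. (fst q, \<phi>0 (fst q) + snd q)) ` (ball x0 s \<times> ball 0 c) = B"
  proof (intro equalityI subsetI)
    fix q assume "q \<in> B"
    then show "q \<in> (\<lambda>q. (fst q, \<phi>0 (fst q) + snd q)) ` (ball x0 s \<times> ball 0 c)"
      by (intro image_eqI[of _ _ "(fst q, snd q - \<phi>0 (fst q))"]) (auto simp: B_def)
  qed (auto simp: B_def)
  ultimately have conB: "connected B" by simp
  have "\<exists>w\<in>B. T w \<noteq> 0"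
  proof -
    define x where "x = x0 + of_real (s / 2)"
    have x: "x \<in> ball x0 s" "x \<noteq> x0" using s by (auto simp: x_def dist_norm)
    have hx: "(\<lambda>z. h (x, z)) holomorphic_on ball 0 c"
      by (rule holomorphic2_on_curve[OF gh(2)]) (use x in \<open>auto intro!: holomorphic_intros\<close>)
    have "isCont (\<lambda>z. h (x, z)) 0"
      using holomorphic_on_imp_continuous_on[OF hx] s by (auto simp: continuous_on_eq_continuous_at)
    then have "(\<lambda>z. h (x, z)) \<midarrow>0\<rightarrow> h (x, 0)" by (simp add: isCont_def)
    then have "\<forall>\<^sub>F z in at 0. h (x, z) \<noteq> 0" using nz[OF x] by (rule tendsto_imp_eventually_ne)
    moreover have "\<forall>\<^sub>F z in at 0. z \<in> ball 0 c - {0 :: complex}" by (rule eventually_at_in_open) (use s in auto)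
    ultimately have "\<forall>\<^sub>F z in at 0. h (x, z) \<noteq> 0 \<and> z \<in> ball 0 c - {0}" by eventually_elim auto
    then obtain z where "h (x, z) \<noteq> 0" "z \<in> ball 0 c - {0}" using eventually_happens[of _ "at (0::complex)"] by auto
    then show ?thesis using x by (intro bexI[of _ "(x, \<phi>0 x + z)"]) (auto simp: T_def B_def)
  qed
  then have "B \<subseteq> closure {w \<in> B. T w \<noteq> 0}" using holomorphic2_on_closure_nonzero[OF TB conB] by blast
  then have "U \<subseteq> closure (U \<inter> {w \<in> B. T w \<noteq> 0})" using UB by (intro open_subset_closure_Int oU) auto
  also have "\<dots> \<subseteq> closure {w \<in> U. f w * T w = G w}"
  proof (rule closure_mono, safe)
    fix w1 w2 assume w: "(w1, w2) \<in> U" "(w1, w2) \<in> B" "T (w1, w2) \<noteq> 0"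
    have "f (w1, \<phi>0 w1 + (w2 - \<phi>0 w1)) * ((w2 - \<phi>0 w1) ^ d * h (w1, w2 - \<phi>0 w1)) = g (w1, w2 - \<phi>0 w1)"
      by (rule eq) (use w in \<open>auto simp: B_def T_def\<close>)
    then show "f (w1, w2) * T (w1, w2) = G (w1, w2)" by (simp add: T_def G_def)
  qed
  finally show "U \<subseteq> closure {w \<in> U. f w * T w = G w}" .
qed

text \<open>\<open>S\<close> is the sum of the rescaled series. The conditions on
  \<open>\<kappa>\<close> say in turn that \<open>z / W x\<close> stays inside its disk of
  convergence, that \<open>z\<close> stays in the range of the expansion of \<open>f\<close>, and
  that points with \<open>norm z < \<kappa> * norm (W x)\<close> stay in the bidisk.\<close>

locale pinched_extension =
  fixes \<epsilon> \<rho> r1 r2 C \<kappa> :: real and f S :: "complex \<times> complex \<Rightarrow> complex" and \<phi>0 :: "complex \<Rightarrow> complex"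
    and \<Lambda> :: "complex set" and n0 D :: nat
  assumes \<rho>: "1 < \<rho>" "\<rho> < 1 + \<epsilon>" and f: "meromorphic2_on f (ring_domain \<epsilon>)"
    and \<phi>0: "\<phi>0 holomorphic_on ball 0 (1 + \<epsilon>)" and \<phi>0_less: "\<And>x. norm x < 1 + \<epsilon> \<Longrightarrow> norm (\<phi>0 x) < 1"
    and r: "0 < r1" "1 - \<epsilon> < r1" "r1 < r2" "r2 < 1"
    and \<Lambda>: "finite \<Lambda>" "\<Lambda> \<subseteq> cball 0 r1" and n0: "0 < n0" and C: "0 < C"
    and S: "holomorphic2_on S (ball 0 r2 \<times> ball 0 (1 / C))"
    and S_eq: "\<And>x z. r1 < norm x \<Longrightarrow> norm x < r2 \<Longrightarrow> z \<noteq> 0 \<Longrightarrow> C * norm z < 1 \<Longrightarrow>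
      S (x, z / (\<Prod>c\<in>\<Lambda>. x - c) ^ n0) = (\<Prod>c\<in>\<Lambda>. x - c) ^ n0 * (z ^ D * f (x, \<phi>0 x + z))"
    and f_hol: "holomorphic2_on f {q. r1 < norm (fst q) \<and> norm (fst q) < r2 \<and> snd q \<noteq> \<phi>0 (fst q) \<and>
      C * norm (snd q - \<phi>0 (fst q)) < 1}"
    and \<kappa>: "0 < \<kappa>" "\<kappa> * C < 1"
      "\<And>x. norm x < \<rho> \<Longrightarrow> \<kappa> * norm ((\<Prod>c\<in>\<Lambda>. x - c) ^ n0) * C < 1"
      "\<And>x. norm x < \<rho> \<Longrightarrow> norm (\<phi>0 x) + \<kappa> * norm ((\<Prod>c\<in>\<Lambda>. x - c) ^ n0) < 1"
begin

definition W :: "complex \<Rightarrow> complex" where "W x = (\<Prod>c\<in>\<Lambda>. x - c) ^ n0"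

definition r3 :: real where "r3 = (r1 + r2) / 2"

definition swept :: "(complex \<times> complex) set" where
  "swept = {q. norm (fst q) < \<rho> \<and> norm (snd q - \<phi>0 (fst q)) < \<kappa> * norm (W (fst q))}"

definition den :: "complex \<times> complex \<Rightarrow> complex" where
  "den q = W (fst q) * (snd q - \<phi>0 (fst q)) ^ D"

definition num :: "complex \<times> complex \<Rightarrow> complex" where
  "num q = S (fst q, (snd q - \<phi>0 (fst q)) / W (fst q))"

text \<open>The radius \<open>r3\<close> lies inside the annulus over which both expressions agree
  away from the limit graph, so where exactly one switches is immaterial.\<close>

definition ext :: "complex \<times> complex \<Rightarrow> complex" where
  "ext q = (if norm (fst q) < r3 then num q / den q else f q)"

lemma r3: "r1 < r3" "r3 < r2" using r by (auto simp: r3_def)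

lemma W_eq_0_iff: "W x = 0 \<longleftrightarrow> x \<in> \<Lambda>" using \<Lambda>(1) n0 by (auto simp: W_def)

lemma W_nonzero: "r1 < norm x \<Longrightarrow> W x \<noteq> 0" using \<Lambda>(2) by (auto simp: W_eq_0_iff)

lemma W_holomorphic: "W holomorphic_on A" unfolding W_def by (intro holomorphic_intros)

lemma zeros_W: "\<exists>n. zeros_at_most W A n"
proof -
  have "W = poly ((\<Prod>c\<in>\<Lambda>. [:- c, 1:]) ^ n0)" by (simp add: fun_eq_iff W_def poly_prod)
  moreover have "(\<Prod>c\<in>\<Lambda>. [:- c, 1:]) ^ n0 \<noteq> (0 :: complex poly)" using \<Lambda>(1) by simp
  ultimately show ?thesis using zeros_at_most_poly by metis
qed

lemma \<phi>0_\<rho>: "\<phi>0 holomorphic_on ball 0 \<rho>" by (rule holomorphic_on_subset[OF \<phi>0]) (use \<rho> in auto)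

lemma swept_W: "q \<in> swept \<Longrightarrow> W (fst q) \<noteq> 0" by (auto simp: swept_def)

lemma num_den:
  assumes q: "r1 < norm (fst q)" "norm (fst q) < r2" "q \<in> swept" "snd q \<noteq> \<phi>0 (fst q)"
  shows "num q = den q * f q"
proof -
  have x: "norm (fst q) < \<rho>" and z: "norm (snd q - \<phi>0 (fst q)) < \<kappa> * norm (W (fst q))" using q by (auto simp: swept_def)
  have "norm (snd q - \<phi>0 (fst q)) * C < \<kappa> * norm (W (fst q)) * C" using z C by simp
  also have "\<dots> < 1" using \<kappa>(3)[OF x] by (simp add: W_def)
  finally have "C * norm (snd q - \<phi>0 (fst q)) < 1" by (simp add: mult.commute)
  then have "num q = W (fst q) * ((snd q - \<phi>0 (fst q)) ^ D * f (fst q, \<phi>0 (fst q) + (snd q - \<phi>0 (fst q))))"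
    using S_eq[of "fst q" "snd q - \<phi>0 (fst q)"] q by (simp add: num_def W_def)
  then show ?thesis by (simp add: den_def mult_ac)
qed

lemma open_swept: "open swept"
proof -
  have o: "open (ball 0 \<rho> \<times> (UNIV :: complex set))" by (simp add: open_Times)
  have "continuous_on (ball 0 \<rho> \<times> UNIV) (\<lambda>q. norm (snd q - \<phi>0 (fst q)) - \<kappa> * norm (W (fst q)))"
    by (intro continuous_intros continuous_on_compose2[OF holomorphic_on_imp_continuous_on[OF \<phi>0_\<rho>]]
      continuous_on_compose2[OF holomorphic_on_imp_continuous_on[OF W_holomorphic]]) auto
  from continuous_open_preimage[OF this o, of "{..<0}"]
  have "open ((ball 0 \<rho> \<times> UNIV) \<inter> (\<lambda>q. norm (snd q - \<phi>0 (fst q)) - \<kappa> * norm (W (fst q))) -` {..<0})" by auto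
  moreover have "(ball 0 \<rho> \<times> UNIV) \<inter> (\<lambda>q. norm (snd q - \<phi>0 (fst q)) - \<kappa> * norm (W (fst q))) -` {..<0} = swept"
    by (auto simp: swept_def)
  ultimately show ?thesis by simp
qed

lemma swept_ring: "q \<in> swept \<Longrightarrow> 1 - \<epsilon> < norm (fst q) \<Longrightarrow> q \<in> ring_domain \<epsilon>"
proof -
  assume q: "q \<in> swept" "1 - \<epsilon> < norm (fst q)"
  have "norm (snd q) \<le> norm (\<phi>0 (fst q)) + norm (snd q - \<phi>0 (fst q))" by (metis norm_triangle_sub add.commute)
  also have "\<dots> < 1" using q(1) \<kappa>(4)[of "fst q"] by (auto simp: swept_def W_def)
  finally show ?thesis using q \<rho> by (cases q) (auto simp: ring_domain_def swept_def)
qed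

lemma holomorphic2_num_den:
  assumes U: "open U" "U \<subseteq> swept" "\<And>q. q \<in> U \<Longrightarrow> norm (fst q) < r2"
  shows "holomorphic2_on num U" "holomorphic2_on den U" "holomorphic2_on (\<lambda>q. snd q - \<phi>0 (fst q)) U"
proof -
  have z: "holomorphic2_on (\<lambda>q. snd q - \<phi>0 (fst q)) U"
    by (intro holomorphic2_intros holomorphic2_on_fst_comp[OF \<phi>0_\<rho>] U) (use U in \<open>auto simp: swept_def\<close>)
  have w: "holomorphic2_on (\<lambda>q. W (fst q)) U" by (rule holomorphic2_on_fst_comp[OF W_holomorphic open_UNIV U(1)]) auto
  show "holomorphic2_on (\<lambda>q. snd q - \<phi>0 (fst q)) U" by fact
  show "holomorphic2_on den U" unfolding den_def by (intro holomorphic2_intros z w)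
  show "holomorphic2_on num U" unfolding num_def
  proof (rule holomorphic2_on_compose[OF S holomorphic2_on_fst[OF U(1)]])
    show "holomorphic2_on (\<lambda>q. (snd q - \<phi>0 (fst q)) / W (fst q)) U"
      by (intro holomorphic2_intros z w) (use U swept_W in auto)
    fix q assume q: "q \<in> U"
    then have "W (fst q) \<noteq> 0" "norm (snd q - \<phi>0 (fst q)) < \<kappa> * norm (W (fst q))" using U swept_W by (auto simp: swept_def)
    then have "norm ((snd q - \<phi>0 (fst q)) / W (fst q)) < \<kappa>" by (simp add: norm_divide field_simps)
    also have "\<kappa> < 1 / C" using \<kappa>(2) C by (simp add: field_simps)
    finally show "(fst q, (snd q - \<phi>0 (fst q)) / W (fst q)) \<in> ball 0 r2 \<times> ball 0 (1 / C)" using U(3)[OF q] by simp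
  qed
qed

lemma off_graph_dense:
  assumes U: "open U"
  shows "U \<subseteq> closure (U \<inter> {q. snd q \<noteq> \<phi>0 (fst q)})"
proof
  fix q assume q: "q \<in> U"
  show "q \<in> closure (U \<inter> {q. snd q \<noteq> \<phi>0 (fst q)})"
    unfolding closure_approachable
  proof (intro allI impI)
    fix e :: real assume e: "0 < e"
    obtain \<delta> where \<delta>: "0 < \<delta>" "ball q \<delta> \<subseteq> U" using U q open_contains_ball by blast
    define t where "t = (if snd q = \<phi>0 (fst q) then min \<delta> e / 2 else 0)"
    have t: "0 \<le> t" "t < \<delta>" "t < e" using \<delta> e by (auto simp: t_def)
    define p where "p = (fst q, snd q + of_real t)"
    have d: "dist p q = t" using t by (simp add: p_def dist_prod_def dist_norm)
    have "p \<in> U" using d t \<delta> by (auto simp: dist_commute)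
    moreover have "snd p \<noteq> \<phi>0 (fst p)" using \<delta> e by (auto simp: p_def t_def)
    ultimately show "\<exists>y\<in>U \<inter> {q. snd q \<noteq> \<phi>0 (fst q)}. dist y q < e" using d t by (intro bexI[of _ p]) auto
  qed
qed

definition V where "V = {q \<in> swept. 1 - \<epsilon> < norm (fst q) \<and> norm (fst q) < r2}"

lemma V: "open V" "V \<subseteq> ring_domain \<epsilon>" "holomorphic2_on den V" "holomorphic2_on num V"
proof -
  have "open (swept \<inter> {q. 1 - \<epsilon> < norm (fst q)} \<inter> {q. norm (fst q) < r2})"
    by (intro open_Int open_swept open_Collect_less continuous_intros)
  moreover have "swept \<inter> {q. 1 - \<epsilon> < norm (fst q)} \<inter> {q. norm (fst q) < r2} = V" by (auto simp: V_def)
  ultimately show o: "open V" by simp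
  show "V \<subseteq> ring_domain \<epsilon>" using swept_ring by (auto simp: V_def)
  show "holomorphic2_on den V" "holomorphic2_on num V" by (rule holomorphic2_num_den[OF o]; auto simp: V_def)+
qed

text \<open>The relation is known for \<open>r1 < norm (fst q)\<close> off the limit graph, but the
  ring may reach further inwards. \<open>V\<close> is connected, being the image of an annulus minus
  finitely many points times a disk under \<open>(x, t) \<mapsto> (x, \<phi>0 x + W x * t)\<close>,
  so the identity theorem carries the relation over all of it.\<close>

lemma V_dense: "V \<subseteq> closure {w \<in> V. f w * den w = num w}"
proof (rule meromorphic2_identity[OF f V(1) _ V(2-4)])
  define A where "A = {x :: complex. 1 - \<epsilon> < norm (x - 0) \<and> norm (x - 0) < r2} - \<Lambda>"
  have oA: "open {x :: complex. 1 - \<epsilon> < norm (x - 0) \<and> norm (x - 0) < r2}"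
    by (intro open_Collect_conj open_Collect_less continuous_intros)
  have cA: "connected A" unfolding A_def
    by (intro connected_open_delete_finite oA connected_annulus \<Lambda>(1)) simp_all
  have A\<rho>: "A \<subseteq> ball 0 \<rho>" using r \<rho> by (auto simp: A_def)
  have "connected ((\<lambda>q. (fst q, \<phi>0 (fst q) + W (fst q) * snd q)) ` (A \<times> ball 0 \<kappa>))"
  proof (rule connected_continuous_image)
    show "continuous_on (A \<times> ball 0 \<kappa>) (\<lambda>q. (fst q, \<phi>0 (fst q) + W (fst q) * snd q))"
      by (intro continuous_intros continuous_on_compose2[OF holomorphic_on_imp_continuous_on[OF \<phi>0_\<rho>]]
          continuous_on_compose2[OF holomorphic_on_imp_continuous_on[OF W_holomorphic]]) (use A\<rho> in auto)
  qed (use cA in \<open>simp add: connected_Times\<close>)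
  moreover have "(\<lambda>q. (fst q, \<phi>0 (fst q) + W (fst q) * snd q)) ` (A \<times> ball 0 \<kappa>) = V"
  proof (intro equalityI subsetI)
    fix q assume "q \<in> V"
    then have q: "W (fst q) \<noteq> 0" "norm (snd q - \<phi>0 (fst q)) < \<kappa> * norm (W (fst q))" "fst q \<in> A"
      using swept_W by (auto simp: V_def swept_def A_def W_eq_0_iff)
    then have "norm ((snd q - \<phi>0 (fst q)) / W (fst q)) < \<kappa>" by (simp add: norm_divide field_simps)
    then show "q \<in> (\<lambda>q. (fst q, \<phi>0 (fst q) + W (fst q) * snd q)) ` (A \<times> ball 0 \<kappa>)"
      using q by (intro image_eqI[of _ _ "(fst q, (snd q - \<phi>0 (fst q)) / W (fst q))"]) auto
  next
    fix q assume "q \<in> (\<lambda>q. (fst q, \<phi>0 (fst q) + W (fst q) * snd q)) ` (A \<times> ball 0 \<kappa>)"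
    then obtain x t where q: "q = (x, \<phi>0 x + W x * t)" "x \<in> A" "norm t < \<kappa>" by (force simp del: mult_cancel_left)
    then have "W x \<noteq> 0" by (auto simp: A_def W_eq_0_iff)
    then have "norm (W x * t) < \<kappa> * norm (W x)" using q by (simp add: norm_mult mult.commute)
    moreover have "norm x < \<rho>" using q(2) A\<rho> by auto
    ultimately show "q \<in> V" using q by (auto simp: V_def swept_def A_def)
  qed
  ultimately show "connected V" by simp
next
  define N where "N = {q \<in> V. r1 < norm (fst q)} \<inter> {q. snd q \<noteq> \<phi>0 (fst q)}"
  have "open (V \<inter> {q. r1 < norm (fst q)})" by (intro open_Int V open_Collect_less continuous_intros)
  moreover have VV: "V \<inter> {q. r1 < norm (fst q)} = {q \<in> V. r1 < norm (fst q)}" by auto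
  ultimately have oV: "open {q \<in> V. r1 < norm (fst q)}" by simp
  have "N = {w \<in> {q \<in> V. r1 < norm (fst q)}. snd w - \<phi>0 (fst w) \<noteq> 0}" by (auto simp: N_def)
  moreover have "open {w \<in> {q \<in> V. r1 < norm (fst q)}. snd w - \<phi>0 (fst w) \<noteq> 0}"
    by (intro open_nonzero_set holomorphic2_num_den oV) (auto simp: V_def)
  ultimately show "open N" by simp
  show "N \<subseteq> V" by (auto simp: N_def)
  have "(of_real r3, \<phi>0 (of_real r3)) \<in> V"
    using W_nonzero[of "of_real r3"] r r3 \<rho> \<kappa>(1) by (auto simp: V_def swept_def)
  then have "{q \<in> V. r1 < norm (fst q)} \<noteq> {}" using r r3 by (intro ex_in_conv[THEN iffD1] exI[of _ "(of_real r3, \<phi>0 (of_real r3))"]) auto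
  then show "N \<noteq> {}" using off_graph_dense[OF oV] unfolding N_def by auto
  show "f w * den w = num w" if "w \<in> N" for w
    using num_den[of w] that by (auto simp: N_def V_def mult.commute)
qed

lemma ext_eq:
  assumes q: "q \<in> swept" "snd q \<noteq> \<phi>0 (fst q)" "norm (fst q) < r2"
  shows "ext q * den q = num q"
proof (cases "norm (fst q) < r3")
  case True
  have "den q \<noteq> 0" using q swept_W by (auto simp: den_def)
  then show ?thesis using True by (simp add: ext_def)
next
  case False
  then show ?thesis using num_den[of q] q r3 by (auto simp: ext_def mult.commute)
qed

lemma ext_meromorphic:
  assumes P: "open P" "P \<subseteq> swept"
  shows "meromorphic2_on ext P"
  unfolding meromorphic2_on_def
proof (intro conjI ballI P(1))
  fix q assume q: "q \<in> P"
  let ?Q = "\<lambda>W g h. connected W \<and> q \<in> W \<and> W \<subseteq> P \<and> holomorphic2_on g W \<and> holomorphic2_on h W \<and> (\<exists>w\<in>W. h w \<noteq> 0) \<and>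
        (\<forall>w\<in>W. h w \<noteq> 0 \<longrightarrow> ext w = g w / h w)"
  show "\<exists>W g h. ?Q W g h"
  proof (cases "norm (fst q) < r2")
    case True
    have "open (P \<inter> {q. norm (fst q) < r2})" by (intro open_Int P open_Collect_less continuous_intros)
    then obtain e where e: "0 < e" "ball q e \<subseteq> P \<inter> {q. norm (fst q) < r2}" using q True open_contains_ball by blast
    have hol: "holomorphic2_on num (ball q e)" "holomorphic2_on den (ball q e)" "holomorphic2_on (\<lambda>q. snd q - \<phi>0 (fst q)) (ball q e)"
      by (rule holomorphic2_num_den; use e P in auto)+
    \<comment> \<open>The additional factor \<open>snd q - \<phi>0 (fst q)\<close> removes the limit
      graph from the points where the quotient must equal \<open>ext\<close>: for
      \<open>D = 0\<close> the function \<open>den\<close> does not vanish there, but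
      \<open>f\<close> may have arbitrary values.\<close>
    have "?Q (ball q e) (\<lambda>q. num q * (snd q - \<phi>0 (fst q))) (\<lambda>q. den q * (snd q - \<phi>0 (fst q)))"
    proof (intro conjI ballI impI connected_ball)
      show "holomorphic2_on (\<lambda>q. num q * (snd q - \<phi>0 (fst q))) (ball q e)" by (rule holomorphic2_on_mult[OF hol(1,3)])
      show "holomorphic2_on (\<lambda>q. den q * (snd q - \<phi>0 (fst q))) (ball q e)" by (rule holomorphic2_on_mult[OF hol(2,3)])
      show "q \<in> ball q e" "ball q e \<subseteq> P" using e by auto
      have "ball q e \<inter> {q. snd q \<noteq> \<phi>0 (fst q)} \<noteq> {}" using off_graph_dense[of "ball q e"] e(1) by auto
      then obtain w where w: "w \<in> ball q e" "snd w \<noteq> \<phi>0 (fst w)" by blast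
      then have "W (fst w) \<noteq> 0" using e P swept_W by blast
      then show "\<exists>w\<in>ball q e. den w * (snd w - \<phi>0 (fst w)) \<noteq> 0" using w by (intro bexI[of _ w]) (auto simp: den_def)
      fix w assume w: "w \<in> ball q e" "den w * (snd w - \<phi>0 (fst w)) \<noteq> 0"
      have "w \<in> swept" "norm (fst w) < r2" using w(1) e P by auto
      then have "ext w * den w = num w" using w(2) by (intro ext_eq) auto
      then have "num w * (snd w - \<phi>0 (fst w)) = ext w * (den w * (snd w - \<phi>0 (fst w)))" by simp
      then show "ext w = num w * (snd w - \<phi>0 (fst w)) / (den w * (snd w - \<phi>0 (fst w)))" using w(2) by (simp add: nonzero_eq_divide_eq)
    qed
    then show ?thesis by blast
  next
    case False
    then have "1 - \<epsilon> < norm (fst q)" using r by linarith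
    then have qR: "q \<in> ring_domain \<epsilon>" using q P swept_ring by blast
    obtain U g h where U: "connected U" "open U" "q \<in> U" "U \<subseteq> ring_domain \<epsilon>" "holomorphic2_on g U" "holomorphic2_on h U"
      "\<exists>w\<in>U. h w \<noteq> 0" "\<And>w. w \<in> U \<Longrightarrow> h w \<noteq> 0 \<Longrightarrow> f w = g w / h w"
      using meromorphic2_onE[OF f qR] by blast
    have "open (P \<inter> U \<inter> {q. r3 < norm (fst q)})" by (intro open_Int P U open_Collect_less continuous_intros)
    moreover have "q \<in> P \<inter> U \<inter> {q. r3 < norm (fst q)}" using q U False r3 by auto
    ultimately obtain e where e: "0 < e" "ball q e \<subseteq> P \<inter> U \<inter> {q. r3 < norm (fst q)}" using open_contains_ball by blast
    have "?Q (ball q e) g h"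
    proof (intro conjI ballI impI connected_ball)
      show "q \<in> ball q e" "ball q e \<subseteq> P" using e by auto
      show "holomorphic2_on g (ball q e)" "holomorphic2_on h (ball q e)" using U(5,6) e by (auto intro: holomorphic2_on_subset)
      have "ball q e \<inter> U \<noteq> {}" using U(3) e(1) by (metis IntI centre_in_ball empty_iff)
      then show "\<exists>w\<in>ball q e. h w \<noteq> 0" using holomorphic2_on_nonzero_dense[OF U(6,1,7) open_ball] by blast
      fix w assume w: "w \<in> ball q e" "h w \<noteq> 0"
      then show "ext w = g w / h w" using U(8)[of w] e by (auto simp: ext_def)
    qed
    then show ?thesis by blast
  qed
qed

text \<open>Where \<open>norm (fst q)\<close> is at least \<open>r3\<close> both functions are
  literally equal. Inside, the points off the limit graph are dense and \<open>den\<close> does not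
  vanish at them, so the dense relation with \<open>f\<close> may be divided by
  \<open>den\<close>.\<close>

lemma ext_meromorphic_eq:
  assumes P: "open P" "P \<subseteq> swept"
  shows "meromorphic_eq (P \<inter> ring_domain \<epsilon>) ext f"
  unfolding meromorphic_eq_def
proof
  let ?A = "{w \<in> P \<inter> ring_domain \<epsilon>. ext w = f w}"
  fix q assume q: "q \<in> P \<inter> ring_domain \<epsilon>"
  show "q \<in> closure ?A"
  proof (cases "norm (fst q) < r3")
    case False
    then have "q \<in> ?A" using q by (simp add: ext_def)
    then show ?thesis by (rule subsetD[OF closure_subset])
  next
    case True
    define U where "U = P \<inter> V \<inter> {q. norm (fst q) < r3}"
    have oU: "open U" unfolding U_def by (intro open_Int P V open_Collect_less continuous_intros)
    have "q \<in> V" using q True P r3 by (auto simp: V_def ring_domain_def)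
    then have qU: "q \<in> U" using q True by (simp add: U_def)
    define Z where "Z = {w \<in> U. snd w - \<phi>0 (fst w) \<noteq> 0}"
    have oZ: "open Z" unfolding Z_def by (intro open_nonzero_set holomorphic2_num_den oU) (auto simp: U_def V_def)
    have "Z = U \<inter> {q. snd q \<noteq> \<phi>0 (fst q)}" by (auto simp: Z_def)
    then have qZ: "q \<in> closure Z" using off_graph_dense[OF oU] qU by auto
    have "Z \<subseteq> closure (Z \<inter> {w \<in> V. f w * den w = num w})"
      using V_dense by (intro open_subset_closure_Int oZ) (auto simp: Z_def U_def)
    also have "\<dots> \<subseteq> closure ?A"
    proof (rule closure_mono, rule subsetI)
      fix w assume w: "w \<in> Z \<inter> {w \<in> V. f w * den w = num w}"
      have "den w \<noteq> 0" using w swept_W[of w] by (auto simp: Z_def U_def V_def den_def)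
      moreover have "w \<in> P" "w \<in> V" "norm (fst w) < r3" "f w * den w = num w" using w by (auto simp: Z_def U_def)
      ultimately have "num w / den w = f w" "w \<in> P" "w \<in> ring_domain \<epsilon>" "norm (fst w) < r3"
        using V(2) by (auto simp: nonzero_divide_eq_eq)
      then show "w \<in> ?A" by (simp add: ext_def)
    qed
    finally show ?thesis using qZ closure_minimal[of Z "closure ?A"] by auto
  qed
qed

end

section \<open>Restrictions to graphs with a uniform number of poles\<close>

context pinched_extension
begin

definition graph_fun :: "(complex \<Rightarrow> complex) \<Rightarrow> complex \<Rightarrow> complex" where
  "graph_fun \<alpha> x = \<phi>0 x + W x * \<alpha> x"

lemma graph_swept:
  "norm x < \<rho> \<Longrightarrow> W x \<noteq> 0 \<Longrightarrow> norm (\<alpha> x) < \<kappa> \<Longrightarrow> (x, graph_fun \<alpha> x) \<in> swept"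
  by (simp add: swept_def graph_fun_def norm_mult mult.commute)

text \<open>Over the inner disk the restriction is \<open>S (x, \<alpha> x)\<close> divided by
  powers of \<open>W\<close> and \<open>\<alpha>\<close>; over the remaining compact annulus it is
  controlled by finitely many polar forms. Each piece has a denominator with a bounded number of
  zeros. The graph enters the final bound only through \<open>n\<alpha>\<close> and the
  \<open>nh x0\<close>.\<close>

lemma restriction_extends:
  assumes \<alpha>: "\<alpha> holomorphic_on ball 0 (1 + \<epsilon>)" "\<And>x. x \<in> ball 0 (1 + \<epsilon>) \<Longrightarrow> norm (\<alpha> x) < \<kappa>"
    and z\<alpha>: "zeros_at_most \<alpha> (ball 0 \<rho>) n\<alpha>" and zW: "zeros_at_most W UNIV nW"
    and J: "finite J" "\<And>x0. x0 \<in> J \<Longrightarrow> polar_form f \<phi>0 {x. r1 < norm x \<and> norm x < 1 + \<epsilon>} x0 (s x0) (c x0) (d x0) (g x0) (h x0)"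
    and cov: "{x. r3 \<le> norm x \<and> norm x \<le> \<rho>} \<subseteq> (\<Union>x0\<in>J. ball x0 (s x0 / 2))"
    and small: "\<And>x0 x. x0 \<in> J \<Longrightarrow> x \<in> ball x0 (s x0) \<Longrightarrow> norm (W x * \<alpha> x) < c x0"
    and zh: "\<And>x0. x0 \<in> J \<Longrightarrow> zeros_at_most (\<lambda>x. h x0 (x, W x * \<alpha> x)) (ball x0 (s x0 / 2)) (nh x0)"
  shows "\<exists>u. restriction_extends_to f (ring_domain \<epsilon>) (ball 0 \<rho>) (graph_fun \<alpha>) u \<and>
    poles_at_most u (ball 0 \<rho>) ((nW + (nW + n\<alpha>) * (D + 1)) + (\<Sum>x0\<in>J. (nW + n\<alpha>) * (d x0 + 1) + nh x0))"
proof -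
  let ?S1 = "{x :: complex. r1 < norm x \<and> norm x < 1 + \<epsilon>}"
  have oS1: "open ?S1" by (intro open_Collect_conj open_Collect_less continuous_intros)
  define \<beta> where "\<beta> x = W x * \<alpha> x" for x
  have \<psi>: "graph_fun \<alpha> x = \<phi>0 x + \<beta> x" for x by (simp add: graph_fun_def \<beta>_def)
  define u0 where "u0 x = (if norm x < r3 then S (x, \<alpha> x) / (W x * \<beta> x ^ D) else f (x, \<phi>0 x + \<beta> x))" for x
  define u where "u = remove_sings u0"
  \<comment> \<open>\<open>None\<close> is the inner disk, \<open>Some x0\<close> a polar disk. The
    exponents are raised by \<open>1\<close> so that the denominators vanish where the graph meets
    the limit graph: values of \<open>f\<close> at such points are arbitrary.\<close>
  define Hf where "Hf i x = (case i of None \<Rightarrow> W x * \<beta> x ^ (D + 1) | Some x0 \<Rightarrow> \<beta> x ^ (d x0 + 1) * h x0 (x, \<beta> x))" for i x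
  define Gf where "Gf i x = (case i of None \<Rightarrow> S (x, \<alpha> x) * \<beta> x | Some x0 \<Rightarrow> g x0 (x, \<beta> x) * \<beta> x)" for i x
  define Vf where "Vf i = (case i of None \<Rightarrow> ball 0 r2 | Some x0 \<Rightarrow> ball x0 (s x0 / 2) \<inter> ball 0 \<rho>)" for i
  define nf where "nf i = (case i of None \<Rightarrow> nW + (nW + n\<alpha>) * (D + 1) | Some x0 \<Rightarrow> (nW + n\<alpha>) * (d x0 + 1) + nh x0)" for i
  define I where "I = insert None (Some ` J)"
  have r2\<rho>: "ball 0 r2 \<subseteq> ball (0::complex) \<rho>" "ball 0 \<rho> \<subseteq> ball (0::complex) (1 + \<epsilon>)" using r \<rho> by auto
  have \<beta>h: "\<beta> holomorphic_on ball 0 (1 + \<epsilon>)" unfolding \<beta>_def by (intro holomorphic_intros W_holomorphic \<alpha>)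
  have on: "f (x, \<phi>0 x + \<beta> x) * (W x * \<beta> x ^ D) = S (x, \<alpha> x)" if x: "r1 < norm x" "norm x < r2" "\<beta> x \<noteq> 0" for x
  proof -
    have "W x \<noteq> 0" "norm (\<alpha> x) < \<kappa>" "norm x < \<rho>" using W_nonzero[OF x(1)] \<alpha>(2)[of x] x r2\<rho> r \<rho> by auto
    then show ?thesis using num_den[of "(x, graph_fun \<alpha> x)"] graph_swept[of x \<alpha>] x
      by (auto simp: num_def den_def \<psi> \<beta>_def mult_ac)
  qed
  have u0_ring: "u0 x = f (x, \<phi>0 x + \<beta> x)" if x: "r1 < norm x" "\<beta> x \<noteq> 0" for x
  proof (cases "norm x < r3")
    case True
    then have "f (x, \<phi>0 x + \<beta> x) * (W x * \<beta> x ^ D) = S (x, \<alpha> x)" using on x r3 by auto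
    moreover have "W x * \<beta> x ^ D \<noteq> 0" using W_nonzero[OF x(1)] x(2) by simp
    ultimately have "f (x, \<phi>0 x + \<beta> x) = S (x, \<alpha> x) / (W x * \<beta> x ^ D)" by (simp add: nonzero_eq_divide_eq)
    then show ?thesis using True by (simp add: u0_def)
  qed (simp add: u0_def)
  have u0_in: "u0 x * (W x * \<beta> x ^ D) = S (x, \<alpha> x)" if x: "norm x < r2" "W x \<noteq> 0" "\<beta> x \<noteq> 0" for x
  proof (cases "norm x < r3")
    case False
    then show ?thesis using on[of x] x r3 by (simp add: u0_def)
  qed (use x in \<open>simp add: u0_def\<close>)
  have pf: "0 < s x0" "ball x0 (s x0) \<subseteq> ?S1" "holomorphic2_on (g x0) (ball x0 (s x0) \<times> ball 0 (c x0))"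
     "\<And>x z. x \<in> ball x0 (s x0) \<Longrightarrow> z \<in> ball 0 (c x0) \<Longrightarrow> z ^ d x0 * h x0 (x, z) \<noteq> 0 \<Longrightarrow>
        f (x, \<phi>0 x + z) * (z ^ d x0 * h x0 (x, z)) = g x0 (x, z)" if "x0 \<in> J" for x0
    using J(2)[OF that] by (auto simp: polar_form_def)
  have half: "x \<in> ball x0 (s x0)" if "x \<in> ball x0 (s x0 / 2)" "x0 \<in> J" for x x0 using that pf(1)[OF that(2)] by auto
  have u0_pf: "u0 x * (\<beta> x ^ d x0 * h x0 (x, \<beta> x)) = g x0 (x, \<beta> x)"
    if x: "x0 \<in> J" "x \<in> ball x0 (s x0)" "\<beta> x \<noteq> 0" "h x0 (x, \<beta> x) \<noteq> 0" for x x0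
  proof -
    have "r1 < norm x" using pf(2)[OF x(1)] x(2) by blast
    then have "u0 x = f (x, \<phi>0 x + \<beta> x)" using x(3) by (rule u0_ring)
    moreover have "\<beta> x \<in> ball 0 (c x0)" using small[OF x(1,2)] by (simp add: \<beta>_def)
    ultimately show ?thesis using pf(4)[OF x(1,2), of "\<beta> x"] x by simp
  qed
  have fI: "finite I" using J(1) by (simp add: I_def)
  have oV: "open (Vf i)" for i by (auto simp: Vf_def split: option.splits)
  have z\<beta>: "zeros_at_most (\<lambda>x. \<beta> x ^ m) A ((nW + n\<alpha>) * m)" if "A \<subseteq> ball 0 \<rho>" for m A
  proof -
    have "zeros_at_most (\<lambda>x. W x * \<alpha> x) A (nW + n\<alpha>)"
      by (intro zeros_at_most_mult zeros_at_most_subset[OF zW] zeros_at_most_subset[OF z\<alpha>]) (use that in auto)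
    from zeros_at_most_power[OF this, of m] show ?thesis unfolding \<beta>_def by (simp add: mult.commute)
  qed
  have zH: "zeros_at_most (Hf i) (Vf i) (nf i)" if "i \<in> I" for i
  proof (cases i)
    case None
    have "zeros_at_most (\<lambda>x. W x * \<beta> x ^ (D + 1)) (ball 0 r2) (nW + (nW + n\<alpha>) * (D + 1))"
      by (intro zeros_at_most_mult z\<beta> r2\<rho> zeros_at_most_subset[OF zW]) simp
    then show ?thesis using None by (simp add: Hf_def[abs_def] Vf_def nf_def)
  next
    case (Some x0)
    then have x0: "x0 \<in> J" using that by (auto simp: I_def)
    have "zeros_at_most (\<lambda>x. \<beta> x ^ (d x0 + 1) * h x0 (x, \<beta> x)) (ball x0 (s x0 / 2) \<inter> ball 0 \<rho>) ((nW + n\<alpha>) * (d x0 + 1) + nh x0)"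
      unfolding \<beta>_def
      by (intro zeros_at_most_mult z\<beta>[unfolded \<beta>_def] zeros_at_most_subset[OF zh[OF x0]]) auto
    then show ?thesis using Some by (simp add: Hf_def[abs_def] Vf_def nf_def)
  qed
  have hG: "Gf i holomorphic_on Vf i" if "i \<in> I" for i
  proof (cases i)
    case None
    have "(\<lambda>x. S (x, \<alpha> x)) holomorphic_on ball 0 r2"
    proof (rule holomorphic2_on_curve[OF S])
      show "\<alpha> holomorphic_on ball 0 r2" by (rule holomorphic_on_subset[OF \<alpha>(1)]) (use r2\<rho> in blast)
      fix x :: complex assume x: "x \<in> ball 0 r2"
      then have "norm (\<alpha> x) < \<kappa>" using \<alpha>(2) r2\<rho> by blast
      also have "\<kappa> < 1 / C" using \<kappa>(2) C by (simp add: field_simps)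
      finally show "(x, \<alpha> x) \<in> ball 0 r2 \<times> ball 0 (1 / C)" using x by simp
    qed (auto intro!: holomorphic_intros)
    then have "(\<lambda>x. S (x, \<alpha> x) * \<beta> x) holomorphic_on ball 0 r2"
      by (intro holomorphic_intros holomorphic_on_subset[OF \<beta>h]) (use r \<rho> in auto)
    then show ?thesis using None by (simp add: Gf_def[abs_def] Vf_def)
  next
    case (Some x0)
    then have x0: "x0 \<in> J" using that by (auto simp: I_def)
    have "(\<lambda>x. g x0 (x, \<beta> x)) holomorphic_on ball x0 (s x0 / 2) \<inter> ball 0 \<rho>"
    proof (rule holomorphic2_on_curve[OF pf(3)[OF x0]])
      fix x assume "x \<in> ball x0 (s x0 / 2) \<inter> ball 0 \<rho>"
      then have "x \<in> ball x0 (s x0)" using half x0 by blast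
      then show "(x, \<beta> x) \<in> ball x0 (s x0) \<times> ball 0 (c x0)" using small[OF x0] by (simp add: \<beta>_def)
    qed (use r2\<rho> in \<open>auto intro!: holomorphic_intros holomorphic_on_subset[OF \<beta>h]\<close>)
    then have "(\<lambda>x. g x0 (x, \<beta> x) * \<beta> x) holomorphic_on ball x0 (s x0 / 2) \<inter> ball 0 \<rho>"
      by (intro holomorphic_intros holomorphic_on_subset[OF \<beta>h]) (use r \<rho> in auto)
    then show ?thesis using Some by (simp add: Gf_def[abs_def] Vf_def)
  qed
  have uHG: "u0 x * Hf i x = Gf i x" if i: "i \<in> I" "x \<in> Vf i" "Hf i x \<noteq> 0" for i x
  proof (cases i)
    case None
    then show ?thesis using u0_in[of x] i by (auto simp: Hf_def Gf_def Vf_def mult_ac)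
  next
    case (Some x0)
    then have x0: "x0 \<in> J" using i by (auto simp: I_def)
    have "x \<in> ball x0 (s x0)" "\<beta> x \<noteq> 0" "h x0 (x, \<beta> x) \<noteq> 0" using i Some half[OF _ x0] by (auto simp: Hf_def Vf_def)
    from u0_pf[OF x0 this] have "u0 x * (\<beta> x ^ d x0 * h x0 (x, \<beta> x)) * \<beta> x = g x0 (x, \<beta> x) * \<beta> x" by simp
    then show ?thesis using Some by (simp add: Hf_def Gf_def mult_ac)
  qed
  have covV: "ball 0 \<rho> \<subseteq> (\<Union>i\<in>I. Vf i)"
  proof
    fix x :: complex assume x: "x \<in> ball 0 \<rho>"
    show "x \<in> (\<Union>i\<in>I. Vf i)"
    proof (cases "norm x < r2")
      case False
      then have "x \<in> {x. r3 \<le> norm x \<and> norm x \<le> \<rho>}" using x r3 by auto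
      then obtain x0 where "x0 \<in> J" "x \<in> ball x0 (s x0 / 2)" using cov by blast
      then show ?thesis using x by (intro UN_I[of "Some x0"]) (auto simp: I_def Vf_def)
    qed (auto simp: I_def Vf_def)
  qed
  note rem = remove_sings_poles_at_most[OF open_ball fI oV covV zH hG uHG]
  have nI: "(\<Sum>i\<in>I. nf i) = (nW + (nW + n\<alpha>) * (D + 1)) + (\<Sum>x0\<in>J. (nW + n\<alpha>) * (d x0 + 1) + nh x0)"
    using J(1) by (simp add: I_def nf_def sum.reindex)
  have nzH: "\<forall>\<^sub>F x in at \<zeta>. Hf i x \<noteq> 0" if "i \<in> I" "\<zeta> \<in> Vf i" for i \<zeta>
    by (rule zeros_at_most_eventually_nonzero[OF zH oV]) (use that in auto)
  have cont: "isCont (graph_fun \<alpha>) \<zeta>" if "\<zeta> \<in> ball 0 \<rho>" for \<zeta>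
  proof -
    have "graph_fun \<alpha> holomorphic_on ball 0 \<rho>"
      unfolding graph_fun_def by (intro holomorphic_intros \<phi>0_\<rho> W_holomorphic holomorphic_on_subset[OF \<alpha>(1) r2\<rho>(2)])
    then show ?thesis using that holomorphic_on_imp_continuous_on continuous_on_eq_continuous_at[of "ball 0 \<rho>"] by blast
  qed
  have ring: "(x, graph_fun \<alpha> x) \<in> ring_domain \<epsilon>" if x: "r1 < norm x" "norm x < \<rho>" for x
    using graph_swept[of x \<alpha>] swept_ring[of "(x, graph_fun \<alpha> x)"] W_nonzero[of x] \<alpha>(2)[of x] x r \<rho> by auto
  \<comment> \<open>Every regular value over the ring has to be matched, also inwards of
    \<open>r1\<close>; there the relation obtained on \<open>V\<close> by analytic continuation is
    used, and the polar forms further out.\<close>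
  have val: "u \<zeta> = v" if \<zeta>: "\<zeta> \<in> ball 0 \<rho>" "(\<zeta>, graph_fun \<alpha> \<zeta>) \<in> ring_domain \<epsilon>"
      and v: "has_regular_value f (\<zeta>, graph_fun \<alpha> \<zeta>) v" for \<zeta> v
  proof (cases "norm \<zeta> < r2")
    case True
    have \<zeta>': "1 - \<epsilon> < norm \<zeta>" using \<zeta>(2) by (simp add: ring_domain_def)
    have "open {x :: complex. 1 - \<epsilon> < norm x \<and> norm x < r2}" by (intro open_Collect_conj open_Collect_less continuous_intros)
    then have e1: "\<forall>\<^sub>F x in at \<zeta>. x \<in> {x. 1 - \<epsilon> < norm x \<and> norm x < r2} - {\<zeta>}"
      by (rule eventually_at_in_open) (use True \<zeta>' in auto)
    have e2: "\<forall>\<^sub>F x in at \<zeta>. Hf None x \<noteq> 0" by (rule nzH) (use True in \<open>auto simp: I_def Vf_def\<close>)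
    have ev: "\<forall>\<^sub>F x in at \<zeta>. (x, graph_fun \<alpha> x) \<in> V \<and> den (x, graph_fun \<alpha> x) \<noteq> 0 \<and>
       u0 x * den (x, graph_fun \<alpha> x) = num (x, graph_fun \<alpha> x)"
      using e1 e2
    proof eventually_elim
      case (elim x)
      then have x: "1 - \<epsilon> < norm x" "norm x < r2" "W x \<noteq> 0" "\<beta> x \<noteq> 0" by (auto simp: Hf_def)
      have "x \<in> ball 0 \<rho>" using x(2) r2\<rho>(1) by auto
      then have "(x, graph_fun \<alpha> x) \<in> swept" using graph_swept[OF _ x(3)] \<alpha>(2) r2\<rho>(2) by auto
      then have "(x, graph_fun \<alpha> x) \<in> V" using x by (simp add: V_def)
      moreover have "den (x, graph_fun \<alpha> x) = W x * \<beta> x ^ D" by (simp add: den_def \<psi>)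
      moreover have "num (x, graph_fun \<alpha> x) = S (x, \<alpha> x)" using x(3) by (simp add: num_def \<psi> \<beta>_def)
      ultimately show ?case using u0_in[OF x(2-4)] x by simp
    qed
    show ?thesis unfolding u_def
      by (rule remove_sings_eq_regular_value[OF f V(1-4) V_dense cont[OF \<zeta>(1)] ev v])
  next
    case False
    then have "\<zeta> \<in> {x. r3 \<le> norm x \<and> norm x \<le> \<rho>}" using \<zeta>(1) r3 by auto
    then obtain x0 where x0: "x0 \<in> J" "\<zeta> \<in> ball x0 (s x0 / 2)" using cov by blast
    have oR: "open (ring_domain \<epsilon>)" using f by (simp add: meromorphic2_on_def)
    have \<phi>1: "\<phi>0 holomorphic_on ?S1" by (rule holomorphic_on_subset[OF \<phi>0]) auto
    note pd = polar_form_dense[OF J(2)[OF x0(1)] \<phi>1 oS1 oR]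
    let ?B = "Vf (Some x0) \<inter> {x. r1 < norm x}"
    have \<zeta>B: "\<zeta> \<in> ?B" using x0 \<zeta>(1) False r by (auto simp: Vf_def)
    have oB: "open ?B" by (intro open_Int oV open_Collect_less continuous_intros)
    have e1: "\<forall>\<^sub>F x in at \<zeta>. x \<in> ?B - {\<zeta>}" by (rule eventually_at_in_open[OF oB \<zeta>B])
    have e2: "\<forall>\<^sub>F x in at \<zeta>. Hf (Some x0) x \<noteq> 0" by (rule nzH) (use x0 \<zeta>B in \<open>auto simp: I_def\<close>)
    show ?thesis unfolding u_def
    proof (rule remove_sings_eq_regular_value[OF f pd(1) _ pd(2-4) cont[OF \<zeta>(1)] _ v], goal_cases)
      case 2
      from e1 e2 show ?case
      proof eventually_elim
        case (elim x)
        then have x: "x \<in> ball x0 (s x0)" "\<beta> x \<noteq> 0" "h x0 (x, \<beta> x) \<noteq> 0" "r1 < norm x" "norm x < \<rho>"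
          using half[OF _ x0(1)] by (auto simp: Hf_def Vf_def)
        have "norm (\<beta> x) < c x0" using small[OF x0(1) x(1)] by (simp add: \<beta>_def)
        then show ?case using u0_pf[OF x0(1) x(1-3)] x(1-3) ring[OF x(4,5)] by (simp add: \<psi>)
      qed
    qed auto
  qed
  \<comment> \<open>Well-definedness of the restriction: near modulus \<open>r3\<close> some point
    of the graph lies off the limit graph, and \<open>f\<close> is holomorphic there.\<close>
  have reg: "\<exists>\<zeta>\<in>ball 0 \<rho>. (\<zeta>, graph_fun \<alpha> \<zeta>) \<in> ring_domain \<epsilon> \<and> (\<exists>v. has_regular_value f (\<zeta>, graph_fun \<alpha> \<zeta>) v)"
  proof -
    have "open {x :: complex. r1 < norm x \<and> norm x < r2}" by (intro open_Collect_conj open_Collect_less continuous_intros)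
    then have e1: "\<forall>\<^sub>F x in at (of_real r3). x \<in> {x :: complex. r1 < norm x \<and> norm x < r2} - {of_real r3}"
      by (rule eventually_at_in_open) (use r r3 in auto)
    have e2: "\<forall>\<^sub>F x in at (of_real r3). Hf None x \<noteq> 0" by (rule nzH) (use r r3 in \<open>auto simp: I_def Vf_def\<close>)
    from e1 e2 have "\<forall>\<^sub>F x in at (of_real r3). r1 < norm x \<and> norm x < r2 \<and> \<beta> x \<noteq> 0"
      by eventually_elim (auto simp: Hf_def)
    then obtain x where x: "r1 < norm x" "norm x < r2" "\<beta> x \<noteq> 0"
      using eventually_happens[of _ "at (of_real r3 :: complex)"] by auto
    have x\<rho>: "norm x < \<rho>" using x r \<rho> by linarith
    then have "x \<in> ball 0 (1 + \<epsilon>)" using r2\<rho> by auto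
    then have "norm (\<beta> x) * C \<le> \<kappa> * norm (W x) * C"
      using \<alpha>(2)[of x] C by (auto simp: \<beta>_def norm_mult mult.commute intro!: mult_right_mono mult_left_mono)
    also have "\<dots> < 1" using \<kappa>(3)[OF x\<rho>] by (simp add: W_def)
    finally have "has_regular_value f (x, graph_fun \<alpha> x) (f (x, graph_fun \<alpha> x))"
      using x by (intro has_regular_value_holomorphic[OF f_hol]) (auto simp: \<psi> mult.commute)
    then show ?thesis using ring[OF x(1) x\<rho>] x\<rho> by (intro bexI[of _ x]) auto
  qed
  have "u meromorphic_on ball 0 \<rho>" unfolding u_def by (rule rem(2))
  moreover have "poles_at_most u (ball 0 \<rho>) (\<Sum>i\<in>I. nf i)" unfolding u_def by (rule rem(3))
  ultimately show ?thesis
    unfolding nI restriction_extends_to_def using reg val by blast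
qed

text \<open>\<open>\<kappa>'\<close> depends only on the cover by polar disks and is fixed before
  \<open>\<eta>\<close>, since the radius of the ball of parameters is chosen afterwards in terms of
  it. On \<open>norm x = \<rho>\<close> the linear function has modulus exactly
  \<open>\<eta>\<close>, so Rouche's theorem gives one bound for the zeros of all admissible
  \<open>\<alpha>\<close>.\<close>

lemma bounded_pole_number:
  obtains \<kappa>' where "0 < \<kappa>'" "\<And>\<eta>. 0 < \<eta> \<Longrightarrow> \<exists>N. \<forall>\<alpha>. \<alpha> holomorphic_on ball 0 (1 + \<epsilon>) \<longrightarrow>
     (\<forall>x\<in>ball 0 (1 + \<epsilon>). norm (\<alpha> x) < \<kappa>') \<longrightarrow> (\<forall>x\<in>sphere 0 \<rho>. norm (\<alpha> x - of_real (\<eta> / \<rho>) * x) < \<eta>) \<longrightarrow>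
     (\<exists>u. restriction_extends_to f (ring_domain \<epsilon>) (ball 0 \<rho>) (graph_fun \<alpha>) u \<and> poles_at_most u (ball 0 \<rho>) N)"
proof -
  let ?S1 = "{x :: complex. r1 < norm x \<and> norm x < 1 + \<epsilon>}"
  have oS1: "open ?S1" by (intro open_Collect_conj open_Collect_less continuous_intros)
  have \<phi>1: "\<phi>0 holomorphic_on ?S1" by (rule holomorphic_on_subset[OF \<phi>0]) auto
  define K where "K = {x :: complex. r3 \<le> norm x \<and> norm x \<le> \<rho>}"
  have "K = cball 0 \<rho> - ball 0 r3" by (auto simp: K_def)
  then have K: "compact K" by (simp add: compact_diff)
  have KS: "x \<in> ?S1" "(x, \<phi>0 x) \<in> ring_domain \<epsilon>" if "x \<in> K" for x
    using that r3 r \<rho> \<phi>0_less[of x] by (auto simp: K_def ring_domain_def)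
  have "\<forall>x0\<in>K. \<exists>s c d g h \<delta> n. polar_form f \<phi>0 ?S1 x0 s c d g h \<and> 0 < \<delta> \<and> \<delta> \<le> c \<and>
     (\<forall>\<beta>. \<beta> holomorphic_on ball x0 s \<longrightarrow> (\<forall>x\<in>ball x0 s. norm (\<beta> x) < \<delta>) \<longrightarrow>
       zeros_at_most (\<lambda>x. h (x, \<beta> x)) (ball x0 (s / 2)) n)"
  proof
    fix x0 assume x0: "x0 \<in> K"
    show "\<exists>s c d g h \<delta> n. polar_form f \<phi>0 ?S1 x0 s c d g h \<and> 0 < \<delta> \<and> \<delta> \<le> c \<and>
     (\<forall>\<beta>. \<beta> holomorphic_on ball x0 s \<longrightarrow> (\<forall>x\<in>ball x0 s. norm (\<beta> x) < \<delta>) \<longrightarrow>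
       zeros_at_most (\<lambda>x. h (x, \<beta> x)) (ball x0 (s / 2)) n)"
    proof (rule polar_form_exists[OF f \<phi>1 oS1 KS[OF x0]])
      fix s c d g h assume pf: "polar_form f \<phi>0 ?S1 x0 s c d g h"
      show ?thesis
      proof (rule polar_form_zeros[OF pf])
        fix \<delta> n assume \<delta>: "0 < \<delta>" "\<delta> \<le> c" and *: "\<And>\<beta>. \<beta> holomorphic_on ball x0 s \<Longrightarrow>
           (\<And>x. x \<in> ball x0 s \<Longrightarrow> norm (\<beta> x) < \<delta>) \<Longrightarrow> zeros_at_most (\<lambda>x. h (x, \<beta> x)) (ball x0 (s / 2)) n"
        show ?thesis
          by (rule exI[of _ s], rule exI[of _ c], rule exI[of _ d], rule exI[of _ g], rule exI[of _ h], rule exI[of _ \<delta>], rule exI[of _ n])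
            (use pf \<delta> in \<open>auto intro!: *\<close>)
      qed
    qed
  qed
  then obtain s c d g h \<delta> n where all: "\<forall>x0\<in>K. polar_form f \<phi>0 ?S1 x0 (s x0) (c x0) (d x0) (g x0) (h x0) \<and>
     0 < \<delta> x0 \<and> \<delta> x0 \<le> c x0 \<and> (\<forall>\<beta>. \<beta> holomorphic_on ball x0 (s x0) \<longrightarrow> (\<forall>x\<in>ball x0 (s x0). norm (\<beta> x) < \<delta> x0) \<longrightarrow>
       zeros_at_most (\<lambda>x. h x0 (x, \<beta> x)) (ball x0 (s x0 / 2)) (n x0))"
    unfolding bchoice_iff by (elim exE) (rule that)
  have pf: "polar_form f \<phi>0 ?S1 x0 (s x0) (c x0) (d x0) (g x0) (h x0)" if "x0 \<in> K" for x0 using all that by blast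
  have \<delta>: "0 < \<delta> x0" "\<delta> x0 \<le> c x0" if "x0 \<in> K" for x0 using all that by blast+
  have n: "zeros_at_most (\<lambda>x. h x0 (x, \<beta> x)) (ball x0 (s x0 / 2)) (n x0)"
    if "x0 \<in> K" "\<beta> holomorphic_on ball x0 (s x0)" "\<And>x. x \<in> ball x0 (s x0) \<Longrightarrow> norm (\<beta> x) < \<delta> x0" for x0 \<beta>
    using bspec[OF all that(1)] that(2,3) by blast
  have "\<exists>J\<subseteq>K. finite J \<and> K \<subseteq> (\<Union>x0\<in>J. ball x0 (s x0 / 2))"
  proof -
    have "K \<subseteq> (\<Union>x0\<in>K. ball x0 (s x0 / 2))"
    proof
      fix x assume x: "x \<in> K"
      then have "x \<in> ball x (s x / 2)" using pf[OF x] by (simp add: polar_form_def)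
      then show "x \<in> (\<Union>x0\<in>K. ball x0 (s x0 / 2))" using x by blast
    qed
    then show ?thesis by (rule compactE_image[OF K open_ball]) blast
  qed
  then obtain J where J: "J \<subseteq> K" "finite J" "K \<subseteq> (\<Union>x0\<in>J. ball x0 (s x0 / 2))" by blast
  obtain M where M: "0 < M" "\<And>x. x \<in> ball 0 (1 + \<epsilon>) \<Longrightarrow> norm (W x) \<le> M"
  proof -
    have "compact (W ` cball 0 (1 + \<epsilon>))"
      by (intro compact_continuous_image compact_cball holomorphic_on_imp_continuous_on W_holomorphic)
    then obtain M where "0 < M" "\<forall>y\<in>W ` cball 0 (1 + \<epsilon>). norm y \<le> M" using compact_imp_bounded bounded_pos by blast
    then show ?thesis by (intro that[of M]) auto
  qed
  obtain nW where nW: "zeros_at_most W UNIV nW" using zeros_W by blast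
  \<comment> \<open>With \<open>norm (\<alpha> x) < m\<close> the product
    \<open>W x * \<alpha> x\<close> stays below the threshold \<open>\<delta> x0\<close> of each of
    the finitely many polar disks.\<close>
  define m where "m = Min (insert \<kappa> ((\<lambda>x0. \<delta> x0 / M) ` J))"
  have m: "0 < m" "m \<le> \<kappa>" "\<And>x0. x0 \<in> J \<Longrightarrow> m \<le> \<delta> x0 / M"
    unfolding m_def using J(1,2) \<delta>(1) M(1) \<kappa>(1) by (auto simp: Min_gr_iff)
  show ?thesis
  proof (rule that[OF m(1)])
    fix \<eta> :: real assume \<eta>: "0 < \<eta>"
    have sph: "cball 0 \<rho> \<subseteq> ball (0::complex) (1 + \<epsilon>)" using \<rho> by auto
    have lin: "(\<lambda>x. of_real (\<eta> / \<rho>) * x) holomorphic_on ball (0::complex) (1 + \<epsilon>)" by (intro holomorphic_intros)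
    have linn: "norm (of_real (\<eta> / \<rho>) * x) = \<eta>" if "x \<in> sphere (0::complex) \<rho>" for x
      using that \<eta> \<rho> by (simp add: norm_mult norm_divide)
    obtain k where k: "\<And>\<alpha>. \<alpha> holomorphic_on ball 0 (1 + \<epsilon>) \<Longrightarrow>
       (\<And>x. x \<in> sphere 0 \<rho> \<Longrightarrow> norm (\<alpha> x - of_real (\<eta> / \<rho>) * x) < norm (of_real (\<eta> / \<rho>) * x)) \<Longrightarrow> zeros_at_most \<alpha> (ball 0 \<rho>) k"
    proof (rule zeros_at_most_perturb[OF lin open_ball sph])
      show "0 < \<rho>" using \<rho> by simp
      show "of_real (\<eta> / \<rho>) * x \<noteq> 0" if "x \<in> sphere 0 \<rho>" for x :: complex using linn[OF that] \<eta> by force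
      fix n assume "\<And>g. g holomorphic_on ball 0 (1 + \<epsilon>) \<Longrightarrow> (\<And>x. x \<in> sphere 0 \<rho> \<Longrightarrow>
        norm (g x - of_real (\<eta> / \<rho>) * x) < norm (of_real (\<eta> / \<rho>) * x)) \<Longrightarrow> zeros_at_most g (ball 0 \<rho>) n"
      then show thesis by (rule that)
    qed
    show "\<exists>N. \<forall>\<alpha>. \<alpha> holomorphic_on ball 0 (1 + \<epsilon>) \<longrightarrow>
     (\<forall>x\<in>ball 0 (1 + \<epsilon>). norm (\<alpha> x) < m) \<longrightarrow> (\<forall>x\<in>sphere 0 \<rho>. norm (\<alpha> x - of_real (\<eta> / \<rho>) * x) < \<eta>) \<longrightarrow>
     (\<exists>u. restriction_extends_to f (ring_domain \<epsilon>) (ball 0 \<rho>) (graph_fun \<alpha>) u \<and> poles_at_most u (ball 0 \<rho>) N)"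
    proof (intro exI[of _ "(nW + (nW + k) * (D + 1)) + (\<Sum>x0\<in>J. (nW + k) * (d x0 + 1) + n x0)"] allI impI)
      fix \<alpha> assume \<alpha>: "\<alpha> holomorphic_on ball 0 (1 + \<epsilon>)" "\<forall>x\<in>ball 0 (1 + \<epsilon>). norm (\<alpha> x) < m"
        "\<forall>x\<in>sphere 0 \<rho>. norm (\<alpha> x - of_real (\<eta> / \<rho>) * x) < \<eta>"
      have sub: "ball x0 (s x0) \<subseteq> ball 0 (1 + \<epsilon>)" if "x0 \<in> J" for x0
      proof -
        have "ball x0 (s x0) \<subseteq> ?S1" using pf[of x0] J(1) that by (auto simp: polar_form_def)
        then show ?thesis by auto
      qed
      have sm: "norm (W x * \<alpha> x) < \<delta> x0" if "x0 \<in> J" "x \<in> ball x0 (s x0)" for x0 x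
      proof -
        have x: "x \<in> ball 0 (1 + \<epsilon>)" using sub that by blast
        have "norm (W x * \<alpha> x) \<le> M * norm (\<alpha> x)" using M(2)[OF x] by (simp add: norm_mult mult_right_mono)
        also have "\<dots> < M * m" using \<alpha>(2) x M(1) by simp
        also have "\<dots> \<le> \<delta> x0" using m(3)[OF that(1)] M(1) by (simp add: field_simps)
        finally show ?thesis .
      qed
      show "\<exists>u. restriction_extends_to f (ring_domain \<epsilon>) (ball 0 \<rho>) (graph_fun \<alpha>) u \<and>
        poles_at_most u (ball 0 \<rho>) ((nW + (nW + k) * (D + 1)) + (\<Sum>x0\<in>J. (nW + k) * (d x0 + 1) + n x0))"
      proof (rule restriction_extends[OF \<alpha>(1) _ _ nW J(2)])
        show "norm (\<alpha> x) < \<kappa>" if "x \<in> ball 0 (1 + \<epsilon>)" for x using \<alpha>(2) that m(2) by fastforce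
        show "zeros_at_most \<alpha> (ball 0 \<rho>) k" by (rule k[OF \<alpha>(1)]) (use \<alpha>(3) linn in auto)
        show "{x. r3 \<le> norm x \<and> norm x \<le> \<rho>} \<subseteq> (\<Union>x0\<in>J. ball x0 (s x0 / 2))" using J(3) by (simp add: K_def)
        fix x0 assume x0: "x0 \<in> J"
        then have x0K: "x0 \<in> K" using J(1) by blast
        show "polar_form f \<phi>0 ?S1 x0 (s x0) (c x0) (d x0) (g x0) (h x0)" by (rule pf[OF x0K])
        show "norm (W x * \<alpha> x) < c x0" if "x \<in> ball x0 (s x0)" for x
          using sm[OF x0 that] \<delta>(2)[OF x0K] by linarith
        show "zeros_at_most (\<lambda>x. h x0 (x, W x * \<alpha> x)) (ball x0 (s x0 / 2)) (n x0)"
        proof (rule n[OF x0K])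
          show "(\<lambda>x. W x * \<alpha> x) holomorphic_on ball x0 (s x0)"
            by (intro holomorphic_intros W_holomorphic holomorphic_on_subset[OF \<alpha>(1) sub[OF x0]])
        qed (rule sm[OF x0])
      qed
    qed
  qed
qed

end

section \<open>Complex Banach spaces and their open submanifolds\<close>

text \<open>The library locale \<open>Metric_space\<close> requires nonnegativity and symmetry of the distance on the whole type, hence the
  last two assumptions.\<close>

locale cbanach =
  fixes E :: "('v::ab_group_add) banach_data"
  assumes banach: "complex_banach_space E"
    and norm_nonneg [simp]: "\<And>x. 0 \<le> bnorm E x" and norm_minus: "\<And>x. bnorm E (- x) = bnorm E x"
begin

sublocale vs: vector_space "bscale E"
  using banach by (simp add: complex_banach_space_def)

lemma subspace: "vs.subspace (bcarrier E)"
  using banach by (simp add: complex_banach_space_def)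

lemma zero_in [simp]: "0 \<in> bcarrier E" by (rule vs.subspace_0[OF subspace])

lemmas carrier_intros = vs.subspace_add[OF subspace] vs.subspace_diff[OF subspace] vs.subspace_scale[OF subspace]
  vs.subspace_neg[OF subspace]

lemma norm_eq_0 [simp]: "x \<in> bcarrier E \<Longrightarrow> bnorm E x = 0 \<longleftrightarrow> x = 0"
  and norm_scale: "x \<in> bcarrier E \<Longrightarrow> bnorm E (bscale E c x) = norm c * bnorm E x"
  and norm_triangle: "x \<in> bcarrier E \<Longrightarrow> y \<in> bcarrier E \<Longrightarrow> bnorm E (x + y) \<le> bnorm E x + bnorm E y"
  and complete: "Metric_space.mcomplete (bcarrier E) (bdist E)"
  using banach by (auto simp: complex_banach_space_def)

lemma norm_0 [simp]: "bnorm E 0 = 0" by simp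

lemma norm_minus_commute: "bnorm E (x - y) = bnorm E (y - x)"
  using norm_minus[of "x - y"] by simp

lemma norm_triangle_diff: "x \<in> bcarrier E \<Longrightarrow> y \<in> bcarrier E \<Longrightarrow> bnorm E (x - y) \<le> bnorm E x + bnorm E y"
  using norm_triangle[of x "- y"] norm_minus[of y] by (simp add: carrier_intros)

sublocale ms: Metric_space "bcarrier E" "bdist E"
proof
  fix x y z assume xyz: "x \<in> bcarrier E" "y \<in> bcarrier E" "z \<in> bcarrier E"
  show "bdist E x z \<le> bdist E x y + bdist E y z"
    using norm_triangle[of "x - y" "y - z"] xyz by (simp add: bdist_def carrier_intros)
qed (auto simp: bdist_def carrier_intros norm_minus_commute)

lemma mem_bball: "y \<in> bball E x r \<longleftrightarrow> x \<in> bcarrier E \<and> y \<in> bcarrier E \<and> bnorm E (y - x) < r"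
  by (simp add: bball_def bdist_def norm_minus_commute)

lemma openin_btopology:
  "openin (btopology E) U \<longleftrightarrow> U \<subseteq> bcarrier E \<and> (\<forall>x\<in>U. \<exists>r>0. \<forall>h\<in>bcarrier E. bnorm E h < r \<longrightarrow> x + h \<in> U)"
proof -
  have "(\<exists>r>0. bball E x r \<subseteq> U) \<longleftrightarrow> (\<exists>r>0. \<forall>h\<in>bcarrier E. bnorm E h < r \<longrightarrow> x + h \<in> U)" if x: "x \<in> bcarrier E" for x
  proof -
    have "bball E x r \<subseteq> U \<longleftrightarrow> (\<forall>h\<in>bcarrier E. bnorm E h < r \<longrightarrow> x + h \<in> U)" for r
    proof (intro iffI ballI impI subsetI)
      fix h assume "bball E x r \<subseteq> U" "h \<in> bcarrier E" "bnorm E h < r"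
      moreover have "x + h \<in> bball E x r" using \<open>h \<in> bcarrier E\<close> \<open>bnorm E h < r\<close> x by (simp add: mem_bball carrier_intros)
      ultimately show "x + h \<in> U" by (simp add: subset_iff)
    next
      fix y assume *: "\<forall>h\<in>bcarrier E. bnorm E h < r \<longrightarrow> x + h \<in> U" "y \<in> bball E x r"
      have "y - x \<in> bcarrier E" "bnorm E (y - x) < r" using *(2) by (simp_all add: mem_bball carrier_intros)
      then have "x + (y - x) \<in> U" by (rule mp[OF bspec[OF *(1)]])
      then show "y \<in> U" by simp
    qed
    then show ?thesis by simp
  qed
  note key = this
  show ?thesis
  proof (cases "U \<subseteq> bcarrier E")
    case True
    then have "(\<exists>r>0. bball E x r \<subseteq> U) \<longleftrightarrow> (\<exists>r>0. \<forall>h\<in>bcarrier E. bnorm E h < r \<longrightarrow> x + h \<in> U)" if "x \<in> U" for x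
      using key that by blast
    then show ?thesis using True unfolding btopology_def ms.openin_mtopology bball_def[symmetric] by (simp add: Ball_def)
  qed (simp add: btopology_def ms.openin_mtopology)
qed

lemma topspace_btopology [simp]: "topspace (btopology E) = bcarrier E"
  by (simp add: btopology_def)

lemma openin_bball: "openin (btopology E) (bball E a r)"
  by (simp add: btopology_def bball_def)

lemma Hausdorff_btopology: "Hausdorff_space (btopology E)"
  by (simp add: btopology_def ms.Hausdorff_space_mtopology)

lemma cfrechet_id: "cfrechet E E (\<lambda>x. x) x (\<lambda>x. x)"
proof -
  have "bounded_clinear_map E E (\<lambda>x. x)"
    unfolding bounded_clinear_map_def by (auto intro!: exI[of _ 1])
  then show ?thesis unfolding cfrechet_def by (auto intro: exI[of _ 1])
qed

end

section \<open>Frechet derivatives and open submanifolds\<close>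

lemma eq_0_if_le_multiples:
  assumes w: "0 \<le> w" and a: "0 \<le> a" and le: "\<And>e. 0 < e \<Longrightarrow> w \<le> 2 * e * a"
  shows "w = (0 :: real)"
proof (rule ccontr)
  assume "w \<noteq> 0"
  with w have "0 < w" by simp
  with le[of 1] have "0 < a" by simp
  with le[of "w / (4 * a)"] \<open>0 < w\<close> show False by simp
qed

lemma bounded_clinear_mapD:
  assumes "bounded_clinear_map E G L"
  shows "x \<in> bcarrier E \<Longrightarrow> L x \<in> bcarrier G"
    and "x \<in> bcarrier E \<Longrightarrow> y \<in> bcarrier E \<Longrightarrow> L (x + y) = L x + L y"
    and "x \<in> bcarrier E \<Longrightarrow> L (bscale E c x) = bscale G c (L x)"
  using assms by (auto simp: bounded_clinear_map_def)

lemma cfrechet_linear: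
  assumes E: "cbanach E" and G: "cbanach G" and L: "bounded_clinear_map E G L" and x: "x \<in> bcarrier E"
  shows "cfrechet E G L x L"
proof -
  interpret E: cbanach E by fact
  interpret G: cbanach G by fact
  have "L (x + h) - L x - L h = 0" if "h \<in> bcarrier E" for h using bounded_clinear_mapD(2)[OF L x that] by simp
  then show ?thesis using L unfolding cfrechet_def by (auto intro: exI[of _ 1])
qed

lemma cfrechet_cong:
  assumes E: "cbanach E" and U: "openin (btopology E) U" "x \<in> U" and eq: "\<And>y. y \<in> U \<Longrightarrow> f y = g y" and f: "cfrechet E G f x L"
  shows "cfrechet E G g x L"
proof -
  interpret E: cbanach E by fact
  obtain r where r: "0 < r" "\<And>h. h \<in> bcarrier E \<Longrightarrow> bnorm E h < r \<Longrightarrow> x + h \<in> U"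
    using U unfolding E.openin_btopology by blast
  show ?thesis unfolding cfrechet_def
  proof (intro conjI allI impI)
    show "bounded_clinear_map E G L" using f by (simp add: cfrechet_def)
    fix e :: real assume "0 < e"
    then obtain d where d: "0 < d" "\<And>h. h \<in> bcarrier E \<Longrightarrow> bnorm E h < d \<Longrightarrow> bnorm G (f (x + h) - f x - L h) \<le> e * bnorm E h"
      using f unfolding cfrechet_def by blast
    show "\<exists>d>0. \<forall>h\<in>bcarrier E. bnorm E h < d \<longrightarrow> bnorm G (g (x + h) - g x - L h) \<le> e * bnorm E h"
    proof (intro exI[of _ "min d r"] conjI ballI impI)
      fix h assume h: "h \<in> bcarrier E" "bnorm E h < min d r"
      then have "f (x + h) = g (x + h)" "f x = g x" using r(2)[of h] eq U(2) by auto
      then show "bnorm G (g (x + h) - g x - L h) \<le> e * bnorm E h" using d(2)[of h] h by simp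
    qed (use d r in simp)
  qed
qed

text \<open>Both derivatives are tested on a small multiple of \<open>h\<close>; they differ by at
  most \<open>2 * e * bnorm E h\<close> for every \<open>e > 0\<close>. Uniqueness is needed because
  submersions and embeddings are required to satisfy their condition for every element of
  \<open>differentials\<close>.\<close>

lemma cfrechet_unique:
  assumes E: "cbanach E" and G: "cbanach G" and L: "cfrechet E G f x L" and L': "cfrechet E G f x L'"
    and f: "x \<in> U" "openin (btopology E) U" "\<And>y. y \<in> U \<Longrightarrow> f y \<in> bcarrier G" and h: "h \<in> bcarrier E"
  shows "L h = L' h"
proof -
  interpret E: cbanach E by fact
  interpret G: cbanach G by fact
  have bL: "bounded_clinear_map E G L" "bounded_clinear_map E G L'" using L L' by (auto simp: cfrechet_def)
  note D = bounded_clinear_mapD[OF bL(1)] bounded_clinear_mapD[OF bL(2)]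
  obtain r where r: "0 < r" "\<And>h. h \<in> bcarrier E \<Longrightarrow> bnorm E h < r \<Longrightarrow> x + h \<in> U"
    using f unfolding E.openin_btopology by blast
  have "bnorm G (L h - L' h) = 0"
  proof (rule eq_0_if_le_multiples[of _ "bnorm E h"])
    fix e :: real assume e: "0 < e"
    obtain d where d: "0 < d" "\<And>h. h \<in> bcarrier E \<Longrightarrow> bnorm E h < d \<Longrightarrow> bnorm G (f (x + h) - f x - L h) \<le> e * bnorm E h"
      using L e unfolding cfrechet_def by blast
    obtain d' where d': "0 < d'" "\<And>h. h \<in> bcarrier E \<Longrightarrow> bnorm E h < d' \<Longrightarrow> bnorm G (f (x + h) - f x - L' h) \<le> e * bnorm E h"
      using L' e unfolding cfrechet_def by blast
    define m where "m = min r (min d d')"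
    \<comment> \<open>The summand \<open>1\<close> avoids a division by zero for
      \<open>h = 0\<close> and gives the strict inequality \<open>t * bnorm E h < m\<close>.\<close>
    define t where "t = m / (bnorm E h + 1)"
    have m: "0 < m" "m \<le> r" "m \<le> d" "m \<le> d'" using d d' r by (auto simp: m_def)
    have p: "0 < bnorm E h + 1" using E.norm_nonneg[of h] by linarith
    have t: "0 < t" using m p by (simp add: t_def)
    have "t * bnorm E h < t * (bnorm E h + 1)" using t by simp
    also have "\<dots> = m" using p by (simp add: t_def)
    finally have tm: "t * bnorm E h < m" .
    define k where "k = bscale E (of_real t) h"
    have k: "k \<in> bcarrier E" using h by (simp add: k_def E.carrier_intros)
    have nk: "bnorm E k = t * bnorm E h" using h t by (simp add: k_def E.norm_scale)
    have fx: "f x \<in> bcarrier G" "f (x + k) \<in> bcarrier G" using f r(2)[OF k] nk tm m by auto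
    have a: "f (x + k) - f x - L k \<in> bcarrier G" "f (x + k) - f x - L' k \<in> bcarrier G"
      using fx D(1,4) k by (auto intro!: G.carrier_intros)
    have "bscale G (of_real t) (L h - L' h) = L k - L' k"
      using D(3,6) h by (simp add: k_def G.vs.scale_right_diff_distrib)
    also have "\<dots> = (f (x + k) - f x - L' k) - (f (x + k) - f x - L k)" by simp
    finally have "t * bnorm G (L h - L' h) = bnorm G ((f (x + k) - f x - L' k) - (f (x + k) - f x - L k))"
      using G.norm_scale[of "L h - L' h" "of_real t"] D(1,4) h t by (simp add: G.carrier_intros)
    also have "\<dots> \<le> bnorm G (f (x + k) - f x - L' k) + bnorm G (f (x + k) - f x - L k)"
      by (rule G.norm_triangle_diff[OF a(2,1)])
    also have "\<dots> \<le> e * bnorm E k + e * bnorm E k"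
      by (intro add_mono d d' k) (use nk tm m in linarith)+
    finally have "t * bnorm G (L h - L' h) \<le> t * (2 * e * bnorm E h)" by (simp add: nk algebra_simps)
    then show "bnorm G (L h - L' h) \<le> 2 * e * bnorm E h" using t by simp
  qed auto
  then show ?thesis using D(1,4) h by (simp add: G.carrier_intros)
qed

lemma continuous_map_cfrechet:
  assumes E: "cbanach E" and G: "cbanach G" and U: "openin (btopology E) U" and V: "V \<subseteq> bcarrier G"
    and f: "\<And>x. x \<in> U \<Longrightarrow> f x \<in> V" and L: "\<And>x. x \<in> U \<Longrightarrow> \<exists>L. cfrechet E G f x L"
  shows "continuous_map (subtopology (btopology E) U) (subtopology (btopology G) V) f"
proof -
  interpret E: cbanach E by fact
  interpret G: cbanach G by fact
  have UE: "U \<subseteq> bcarrier E" using U E.openin_btopology by blast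
  have "continuous_map (subtopology (btopology E) U) (btopology G) f"
    unfolding continuous_map
  proof (intro conjI allI impI)
    show "f ` topspace (subtopology (btopology E) U) \<subseteq> topspace (btopology G)" using f V UE by auto
    fix O' assume O: "openin (btopology G) O'"
    have "openin (btopology E) {x \<in> U. f x \<in> O'}"
      unfolding E.openin_btopology
    proof (intro conjI ballI)
      fix x assume "x \<in> {x \<in> U. f x \<in> O'}"
      then have x: "x \<in> U" "f x \<in> O'" by auto
      obtain r where r: "0 < r" "\<And>h. h \<in> bcarrier G \<Longrightarrow> bnorm G h < r \<Longrightarrow> f x + h \<in> O'"
        using O x(2) unfolding G.openin_btopology by blast
      obtain s where s: "0 < s" "\<And>h. h \<in> bcarrier E \<Longrightarrow> bnorm E h < s \<Longrightarrow> x + h \<in> U"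
        using U x(1) unfolding E.openin_btopology by blast
      obtain L where L: "cfrechet E G f x L" using assms(6)[OF x(1)] by blast
      have bL: "bounded_clinear_map E G L" using L by (simp add: cfrechet_def)
      then obtain K where K: "\<And>h. h \<in> bcarrier E \<Longrightarrow> bnorm G (L h) \<le> K * bnorm E h" unfolding bounded_clinear_map_def by meson
      obtain d where d: "0 < d" "\<And>h. h \<in> bcarrier E \<Longrightarrow> bnorm E h < d \<Longrightarrow> bnorm G (f (x + h) - f x - L h) \<le> 1 * bnorm E h"
        using L unfolding cfrechet_def by (metis zero_less_one)
      define q where "q = \<bar>K\<bar> + 1"
      have q: "0 < q" by (simp add: q_def)
      show "\<exists>r>0. \<forall>h\<in>bcarrier E. bnorm E h < r \<longrightarrow> x + h \<in> {x \<in> U. f x \<in> O'}"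
      proof (intro exI[of _ "min (min d s) (r / q)"] conjI ballI impI)
        show "0 < min (min d s) (r / q)" using d s r q by simp
        fix h assume h: "h \<in> bcarrier E" "bnorm E h < min (min d s) (r / q)"
        have xh: "x + h \<in> U" using s h by simp
        have fx: "f x \<in> bcarrier G" "f (x + h) \<in> bcarrier G" "L h \<in> bcarrier G"
          using f V x xh bounded_clinear_mapD(1)[OF bL h(1)] by blast+
        have "bnorm G (f (x + h) - f x) = bnorm G ((f (x + h) - f x - L h) + L h)" by simp
        also have "\<dots> \<le> bnorm G (f (x + h) - f x - L h) + bnorm G (L h)"
          using fx by (intro G.norm_triangle G.carrier_intros)
        also have "\<dots> \<le> 1 * bnorm E h + K * bnorm E h" using d(2)[OF h(1)] K[OF h(1)] h by auto
        also have "\<dots> \<le> q * bnorm E h" by (simp add: q_def algebra_simps mult_right_mono)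
        also have "\<dots> < r" using h q by (simp add: field_simps)
        finally have "f x + (f (x + h) - f x) \<in> O'" using fx by (intro r G.carrier_intros)
        then show "x + h \<in> {x \<in> U. f x \<in> O'}" using xh by simp
      qed
    qed (use UE in auto)
    moreover have "{x \<in> topspace (subtopology (btopology E) U). f x \<in> O'} = U \<inter> {x \<in> U. f x \<in> O'}" using UE by auto
    ultimately show "openin (subtopology (btopology E) U) {x \<in> topspace (subtopology (btopology E) U). f x \<in> O'}"
      by (auto simp: openin_subtopology_alt intro!: openin_subtopology_Int2)
  qed
  then show ?thesis using f UE by (auto simp: continuous_map_in_subtopology)
qed

lemma inv_into_ident: "x \<in> U \<Longrightarrow> inv_into U (\<lambda>x. x) x = x"
  using inv_into_f_f[of "\<lambda>x. x" U x] by simp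

lemma complex_manifold_open_submanifold:
  assumes E: "cbanach E" and U: "openin (btopology E) U"
  shows "complex_manifold (open_submanifold E U)"
proof -
  interpret E: cbanach E by fact
  have UE: "U \<subseteq> bcarrier E" using U E.openin_btopology by blast
  have "homeomorphic_map (subtopology (subtopology (btopology E) U) U) (subtopology (btopology E) ((\<lambda>x. x) ` U)) (\<lambda>x. x)"
    using homeomorphic_map_id[of "subtopology (btopology E) U" "subtopology (btopology E) U"]
    by (simp add: id_def subtopology_subtopology)
  moreover have "\<exists>L. cfrechet E E ((\<lambda>x. x) \<circ> inv_into U (\<lambda>x. x)) x L" if "x \<in> U" for x
    by (rule exI, rule cfrechet_cong[OF E U that _ E.cfrechet_id]) (simp add: inv_into_ident)
  moreover have "((\<lambda>x. x) \<circ> inv_into U (\<lambda>x. x)) ` ((\<lambda>x. x) ` (U \<inter> U)) \<subseteq> bcarrier E" using UE by (auto simp: inv_into_ident)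
  ultimately show ?thesis
    using U UE E.banach E.Hausdorff_btopology
    unfolding complex_manifold_def open_submanifold_def holomorphic_between_def
    by (auto simp: Hausdorff_space_subtopology openin_subtopology_alt)
qed

lemma holomorphic_map_open_submanifold:
  assumes E: "cbanach E" and G: "cbanach G" and U: "openin (btopology E) U" and V: "V \<subseteq> bcarrier G"
    and f: "\<And>x. x \<in> U \<Longrightarrow> f x \<in> V" and L: "\<And>x. x \<in> U \<Longrightarrow> \<exists>L. cfrechet E G f x L"
  shows "holomorphic_map (open_submanifold E U) (open_submanifold G V) f"
proof -
  have "\<exists>L. cfrechet E G ((\<lambda>x. x) \<circ> f \<circ> inv_into U (\<lambda>x. x)) x L" if x: "x \<in> U" for x
  proof -
    obtain L where "cfrechet E G f x L" using assms(6)[OF x] by blast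
    then have "cfrechet E G ((\<lambda>x. x) \<circ> f \<circ> inv_into U (\<lambda>x. x)) x L"
      by (rule cfrechet_cong[OF E U x, rotated]) (simp add: inv_into_ident)
    then show ?thesis by blast
  qed
  moreover have "U \<inter> f -` V = U" using f by auto
  ultimately show ?thesis
    using continuous_map_cfrechet[OF assms] U f V
    unfolding holomorphic_map_def open_submanifold_def holomorphic_between_def by (auto simp: inv_into_ident)
qed

lemma differentials_open_submanifold:
  assumes E: "cbanach E" and U: "openin (btopology E) U" "x \<in> U" and f: "f x \<in> V"
  shows "L \<in> differentials (open_submanifold E U) (open_submanifold G V) f x \<longleftrightarrow> cfrechet E G f x L"
proof -
  have *: "cfrechet E G ((\<lambda>x. x) \<circ> f \<circ> inv_into U (\<lambda>x. x)) x L \<longleftrightarrow> cfrechet E G f x L"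
    by (intro iffI; erule cfrechet_cong[OF E U, rotated]) (simp_all add: inv_into_ident)
  show ?thesis using * U f by (simp add: differentials_def open_submanifold_def)
qed

section \<open>Products and concrete Banach spaces\<close>

definition bprod :: "('v::ab_group_add) banach_data \<Rightarrow> ('w::ab_group_add) banach_data \<Rightarrow> ('v \<times> 'w) banach_data" where
  "bprod E G = \<lparr>bscale = (\<lambda>c p. (bscale E c (fst p), bscale G c (snd p))), bcarrier = bcarrier E \<times> bcarrier G,
     bnorm = (\<lambda>p. bnorm E (fst p) + bnorm G (snd p))\<rparr>"

lemma bprod_simps [simp]: "bscale (bprod E G) c p = (bscale E c (fst p), bscale G c (snd p))"
  "bcarrier (bprod E G) = bcarrier E \<times> bcarrier G" "bnorm (bprod E G) p = bnorm E (fst p) + bnorm G (snd p)"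
  by (auto simp: bprod_def)

lemma cbanachI:
  assumes vs: "vector_space (bscale E)" and sub: "module.subspace (bscale E) (bcarrier E)"
    and nonneg: "\<And>x. 0 \<le> bnorm E x" and minus: "\<And>x. bnorm E (- x) = bnorm E x"
    and n0: "\<And>x. x \<in> bcarrier E \<Longrightarrow> bnorm E x = 0 \<longleftrightarrow> x = 0"
    and sc: "\<And>c x. x \<in> bcarrier E \<Longrightarrow> bnorm E (bscale E c x) = norm c * bnorm E x"
    and tri: "\<And>x y. x \<in> bcarrier E \<Longrightarrow> y \<in> bcarrier E \<Longrightarrow> bnorm E (x + y) \<le> bnorm E x + bnorm E y"
    and comp: "\<And>\<sigma> :: nat \<Rightarrow> _. (\<And>n. \<sigma> n \<in> bcarrier E) \<Longrightarrow>
       (\<And>e. 0 < e \<Longrightarrow> \<exists>N. \<forall>n\<ge>N. \<forall>m\<ge>N. bnorm E (\<sigma> n - \<sigma> m) < e) \<Longrightarrow>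
       \<exists>x\<in>bcarrier E. \<forall>e>0. \<exists>N. \<forall>n\<ge>N. bnorm E (\<sigma> n - x) < e"
  shows "cbanach E"
proof
  interpret vs: vector_space "bscale E" by fact
  interpret Metric_space "bcarrier E" "bdist E"
  proof
    fix x y z assume xyz: "x \<in> bcarrier E" "y \<in> bcarrier E" "z \<in> bcarrier E"
    show "bdist E x z \<le> bdist E x y + bdist E y z"
      using tri[of "x - y" "y - z"] xyz by (simp add: bdist_def vs.subspace_diff[OF sub])
  next
    fix x y show "bdist E x y = bdist E y x" using minus[of "x - y"] by (simp add: bdist_def)
  qed (auto simp: bdist_def nonneg n0 vs.subspace_diff[OF sub])
  have "mcomplete"
    unfolding mcomplete_def
  proof (intro allI impI)
    fix \<sigma> assume "MCauchy \<sigma>"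
    then have *: "range \<sigma> \<subseteq> bcarrier E" "\<forall>e>0. \<exists>N. \<forall>n m. N \<le> n \<longrightarrow> N \<le> m \<longrightarrow> bnorm E (\<sigma> n - \<sigma> m) < e"
      unfolding MCauchy_def bdist_def by blast+
    have \<sigma>: "\<sigma> n \<in> bcarrier E" for n using *(1) by blast
    have "\<exists>N. \<forall>n\<ge>N. \<forall>m\<ge>N. bnorm E (\<sigma> n - \<sigma> m) < e" if "0 < e" for e using *(2) that by meson
    from comp[OF \<sigma> this] obtain x where "x \<in> bcarrier E" "\<forall>e>0. \<exists>N. \<forall>n\<ge>N. bnorm E (\<sigma> n - x) < e"
      by blast
    then show "\<exists>x. limitin mtopology \<sigma> x sequentially"
      using \<sigma> by (intro exI[of _ x]) (simp add: limitin_metric eventually_sequentially bdist_def)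
  qed
  then show "complex_banach_space E"
    using assms by (auto simp: complex_banach_space_def)
qed (use nonneg minus in auto)

lemma (in cbanach) completeness:
  fixes \<sigma> :: "nat \<Rightarrow> 'v"
  assumes "\<And>n. \<sigma> n \<in> bcarrier E" "\<And>e. 0 < e \<Longrightarrow> \<exists>N. \<forall>n\<ge>N. \<forall>m\<ge>N. bnorm E (\<sigma> n - \<sigma> m) < e"
  shows "\<exists>x\<in>bcarrier E. \<forall>e>0. \<exists>N. \<forall>n\<ge>N. bnorm E (\<sigma> n - x) < e"
proof -
  have "ms.MCauchy \<sigma>" unfolding ms.MCauchy_def bdist_def using assms by (meson image_subsetI)
  then obtain x where "limitin ms.mtopology \<sigma> x sequentially" using complete unfolding ms.mcomplete_def by blast
  then have x: "x \<in> bcarrier E" "\<forall>e>0. \<exists>N. \<forall>n\<ge>N. \<sigma> n \<in> bcarrier E \<and> bnorm E (\<sigma> n - x) < e"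
    by (simp_all add: ms.limitin_metric eventually_sequentially bdist_def)
  show ?thesis using x(2) by (intro bexI[OF _ x(1)]) meson
qed

lemma cbanach_bprod:
  assumes "cbanach E" "cbanach G"
  shows "cbanach (bprod E G)"
proof -
  interpret E: cbanach E by fact
  interpret G: cbanach G by fact
  have vs: "vector_space (bscale (bprod E G))"
    by unfold_locales (auto simp: E.vs.scale_right_distrib G.vs.scale_right_distrib E.vs.scale_left_distrib G.vs.scale_left_distrib)
  interpret vector_space "bscale (bprod E G)" by (rule vs)
  show ?thesis
  proof (rule cbanachI[OF vs])
    show "subspace (bcarrier (bprod E G))"
      unfolding subspace_def by (auto simp: E.carrier_intros G.carrier_intros zero_prod_def)
    fix p q c assume p: "p \<in> bcarrier (bprod E G)"
    show "bnorm (bprod E G) p = 0 \<longleftrightarrow> p = 0"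
      using p by (cases p) (auto simp: add_nonneg_eq_0_iff zero_prod_def)
    show "bnorm (bprod E G) (bscale (bprod E G) c p) = norm c * bnorm (bprod E G) p"
      using p by (auto simp: E.norm_scale G.norm_scale distrib_left)
    assume q: "q \<in> bcarrier (bprod E G)"
    show "bnorm (bprod E G) (p + q) \<le> bnorm (bprod E G) p + bnorm (bprod E G) q"
      using p q E.norm_triangle[of "fst p" "fst q"] G.norm_triangle[of "snd p" "snd q"] by auto
  next
    fix \<sigma> :: "nat \<Rightarrow> _" assume \<sigma>: "\<And>n. \<sigma> n \<in> bcarrier (bprod E G)"
      and C: "\<And>e. 0 < e \<Longrightarrow> \<exists>N. \<forall>n\<ge>N. \<forall>m\<ge>N. bnorm (bprod E G) (\<sigma> n - \<sigma> m) < e"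
    have \<sigma>': "fst (\<sigma> n) \<in> bcarrier E" "snd (\<sigma> n) \<in> bcarrier G" for n using \<sigma>[of n] by auto
    have b: "bnorm E (fst (\<sigma> n) - fst (\<sigma> m)) \<le> bnorm (bprod E G) (\<sigma> n - \<sigma> m)"
      "bnorm G (snd (\<sigma> n) - snd (\<sigma> m)) \<le> bnorm (bprod E G) (\<sigma> n - \<sigma> m)" for n m by auto
    have "\<exists>x\<in>bcarrier E. \<forall>e>0. \<exists>N. \<forall>n\<ge>N. bnorm E (fst (\<sigma> n) - x) < e"
      by (rule E.completeness[OF \<sigma>'(1)]) (meson C b(1) le_less_trans)
    then obtain x where x: "x \<in> bcarrier E" "\<forall>e>0. \<exists>N. \<forall>n\<ge>N. bnorm E (fst (\<sigma> n) - x) < e" by blast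
    have "\<exists>x\<in>bcarrier G. \<forall>e>0. \<exists>N. \<forall>n\<ge>N. bnorm G (snd (\<sigma> n) - x) < e"
      by (rule G.completeness[OF \<sigma>'(2)]) (meson C b(2) le_less_trans)
    then obtain y where y: "y \<in> bcarrier G" "\<forall>e>0. \<exists>N. \<forall>n\<ge>N. bnorm G (snd (\<sigma> n) - y) < e" by blast
    show "\<exists>x\<in>bcarrier (bprod E G). \<forall>e>0. \<exists>N. \<forall>n\<ge>N. bnorm (bprod E G) (\<sigma> n - x) < e"
    proof (intro bexI[of _ "(x, y)"] allI impI)
      fix e :: real assume "0 < e"
      then have "0 < e / 2" by simp
      obtain N where "\<forall>n\<ge>N. bnorm E (fst (\<sigma> n) - x) < e / 2" using x(2) \<open>0 < e / 2\<close> by blast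
      moreover obtain M where "\<forall>n\<ge>M. bnorm G (snd (\<sigma> n) - y) < e / 2" using y(2) \<open>0 < e / 2\<close> by blast
      ultimately have "bnorm (bprod E G) (\<sigma> n - (x, y)) < e" if "max N M \<le> n" for n
        using that by (simp add: fst_diff snd_diff) (smt (verit) field_sum_of_halves)
      then show "\<exists>N. \<forall>n\<ge>N. bnorm (bprod E G) (\<sigma> n - (x, y)) < e" by blast
    qed (use x y in auto)
  qed (auto simp: E.norm_minus G.norm_minus)
qed

lemma banach_complete:
  fixes \<sigma> :: "nat \<Rightarrow> 'a::banach"
  assumes "\<And>e. 0 < e \<Longrightarrow> \<exists>N. \<forall>n\<ge>N. \<forall>m\<ge>N. norm (\<sigma> n - \<sigma> m) < e"
  shows "\<exists>x. \<forall>e>0. \<exists>N. \<forall>n\<ge>N. norm (\<sigma> n - x) < e"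
proof -
  have "Cauchy \<sigma>" using assms by (auto simp: Cauchy_def dist_norm)
  then obtain x where "\<sigma> \<longlonglongrightarrow> x" using Cauchy_convergent convergent_def by blast
  then show ?thesis by (auto simp: lim_sequentially dist_norm)
qed

lemma cbanach_complex_line: "cbanach complex_line"
proof -
  have vs: "vector_space (bscale complex_line)" by unfold_locales (auto simp: complex_line_def algebra_simps)
  interpret vector_space "bscale complex_line" by (rule vs)
  show ?thesis
    by (rule cbanachI[OF vs]) (auto simp: complex_line_def subspace_def norm_mult norm_triangle_ineq intro: banach_complete)
qed

lemma cbanach_complex_plane2: "cbanach complex_plane2"
proof -
  have vs: "vector_space (bscale complex_plane2)" by unfold_locales (auto simp: complex_plane2_def algebra_simps)
  interpret vector_space "bscale complex_plane2" by (rule vs)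
  have "norm (c * x, c * y) = norm c * norm (x, y)" for c x y :: complex
    by (simp add: norm_Pair norm_mult power_mult_distrib real_sqrt_mult flip: distrib_left)
  moreover have "subspace (bcarrier complex_plane2)" using subspace_UNIV by (simp add: complex_plane2_def)
  ultimately show ?thesis
    by (intro cbanachI[OF vs]) (auto simp: complex_plane2_def simp del: split_paired_Ex intro: norm_triangle_ineq banach_complete)
qed

lemma openin_complex_line: "openin (btopology complex_line) U \<longleftrightarrow> open U"
proof -
  have "bdist complex_line = dist" by (auto simp: bdist_def complex_line_def dist_norm fun_eq_iff)
  then show ?thesis by (simp add: btopology_def complex_line_def)
qed

section \<open>The family of graphs over a ball of bounded holomorphic functions\<close>

text \<open>The Hardy space of bounded holomorphic functions with the supremum norm. Extension by
  \<open>0\<close> off \<open>U\<close> makes an element determined by its values on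
  \<open>U\<close>; the default \<open>0\<close> for unbounded functions keeps the norm nonnegative
  and even on the whole type, as \<open>cbanach\<close> demands.\<close>

definition Hinf :: "complex set \<Rightarrow> (complex \<Rightarrow> complex) banach_data" where
  "Hinf U = \<lparr>bscale = (\<lambda>c \<alpha> x. c * \<alpha> x),
     bcarrier = {\<alpha>. \<alpha> holomorphic_on U \<and> bdd_above ((\<lambda>x. norm (\<alpha> x)) ` U) \<and> (\<forall>x. x \<notin> U \<longrightarrow> \<alpha> x = 0)},
     bnorm = (\<lambda>\<alpha>. if bdd_above ((\<lambda>x. norm (\<alpha> x)) ` U) then SUP x\<in>U. norm (\<alpha> x) else 0)\<rparr>"

lemma bscale_Hinf [simp]: "bscale (Hinf U) c \<alpha> = (\<lambda>x. c * \<alpha> x)" by (simp add: Hinf_def)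

lemma Hinf_carrierI:
  "\<alpha> holomorphic_on U \<Longrightarrow> (\<And>x. x \<in> U \<Longrightarrow> norm (\<alpha> x) \<le> B) \<Longrightarrow> (\<And>x. x \<notin> U \<Longrightarrow> \<alpha> x = 0) \<Longrightarrow> \<alpha> \<in> bcarrier (Hinf U)"
  by (auto simp: Hinf_def bdd_above_def)

lemma Hinf_carrierD:
  assumes "\<alpha> \<in> bcarrier (Hinf U)"
  shows "\<alpha> holomorphic_on U" "x \<notin> U \<Longrightarrow> \<alpha> x = 0"
  using assms by (auto simp: Hinf_def)

lemma Hinf_norm_upper: "\<alpha> \<in> bcarrier (Hinf U) \<Longrightarrow> x \<in> U \<Longrightarrow> norm (\<alpha> x) \<le> bnorm (Hinf U) \<alpha>"
  by (auto simp: Hinf_def intro: cSUP_upper)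

lemma Hinf_norm_le:
  "U \<noteq> {} \<Longrightarrow> (\<And>x. x \<in> U \<Longrightarrow> norm (\<alpha> x) \<le> B) \<Longrightarrow> bnorm (Hinf U) \<alpha> \<le> B"
  by (auto simp: Hinf_def bdd_above_def intro!: cSUP_least)

text \<open>As the functions vanish off \<open>U\<close>, norm convergence is uniform convergence
  everywhere; completeness is then Weierstrass' theorem on uniform limits of holomorphic
  functions.\<close>

lemma cbanach_Hinf:
  assumes U: "open U" "U \<noteq> {}"
  shows "cbanach (Hinf U)"
proof -
  let ?E = "Hinf U"
  have vs: "vector_space (bscale ?E)"
    by unfold_locales (auto simp: algebra_simps fun_eq_iff)
  interpret vector_space "bscale ?E" by (rule vs)
  have up: "norm (\<alpha> x) \<le> bnorm ?E \<alpha>" if "\<alpha> \<in> bcarrier ?E" for \<alpha> x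
  proof (cases "x \<in> U")
    case False
    obtain y where "y \<in> U" using U by blast
    have "norm (\<alpha> x) \<le> norm (\<alpha> y)" using False that by (simp add: Hinf_carrierD)
    then show ?thesis using Hinf_norm_upper[OF that \<open>y \<in> U\<close>] by linarith
  qed (use that Hinf_norm_upper in auto)
  have sub: "subspace (bcarrier ?E)"
    unfolding subspace_def
  proof (intro conjI ballI allI)
    have "(\<lambda>_. 0) \<in> bcarrier ?E" by (rule Hinf_carrierI[of _ _ 0]) simp_all
    then show "0 \<in> bcarrier ?E" by (simp add: zero_fun_def)
    fix \<alpha> \<beta> c assume \<alpha>: "\<alpha> \<in> bcarrier ?E"
    have "norm (c * \<alpha> x) \<le> norm c * bnorm ?E \<alpha>" for x using up[OF \<alpha>] by (simp add: norm_mult mult_left_mono)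
    then show "bscale ?E c \<alpha> \<in> bcarrier ?E"
      unfolding bscale_Hinf by (intro Hinf_carrierI holomorphic_intros Hinf_carrierD(1)[OF \<alpha>]) (simp_all add: Hinf_carrierD(2)[OF \<alpha>])
    assume \<beta>: "\<beta> \<in> bcarrier ?E"
    have "norm (\<alpha> x + \<beta> x) \<le> bnorm ?E \<alpha> + bnorm ?E \<beta>" for x by (rule norm_triangle_mono[OF up[OF \<alpha>] up[OF \<beta>]])
    then have "(\<lambda>x. \<alpha> x + \<beta> x) \<in> bcarrier ?E"
      by (intro Hinf_carrierI holomorphic_intros Hinf_carrierD(1)[OF \<alpha>] Hinf_carrierD(1)[OF \<beta>])
        (simp_all add: Hinf_carrierD(2)[OF \<alpha>] Hinf_carrierD(2)[OF \<beta>])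
    then show "\<alpha> + \<beta> \<in> bcarrier ?E" by (simp add: plus_fun_def)
  qed
  show ?thesis
  proof (rule cbanachI[OF vs sub])
    obtain y where y: "y \<in> U" using U by blast
    show nn: "0 \<le> bnorm ?E \<alpha>" for \<alpha>
    proof (cases "bdd_above ((\<lambda>x. norm (\<alpha> x)) ` U)")
      case True
      then have "norm (\<alpha> y) \<le> (SUP x\<in>U. norm (\<alpha> x))" by (rule cSUP_upper[OF y])
      then have "0 \<le> (SUP x\<in>U. norm (\<alpha> x))" using norm_ge_zero[of "\<alpha> y"] by linarith
      then show ?thesis using True by (simp add: Hinf_def)
    qed (simp add: Hinf_def)
    show "bnorm ?E (- \<alpha>) = bnorm ?E \<alpha>" for \<alpha> by (simp add: Hinf_def)
    fix \<alpha> \<beta> c assume \<alpha>: "\<alpha> \<in> bcarrier ?E"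
    show "bnorm ?E \<alpha> = 0 \<longleftrightarrow> \<alpha> = 0"
    proof
      assume "bnorm ?E \<alpha> = 0"
      then show "\<alpha> = 0" using up[OF \<alpha>] by (simp add: fun_eq_iff)
    next
      assume "\<alpha> = 0"
      then have "bnorm ?E \<alpha> \<le> 0" by (intro Hinf_norm_le U) simp
      then show "bnorm ?E \<alpha> = 0" using nn[of \<alpha>] by linarith
    qed
    show "bnorm ?E (bscale ?E c \<alpha>) = norm c * bnorm ?E \<alpha>"
    proof (rule antisym)
      show "bnorm ?E (bscale ?E c \<alpha>) \<le> norm c * bnorm ?E \<alpha>"
        using up[OF \<alpha>] by (intro Hinf_norm_le U) (simp add: norm_mult mult_left_mono)
      show "norm c * bnorm ?E \<alpha> \<le> bnorm ?E (bscale ?E c \<alpha>)"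
      proof (cases "c = 0")
        case False
        have "bnorm ?E \<alpha> \<le> bnorm ?E (bscale ?E c \<alpha>) / norm c"
        proof (rule Hinf_norm_le[OF U(2)])
          fix x assume "x \<in> U"
          have "norm (bscale ?E c \<alpha> x) \<le> bnorm ?E (bscale ?E c \<alpha>)" by (rule up[OF subspace_scale[OF sub \<alpha>]])
          then show "norm (\<alpha> x) \<le> bnorm ?E (bscale ?E c \<alpha>) / norm c" using False by (simp add: norm_mult field_simps)
        qed
        then show ?thesis using False by (simp add: field_simps)
      qed (use nn in simp)
    qed
    assume \<beta>: "\<beta> \<in> bcarrier ?E"
    show "bnorm ?E (\<alpha> + \<beta>) \<le> bnorm ?E \<alpha> + bnorm ?E \<beta>"
      by (rule Hinf_norm_le[OF U(2)]) (simp add: norm_triangle_mono[OF up[OF \<alpha>] up[OF \<beta>]])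
  next
    fix \<sigma> :: "nat \<Rightarrow> complex \<Rightarrow> complex"
    assume \<sigma>: "\<And>n. \<sigma> n \<in> bcarrier ?E" and C: "\<And>e. 0 < e \<Longrightarrow> \<exists>N. \<forall>n\<ge>N. \<forall>m\<ge>N. bnorm ?E (\<sigma> n - \<sigma> m) < e"
    have "uniformly_Cauchy_on UNIV \<sigma>"
    proof (rule uniformly_Cauchy_onI)
      fix e :: real assume "0 < e"
      then obtain N where N: "\<And>n m. n \<ge> N \<Longrightarrow> m \<ge> N \<Longrightarrow> bnorm ?E (\<sigma> n - \<sigma> m) < e" using C by blast
      have "dist (\<sigma> m x) (\<sigma> n x) < e" if "m \<ge> N" "n \<ge> N" for m n x
        using up[OF subspace_diff[OF sub \<sigma> \<sigma>], of m n x] N[OF that] by (simp add: dist_norm)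
      then show "\<exists>M. \<forall>x\<in>UNIV. \<forall>m\<ge>M. \<forall>n\<ge>M. dist (\<sigma> m x) (\<sigma> n x) < e" by blast
    qed
    then obtain g where g: "uniform_limit UNIV \<sigma> g sequentially"
      using Cauchy_uniformly_convergent uniformly_convergent_on_def by blast
    have lim: "\<exists>N. \<forall>n\<ge>N. \<forall>x. norm (\<sigma> n x - g x) < e" if "0 < e" for e
      using uniform_limitD[OF g that] by (auto simp: eventually_sequentially dist_norm)
    obtain N where N: "\<And>x. norm (\<sigma> N x - g x) < 1" using lim[of 1] by force
    show "\<exists>x\<in>bcarrier ?E. \<forall>e>0. \<exists>N. \<forall>n\<ge>N. bnorm ?E (\<sigma> n - x) < e"
    proof (intro bexI[of _ g] allI impI)
      show "g \<in> bcarrier ?E"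
      proof (rule Hinf_carrierI[of _ _ "bnorm ?E (\<sigma> N) + 1"])
        show "g holomorphic_on U"
        proof (rule holomorphic_uniform_sequence[OF U(1)])
          show "\<sigma> n holomorphic_on U" for n by (rule Hinf_carrierD[OF \<sigma>])
          fix x assume "x \<in> U"
          then obtain d where "0 < d" "cball x d \<subseteq> U" using U(1) open_contains_cball by blast
          then show "\<exists>d. 0 < d \<and> cball x d \<subseteq> U \<and> uniform_limit (cball x d) \<sigma> g sequentially"
            using uniform_limit_on_subset[OF g] by blast
        qed
        show "norm (g x) \<le> bnorm ?E (\<sigma> N) + 1" for x
          using norm_triangle_sub[of "g x" "\<sigma> N x"] N[of x] up[OF \<sigma>, of N x] by (simp add: norm_minus_commute)
        fix x assume x: "x \<notin> U"
        have "(\<lambda>n. \<sigma> n x) \<longlonglongrightarrow> g x" by (rule tendsto_uniform_limitI[OF g]) simp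
        moreover have "\<sigma> n x = 0" for n using Hinf_carrierD(2)[OF \<sigma> x] .
        ultimately show "g x = 0" by (simp add: LIMSEQ_const_iff)
      qed
      fix e :: real assume e: "0 < e"
      then obtain M where M: "\<And>n x. n \<ge> M \<Longrightarrow> norm (\<sigma> n x - g x) < e / 2" using lim[of "e / 2"] by auto
      have "bnorm ?E (\<sigma> n - g) \<le> e / 2" if "n \<ge> M" for n
        by (rule Hinf_norm_le[OF U(2)]) (use M[OF that] in \<open>simp add: less_imp_le\<close>)
      then show "\<exists>N. \<forall>n\<ge>N. bnorm ?E (\<sigma> n - g) < e" using e by (intro exI[of _ M]) fastforce
    qed
  qed
qed

lemma sum_fun_apply: "(\<Sum>v\<in>A. f v) x = (\<Sum>v\<in>A. (f v x :: 'a::ab_group_add))"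
  by (induction A rule: infinite_finite_induct) auto

text \<open>The monomials of degree at most \<open>card S\<close> are bounded on \<open>U\<close>
  and independent, because a nonzero polynomial has finitely many roots and \<open>U\<close> is
  infinite. There is one more of them than a span of \<open>S\<close> can hold.\<close>

lemma infinite_dimensional_Hinf:
  assumes U: "open U" "U \<noteq> {}" "bounded U"
  shows "infinite_dimensional (Hinf U)"
  unfolding infinite_dimensional_def
proof
  let ?E = "Hinf U"
  interpret cbanach ?E by (rule cbanach_Hinf[OF U(1,2)])
  assume "\<exists>S. finite S \<and> S \<subseteq> bcarrier ?E \<and> bcarrier ?E \<subseteq> vs.span S"
  then obtain S where S: "finite S" "bcarrier ?E \<subseteq> vs.span S" by blast
  define e where "e k = (\<lambda>x. if x \<in> U then x ^ k else 0)" for k :: nat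
  obtain B where B: "\<And>x. x \<in> U \<Longrightarrow> norm x \<le> B" using U(3) bounded_iff by blast
  have e: "e k \<in> bcarrier ?E" for k
  proof (rule Hinf_carrierI[of _ _ "B ^ k"])
    show "e k holomorphic_on U" by (rule holomorphic_transform[of "\<lambda>x. x ^ k"]) (auto simp: e_def intro!: holomorphic_intros)
  qed (use B in \<open>auto simp: e_def norm_power intro: power_mono\<close>)
  have inf: "infinite U" using U finite_imp_not_open by blast
  have poly: "c i = 0" if "\<And>x. x \<in> U \<Longrightarrow> (\<Sum>k\<le>n. c k * x ^ k) = 0" "i \<le> n" for c :: "nat \<Rightarrow> complex" and n i
  proof (rule ccontr)
    assume "c i \<noteq> 0"
    then have "finite {z. (\<Sum>k\<le>n. c k * z ^ k) = 0}" using that(2) by (auto simp: polyfun_finite_roots)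
    moreover have "U \<subseteq> {z. (\<Sum>k\<le>n. c k * z ^ k) = 0}" using that(1) by blast
    ultimately show False using inf finite_subset by blast
  qed
  let ?n = "card S"
  have inj: "inj_on e {..?n}"
  proof (rule inj_onI, rule ccontr)
    fix i j assume ij: "i \<in> {..?n}" "j \<in> {..?n}" "e i = e j" "i \<noteq> j"
    define c :: "nat \<Rightarrow> complex" where "c k = (if k = i then 1 else 0) - (if k = j then 1 else 0)" for k
    have "(\<Sum>k\<le>?n. c k * x ^ k) = 0" if "x \<in> U" for x
    proof -
      have "(\<Sum>k\<le>?n. c k * x ^ k) = (\<Sum>k\<le>?n. (if k = i then x ^ k else 0) - (if k = j then x ^ k else 0))"
        by (intro sum.cong) (auto simp: c_def)
      also have "\<dots> = x ^ i - x ^ j" using ij by (simp add: sum_subtractf)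
      finally show ?thesis using fun_cong[OF ij(3), of x] that by (simp add: e_def)
    qed
    from poly[OF this, of i] show False using ij by (simp add: c_def)
  qed
  have "vs.independent (e ` {..?n})"
  proof (rule vs.independent_if_scalars_zero)
    fix u v assume 0: "(\<Sum>v\<in>e ` {..?n}. bscale ?E (u v) v) = 0" and v: "v \<in> e ` {..?n}"
    obtain i where i: "v = e i" "i \<le> ?n" using v by blast
    have "(\<Sum>k\<le>?n. u (e k) * x ^ k) = 0" if x: "x \<in> U" for x
    proof -
      have "0 = (\<Sum>v\<in>e ` {..?n}. bscale ?E (u v) v) x" using 0 by simp
      also have "\<dots> = (\<Sum>v\<in>e ` {..?n}. u v * v x)" by (simp add: sum_fun_apply)
      also have "\<dots> = (\<Sum>k\<le>?n. u (e k) * e k x)" using inj by (simp add: sum.reindex)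
      finally show ?thesis using x by (simp add: e_def)
    qed
    from poly[OF this i(2)] show "u v = 0" by (simp add: i)
  qed simp
  moreover have "e ` {..?n} \<subseteq> vs.span S" using e S by blast
  ultimately have "card (e ` {..?n}) \<le> card S" using vs.independent_span_bound[OF S(1)] by blast
  then show False using inj by (simp add: card_image)
qed

text \<open>Cauchy's inequality on circles of radius \<open>\<delta> / 4\<close> around points of
  the half-size disk. The constant is linear in \<open>B\<close>, so a perturbation of small norm
  has a correspondingly small Lipschitz constant.\<close>

lemma holomorphic_lipschitz:
  assumes g: "g holomorphic_on ball x0 \<delta>" and B: "\<And>x. x \<in> ball x0 \<delta> \<Longrightarrow> norm (g x) \<le> B" and h: "norm h < \<delta> / 2"
  shows "norm (g (x0 + h) - g x0) \<le> 4 * B / \<delta> * norm h"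
proof -
  have \<delta>: "0 < \<delta>" using h norm_ge_zero[of h] by linarith
  have "norm (g (x0 + h) - g x0) \<le> 4 * B / \<delta> * norm (x0 + h - x0)"
  proof (rule field_differentiable_bound)
    show "convex (ball x0 (\<delta> / 2))" by simp
    fix y assume y: "y \<in> ball x0 (\<delta> / 2)"
    have yb: "y \<in> ball x0 \<delta>" using y \<delta> by auto
    have "(g has_field_derivative deriv g y) (at y)" by (rule holomorphic_derivI[OF g _ yb]) simp
    then show "(g has_field_derivative deriv g y) (at y within ball x0 (\<delta> / 2))" by (rule has_field_derivative_at_within)
    have sub: "cball y (\<delta> / 4) \<subseteq> ball x0 \<delta>"
    proof
      fix w assume "w \<in> cball y (\<delta> / 4)"
      then show "w \<in> ball x0 \<delta>" using y \<delta> dist_triangle[of x0 w y] by auto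
    qed
    have "norm ((deriv ^^ 1) g y) \<le> fact 1 * B / (\<delta> / 4) ^ 1"
    proof (rule Cauchy_inequality)
      show "g holomorphic_on ball y (\<delta> / 4)" using holomorphic_on_subset[OF g] sub ball_subset_cball by blast
      show "continuous_on (cball y (\<delta> / 4)) g" by (rule continuous_on_subset[OF holomorphic_on_imp_continuous_on[OF g] sub])
      show "norm (g w) \<le> B" if "norm (y - w) = \<delta> / 4" for w
        by (rule B, rule subsetD[OF sub]) (simp add: dist_norm that)
    qed (use \<delta> in simp)
    then show "norm (deriv g y) \<le> 4 * B / \<delta>" by (simp add: mult.commute)
  qed (use h \<delta> in \<open>auto simp: dist_norm\<close>)
  then show ?thesis by simp
qed

lemma topspace_open_submanifold:
  "cbanach E \<Longrightarrow> U \<subseteq> bcarrier E \<Longrightarrow> topspace (mtop (open_submanifold E U)) = U"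
  using cbanach.topspace_btopology by (fastforce simp: open_submanifold_def)

lemma openin_bprod:
  assumes E: "cbanach E" and G: "cbanach G" and U: "openin (btopology E) U" and V: "openin (btopology G) V"
  shows "openin (btopology (bprod E G)) (U \<times> V)"
proof -
  interpret E: cbanach E by fact
  interpret G: cbanach G by fact
  interpret P: cbanach "bprod E G" by (rule cbanach_bprod[OF E G])
  show ?thesis unfolding P.openin_btopology
  proof (intro conjI ballI)
    show "U \<times> V \<subseteq> bcarrier (bprod E G)" using U V unfolding E.openin_btopology G.openin_btopology by auto
    fix p assume p: "p \<in> U \<times> V"
    obtain r where r: "0 < r" "\<And>h. h \<in> bcarrier E \<Longrightarrow> bnorm E h < r \<Longrightarrow> fst p + h \<in> U"
      using U p unfolding E.openin_btopology by fastforce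
    obtain s where s: "0 < s" "\<And>h. h \<in> bcarrier G \<Longrightarrow> bnorm G h < s \<Longrightarrow> snd p + h \<in> V"
      using V p unfolding G.openin_btopology by fastforce
    show "\<exists>r>0. \<forall>h\<in>bcarrier (bprod E G). bnorm (bprod E G) h < r \<longrightarrow> p + h \<in> U \<times> V"
    proof (intro exI[of _ "min r s"] conjI ballI impI)
      fix h assume h: "h \<in> bcarrier (bprod E G)" "bnorm (bprod E G) h < min r s"
      have "bnorm E (fst h) + bnorm G (snd h) < min r s" using h(2) by simp
      then have "bnorm E (fst h) < r" "bnorm G (snd h) < s" using E.norm_nonneg[of "fst h"] G.norm_nonneg[of "snd h"] by linarith+
      moreover have "fst h \<in> bcarrier E" "snd h \<in> bcarrier G" using h(1) by auto
      ultimately have "fst p + fst h \<in> U" "snd p + snd h \<in> V" using r s by blast+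
      then show "p + h \<in> U \<times> V" by (simp add: mem_Times_iff)
    qed (use r s in simp)
  qed
qed

text \<open>The parameters are bounded functions on the larger disk of radius \<open>R\<close>, the
  graphs are taken over the disk of radius \<open>\<rho>\<close>. The total space is the product of
  this disk with the ball of parameters.\<close>

locale graph_family =
  fixes R \<rho> r :: real and \<phi>0 W a :: "complex \<Rightarrow> complex" and \<Lambda> :: "complex set"
  assumes \<rho>: "0 < \<rho>" "\<rho> < R" and r: "0 < r"
    and hol: "\<phi>0 holomorphic_on ball 0 R" "W holomorphic_on ball 0 R"
    and \<Lambda>: "finite \<Lambda>" "\<And>x. x \<in> ball 0 \<rho> - \<Lambda> \<Longrightarrow> W x \<noteq> 0"
    and a: "a \<in> bcarrier (Hinf (ball 0 R))"
    and bound: "\<And>\<alpha> x. \<alpha> \<in> bball (Hinf (ball 0 R)) a r \<Longrightarrow> x \<in> ball 0 \<rho> \<Longrightarrow> norm (\<phi>0 x + W x * \<alpha> x) < 1"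
begin

abbreviation E where "E \<equiv> Hinf (ball (0::complex) R)"
abbreviation P where "P \<equiv> bprod complex_line E"
definition A where "A = bball E a r"
definition X where "X = ball (0::complex) \<rho> \<times> A"
definition \<Phi> :: "complex \<times> (complex \<Rightarrow> complex) \<Rightarrow> complex \<times> complex" where
  "\<Phi> p = (fst p, \<phi>0 (fst p) + W (fst p) * snd p (fst p))"

sublocale E: cbanach E
  using \<rho> by (intro cbanach_Hinf) auto

sublocale P: cbanach P by (intro cbanach_bprod cbanach_complex_line E.cbanach_axioms)

lemma complex_line_simps [simp]: "bcarrier complex_line = UNIV" "bnorm complex_line = norm" "bscale complex_line = (*)"
  by (simp_all add: complex_line_def)

lemma complex_plane2_simps [simp]: "bcarrier complex_plane2 = UNIV" "bnorm complex_plane2 = norm"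
  "bscale complex_plane2 c (x, y) = (c * x, c * y)"
  by (simp_all add: complex_plane2_def)

lemma A: "openin (btopology E) A" "A \<subseteq> bcarrier E" "a \<in> A"
  using E.openin_bball[of a r] r a by (auto simp: A_def E.mem_bball)

lemma X: "openin (btopology P) X" "X \<subseteq> bcarrier P"
  using A openin_bprod[OF cbanach_complex_line E.cbanach_axioms _ A(1), of "ball 0 \<rho>"]
  by (auto simp: X_def openin_complex_line)

lemma norm_le: "\<beta> \<in> bcarrier E \<Longrightarrow> x \<in> ball 0 R \<Longrightarrow> norm (\<beta> x) \<le> bnorm E \<beta>"
  by (rule Hinf_norm_upper)

definition \<Phi>' :: "complex \<times> (complex \<Rightarrow> complex) \<Rightarrow> complex \<times> (complex \<Rightarrow> complex) \<Rightarrow> complex \<times> complex" where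
  "\<Phi>' p q = (fst q, deriv (\<lambda>x. \<phi>0 x + W x * snd p x) (fst p) * fst q + W (fst p) * snd q (fst p))"

text \<open>The only nonlinear effect is the evaluation of the parameter at a moving point. The
  error is that of the one-variable function \<open>b = \<phi>0 + W * \<alpha>\<close> plus the
  increment of \<open>W * \<beta>\<close> from \<open>x0\<close> to \<open>x0 + h\<close>, which is
  bounded by a multiple of \<open>bnorm E \<beta> * norm h\<close> and so of second order.\<close>

lemma cfrechet_\<Phi>:
  assumes p: "fst p \<in> ball 0 R" "snd p \<in> bcarrier E"
  shows "cfrechet P complex_plane2 \<Phi> p (\<Phi>' p)"
proof -
  obtain x0 \<alpha> where px: "p = (x0, \<alpha>)" by (cases p)
  have x0: "x0 \<in> ball 0 R" and \<alpha>: "\<alpha> \<in> bcarrier E" using p by (auto simp: px)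
  define b where "b x = \<phi>0 x + W x * \<alpha> x" for x
  have bh: "b holomorphic_on ball 0 R" unfolding b_def by (intro holomorphic_intros hol Hinf_carrierD(1)[OF \<alpha>])
  have \<Phi>'_eq: "\<Phi>' p (h, \<beta>) = (h, deriv b x0 * h + W x0 * \<beta> x0)" for h \<beta> by (simp add: \<Phi>'_def px b_def[abs_def])
  obtain \<delta> where \<delta>: "0 < \<delta>" "cball x0 \<delta> \<subseteq> ball 0 R" using x0 open_ball open_contains_cball by blast
  have cW: "compact (W ` cball x0 \<delta>)"
    by (intro compact_continuous_image continuous_on_subset[OF holomorphic_on_imp_continuous_on[OF hol(2)] \<delta>(2)] compact_cball)
  obtain M where M: "0 < M" "\<And>x. x \<in> cball x0 \<delta> \<Longrightarrow> norm (W x) \<le> M"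
    using compact_imp_bounded[OF cW] by (auto simp: bounded_pos)
  have bounded: "bounded_clinear_map P complex_plane2 (\<Phi>' p)"
    unfolding bounded_clinear_map_def
  proof (intro conjI ballI allI exI[of _ "1 + norm (deriv b x0) + norm (W x0)"])
    fix q c assume q: "q \<in> bcarrier P"
    obtain h \<beta> where hb: "q = (h, \<beta>)" "\<beta> \<in> bcarrier E" using q by (cases q) auto
    show "\<Phi>' p (bscale P c q) = bscale complex_plane2 c (\<Phi>' p q)"
      by (simp add: hb \<Phi>'_eq algebra_simps)
    have "norm (\<Phi>' p q) \<le> norm h + norm (deriv b x0 * h + W x0 * \<beta> x0)"
      unfolding hb(1) \<Phi>'_eq by (rule norm_Pair_le)
    also have "\<dots> \<le> norm h + (norm (deriv b x0) * norm h + norm (W x0) * norm (\<beta> x0))"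
      by (intro add_left_mono order_trans[OF norm_triangle_ineq]) (simp add: norm_mult)
    also have "\<dots> \<le> norm h + (norm (deriv b x0) * norm h + norm (W x0) * bnorm E \<beta>)"
      by (intro add_left_mono mult_left_mono norm_le hb x0) simp
    also have "\<dots> \<le> (1 + norm (deriv b x0) + norm (W x0)) * (norm h + bnorm E \<beta>)"
      by (simp add: algebra_simps)
    finally show "bnorm complex_plane2 (\<Phi>' p q) \<le> (1 + norm (deriv b x0) + norm (W x0)) * bnorm P q" by (simp add: hb)
  next
    fix q q' show "\<Phi>' p (q + q') = \<Phi>' p q + \<Phi>' p q'"
      by (cases q; cases q') (simp add: \<Phi>'_eq algebra_simps)
  qed simp
  show ?thesis unfolding cfrechet_def
  proof (intro conjI allI impI bounded)
    fix e :: real assume e: "0 < e"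
    have "(b has_field_derivative deriv b x0) (at x0)" by (rule holomorphic_derivI[OF bh _ x0]) simp
    then have "(b has_derivative (*) (deriv b x0)) (at x0)" by (simp add: has_field_derivative_def)
    then obtain d where d: "0 < d" "\<And>y. norm (y - x0) < d \<Longrightarrow> norm (b y - b x0 - deriv b x0 * (y - x0)) \<le> e * norm (y - x0)"
      using e unfolding has_derivative_at_alt by blast
    define K where "K = 4 * M / \<delta>"
    have K: "0 < K" using M \<delta> by (simp add: K_def)
    show "\<exists>d>0. \<forall>q\<in>bcarrier P. bnorm P q < d \<longrightarrow> bnorm complex_plane2 (\<Phi> (p + q) - \<Phi> p - \<Phi>' p q) \<le> e * bnorm P q"
    proof (intro exI[of _ "min d (min (\<delta> / 2) (e / K))"] conjI ballI impI)
      show "0 < min d (min (\<delta> / 2) (e / K))" using d \<delta> e K by simp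
      fix q assume q: "q \<in> bcarrier P" "bnorm P q < min d (min (\<delta> / 2) (e / K))"
      obtain h \<beta> where hb: "q = (h, \<beta>)" "\<beta> \<in> bcarrier E" using q(1) by (cases q) auto
      have nb: "0 \<le> bnorm E \<beta>" by simp
      have "norm h + bnorm E \<beta> < min d (min (\<delta> / 2) (e / K))" using q(2) by (simp add: hb)
      then have h: "norm h < d" "norm h < \<delta> / 2" "norm h < e / K" using nb by linarith+
      define g where "g x = W x * \<beta> x" for x
      have sub: "ball x0 \<delta> \<subseteq> ball 0 R" using \<delta>(2) ball_subset_cball by blast
      have gh: "g holomorphic_on ball x0 \<delta>" unfolding g_def
        by (intro holomorphic_intros holomorphic_on_subset[OF hol(2) sub] holomorphic_on_subset[OF Hinf_carrierD(1)[OF hb(2)] sub])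
      have "norm (g x) \<le> M * bnorm E \<beta>" if "x \<in> ball x0 \<delta>" for x
      proof -
        have "norm (W x) \<le> M" using that by (intro M) auto
        moreover have "norm (\<beta> x) \<le> bnorm E \<beta>" using that sub by (intro norm_le hb) blast
        ultimately show ?thesis unfolding g_def norm_mult by (intro mult_mono) (use M in auto)
      qed
      from holomorphic_lipschitz[OF gh this h(2)]
      have "norm (g (x0 + h) - g x0) \<le> 4 * (M * bnorm E \<beta>) / \<delta> * norm h" .
      also have "\<dots> = bnorm E \<beta> * (K * norm h)" by (simp add: K_def)
      also have "\<dots> \<le> bnorm E \<beta> * e" using h(3) K by (intro mult_left_mono nb) (simp add: field_simps)
      finally have g: "norm (g (x0 + h) - g x0) \<le> e * bnorm E \<beta>" by (simp add: mult.commute)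
      have "norm (b (x0 + h) - b x0 - deriv b x0 * h) \<le> e * norm h" using d(2)[of "x0 + h"] h(1) by simp
      then have "norm ((b (x0 + h) - b x0 - deriv b x0 * h) + (g (x0 + h) - g x0)) \<le> e * norm h + e * bnorm E \<beta>"
        by (rule norm_triangle_mono[OF _ g])
      moreover have "\<Phi> (p + q) - \<Phi> p - \<Phi>' p q = (0, (b (x0 + h) - b x0 - deriv b x0 * h) + (g (x0 + h) - g x0))"
        by (simp add: \<Phi>_def px hb \<Phi>'_eq[unfolded px] b_def g_def algebra_simps)
      ultimately show "bnorm complex_plane2 (\<Phi> (p + q) - \<Phi> p - \<Phi>' p q) \<le> e * bnorm P q"
        by (simp add: hb algebra_simps)
    qed
  qed
qed

lemma X_mem: "p \<in> X \<Longrightarrow> fst p \<in> ball 0 R \<and> snd p \<in> bcarrier E"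
  using \<rho> A by (auto simp: X_def)

text \<open>The projection is linear, hence its own derivative, and
  \<open>w \<mapsto> (0, w)\<close> is a bounded right inverse; uniqueness of derivatives identifies
  all its differentials on the carrier.\<close>

lemma submersion: "holomorphic_submersion (open_submanifold P X) (open_submanifold E A) snd"
proof -
  have lin: "bounded_clinear_map P E snd"
    unfolding bounded_clinear_map_def by (auto intro!: exI[of _ 1])
  have fr: "cfrechet P E snd p snd" if "p \<in> X" for p
    by (rule cfrechet_linear[OF P.cbanach_axioms E.cbanach_axioms lin]) (use that X in blast)
  have hm: "holomorphic_map (open_submanifold P X) (open_submanifold E A) snd"
    by (rule holomorphic_map_open_submanifold[OF P.cbanach_axioms E.cbanach_axioms X(1) A(2)])
      (use fr in \<open>auto simp: X_def\<close>)
  have inv: "bounded_clinear_map E P (\<lambda>w. (0, w))"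
    unfolding bounded_clinear_map_def by (auto intro!: exI[of _ 1])
  show ?thesis unfolding holomorphic_submersion_def
  proof (intro conjI ballI hm)
    fix p L assume p: "p \<in> topspace (mtop (open_submanifold P X))"
      and L: "L \<in> differentials (open_submanifold P X) (open_submanifold E A) snd p"
    have pX: "p \<in> X" using p X topspace_open_submanifold[OF P.cbanach_axioms] by simp
    then have "snd p \<in> A" by (auto simp: X_def)
    then have L: "cfrechet P E snd p L" using L differentials_open_submanifold[OF P.cbanach_axioms X(1) pX] by blast
    have "L (0, w) = snd (0 :: complex, w)" if "w \<in> bcarrier E" for w
      by (rule cfrechet_unique[OF P.cbanach_axioms E.cbanach_axioms L fr[OF pX] pX X(1)]) (use that X_mem in auto)
    then show "\<exists>R. bounded_clinear_map (mmodel (open_submanifold E A)) (mmodel (open_submanifold P X)) R \<and>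
            (\<forall>w\<in>bcarrier (mmodel (open_submanifold E A)). L (R w) = w)"
      using inv by (intro exI[of _ "\<lambda>w. (0, w)"]) (simp add: open_submanifold_def)
  qed
qed

text \<open>The fibre is parametrised by scaling the unit disk to radius \<open>\<rho>\<close>.
  Division of the first component by \<open>\<rho>\<close> is a continuous inverse defined on the
  whole total space, which makes the map an embedding.\<close>

lemma fibre_disk:
  assumes \<alpha>: "\<alpha> \<in> A"
  shows "embedded_disk (open_submanifold P X) {p \<in> X. snd p = \<alpha>}"
proof -
  define j where "j \<zeta> = (of_real \<rho> * \<zeta>, \<alpha>)" for \<zeta> :: complex
  define L where "L h = (of_real \<rho> * h, 0 :: complex \<Rightarrow> complex)" for h :: complex
  note cl = cbanach_complex_line
  have oD: "openin (btopology complex_line) (ball 0 1)" by (simp add: openin_complex_line)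
  have jX: "j \<zeta> \<in> X" if "\<zeta> \<in> ball 0 1" for \<zeta>
    using that \<alpha> \<rho> by (auto simp: j_def X_def norm_mult)
  have im: "j ` ball 0 1 = {p \<in> X. snd p = \<alpha>}"
  proof (intro equalityI subsetI)
    fix p assume p: "p \<in> {p \<in> X. snd p = \<alpha>}"
    then have "norm (fst p) < \<rho>" by (auto simp: X_def)
    then have "fst p / of_real \<rho> \<in> ball 0 1" using \<rho> by (simp add: norm_divide)
    moreover have "p = j (fst p / of_real \<rho>)" using p \<rho> by (cases p) (auto simp: j_def)
    ultimately show "p \<in> j ` ball 0 1" by (rule image_eqI[rotated])
  qed (use jX in \<open>auto simp: j_def\<close>)
  have Lb: "bounded_clinear_map complex_line P L"
    unfolding bounded_clinear_map_def using \<rho>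
    by (auto intro!: exI[of _ \<rho>] simp: L_def algebra_simps norm_mult fun_eq_iff)
  have fr: "cfrechet complex_line P j \<zeta> L" for \<zeta>
  proof -
    have "j (\<zeta> + h) - j \<zeta> - L h = 0" for h by (simp add: j_def L_def zero_prod_def algebra_simps)
    then show ?thesis unfolding cfrechet_def using Lb by (auto intro!: exI[of _ 1])
  qed
  have hm: "holomorphic_map (open_submanifold complex_line (ball 0 1)) (open_submanifold P X) j"
    by (rule holomorphic_map_open_submanifold[OF cl P.cbanach_axioms oD X(2) jX]) (use fr in auto)
  define g :: "complex \<times> (complex \<Rightarrow> complex) \<Rightarrow> complex" where "g p = fst p / of_real \<rho>" for p
  have gb: "bounded_clinear_map P complex_line g"
    unfolding bounded_clinear_map_def using \<rho>
    by (auto intro!: exI[of _ "1 / \<rho>"] simp: g_def norm_divide add_divide_distrib divide_right_mono)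
  have gc: "continuous_map (subtopology (btopology P) X) (subtopology (btopology complex_line) (ball 0 1)) g"
  proof (rule continuous_map_cfrechet[OF P.cbanach_axioms cl X(1)])
    show "g p \<in> ball 0 1" if "p \<in> X" for p using that \<rho> by (auto simp: g_def X_def norm_divide)
    show "\<exists>L. cfrechet P complex_line g p L" if "p \<in> X" for p
      using cfrechet_linear[OF P.cbanach_axioms cl gb] that X by blast
  qed simp
  have gj: "g (j \<zeta>) = \<zeta>" for \<zeta> using \<rho> by (simp add: g_def j_def)
  let ?D = "mtop (open_submanifold complex_line (ball 0 1))" and ?X = "mtop (open_submanifold P X)"
  have tD: "topspace ?D = ball 0 1" by (rule topspace_open_submanifold[OF cl]) simp
  have cj: "continuous_map ?D ?X j" using hm by (simp add: holomorphic_map_def)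
  have emb: "embedding_map ?D ?X j"
    unfolding embedding_map_def homeomorphic_map_maps
  proof (intro exI[of _ g])
    show "homeomorphic_maps ?D (subtopology ?X (j ` topspace ?D)) j g"
      unfolding homeomorphic_maps_def
    proof (intro conjI ballI)
      show "continuous_map ?D (subtopology ?X (j ` topspace ?D)) j"
        using cj by (simp add: continuous_map_in_subtopology)
      show "continuous_map (subtopology ?X (j ` topspace ?D)) ?D g"
        using gc by (intro continuous_map_from_subtopology) (simp add: open_submanifold_def)
      show "g (j x) = x" for x by (rule gj)
      show "j (g y) = y" if "y \<in> topspace (subtopology ?X (j ` topspace ?D))" for y
        using that gj by auto
    qed
  qed
  have "inj L'" if \<zeta>: "\<zeta> \<in> ball 0 1" and L': "L' \<in> differentials (open_submanifold complex_line (ball 0 1)) (open_submanifold P X) j \<zeta>" for \<zeta> L'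
  proof -
    have "cfrechet complex_line P j \<zeta> L'" using L' differentials_open_submanifold[OF cl oD \<zeta>] jX[OF \<zeta>] by blast
    then have "L' h = L h" for h
      by (rule cfrechet_unique[OF cl P.cbanach_axioms _ fr \<zeta> oD]) (use jX X in auto)
    then show ?thesis using \<rho> by (auto intro!: injI simp: L_def)
  qed
  then show ?thesis unfolding embedded_disk_def Let_def using hm emb im by blast
qed

lemma \<Phi>_holomorphic: "holomorphic_map (open_submanifold P X) (open_submanifold complex_plane2 UNIV) \<Phi>"
  by (rule holomorphic_map_open_submanifold[OF P.cbanach_axioms cbanach_complex_plane2 X(1)])
    (simp_all, use cfrechet_\<Phi> X_mem in blast)

text \<open>Where \<open>W\<close> does not vanish, constant variations of the parameter move the
  second coordinate freely, so the derivative is onto. The excluded first coordinates form a finite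
  set, hence these points are dense.\<close>

lemma \<Phi>_rank: "generic_rank_2 (open_submanifold P X) \<Phi>"
proof -
  let ?S = "{p \<in> topspace (mtop (open_submanifold P X)).
     \<exists>L\<in>differentials (open_submanifold P X) (open_submanifold complex_plane2 UNIV) \<Phi> p.
          L ` bcarrier (mmodel (open_submanifold P X)) = UNIV}"
  have tX: "topspace (mtop (open_submanifold P X)) = X" by (rule topspace_open_submanifold[OF P.cbanach_axioms X(2)])
  have good: "p \<in> ?S" if p: "p \<in> X" "W (fst p) \<noteq> 0" for p
  proof -
    have "cfrechet P complex_plane2 \<Phi> p (\<Phi>' p)" using X_mem[OF p(1)] by (intro cfrechet_\<Phi>) auto
    then have "\<Phi>' p \<in> differentials (open_submanifold P X) (open_submanifold complex_plane2 UNIV) \<Phi> p"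
      using differentials_open_submanifold[OF P.cbanach_axioms X(1) p(1)] by blast
    moreover have "\<Phi>' p ` bcarrier P = UNIV"
    proof (intro equalityI subsetI UNIV_I)
      fix y :: "complex \<times> complex"
      define c where "c = (snd y - deriv (\<lambda>x. \<phi>0 x + W x * snd p x) (fst p) * fst y) / W (fst p)"
      define \<beta> :: "complex \<Rightarrow> complex" where "\<beta> = (\<lambda>x. if x \<in> ball 0 R then c else 0)"
      have "\<beta> \<in> bcarrier E"
      proof (rule Hinf_carrierI[of _ _ "norm c"])
        show "\<beta> holomorphic_on ball 0 R" by (rule holomorphic_transform[of "\<lambda>_. c"]) (auto simp: \<beta>_def)
      qed (auto simp: \<beta>_def)
      moreover have "\<Phi>' p (fst y, \<beta>) = y"
        using p(2) X_mem[OF p(1)] by (cases y) (simp add: \<Phi>'_def \<beta>_def c_def)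
      ultimately show "y \<in> \<Phi>' p ` bcarrier P" by (intro image_eqI[of _ _ "(fst y, \<beta>)"]) auto
    qed
    ultimately show ?thesis using p(1) tX by (auto simp: open_submanifold_def)
  qed
  have "p \<in> mtop (open_submanifold P X) closure_of ?S" if p: "p \<in> X" for p
    unfolding in_closure_of
  proof (intro conjI allI impI)
    show "p \<in> topspace (mtop (open_submanifold P X))" using p tX by simp
    fix T assume T: "p \<in> T \<and> openin (mtop (open_submanifold P X)) T"
    then have "openin (btopology P) T" "T \<subseteq> X"
      using openin_open_subtopology[OF X(1)] by (auto simp: open_submanifold_def)
    then obtain s where s: "0 < s" "\<And>h. h \<in> bcarrier P \<Longrightarrow> bnorm P h < s \<Longrightarrow> p + h \<in> T"
      using T unfolding P.openin_btopology by blast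
    have "infinite (ball (fst p) s)" using s(1) finite_imp_not_open[of "ball (fst p) s"] by auto
    then have "infinite (ball (fst p) s - \<Lambda>)" using \<Lambda>(1) by simp
    then obtain x where x: "x \<in> ball (fst p) s" "x \<notin> \<Lambda>" using infinite_imp_nonempty by blast
    have "p + (x - fst p, 0) \<in> T" by (rule s) (use x in \<open>auto simp: dist_norm norm_minus_commute\<close>)
    then have "(x, snd p) \<in> T" by (cases p) simp
    moreover from this have "(x, snd p) \<in> X" using \<open>T \<subseteq> X\<close> by blast
    moreover from this have "W x \<noteq> 0" using \<Lambda>(2)[of x] x(2) by (auto simp: X_def)
    ultimately show "\<exists>y. y \<in> ?S \<and> y \<in> T" using good[of "(x, snd p)"] by auto
  qed
  then have "X \<subseteq> mtop (open_submanifold P X) closure_of ?S" by blast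
  moreover have "mtop (open_submanifold P X) closure_of ?S \<subseteq> topspace (mtop (open_submanifold P X))"
    by (rule closure_of_subset_topspace)
  ultimately show ?thesis unfolding generic_rank_2_def tX by blast
qed

theorem analytic_graph_family:
  "analytic_graph_family (ball 0 \<rho>) (open_submanifold P X) snd (open_submanifold E A) \<Phi> (\<lambda>\<alpha> x. \<phi>0 x + W x * \<alpha> x)"
proof -
  have tX: "topspace (mtop (open_submanifold P X)) = X" by (rule topspace_open_submanifold[OF P.cbanach_axioms X(2)])
  have tA: "topspace (mtop (open_submanifold E A)) = A" by (rule topspace_open_submanifold[OF E.cbanach_axioms A(2)])
  have "(\<lambda>x. if x \<in> ball 0 R then 1 else 0 :: complex) \<in> bcarrier E"
  proof (rule Hinf_carrierI[of _ _ 1])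
    show "(\<lambda>x. if x \<in> ball 0 R then 1 else 0 :: complex) holomorphic_on ball 0 R"
      by (rule holomorphic_transform[of "\<lambda>_. 1"]) auto
  qed auto
  moreover have "(\<lambda>x. if x \<in> ball 0 R then 1 else 0 :: complex) \<noteq> 0" using \<rho> by (auto simp: fun_eq_iff intro!: exI[of _ 0])
  ultimately have nontriv: "\<exists>v\<in>bcarrier (mmodel (open_submanifold E A)). v \<noteq> 0"
    unfolding open_submanifold_def by auto
  have "snd ` X = A" using \<rho> by (force simp: X_def)
  moreover have "\<Phi> ` {p \<in> X. snd p = \<alpha>} = graph_over (ball 0 \<rho>) (\<lambda>x. \<phi>0 x + W x * \<alpha> x)" if "\<alpha> \<in> A" for \<alpha>
  proof (intro equalityI subsetI)
    fix q assume "q \<in> graph_over (ball 0 \<rho>) (\<lambda>x. \<phi>0 x + W x * \<alpha> x)"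
    then obtain x where "x \<in> ball 0 \<rho>" "q = \<Phi> (x, \<alpha>)" by (auto simp: graph_over_def \<Phi>_def)
    then show "q \<in> \<Phi> ` {p \<in> X. snd p = \<alpha>}" using that by (auto simp: X_def)
  qed (auto simp: graph_over_def \<Phi>_def X_def)
  moreover have "(\<lambda>x. \<phi>0 x + W x * \<alpha> x) holomorphic_on ball 0 \<rho>" if "\<alpha> \<in> A" for \<alpha>
  proof -
    have "\<alpha> \<in> bcarrier E" using that A by blast
    then have "(\<lambda>x. \<phi>0 x + W x * \<alpha> x) holomorphic_on ball 0 R" by (intro holomorphic_intros hol Hinf_carrierD(1))
    then show ?thesis by (rule holomorphic_on_subset) (use \<rho> in auto)
  qed
  moreover have "(\<lambda>x. \<phi>0 x + W x * \<alpha> x) ` ball 0 \<rho> \<subseteq> ball 0 1" if "\<alpha> \<in> A" for \<alpha>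
    using bound[of \<alpha>] that by (auto simp: A_def)
  ultimately show ?thesis
    unfolding analytic_graph_family_def tX tA
    using complex_manifold_open_submanifold[OF P.cbanach_axioms X(1)] complex_manifold_open_submanifold[OF E.cbanach_axioms A(1)]
      nontriv submersion fibre_disk \<Phi>_holomorphic \<Phi>_rank by blast
qed

end

section \<open>The swept domain and its pinches\<close>

locale pinched_family =
  fixes R \<rho> \<eta> :: real and \<phi>0 W :: "complex \<Rightarrow> complex" and \<Lambda> :: "complex set" and n0 :: nat
  assumes \<rho>: "1 < \<rho>" "\<rho> < R" and \<eta>: "0 < \<eta>" and \<phi>0: "\<phi>0 holomorphic_on ball 0 R"
    and \<Lambda>: "finite \<Lambda>" "\<Lambda> \<subseteq> ball 0 1" and n0: "0 < n0" and W_eq: "\<And>x. W x = (\<Prod>c\<in>\<Lambda>. x - c) ^ n0"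
begin

text \<open>The scaling gives modulus \<open>\<eta>\<close>, the radius of the ball, exactly on
  \<open>norm x = \<rho>\<close>: there every member of the ball is subject to Rouche's theorem. On
  the closed unit disk the modulus is at most \<open>\<eta> / \<rho> < \<eta>\<close>, so small
  values remain attainable.\<close>

definition center :: "complex \<Rightarrow> complex" where
  "center x = (if x \<in> ball 0 R then of_real (\<eta> / \<rho>) * x else 0)"

abbreviation E where "E \<equiv> Hinf (ball (0::complex) R)"

definition graphs :: "(complex \<times> complex) set" where
  "graphs = (\<Union>\<alpha>\<in>bball E center \<eta>. graph_over (ball 0 \<rho>) (\<lambda>x. \<phi>0 x + W x * \<alpha> x))"

sublocale E: cbanach E
  using \<rho> by (intro cbanach_Hinf) auto

lemma W_0_iff: "W x = 0 \<longleftrightarrow> x \<in> \<Lambda>" using \<Lambda>(1) n0 by (auto simp: W_eq)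

lemma center: "center \<in> bcarrier E"
proof (rule Hinf_carrierI[of _ _ "\<eta> / \<rho> * R"])
  show "center holomorphic_on ball 0 R"
    by (rule holomorphic_transform[of "\<lambda>x. of_real (\<eta> / \<rho>) * x"]) (auto simp: center_def intro!: holomorphic_intros)
  fix x :: complex assume "x \<in> ball 0 R"
  then show "norm (center x) \<le> \<eta> / \<rho> * R" using \<eta> \<rho> by (simp add: center_def norm_mult norm_divide divide_right_mono)
qed (simp add: center_def)

lemma member:
  assumes "\<alpha> \<in> bball E center \<eta>"
  shows "\<alpha> \<in> bcarrier E" and "x \<in> ball 0 R \<Longrightarrow> norm (\<alpha> x - of_real (\<eta> / \<rho>) * x) < \<eta>"
    and "x \<in> ball 0 R \<Longrightarrow> norm (\<alpha> x) < \<eta> * (1 + R / \<rho>)"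
proof -
  show \<alpha>: "\<alpha> \<in> bcarrier E" using assms by (simp add: E.mem_bball)
  have *: "norm (\<alpha> x - of_real (\<eta> / \<rho>) * x) < \<eta>" if x: "x \<in> ball 0 R" for x
  proof -
    have "norm ((\<alpha> - center) x) \<le> bnorm E (\<alpha> - center)"
      by (rule Hinf_norm_upper[OF E.carrier_intros(2)[OF \<alpha> center] x])
    also have "\<dots> < \<eta>" using assms by (simp add: E.mem_bball)
    finally show ?thesis using x by (simp add: center_def)
  qed
  show "norm (\<alpha> x - of_real (\<eta> / \<rho>) * x) < \<eta>" if "x \<in> ball 0 R" by (rule *[OF that])
  show "norm (\<alpha> x) < \<eta> * (1 + R / \<rho>)" if x: "x \<in> ball 0 R"
  proof -
    have "norm (\<alpha> x) \<le> norm (of_real (\<eta> / \<rho>) * x) + norm (\<alpha> x - of_real (\<eta> / \<rho>) * x)" by (rule norm_triangle_sub)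
    also have "norm (of_real (\<eta> / \<rho>) * x) \<le> \<eta> / \<rho> * R" using x \<eta> \<rho> by (simp add: norm_mult norm_divide divide_right_mono)
    finally show ?thesis using *[OF x] by (simp add: distrib_left)
  qed
qed

text \<open>Such a point lies on the graph whose parameter is the centre plus a constant
  \<open>t\<close> with \<open>norm t < \<eta>\<close>, and the set of these points is open.\<close>

lemma swept_subset:
  "{q. norm (fst q) < \<rho> \<and> norm (snd q - \<phi>0 (fst q) - W (fst q) * (of_real (\<eta> / \<rho>) * fst q)) < \<eta> * norm (W (fst q))}
    \<subseteq> interior graphs" (is "?O \<subseteq> _")
proof (rule interior_maximal)
  have o: "open (ball 0 \<rho> \<times> (UNIV :: complex set))" by (simp add: open_Times)
  have hW: "W holomorphic_on UNIV" unfolding W_eq by (intro holomorphic_intros)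
  have "continuous_on (ball 0 \<rho> \<times> UNIV)
     (\<lambda>q. norm (snd q - \<phi>0 (fst q) - W (fst q) * (of_real (\<eta> / \<rho>) * fst q)) - \<eta> * norm (W (fst q)))"
    by (intro continuous_intros continuous_on_compose2[OF holomorphic_on_imp_continuous_on[OF \<phi>0]]
      continuous_on_compose2[OF holomorphic_on_imp_continuous_on[OF hW]]) (use \<rho> in auto)
  from continuous_open_preimage[OF this o, of "{..<0}"]
  have "open ((ball 0 \<rho> \<times> UNIV) \<inter>
     (\<lambda>q. norm (snd q - \<phi>0 (fst q) - W (fst q) * (of_real (\<eta> / \<rho>) * fst q)) - \<eta> * norm (W (fst q))) -` {..<0})" by auto
  moreover have "(ball 0 \<rho> \<times> UNIV) \<inter>
     (\<lambda>q. norm (snd q - \<phi>0 (fst q) - W (fst q) * (of_real (\<eta> / \<rho>) * fst q)) - \<eta> * norm (W (fst q))) -` {..<0} = ?O" by auto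
  ultimately show "open ?O" by simp
  show "?O \<subseteq> graphs"
  proof
    fix q assume q: "q \<in> ?O"
    define t where "t = (snd q - \<phi>0 (fst q) - W (fst q) * (of_real (\<eta> / \<rho>) * fst q)) / W (fst q)"
    have W: "W (fst q) \<noteq> 0" using q by auto
    then have t: "norm t < \<eta>" using q by (simp add: t_def norm_divide divide_less_eq)
    define \<alpha> where "\<alpha> = (\<lambda>x. if x \<in> ball 0 R then of_real (\<eta> / \<rho>) * x + t else 0)"
    have "(\<lambda>x. if x \<in> ball 0 R then t else 0) \<in> bcarrier E"
    proof (rule Hinf_carrierI[of _ _ "norm t"])
      show "(\<lambda>x. if x \<in> ball 0 R then t else 0) holomorphic_on ball 0 R"
        by (rule holomorphic_transform[of "\<lambda>_. t"]) auto
    qed auto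
    from E.carrier_intros(1)[OF center this]
    have \<alpha>E: "\<alpha> \<in> bcarrier E" by (simp add: \<alpha>_def center_def plus_fun_def if_distrib cong: if_cong)
    have "bnorm E (\<alpha> - center) \<le> norm t"
      by (rule Hinf_norm_le) (use \<rho> in \<open>auto simp: \<alpha>_def center_def\<close>)
    then have "\<alpha> \<in> bball E center \<eta>" using t \<alpha>E center by (simp add: E.mem_bball)
    moreover have "\<phi>0 (fst q) + W (fst q) * \<alpha> (fst q) = snd q"
      using W q \<rho> by (simp add: \<alpha>_def t_def distrib_left)
    then have "q \<in> graph_over (ball 0 \<rho>) (\<lambda>x. \<phi>0 x + W x * \<alpha> x)"
      using q unfolding graph_over_def by (cases q) auto
    ultimately show "q \<in> graphs" by (auto simp: graphs_def)
  qed
qed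

text \<open>Over a zero of \<open>W\<close> all graphs pass through one common point, so the
  vertical line there meets their union in a single point, which cannot be interior. Taking the
  interior thus removes the pinches.\<close>

lemma interior_graphs:
  assumes q: "q \<in> interior graphs"
  shows "W (fst q) \<noteq> 0" and "\<exists>\<alpha>\<in>bball E center \<eta>. norm (fst q) < \<rho> \<and> snd q = \<phi>0 (fst q) + W (fst q) * \<alpha> (fst q)"
proof -
  show "\<exists>\<alpha>\<in>bball E center \<eta>. norm (fst q) < \<rho> \<and> snd q = \<phi>0 (fst q) + W (fst q) * \<alpha> (fst q)"
    using subsetD[OF interior_subset q] by (auto simp: graphs_def graph_over_def)
  show "W (fst q) \<noteq> 0"
  proof
    assume W: "W (fst q) = 0"
    obtain e where e: "0 < e" "ball q e \<subseteq> graphs" using q by (auto simp: mem_interior)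
    define p where "p = (fst q, snd q + of_real (e / 2))"
    have "dist q p < e" using e by (simp add: p_def dist_prod_def dist_norm)
    then have "p \<in> graphs" "q \<in> graphs" using e by auto
    then have "snd p = \<phi>0 (fst q)" "snd q = \<phi>0 (fst q)" using W by (auto simp: graphs_def graph_over_def p_def)
    then show False using e by (simp add: p_def)
  qed
qed

lemma pinched: "pinched_domain \<phi>0 (interior graphs)"
proof -
  define P where "P = (\<lambda>(\<zeta>, z). (\<zeta>, z - \<phi>0 \<zeta>)) ` interior graphs"
  have P_iff: "(\<zeta>, z) \<in> P \<longleftrightarrow> (\<zeta>, \<phi>0 \<zeta> + z) \<in> interior graphs" for \<zeta> z
    unfolding P_def by (force simp: image_iff)
  have P_\<rho>: "norm \<zeta> < \<rho>" if "(\<zeta>, z) \<in> P" for \<zeta> z using that interior_graphs(2) unfolding P_iff by fastforce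
  have oP: "open P"
  proof -
    have o: "open (ball 0 \<rho> \<times> (UNIV :: complex set))" by (simp add: open_Times)
    have "continuous_on (ball 0 \<rho> \<times> UNIV) (\<lambda>q. (fst q, \<phi>0 (fst q) + snd q))"
      by (intro continuous_intros continuous_on_compose2[OF holomorphic_on_imp_continuous_on[OF \<phi>0]]) (use \<rho> in auto)
    from continuous_open_preimage[OF this o open_interior]
    have "open ((ball 0 \<rho> \<times> UNIV) \<inter> (\<lambda>q. (fst q, \<phi>0 (fst q) + snd q)) -` interior graphs)" .
    moreover have "(ball 0 \<rho> \<times> UNIV) \<inter> (\<lambda>q. (fst q, \<phi>0 (fst q) + snd q)) -` interior graphs = P"
      using P_\<rho> by (auto simp: P_iff)
    ultimately show ?thesis by simp
  qed
  \<comment> \<open>\<open>1 - 1 / \<rho>\<close> is the fraction of the radius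
    \<open>\<eta>\<close> left after the centre, of modulus at most \<open>\<eta> / \<rho>\<close>
    over the closed unit disk, has been subtracted.\<close>
  have inP: "(\<zeta>, z) \<in> P" if \<zeta>: "norm \<zeta> \<le> 1" and z: "norm z < \<eta> * (1 - 1 / \<rho>) * norm (W \<zeta>)" for \<zeta> z :: complex
  proof -
    have "norm (z - W \<zeta> * (of_real (\<eta> / \<rho>) * \<zeta>)) \<le> norm z + norm (W \<zeta> * (of_real (\<eta> / \<rho>) * \<zeta>))" by (rule norm_triangle_ineq4)
    also have "norm (W \<zeta> * (of_real (\<eta> / \<rho>) * \<zeta>)) \<le> norm (W \<zeta>) * (\<eta> / \<rho>)"
      using \<zeta> \<eta> \<rho> by (simp add: norm_mult norm_divide mult_left_mono divide_right_mono mult_left_le)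
    finally have "norm (z - W \<zeta> * (of_real (\<eta> / \<rho>) * \<zeta>)) < \<eta> * norm (W \<zeta>)" using z by (simp add: algebra_simps)
    then show ?thesis unfolding P_iff using \<zeta> \<rho> by (intro subsetD[OF swept_subset]) simp
  qed
  have pinch: "\<exists>r>0. \<exists>c>0. \<exists>l0::nat. l0 \<ge> 1 \<and>
      {(\<zeta>, z). norm (\<zeta> - \<zeta>0) < r \<and> norm z < r \<and> norm z < c * norm (\<zeta> - \<zeta>0) ^ l0} - {(\<zeta>0, 0)} \<subseteq> P" if \<zeta>0: "\<zeta>0 \<in> \<Lambda>" for \<zeta>0
  proof -
    \<comment> \<open>The cofactor of the zero \<open>\<zeta>0\<close> in \<open>W\<close>; its
      lower bound near \<open>\<zeta>0\<close> turns the region into one of pinch order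
      \<open>n0\<close>.\<close>
    define g where "g x = (\<Prod>c\<in>\<Lambda> - {\<zeta>0}. x - c) ^ n0" for x
    have Wg: "W x = (x - \<zeta>0) ^ n0 * g x" for x
      by (simp add: W_eq g_def prod.remove[OF \<Lambda>(1) \<zeta>0] power_mult_distrib)
    have g0: "norm (g \<zeta>0) > 0" using \<Lambda>(1) by (auto simp: g_def)
    have "isCont g \<zeta>0" unfolding g_def by (intro continuous_intros)
    then have "((\<lambda>x. norm (g x)) \<longlongrightarrow> norm (g \<zeta>0)) (at \<zeta>0)" by (intro tendsto_norm) (simp add: isCont_def)
    then have "\<forall>\<^sub>F x in at \<zeta>0. norm (g x) > norm (g \<zeta>0) / 2" by (rule order_tendstoD) (use g0 in simp)
    then obtain d where d: "0 < d" "\<And>x. x \<noteq> \<zeta>0 \<Longrightarrow> dist x \<zeta>0 < d \<Longrightarrow> norm (g x) > norm (g \<zeta>0) / 2"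
      unfolding eventually_at by auto
    define c where "c = \<eta> * (1 - 1 / \<rho>) * (norm (g \<zeta>0) / 2)"
    define r where "r = min d (1 - norm \<zeta>0)"
    have k: "0 < \<eta> * (1 - 1 / \<rho>)" using \<eta> \<rho> by simp
    have "0 < c" unfolding c_def by (intro mult_pos_pos k) (use g0 in simp)
    moreover have "0 < r" using d \<Lambda>(2) \<zeta>0 by (auto simp: r_def)
    moreover have "{(\<zeta>, z). norm (\<zeta> - \<zeta>0) < r \<and> norm z < r \<and> norm z < c * norm (\<zeta> - \<zeta>0) ^ n0} - {(\<zeta>0, 0)} \<subseteq> P"
    proof
      fix q :: "complex \<times> complex" assume q: "q \<in> {(\<zeta>, z). norm (\<zeta> - \<zeta>0) < r \<and> norm z < r \<and> norm z < c * norm (\<zeta> - \<zeta>0) ^ n0} - {(\<zeta>0, 0)}"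
      obtain \<zeta> z where qz: "q = (\<zeta>, z)" by (cases q)
      have \<zeta>: "norm (\<zeta> - \<zeta>0) < r" and z: "norm z < c * norm (\<zeta> - \<zeta>0) ^ n0" using q by (simp_all add: qz)
      have ne: "\<zeta> \<noteq> \<zeta>0" using z n0 by (auto simp: zero_power)
      have "norm (g \<zeta>0) / 2 < norm (g \<zeta>)" using \<zeta> by (intro d(2) ne) (simp add: r_def dist_norm)
      then have "c \<le> \<eta> * (1 - 1 / \<rho>) * norm (g \<zeta>)" unfolding c_def using k by (intro mult_left_mono) auto
      then have "c * norm (\<zeta> - \<zeta>0) ^ n0 \<le> \<eta> * (1 - 1 / \<rho>) * norm (g \<zeta>) * norm (\<zeta> - \<zeta>0) ^ n0" by (intro mult_right_mono) auto
      also have "\<dots> = \<eta> * (1 - 1 / \<rho>) * norm (W \<zeta>)" by (simp add: Wg norm_mult norm_power mult_ac)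
      finally have "norm z < \<eta> * (1 - 1 / \<rho>) * norm (W \<zeta>)" using z by linarith
      moreover have "norm \<zeta> \<le> 1" using norm_triangle_sub[of \<zeta> \<zeta>0] \<zeta> by (simp add: r_def)
      ultimately show "q \<in> P" unfolding qz by (intro inP)
    qed
    ultimately show ?thesis using n0 by (intro exI[of _ r] conjI exI[of _ c] exI[of _ n0]) auto
  qed
  have notin: "(\<zeta>0, 0) \<notin> P" if "\<zeta>0 \<in> \<Lambda>" for \<zeta>0
    using interior_graphs(1)[of "(\<zeta>0, \<phi>0 \<zeta>0 + 0)"] that W_0_iff[of \<zeta>0] unfolding P_iff by auto
  have disk: "(\<zeta>, 0) \<in> P" if "\<zeta> \<in> cball 0 1 - \<Lambda>" for \<zeta>
  proof (rule inP)
    have "W \<zeta> \<noteq> 0" using that W_0_iff by blast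
    then show "norm (0 :: complex) < \<eta> * (1 - 1 / \<rho>) * norm (W \<zeta>)" using \<eta> \<rho> by simp
  qed (use that in simp)
  show ?thesis
    unfolding pinched_domain_def pinched_domain_0_def P_def[symmetric]
    by (intro conjI exI[of _ \<Lambda>] ballI oP \<Lambda> disk notin pinch)
qed

end

text \<open>The graphs are taken over the disk of radius \<open>1 + \<epsilon>'\<close> for an
  arbitrary \<open>\<epsilon>' < \<epsilon>\<close>: its closure is compact in the disk where the
  data live, which yields the uniform constants. Extension of \<open>f\<close> means equality on a
  dense set, in keeping with the arbitrary values of meromorphic functions.\<close>

theorem theorem1:
  fixes \<epsilon> \<epsilon>' :: real
    and f :: "complex \<times> complex \<Rightarrow> complex"
    and \<phi> :: "nat \<Rightarrow> complex \<Rightarrow> complex"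
    and \<phi>0 :: "complex \<Rightarrow> complex"
  assumes "0 < \<epsilon>" and "0 < \<epsilon>'" and "\<epsilon>' < \<epsilon>"
    and "meromorphic2_on f (ring_domain \<epsilon>)"
    and "test_sequence \<epsilon> \<phi> \<phi>0"
    and "\<exists>N. \<forall>k\<ge>1. \<exists>u.
           restriction_extends_to f (ring_domain \<epsilon>) (ball 0 (1 + \<epsilon>)) (\<phi> k) u \<and>
           poles_at_most u (ball 0 (1 + \<epsilon>)) N"
  shows "\<exists>(E :: (complex \<Rightarrow> complex) banach_data) a r
            (X :: (complex \<times> (complex \<Rightarrow> complex), complex \<times> (complex \<Rightarrow> complex)) cmanifold)
            p \<Phi> \<psi>.
     complex_banach_space E \<and> infinite_dimensional E \<and> a \<in> bcarrier E \<and> 0 < r \<and>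
     analytic_graph_family (ball 0 (1 + \<epsilon>')) X p (open_submanifold E (bball E a r)) \<Phi> \<psi> \<and>
     (\<exists>N. \<forall>\<alpha>\<in>bball E a r. \<exists>u.
        restriction_extends_to f (ring_domain \<epsilon>) (ball 0 (1 + \<epsilon>')) (\<psi> \<alpha>) u \<and>
        poles_at_most u (ball 0 (1 + \<epsilon>')) N) \<and>
     (let P = interior (\<Union>\<alpha>\<in>bball E a r. graph_over (ball 0 (1 + \<epsilon>')) (\<psi> \<alpha>)) in
        pinched_domain \<phi>0 P \<and>
        (\<exists>F. meromorphic2_on F P \<and> meromorphic_eq (P \<inter> ring_domain \<epsilon>) F f))"
proof -
  obtain N where restr: "\<And>k. 1 \<le> k \<Longrightarrow> \<exists>u. restriction_extends_to f (ring_domain \<epsilon>) (ball 0 (1 + \<epsilon>)) (\<phi> k) u \<and>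
     poles_at_most u (ball 0 (1 + \<epsilon>)) N"
    using assms(6) by blast
  obtain r1 r2 D \<Lambda> n0 B M C where r: "0 < r1" "1 - \<epsilon> < r1" "r1 < r2" "r2 < 1"
    and \<Lambda>: "finite \<Lambda>" "\<Lambda> \<subseteq> cball 0 r1" and n0: "0 < (n0::nat)"
    and B: "\<And>n. B n holomorphic_on ball 0 r2" and C: "0 < (C::real)"
    and BM: "\<And>n x. x \<in> ball 0 r2 \<Longrightarrow> norm (B n x) \<le> M * C ^ n"
    and sums: "\<And>x z. r1 < norm x \<Longrightarrow> norm x < r2 \<Longrightarrow> z \<noteq> 0 \<Longrightarrow> C * norm z < 1 \<Longrightarrow>
      (\<lambda>n. B n x * (z / (\<Prod>c\<in>\<Lambda>. x - c) ^ n0) ^ n) sums ((\<Prod>c\<in>\<Lambda>. x - c) ^ n0 * (z ^ D * f (x, \<phi>0 x + z)))"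
    and f_hol: "holomorphic2_on f {q. r1 < norm (fst q) \<and> norm (fst q) < r2 \<and> snd q \<noteq> \<phi>0 (fst q) \<and>
      C * norm (snd q - \<phi>0 (fst q)) < 1}"
    by (rule extension_along_test_sequence[OF assms(1,4,5) restr], assumption) (rule that)
  define \<rho> where "\<rho> = 1 + \<epsilon>'"
  define S where "S q = (\<Sum>n. B n (fst q) * snd q ^ n)" for q :: "complex \<times> complex"
  have \<rho>: "1 < \<rho>" "\<rho> < 1 + \<epsilon>" using assms(2,3) by (simp_all add: \<rho>_def)
  have \<phi>0: "\<phi>0 holomorphic_on ball 0 (1 + \<epsilon>)" and \<phi>0_ball: "\<phi>0 ` ball 0 (1 + \<epsilon>) \<subseteq> ball 0 1"
    using assms(5) by (simp_all add: test_sequence_def)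
  have \<phi>0_less: "norm (\<phi>0 x) < 1" if "norm x < 1 + \<epsilon>" for x using \<phi>0_ball that by fastforce
  have sub: "cball 0 \<rho> \<subseteq> ball (0::complex) (1 + \<epsilon>)" using \<rho> by auto
  have "0 \<in> cball (0::complex) \<rho>" using \<rho> by simp
  then have ne: "cball (0::complex) \<rho> \<noteq> {}" by blast
  have "continuous_on (cball 0 \<rho>) (\<lambda>x. norm (\<phi>0 x))"
    by (intro continuous_intros continuous_on_subset[OF holomorphic_on_imp_continuous_on[OF \<phi>0] sub])
  then obtain y where y: "y \<in> cball 0 \<rho>" "\<And>x. x \<in> cball 0 \<rho> \<Longrightarrow> norm (\<phi>0 x) \<le> norm (\<phi>0 y)"
    using continuous_attains_sup[OF compact_cball ne] by blast
  have y1: "norm (\<phi>0 y) < 1" using y(1) sub by (intro \<phi>0_less) auto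
  have "compact ((\<lambda>x. (\<Prod>c\<in>\<Lambda>. x - c) ^ n0) ` cball 0 \<rho>)"
    by (intro compact_continuous_image continuous_intros compact_cball)
  then obtain K where K: "0 < K" "\<And>x. x \<in> cball 0 \<rho> \<Longrightarrow> norm ((\<Prod>c\<in>\<Lambda>. x - c) ^ n0) \<le> K"
    using compact_imp_bounded bounded_pos by (metis (no_types, lifting) image_eqI)
  \<comment> \<open>One term for each smallness condition of the extension. \<open>K\<close> bounds
    \<open>W\<close> and \<open>norm (\<phi>0 y)\<close> is the maximum of
    \<open>norm (\<phi>0 x)\<close> over the closed disk of radius \<open>\<rho>\<close>; the
    factors \<open>2\<close> make the inequalities strict.\<close>
  define \<kappa> where "\<kappa> = min (1 / (2 * C)) (min (1 / (2 * K * C)) ((1 - norm (\<phi>0 y)) / (2 * K)))"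
  have \<kappa>0: "0 < \<kappa>" using C K(1) y1 by (simp add: \<kappa>_def)
  have "\<kappa> \<le> 1 / (2 * C)" "\<kappa> \<le> 1 / (2 * K * C)" "\<kappa> \<le> (1 - norm (\<phi>0 y)) / (2 * K)" by (simp_all add: \<kappa>_def)
  then have \<kappa>: "\<kappa> * C < 1" "\<kappa> * K * C < 1" "norm (\<phi>0 y) + \<kappa> * K < 1" using C K(1) y1 by (simp_all add: field_simps)
  interpret pinched_extension \<epsilon> \<rho> r1 r2 C \<kappa> f S \<phi>0 \<Lambda> n0 D
  proof
    show "holomorphic2_on S (ball 0 r2 \<times> ball 0 (1 / C))"
      unfolding S_def by (rule holomorphic2_on_power_series[OF open_ball B BM C])
    show "S (x, z / (\<Prod>c\<in>\<Lambda>. x - c) ^ n0) = (\<Prod>c\<in>\<Lambda>. x - c) ^ n0 * (z ^ D * f (x, \<phi>0 x + z))"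
      if "r1 < norm x" "norm x < r2" "z \<noteq> 0" "C * norm z < 1" for x z
      using sums_unique[OF sums[OF that]] by (simp add: S_def)
    fix x :: complex assume x: "norm x < \<rho>"
    have Wx: "\<kappa> * norm ((\<Prod>c\<in>\<Lambda>. x - c) ^ n0) \<le> \<kappa> * K" using K(2)[of x] x \<kappa>0 by (intro mult_left_mono) auto
    have "\<kappa> * norm ((\<Prod>c\<in>\<Lambda>. x - c) ^ n0) * C \<le> \<kappa> * K * C" using Wx C by (intro mult_right_mono) auto
    then show "\<kappa> * norm ((\<Prod>c\<in>\<Lambda>. x - c) ^ n0) * C < 1" using \<kappa>(2) by linarith
    show "norm (\<phi>0 x) + \<kappa> * norm ((\<Prod>c\<in>\<Lambda>. x - c) ^ n0) < 1" using y(2)[of x] x Wx \<kappa>(3) by auto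
  qed (use \<rho> assms(4) \<phi>0 \<phi>0_less r \<Lambda> n0 C f_hol \<kappa>0 \<kappa>(1) in auto)
  obtain \<kappa>' where \<kappa>': "0 < \<kappa>'" "\<And>\<eta>. 0 < \<eta> \<Longrightarrow> \<exists>N. \<forall>\<alpha>. \<alpha> holomorphic_on ball 0 (1 + \<epsilon>) \<longrightarrow>
     (\<forall>x\<in>ball 0 (1 + \<epsilon>). norm (\<alpha> x) < \<kappa>') \<longrightarrow> (\<forall>x\<in>sphere 0 \<rho>. norm (\<alpha> x - of_real (\<eta> / \<rho>) * x) < \<eta>) \<longrightarrow>
     (\<exists>u. restriction_extends_to f (ring_domain \<epsilon>) (ball 0 \<rho>) (graph_fun \<alpha>) u \<and> poles_at_most u (ball 0 \<rho>) N)"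
    by (rule bounded_pole_number) (rule that)
  \<comment> \<open>A parameter in the ball of radius \<open>\<eta>\<close> about the centre is
    bounded by \<open>\<eta> * m\<close>, the second summand being the size of the centre on the
    large disk.\<close>
  define m where "m = 1 + (1 + \<epsilon>) / \<rho>"
  define \<eta> where "\<eta> = min \<kappa> \<kappa>' / m"
  have m: "0 < m" using \<rho> assms(1) by (auto simp: m_def intro!: add_pos_pos divide_pos_pos)
  have \<eta>: "0 < \<eta>" "\<eta> * m \<le> \<kappa>" "\<eta> * m \<le> \<kappa>'" using m \<kappa>0 \<kappa>'(1) by (simp_all add: \<eta>_def)
  interpret F: pinched_family "1 + \<epsilon>" \<rho> \<eta> \<phi>0 W \<Lambda> n0
  proof
    show "\<Lambda> \<subseteq> ball 0 1" using \<Lambda>(2) r by auto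
  qed (use \<rho> \<eta> \<phi>0 \<Lambda> n0 in \<open>auto simp: W_def\<close>)
  have small: "norm (\<alpha> x) < \<kappa>" "norm (\<alpha> x) < \<kappa>'" if "\<alpha> \<in> bball F.E F.center \<eta>" "x \<in> ball 0 (1 + \<epsilon>)" for \<alpha> x
    using F.member(3)[OF that] \<eta> by (simp_all add: m_def)
  interpret G: graph_family "1 + \<epsilon>" \<rho> \<eta> \<phi>0 W F.center \<Lambda>
  proof
    show "norm (\<phi>0 x + W x * \<alpha> x) < 1" if \<alpha>: "\<alpha> \<in> bball F.E F.center \<eta>" and x: "x \<in> ball 0 \<rho>" for \<alpha> x
    proof -
      have "norm (W x * \<alpha> x) \<le> \<kappa> * norm (W x)"
        using small(1)[OF \<alpha>, of x] x \<rho> by (auto simp: norm_mult mult.commute intro!: mult_right_mono)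
      then show ?thesis using norm_triangle_ineq[of "\<phi>0 x" "W x * \<alpha> x"] \<kappa>(4)[of x] x by (simp add: W_def)
    qed
  qed (use \<rho> \<eta> \<phi>0 \<Lambda> W_holomorphic W_eq_0_iff F.center in auto)
  have fam: "analytic_graph_family (ball 0 (1 + \<epsilon>')) (open_submanifold G.P G.X) snd
      (open_submanifold F.E (bball F.E F.center \<eta>)) G.\<Phi> graph_fun"
    using G.analytic_graph_family unfolding G.A_def graph_fun_def[abs_def] \<rho>_def[symmetric] .
  obtain N' where N': "\<And>\<alpha>. \<alpha> holomorphic_on ball 0 (1 + \<epsilon>) \<Longrightarrow> (\<forall>x\<in>ball 0 (1 + \<epsilon>). norm (\<alpha> x) < \<kappa>') \<Longrightarrow>
     (\<forall>x\<in>sphere 0 \<rho>. norm (\<alpha> x - of_real (\<eta> / \<rho>) * x) < \<eta>) \<Longrightarrow>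
     \<exists>u. restriction_extends_to f (ring_domain \<epsilon>) (ball 0 \<rho>) (graph_fun \<alpha>) u \<and> poles_at_most u (ball 0 \<rho>) N'"
    using \<kappa>'(2)[OF \<eta>(1)] by blast
  have poles: "\<exists>u. restriction_extends_to f (ring_domain \<epsilon>) (ball 0 (1 + \<epsilon>')) (graph_fun \<alpha>) u \<and>
      poles_at_most u (ball 0 (1 + \<epsilon>')) N'" if \<alpha>: "\<alpha> \<in> bball F.E F.center \<eta>" for \<alpha>
    unfolding \<rho>_def[symmetric]
  proof (rule N')
    show "\<alpha> holomorphic_on ball 0 (1 + \<epsilon>)" by (rule Hinf_carrierD(1)[OF F.member(1)[OF \<alpha>]])
    show "\<forall>x\<in>ball 0 (1 + \<epsilon>). norm (\<alpha> x) < \<kappa>'" using small(2)[OF \<alpha>] by blast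
    show "\<forall>x\<in>sphere 0 \<rho>. norm (\<alpha> x - of_real (\<eta> / \<rho>) * x) < \<eta>"
    proof
      fix x :: complex assume "x \<in> sphere 0 \<rho>"
      then have "x \<in> ball 0 (1 + \<epsilon>)" using \<rho> by simp
      then show "norm (\<alpha> x - of_real (\<eta> / \<rho>) * x) < \<eta>" by (rule F.member(2)[OF \<alpha>])
    qed
  qed
  have graphs: "(\<Union>\<alpha>\<in>bball F.E F.center \<eta>. graph_over (ball 0 (1 + \<epsilon>')) (graph_fun \<alpha>)) = F.graphs"
    unfolding F.graphs_def graph_fun_def[abs_def] \<rho>_def[symmetric] ..
  \<comment> \<open>Interior points lie over nonzeros of \<open>W\<close>, where the bound
    \<open>norm (\<alpha> x) < \<kappa>\<close> for parameters is exactly the inequality defining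
    \<open>swept\<close>.\<close>
  have "interior F.graphs \<subseteq> swept"
  proof
    fix q assume q: "q \<in> interior F.graphs"
    obtain \<alpha> where \<alpha>: "\<alpha> \<in> bball F.E F.center \<eta>" "norm (fst q) < \<rho>" "snd q = graph_fun \<alpha> (fst q)"
      using F.interior_graphs(2)[OF q] by (auto simp: graph_fun_def)
    have "norm (\<alpha> (fst q)) < \<kappa>" using \<alpha>(2) \<rho> by (intro small(1)[OF \<alpha>(1)]) simp
    then show "q \<in> swept" using graph_swept[OF \<alpha>(2) F.interior_graphs(1)[OF q], of \<alpha>] \<alpha>(3) by (metis prod.collapse)
  qed
  note F = ext_meromorphic[OF open_interior this] ext_meromorphic_eq[OF open_interior this]
  have polesN: "\<exists>N. \<forall>\<alpha>\<in>bball F.E F.center \<eta>. \<exists>u.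
      restriction_extends_to f (ring_domain \<epsilon>) (ball 0 (1 + \<epsilon>')) (graph_fun \<alpha>) u \<and> poles_at_most u (ball 0 (1 + \<epsilon>')) N"
    using poles by blast
  have inf: "infinite_dimensional F.E"
    by (rule infinite_dimensional_Hinf) (use assms(1) in auto)
  show ?thesis
    unfolding Let_def
    by (rule exI[of _ F.E], rule exI[of _ F.center], rule exI[of _ \<eta>], rule exI[of _ "open_submanifold G.P G.X"],
        rule exI[of _ snd], rule exI[of _ G.\<Phi>], rule exI[of _ graph_fun])
      (unfold graphs, intro conjI F.E.banach inf F.center \<eta>(1) fam polesN F.pinched exI[of _ ext] F)
qed

end
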